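(* Let $F\in\{\mathbb{R},\mathbb{C}\}$ and let $G=\mathrm{Spec}\,A$ be an affine algebraic group over $F$ with an involution $\theta$. Then the contraction group scheme $\mathbf{G}=\mathrm{Spec}\,\mathbf{A}$ over $F[t]$ is isomorphic, as a group scheme over $F[t]$, to the (restriction to $\mathrm{Spec}\,F[t]$ of the) Barbasch--Higson--Subag contraction family of $(G,\theta)$.
   Context: Contraction group scheme: put $A^{\theta}=\{a\in A:\theta(a)=a\}$, $A^{-\theta}=\{a\in A:\theta(a)=-a\}$ (writing $\theta$ also for the induced involution of $A$). $\mathbf{A}$ is the $F[t]$-subalgebra of the Laurent polynomial ring $A[\sqrt{t}^{\pm1}]$ (variable $\sqrt t$, $t=(\sqrt t)^2$) generated by $A^\theta$ and $\frac{1}{\sqrt t}A^{-\theta}$; it is a Hopf algebra over $F[t]$ with structure maps restricted from the Hopf $F[\sqrt t^{\pm1}]$-algebra $A[\sqrt t^{\pm1}]$. Barbasch--Higson--Subag family, complex case ($F=\mathbb{C}$): choose a faithful representation (closed immersion of group schemes) $\iota:G\hookrightarrow \mathrm{SL}_n$. Consider the faithful representation $G\otimes_{\mathbb C}\mathbb{C}[\sqrt t^{\pm1}]\hookrightarrow \mathrm{SL}_{2n}\otimes_{\mathbb C}\mathbb{C}[\sqrt t^{\pm1}]$, $$g\mapsto P\begin{pmatrix}\iota(g)&0\\0&\iota(\theta(g))\end{pmatrix}P^{-1},\qquad P=\begin{pmatrix}\sqrt t I_n&-\sqrt t I_n\\ I_n&I_n\end{pmatrix},$$ i.e. $g\mapsto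 \frac12\begin{pmatrix}\iota(g)+\iota(\theta(g))&\sqrt t(\iota(g)-\iota(\theta(g)))\\ \sqrt t^{-1}(\iota(g)-\iota(\theta(g)))&\iota(g)+\iota(\theta(g))\end{pmatrix}$. Its image is stable under $\sqrt t\mapsto-\sqrt t$, so it descends to a closed subgroup scheme $G_t\subset \mathrm{SL}_{2n}\otimes_{\mathbb C}\mathbb{C}[t^{\pm1}]$. The family is the Zariski closure of $G_t$ in $\mathrm{SL}_{2n}\otimes_{\mathbb C}\mathbb{C}[t]$. Real case ($F=\mathbb{R}$): apply the complex construction to $G\otimes_{\mathbb R}\mathbb{C}$ with the involution induced by $\theta$. The antiholomorphic involution of $G\otimes_{\mathbb{R}}\mathbb{C}$ (complex conjugation), extended to $G\otimes_{\mathbb R}\mathbb{C}[\sqrt t^{\pm1}]$ by complex conjugation on $\mathbb{C}[\sqrt t^{\pm1}]$ fixing $\sqrt t$, induces an antiholomorphic involution of the complex family (semilinear for the complex conjugation of $\mathbb{C}[t]$ fixing $t$); the real family is the resulting group scheme over $\mathbb{R}[t]$ descended from the complex one. *)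

theory Defs
  imports
    "HOL-Analysis.Determinants"
    "HOL-Algebra.Algebraic_Closure_Type"
    "HOL-Algebra.QuotRing"
    "HOL-Algebra.Subrings"
    "HOL-Algebra.Module"
    "HOL-Library.Poly_Mapping"
    "HOL-Computational_Algebra.Polynomial"
begin

no_notation Polynomials.var (\<open>X\<index>\<close>)

text \<open>
  An affine group scheme over a commutative ring R is given by its coordinate ring, a commutative
  Hopf algebra over R; morphisms of affine group schemes are Hopf algebra homomorphisms in the
  opposite direction, and closed immersions are the surjective ones.
\<close>

section \<open>Algebras and their tensor products\<close>

abbreviation univ_ring :: "'r::comm_ring_1 ring" where
  "univ_ring \<equiv> ring_of_type_algebra"

text \<open>The type of a type-class ring, as an algebra via a ring homomorphism into it.\<close>

definition univ_alg :: "('r \<Rightarrow> 's::comm_ring_1) \<Rightarrow> ('r, 's) module" where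
  "univ_alg \<phi> = ring.extend univ_ring (module.fields (\<lambda>r s. \<phi> r * s))"

definition alg_hom ::
  "('r, 'x) ring_scheme \<Rightarrow> ('r, 'a, 'y) module_scheme \<Rightarrow> ('r, 'b, 'z) module_scheme \<Rightarrow> ('a \<Rightarrow> 'b) set" where
  "alg_hom R A B =
     {f \<in> ring_hom A B. \<forall>r\<in>carrier R. \<forall>a\<in>carrier A. f (r \<odot>\<^bsub>A\<^esub> a) = r \<odot>\<^bsub>B\<^esub> f a}"

definition is_subalgebra :: "('r, 'x) ring_scheme \<Rightarrow> ('r, 'a, 'y) module_scheme \<Rightarrow> 'a set \<Rightarrow> bool" where
  "is_subalgebra R A B \<longleftrightarrow> subring B A \<and> (\<forall>r\<in>carrier R. \<forall>b\<in>B. r \<odot>\<^bsub>A\<^esub> b \<in> B)"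

definition generated_subalgebra ::
  "('r, 'x) ring_scheme \<Rightarrow> ('r, 'a, 'y) module_scheme \<Rightarrow> 'a set \<Rightarrow> 'a set" where
  "generated_subalgebra R A X = \<Inter>{B. is_subalgebra R A B \<and> X \<subseteq> B}"

text \<open>The subset B of L, as an algebra along \<open>\<phi>\<close>.\<close>

definition restrict_alg :: "('r \<Rightarrow> 's) \<Rightarrow> ('s, 'a, 'x) module_scheme \<Rightarrow> 'a set \<Rightarrow> ('r, 'a) module" where
  "restrict_alg \<phi> L B =
     \<lparr>carrier = B, monoid.mult = monoid.mult L, one = one L, zero = zero L, add = add L,
      module.smult = (\<lambda>r x. \<phi> r \<odot>\<^bsub>L\<^esub> x)\<rparr>"

definition rep :: "'a set \<Rightarrow> 'a" where
  "rep X = (SOME x. x \<in> X)"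

text \<open>
  \<open>A \<otimes>\<^sub>R B\<close> is the quotient of the free monoid of formal sums of pairs (a, b), written as lists,
  by the congruence generated by commutativity, biadditivity and R-balancedness. (The quotient is a
  group, since (\<open>\<ominus>\<close> a, b) is inverse to (a, b).)
\<close>

inductive tensor_rel ::
  "('r, 'x) ring_scheme \<Rightarrow> ('r, 'a, 'y) module_scheme \<Rightarrow> ('r, 'b, 'z) module_scheme \<Rightarrow>
   ('a \<times> 'b) list \<Rightarrow> ('a \<times> 'b) list \<Rightarrow> bool"
  for R and A (structure) and B (structure) where
  refl: "set x \<subseteq> carrier A \<times> carrier B \<Longrightarrow> tensor_rel R A B x x"
| sym: "tensor_rel R A B x y \<Longrightarrow> tensor_rel R A B y x"
| trans: "tensor_rel R A B x y \<Longrightarrow> tensor_rel R A B y z \<Longrightarrow> tensor_rel R A B x z"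
| append: "tensor_rel R A B x y \<Longrightarrow> tensor_rel R A B x' y' \<Longrightarrow> tensor_rel R A B (x @ x') (y @ y')"
| commute: "set x \<subseteq> carrier A \<times> carrier B \<Longrightarrow> set y \<subseteq> carrier A \<times> carrier B \<Longrightarrow>
    tensor_rel R A B (x @ y) (y @ x)"
| add_left: "a \<in> carrier A \<Longrightarrow> a' \<in> carrier A \<Longrightarrow> b \<in> carrier B \<Longrightarrow>
    tensor_rel R A B [(a \<oplus>\<^bsub>A\<^esub> a', b)] [(a, b), (a', b)]"
| add_right: "a \<in> carrier A \<Longrightarrow> b \<in> carrier B \<Longrightarrow> b' \<in> carrier B \<Longrightarrow>
    tensor_rel R A B [(a, b \<oplus>\<^bsub>B\<^esub> b')] [(a, b), (a, b')]"
| zero_left: "b \<in> carrier B \<Longrightarrow> tensor_rel R A B [(\<zero>\<^bsub>A\<^esub>, b)] []"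
| zero_right: "a \<in> carrier A \<Longrightarrow> tensor_rel R A B [(a, \<zero>\<^bsub>B\<^esub>)] []"
| balanced: "r \<in> carrier R \<Longrightarrow> a \<in> carrier A \<Longrightarrow> b \<in> carrier B \<Longrightarrow>
    tensor_rel R A B [(r \<odot>\<^bsub>A\<^esub> a, b)] [(a, r \<odot>\<^bsub>B\<^esub> b)]"

type_synonym ('a, 'b) tensor = "('a \<times> 'b) list set"

definition tensor_class ::
  "('r, 'x) ring_scheme \<Rightarrow> ('r, 'a, 'y) module_scheme \<Rightarrow> ('r, 'b, 'z) module_scheme \<Rightarrow>
   ('a \<times> 'b) list \<Rightarrow> ('a, 'b) tensor" where
  "tensor_class R A B x = {y. tensor_rel R A B x y}"

definition pure_tensor ::
  "('r, 'x) ring_scheme \<Rightarrow> ('r, 'a, 'y) module_scheme \<Rightarrow> ('r, 'b, 'z) module_scheme \<Rightarrow>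
   'a \<Rightarrow> 'b \<Rightarrow> ('a, 'b) tensor" where
  "pure_tensor R A B a b = tensor_class R A B [(a, b)]"

definition tensor ::
  "('r, 'x) ring_scheme \<Rightarrow> ('r, 'a, 'y) module_scheme \<Rightarrow> ('r, 'b, 'z) module_scheme \<Rightarrow>
   ('r, ('a, 'b) tensor) module" where
  "tensor R A B =
     \<lparr>carrier = tensor_class R A B ` {x. set x \<subseteq> carrier A \<times> carrier B},
      monoid.mult = (\<lambda>X Y. tensor_class R A B
        [(fst p \<otimes>\<^bsub>A\<^esub> fst q, snd p \<otimes>\<^bsub>B\<^esub> snd q). p \<leftarrow> rep X, q \<leftarrow> rep Y]),
      one = pure_tensor R A B \<one>\<^bsub>A\<^esub> \<one>\<^bsub>B\<^esub>,
      zero = tensor_class R A B [],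
      add = (\<lambda>X Y. tensor_class R A B (rep X @ rep Y)),
      module.smult = (\<lambda>r X. tensor_class R A B (map (\<lambda>(a, b). (r \<odot>\<^bsub>A\<^esub> a, b)) (rep X)))\<rparr>"

text \<open>
  The additive map \<open>A \<otimes> B \<rightarrow> M\<close> induced by a balanced biadditive map f, and the map
  \<open>f \<otimes> g\<close> into \<open>A \<otimes>\<^sub>R B\<close>. The source may be a tensor product over a different base ring, with f
  and g semilinear along a ring homomorphism to R.
\<close>

definition tensor_lift :: "('m, 'x) ring_scheme \<Rightarrow> ('a \<times> 'b \<Rightarrow> 'm) \<Rightarrow> ('a, 'b) tensor \<Rightarrow> 'm" where
  "tensor_lift M f X = foldr (\<lambda>p v. f p \<oplus>\<^bsub>M\<^esub> v) (rep X) \<zero>\<^bsub>M\<^esub>"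

definition tensor_map ::
  "('r, 'x) ring_scheme \<Rightarrow> ('r, 'a, 'y) module_scheme \<Rightarrow> ('r, 'b, 'z) module_scheme \<Rightarrow>
   ('c \<Rightarrow> 'a) \<Rightarrow> ('d \<Rightarrow> 'b) \<Rightarrow> ('c, 'd) tensor \<Rightarrow> ('a, 'b) tensor" where
  "tensor_map R A B f g X = tensor_class R A B (map (map_prod f g) (rep X))"

section \<open>Hopf algebras\<close>

record ('r, 'a) hopf = "('r, 'a) module" +
  comult :: "'a \<Rightarrow> ('a, 'a) tensor"
  counit :: "'a \<Rightarrow> 'r"
  antipode :: "'a \<Rightarrow> 'a"

locale hopf_algebra = algebra R H for R :: "'r ring" (structure) and H :: "('r, 'a) hopf" (structure) +
  assumes comult_hom: "comult H \<in> alg_hom R H (tensor R H H)"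
    and counit_hom: "counit H \<in> ring_hom H R"
    and counit_smult: "r \<in> carrier R \<Longrightarrow> x \<in> carrier H \<Longrightarrow> counit H (r \<odot>\<^bsub>H\<^esub> x) = r \<otimes>\<^bsub>R\<^esub> counit H x"
    and antipode_hom: "antipode H \<in> alg_hom R H H"
    and coassoc: "x \<in> carrier H \<Longrightarrow>
      tensor_lift (tensor R H (tensor R H H))
        (\<lambda>(Y, c). tensor_lift (tensor R H (tensor R H H))
           (\<lambda>(a, b). pure_tensor R H (tensor R H H) a (pure_tensor R H H b c)) Y)
        (tensor_map R (tensor R H H) H (comult H) id (comult H x)) =
      tensor_map R H (tensor R H H) id (comult H) (comult H x)"
    and counit_left: "x \<in> carrier H \<Longrightarrow>
      tensor_lift H (\<lambda>(a, b). counit H a \<odot>\<^bsub>H\<^esub> b) (comult H x) = x"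
    and counit_right: "x \<in> carrier H \<Longrightarrow>
      tensor_lift H (\<lambda>(a, b). counit H b \<odot>\<^bsub>H\<^esub> a) (comult H x) = x"
    and antipode_left: "x \<in> carrier H \<Longrightarrow>
      tensor_lift H (\<lambda>(a, b). antipode H a \<otimes>\<^bsub>H\<^esub> b) (comult H x) = counit H x \<odot>\<^bsub>H\<^esub> \<one>\<^bsub>H\<^esub>"
    and antipode_right: "x \<in> carrier H \<Longrightarrow>
      tensor_lift H (\<lambda>(a, b). a \<otimes>\<^bsub>H\<^esub> antipode H b) (comult H x) = counit H x \<odot>\<^bsub>H\<^esub> \<one>\<^bsub>H\<^esub>"

definition hopf_hom :: "'r ring \<Rightarrow> ('r, 'a) hopf \<Rightarrow> ('r, 'b) hopf \<Rightarrow> ('a \<Rightarrow> 'b) set" where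
  "hopf_hom R H K =
     {f \<in> alg_hom R H K. \<forall>x\<in>carrier H.
        comult K (f x) = tensor_map R K K f f (comult H x) \<and>
        counit K (f x) = counit H x \<and>
        antipode K (f x) = f (antipode H x)}"

definition group_schemes_isomorphic :: "'r ring \<Rightarrow> ('r, 'a) hopf \<Rightarrow> ('r, 'b) hopf \<Rightarrow> bool" where
  "group_schemes_isomorphic R H K \<longleftrightarrow>
     hopf_algebra R H \<and> hopf_algebra R K \<and>
     (\<exists>f\<in>hopf_hom R K H. bij_betw f (carrier K) (carrier H))"

definition affine_algebraic_group :: "'r ring \<Rightarrow> ('r, 'a) hopf \<Rightarrow> bool" where
  "affine_algebraic_group R A \<longleftrightarrow>
     hopf_algebra R A \<and>
     (\<exists>X. finite X \<and> X \<subseteq> carrier A \<and> generated_subalgebra R A X = carrier A)"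

definition hopf_involution :: "'r ring \<Rightarrow> ('r, 'a) hopf \<Rightarrow> ('a \<Rightarrow> 'a) \<Rightarrow> bool" where
  "hopf_involution R A \<theta> \<longleftrightarrow> \<theta> \<in> hopf_hom R A A \<and> (\<forall>a\<in>carrier A. \<theta> (\<theta> a) = a)"

text \<open>\<open>S \<otimes>\<^sub>R H\<close> as a Hopf algebra over S, for an R-algebra S.\<close>

definition base_change_alg ::
  "('r, 'x) ring_scheme \<Rightarrow> ('r, 's, 'y) module_scheme \<Rightarrow> ('r, 'a, 'z) module_scheme \<Rightarrow>
   ('s, ('s, 'a) tensor) module" where
  "base_change_alg R S H =
     ring.extend (ring.truncate (tensor R S H))
       (module.fields (\<lambda>s X. tensor_class R S H (map (\<lambda>(s', a). (s \<otimes>\<^bsub>S\<^esub> s', a)) (rep X))))"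

definition base_change :: "'r ring \<Rightarrow> ('r, 's) module \<Rightarrow> ('r, 'a) hopf \<Rightarrow> ('s, ('s, 'a) tensor) hopf" where
  "base_change R S H =
     (let B = base_change_alg R S H;
          T = tensor S B B;
          j = pure_tensor R S H \<one>\<^bsub>S\<^esub>
      in module.extend B (hopf.fields
           (tensor_lift T (\<lambda>(s, a). s \<odot>\<^bsub>T\<^esub> tensor_map S B B j j (comult H a)))
           (tensor_lift S (\<lambda>(s, a). counit H a \<odot>\<^bsub>S\<^esub> s))
           (tensor_map R S H id (antipode H))))"

text \<open>
  The R-subalgebra B of a Hopf algebra L over S, where \<open>\<phi> : R \<rightarrow> S\<close> is injective, with the structure
  maps restricted from L: the comultiplication is the factorization of that of L through
  \<open>B \<otimes>\<^sub>R B \<rightarrow> L \<otimes>\<^sub>S L\<close>.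
\<close>

definition restrict_hopf ::
  "'r ring \<Rightarrow> ('r \<Rightarrow> 's) \<Rightarrow> 's ring \<Rightarrow> ('s, 'a) hopf \<Rightarrow> 'a set \<Rightarrow> ('r, 'a) hopf" where
  "restrict_hopf R \<phi> S L B =
     (let B' = restrict_alg \<phi> L B
      in module.extend B' (hopf.fields
           (\<lambda>x. inv_into (carrier (tensor R B' B')) (tensor_map S L L id id) (comult L x))
           (\<lambda>x. inv_into (carrier R) \<phi> (counit L x))
           (antipode L)))"

text \<open>The closed subscheme of Spec A (or closed subgroup scheme of Spec H) cut out by I.\<close>

definition quot_alg :: "('r, 'a, 'x) module_scheme \<Rightarrow> 'a set \<Rightarrow> ('r, 'a set) module" where
  "quot_alg A I =
     ring.extend (A Quot I) (module.fields (\<lambda>r X. (I +>\<^bsub>A\<^esub> (r \<odot>\<^bsub>A\<^esub> \<one>\<^bsub>A\<^esub>)) \<otimes>\<^bsub>A Quot I\<^esub> X))"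

definition quot_hopf :: "'r ring \<Rightarrow> ('r, 'a) hopf \<Rightarrow> 'a set \<Rightarrow> ('r, 'a set) hopf" where
  "quot_hopf R H I =
     (let Q = quot_alg H I; \<pi> = (\<lambda>x. I +>\<^bsub>H\<^esub> x)
      in module.extend Q (hopf.fields
           (\<lambda>X. tensor_map R Q Q \<pi> \<pi> (comult H (rep X)))
           (\<lambda>X. counit H (rep X))
           (\<lambda>X. \<pi> (antipode H (rep X)))))"

section \<open>The special linear group\<close>

text \<open>Polynomials in the entries of a square matrix with index type \<open>'m\<close>.\<close>

type_synonym ('m, 'r) mat_poly = "('m \<times> 'm \<Rightarrow>\<^sub>0 nat) \<Rightarrow>\<^sub>0 'r"

definition mat_poly_alg :: "('r::comm_ring_1, ('m, 'r) mat_poly) module" where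
  "mat_poly_alg = univ_alg (Poly_Mapping.single 0)"

definition mat_var :: "'m \<Rightarrow> 'm \<Rightarrow> ('m, 'r::comm_ring_1) mat_poly" where
  "mat_var i j = Poly_Mapping.single (Poly_Mapping.single (i, j) 1) 1"

text \<open>Evaluation at a matrix with entries in an R-algebra T.\<close>

definition mat_poly_eval ::
  "('r, 't, 'x) module_scheme \<Rightarrow> ('m \<Rightarrow> 'm \<Rightarrow> 't) \<Rightarrow> ('m, 'r::comm_ring_1) mat_poly \<Rightarrow> 't" where
  "mat_poly_eval T v p =
     finsum T (\<lambda>e. Poly_Mapping.lookup p e \<odot>\<^bsub>T\<^esub>
        finprod T (\<lambda>(i, j). v i j [^]\<^bsub>T\<^esub> Poly_Mapping.lookup e (i, j)) (Poly_Mapping.keys e))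
       (Poly_Mapping.keys p)"

definition SL_ideal :: "('m::finite, 'r::comm_ring_1) mat_poly set" where
  "SL_ideal = PIdl\<^bsub>mat_poly_alg :: ('r, ('m, 'r) mat_poly) module\<^esub> (det (\<chi> i j. mat_var i j) - 1)"

definition SL_alg :: "('r::comm_ring_1, ('m::finite, 'r) mat_poly set) module" where
  "SL_alg = quot_alg mat_poly_alg SL_ideal"

definition SL_class :: "('m::finite, 'r::comm_ring_1) mat_poly \<Rightarrow> ('m, 'r) mat_poly set" where
  "SL_class p = SL_ideal +>\<^bsub>mat_poly_alg :: ('r, ('m, 'r) mat_poly) module\<^esub> p"

text \<open>Entry (i, j) of the adjugate matrix: column i is replaced by the j-th unit vector.\<close>

definition adjugate_entry :: "'m::finite \<Rightarrow> 'm \<Rightarrow> ('m, 'r::comm_ring_1) mat_poly" where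
  "adjugate_entry i j =
     det (\<chi> k l. if l = i then (if k = j then 1 else 0) else mat_var k l)"

definition SL :: "('r::comm_ring_1, ('m::finite, 'r) mat_poly set) hopf" where
  "SL =
     (let T = tensor univ_ring SL_alg SL_alg
      in module.extend SL_alg (hopf.fields
           (\<lambda>X. mat_poly_eval T
              (\<lambda>i j. finsum T (\<lambda>k. pure_tensor univ_ring SL_alg SL_alg
                 (SL_class (mat_var i k)) (SL_class (mat_var k j))) UNIV) (rep X))
           (\<lambda>X. mat_poly_eval (univ_alg id) (\<lambda>i j. if i = j then 1 else 0) (rep X))
           (\<lambda>X. mat_poly_eval SL_alg (\<lambda>i j. SL_class (adjugate_entry i j)) (rep X))))"

text \<open>The coefficientwise map on coordinate rings of SL induced by a ring homomorphism.\<close>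

definition SL_map ::
  "('r::comm_ring_1 \<Rightarrow> 's::comm_ring_1) \<Rightarrow>
   ('m::finite, 'r) mat_poly set \<Rightarrow> ('m, 's) mat_poly set" where
  "SL_map \<phi> X = SL_class (Poly_Mapping.map \<phi> (rep X))"

definition faithful_representation ::
  "('r::comm_ring_1, 'a) hopf \<Rightarrow> (('m::finite, 'r) mat_poly set \<Rightarrow> 'a) \<Rightarrow> bool" where
  "faithful_representation A \<iota> \<longleftrightarrow>
     \<iota> \<in> hopf_hom univ_ring SL A \<and> \<iota> ` carrier (SL :: ('r, ('m, 'r) mat_poly set) hopf) = carrier A"

section \<open>The contraction group scheme\<close>

text \<open>
  \<open>F[t]\<close> is \<open>'f poly\<close>. The type \<open>'f laurent\<close> serves both as \<open>F[t, 1/t]\<close> and as \<open>F[u, 1/u]\<close>, where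
  u is the square root of t.
\<close>

type_synonym 'f laurent = "int \<Rightarrow>\<^sub>0 'f"

definition laurent_alg :: "('f::comm_ring_1, 'f laurent) module" where
  "laurent_alg = univ_alg (Poly_Mapping.single 0)"

definition poly_to_laurent :: "'f::comm_ring_1 poly \<Rightarrow> 'f laurent" where
  "poly_to_laurent p = (\<Sum>i\<le>degree p. Poly_Mapping.single (int i) (coeff p i))"

text \<open>The inclusions of \<open>F[t, 1/t]\<close> and \<open>F[t]\<close> in \<open>F[u, 1/u]\<close>, with t mapped to the square of u.\<close>

definition laurent_t_to_u :: "'f::comm_ring_1 laurent \<Rightarrow> 'f laurent" where
  "laurent_t_to_u p =
     (\<Sum>k\<in>Poly_Mapping.keys p. Poly_Mapping.single (2 * k) (Poly_Mapping.lookup p k))"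

definition poly_t_to_u :: "'f::comm_ring_1 poly \<Rightarrow> 'f laurent" where
  "poly_t_to_u p = laurent_t_to_u (poly_to_laurent p)"

text \<open>\<open>A[u, 1/u] = F[u, 1/u] \<otimes>\<^sub>F A\<close>; the monomial \<open>a u\<^sup>k\<close> is \<open>u\<^sup>k \<otimes> a\<close>.\<close>

definition laurent_hopf :: "('f::comm_ring_1, 'a) hopf \<Rightarrow> ('f laurent, ('f laurent, 'a) tensor) hopf" where
  "laurent_hopf A = base_change univ_ring laurent_alg A"

definition laurent_monom :: "('f::comm_ring_1, 'a) hopf \<Rightarrow> 'f \<Rightarrow> int \<Rightarrow> 'a \<Rightarrow> ('f laurent, 'a) tensor" where
  "laurent_monom A c k a = pure_tensor univ_ring laurent_alg A (Poly_Mapping.single k c) a"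

definition contraction_carrier ::
  "('f::comm_ring_1, 'a) hopf \<Rightarrow> ('a \<Rightarrow> 'a) \<Rightarrow> ('f laurent, 'a) tensor set" where
  "contraction_carrier A \<theta> =
     generated_subalgebra (univ_ring :: 'f poly ring)
       (restrict_alg poly_t_to_u (laurent_hopf A) (carrier (laurent_hopf A)))
       (laurent_monom A 1 0 ` {a \<in> carrier A. \<theta> a = a} \<union>
        laurent_monom A 1 (-1) ` {a \<in> carrier A. \<theta> a = \<ominus>\<^bsub>A\<^esub> a})"

definition contraction ::
  "('f::comm_ring_1, 'a) hopf \<Rightarrow> ('a \<Rightarrow> 'a) \<Rightarrow> ('f poly, ('f laurent, 'a) tensor) hopf" where
  "contraction A \<theta> =
     restrict_hopf univ_ring poly_t_to_u univ_ring (laurent_hopf A) (contraction_carrier A \<theta>)"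

section \<open>The Barbasch--Higson--Subag family\<close>

text \<open>
  The entries of the matrix obtained by conjugating the block diagonal matrix with blocks
  \<open>\<iota>(g)\<close> and \<open>\<iota>(\<theta>(g))\<close> by P; the block index is given by the two summands of \<open>'n + 'n\<close>.
\<close>

fun bhs_entry ::
  "(complex, 'a) hopf \<Rightarrow> ('a \<Rightarrow> 'a) \<Rightarrow> (('n::finite, complex) mat_poly set \<Rightarrow> 'a) \<Rightarrow>
   'n + 'n \<Rightarrow> 'n + 'n \<Rightarrow> (complex laurent, 'a) tensor" where
  "bhs_entry A \<theta> \<iota> (Inl i) (Inl j) =
     (let a = \<iota> (SL_class (mat_var i j)) in laurent_monom A (1/2) 0 (a \<oplus>\<^bsub>A\<^esub> \<theta> a))"
| "bhs_entry A \<theta> \<iota> (Inl i) (Inr j) =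
     (let a = \<iota> (SL_class (mat_var i j)) in laurent_monom A (1/2) 1 (a \<ominus>\<^bsub>A\<^esub> \<theta> a))"
| "bhs_entry A \<theta> \<iota> (Inr i) (Inl j) =
     (let a = \<iota> (SL_class (mat_var i j)) in laurent_monom A (1/2) (-1) (a \<ominus>\<^bsub>A\<^esub> \<theta> a))"
| "bhs_entry A \<theta> \<iota> (Inr i) (Inr j) =
     (let a = \<iota> (SL_class (mat_var i j)) in laurent_monom A (1/2) 0 (a \<oplus>\<^bsub>A\<^esub> \<theta> a))"

text \<open>The representation of the base change of G to \<open>C[u, 1/u]\<close>, on coordinate rings.\<close>

definition bhs_rep ::
  "(complex, 'a) hopf \<Rightarrow> ('a \<Rightarrow> 'a) \<Rightarrow> (('n::finite, complex) mat_poly set \<Rightarrow> 'a) \<Rightarrow>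
   ('n + 'n, complex laurent) mat_poly set \<Rightarrow> (complex laurent, 'a) tensor" where
  "bhs_rep A \<theta> \<iota> X = mat_poly_eval (laurent_hopf A) (bhs_entry A \<theta> \<iota>) (rep X)"

definition bhs_image_ideal ::
  "(complex, 'a) hopf \<Rightarrow> ('a \<Rightarrow> 'a) \<Rightarrow> (('n::finite, complex) mat_poly set \<Rightarrow> 'a) \<Rightarrow>
   ('n + 'n, complex laurent) mat_poly set set" where
  "bhs_image_ideal A \<theta> \<iota> = a_kernel SL (laurent_hopf A) (bhs_rep A \<theta> \<iota>)"

text \<open>
  The ideal of the closed subgroup scheme \<open>G\<^sub>t\<close> to which the image descends. Galois descent along
  \<open>u \<mapsto> -u\<close> takes the invariants of the stable ideal, that is, its intersection with the coordinate
  ring of SL over \<open>C[t, 1/t]\<close>.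
\<close>

definition bhs_descended_ideal ::
  "(complex, 'a) hopf \<Rightarrow> ('a \<Rightarrow> 'a) \<Rightarrow> (('n::finite, complex) mat_poly set \<Rightarrow> 'a) \<Rightarrow>
   ('n + 'n, complex laurent) mat_poly set set" where
  "bhs_descended_ideal A \<theta> \<iota> =
     {X \<in> carrier SL. SL_map laurent_t_to_u X \<in> bhs_image_ideal A \<theta> \<iota>}"

text \<open>The ideal of the Zariski closure of \<open>G\<^sub>t\<close> in SL over \<open>C[t]\<close>.\<close>

definition bhs_closure_ideal ::
  "(complex, 'a) hopf \<Rightarrow> ('a \<Rightarrow> 'a) \<Rightarrow> (('n::finite, complex) mat_poly set \<Rightarrow> 'a) \<Rightarrow>
   ('n + 'n, complex poly) mat_poly set set" where
  "bhs_closure_ideal A \<theta> \<iota> =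
     {X \<in> carrier SL. SL_map poly_to_laurent X \<in> bhs_descended_ideal A \<theta> \<iota>}"

definition bhs_family ::
  "(complex, 'a) hopf \<Rightarrow> ('a \<Rightarrow> 'a) \<Rightarrow> (('n::finite, complex) mat_poly set \<Rightarrow> 'a) \<Rightarrow>
   (complex poly, ('n + 'n, complex poly) mat_poly set set) hopf" where
  "bhs_family A \<theta> \<iota> = quot_hopf univ_ring SL (bhs_closure_ideal A \<theta> \<iota>)"

subsection \<open>The real case\<close>

definition complexification :: "(real, 'a) hopf \<Rightarrow> (complex, (complex, 'a) tensor) hopf" where
  "complexification A = base_change univ_ring (univ_alg of_real) A"

definition complexified_involution ::
  "(real, 'a) hopf \<Rightarrow> ('a \<Rightarrow> 'a) \<Rightarrow> (complex, 'a) tensor \<Rightarrow> (complex, 'a) tensor" where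
  "complexified_involution A \<theta> = tensor_map univ_ring (univ_alg of_real) A id \<theta>"

definition complexification_conj :: "(real, 'a) hopf \<Rightarrow> (complex, 'a) tensor \<Rightarrow> (complex, 'a) tensor" where
  "complexification_conj A = tensor_map univ_ring (univ_alg of_real) A cnj id"

text \<open>Its extension to Laurent polynomials, fixing u.\<close>

definition laurent_conj ::
  "(real, 'a) hopf \<Rightarrow>
   (complex laurent, (complex, 'a) tensor) tensor \<Rightarrow> (complex laurent, (complex, 'a) tensor) tensor" where
  "laurent_conj A =
     tensor_map univ_ring laurent_alg (complexification A)
       (Poly_Mapping.map cnj) (complexification_conj A)"

text \<open>
  The map from the coordinate ring of the family to that of the base change of G to \<open>C[u, 1/u]\<close>;
  it is injective, and the involution of the former is induced by that of the latter along it.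
\<close>

definition bhs_pullback ::
  "(complex, 'a) hopf \<Rightarrow> ('a \<Rightarrow> 'a) \<Rightarrow> (('n::finite, complex) mat_poly set \<Rightarrow> 'a) \<Rightarrow>
   ('n + 'n, complex poly) mat_poly set set \<Rightarrow> (complex laurent, 'a) tensor" where
  "bhs_pullback A \<theta> \<iota> X = bhs_rep A \<theta> \<iota> (SL_map poly_t_to_u (rep X))"

definition bhs_conj ::
  "(real, 'a) hopf \<Rightarrow> ('a \<Rightarrow> 'a) \<Rightarrow>
   (('n::finite, complex) mat_poly set \<Rightarrow> (complex, 'a) tensor) \<Rightarrow>
   ('n + 'n, complex poly) mat_poly set set \<Rightarrow> ('n + 'n, complex poly) mat_poly set set" where
  "bhs_conj A \<theta> \<iota> X =
     (let A' = complexification A; \<theta>' = complexified_involution A \<theta>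
      in inv_into (carrier (bhs_family A' \<theta>' \<iota>)) (bhs_pullback A' \<theta>' \<iota>)
           (laurent_conj A (bhs_pullback A' \<theta>' \<iota> X)))"

text \<open>The descent of the complex family: the invariants of the involution.\<close>

definition real_bhs_family ::
  "(real, 'a) hopf \<Rightarrow> ('a \<Rightarrow> 'a) \<Rightarrow>
   (('n::finite, complex) mat_poly set \<Rightarrow> (complex, 'a) tensor) \<Rightarrow>
   (real poly, ('n + 'n, complex poly) mat_poly set set) hopf" where
  "real_bhs_family A \<theta> \<iota> =
     (let K = bhs_family (complexification A) (complexified_involution A \<theta>) \<iota>
      in restrict_hopf univ_ring (map_poly of_real) univ_ring K
           {X \<in> carrier K. bhs_conj A \<theta> \<iota> X = X})"

end

theory Submission
  imports Defs
begin

text \<open>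
  Both group schemes are recognised inside the Hopf algebra \<open>L = A[u, 1/u]\<close>. The coordinate ring of the
  Zariski closure is the quotient of that of SL by the kernel of the evaluation at the conjugated
  representation, so it embeds into L, with image the \<open>F[t]\<close>-subalgebra generated by the matrix entries.
  These are multiples of \<open>a + \<theta>(a)\<close>, \<open>u (a - \<theta>(a))\<close> and \<open>u\<^sup>-\<^sup>1 (a - \<theta>(a))\<close> for the entries a of the
  faithful representation, and the even and odd parts of products are polynomials in even and odd parts;
  hence the image is the contraction algebra.

  That the inclusions are compatible with the comultiplications only determines these if
  \<open>B \<otimes> B \<rightarrow> L \<otimes> L\<close> is injective, for the \<open>F[t]\<close>-subalgebra B. A linear relation over \<open>F[u, 1/u]\<close>
  between elements fixed by \<open>u \<mapsto> -u\<close> combined with \<open>\<theta>\<close> implies one over \<open>F[t]\<close> (take traces and clear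
  denominators), and over the Euclidean ring \<open>F[t]\<close> such a relation shortens a tensor. The Hopf algebra
  axioms of B are then inherited from L.

  For the real family the same argument applies with \<open>L = A\<^sub>C[u, 1/u]\<close>, where the image is that of the
  real contraction algebra: the invariants of complex conjugation in the complex one.
\<close>

section \<open>Modules over a type-class ring\<close>

text \<open>The comultiplications of the contraction and of the real family are given by
  \<open>inv_into\<close>, that of the quotient by chosen representatives. That the embedding into L
  commutes with them says little about squares over F[t] until the map to the square over F[u, 1/u]
  is injective; coassociativity asks the same for cubes. The base ring changes along with the
  modules, so this is not a matter of tensoring an injection over one ring. Two properties replace
  flatness. Functionals separate the points of L and of \<open>tens L L\<close>, because both arise
  by scalar extension from vector spaces over F; they turn a vanishing tensor into a linear relation
  between its left factors. And such a relation over F[u, 1/u] descends to F[t]. Removing a summand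
  then rests on torsion freeness over F[t] instead of a basis. In the real case the base goes from
  R[t] to C[u, 1/u], and relations are descended twice: along conjugation of the coefficients with
  odd unit i, and along u -> -u with odd unit u. All maps are therefore kept semilinear along an
  explicit ring homomorphism.\<close>

lemma univ_ring_simps [simp]:
  "carrier (univ_ring :: 'r::comm_ring_1 ring) = UNIV"
  "x \<oplus>\<^bsub>univ_ring\<^esub> y = x + (y :: 'r)"
  "x \<otimes>\<^bsub>univ_ring\<^esub> y = x * y"
  "\<zero>\<^bsub>univ_ring\<^esub> = (0 :: 'r)"
  "\<one>\<^bsub>univ_ring\<^esub> = (1 :: 'r)"
  by (simp_all add: ring_of_type_algebra_def)

lemma cring_univ [simp, intro]: "cring (univ_ring :: 'r::comm_ring_1 ring)"
  by (rule cring_from_type_algebra)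

lemma univ_ring_minus [simp]: "\<ominus>\<^bsub>univ_ring\<^esub> x = - (x :: 'r::comm_ring_1)"
proof -
  interpret cring "univ_ring :: 'r ring" ..
  show ?thesis by (metis add.left_inverse minus_equality univ_ring_simps(1,2,4) UNIV_I)
qed

section \<open>Additive and semilinear maps\<close>

definition additive_maps :: "('a, 'x) ring_scheme \<Rightarrow> ('b, 'y) ring_scheme \<Rightarrow> ('a \<Rightarrow> 'b) set" where
  "additive_maps A B = {f \<in> carrier A \<rightarrow> carrier B.
     \<forall>x\<in>carrier A. \<forall>y\<in>carrier A. f (x \<oplus>\<^bsub>A\<^esub> y) = f x \<oplus>\<^bsub>B\<^esub> f y}"

text \<open>Scalars act through \<phi> on the target, so one notion covers linear maps, the
  inclusion of an F[t]-subalgebra in an algebra over F[u, 1/u], complex conjugation and u -> -u. The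
  scalar r ranges over the whole type, in accordance with \<open>univ_ring\<close> as base.\<close>

definition semilinear ::
  "('r \<Rightarrow> 's) \<Rightarrow> ('r, 'a, 'x) module_scheme \<Rightarrow> ('s, 'b, 'y) module_scheme \<Rightarrow> ('a \<Rightarrow> 'b) set" where
  "semilinear \<phi> A B = {f \<in> additive_maps A B. \<forall>r. \<forall>x\<in>carrier A. f (r \<odot>\<^bsub>A\<^esub> x) = \<phi> r \<odot>\<^bsub>B\<^esub> f x}"

lemma additive_mapsD:
  assumes "f \<in> additive_maps A B"
  shows "x \<in> carrier A \<Longrightarrow> f x \<in> carrier B"
    "x \<in> carrier A \<Longrightarrow> y \<in> carrier A \<Longrightarrow> f (x \<oplus>\<^bsub>A\<^esub> y) = f x \<oplus>\<^bsub>B\<^esub> f y"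
  using assms by (auto simp: additive_maps_def)

lemma semilinearD:
  assumes "f \<in> semilinear \<phi> A B"
  shows "x \<in> carrier A \<Longrightarrow> f x \<in> carrier B"
    "x \<in> carrier A \<Longrightarrow> y \<in> carrier A \<Longrightarrow> f (x \<oplus>\<^bsub>A\<^esub> y) = f x \<oplus>\<^bsub>B\<^esub> f y"
    "x \<in> carrier A \<Longrightarrow> f (r \<odot>\<^bsub>A\<^esub> x) = \<phi> r \<odot>\<^bsub>B\<^esub> f x"
    "f \<in> additive_maps A B"
  using assms by (auto simp: additive_maps_def semilinear_def)

lemma additive_mapsI:
  "(\<And>x. x \<in> carrier A \<Longrightarrow> f x \<in> carrier B) \<Longrightarrow>
   (\<And>x y. x \<in> carrier A \<Longrightarrow> y \<in> carrier A \<Longrightarrow> f (x \<oplus>\<^bsub>A\<^esub> y) = f x \<oplus>\<^bsub>B\<^esub> f y) \<Longrightarrow> f \<in> additive_maps A B"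
  by (auto simp: additive_maps_def)

lemma semilinearI:
  "(\<And>x. x \<in> carrier A \<Longrightarrow> f x \<in> carrier B) \<Longrightarrow>
   (\<And>x y. x \<in> carrier A \<Longrightarrow> y \<in> carrier A \<Longrightarrow> f (x \<oplus>\<^bsub>A\<^esub> y) = f x \<oplus>\<^bsub>B\<^esub> f y) \<Longrightarrow>
   (\<And>r x. x \<in> carrier A \<Longrightarrow> f (r \<odot>\<^bsub>A\<^esub> x) = \<phi> r \<odot>\<^bsub>B\<^esub> f x) \<Longrightarrow> f \<in> semilinear \<phi> A B"
  by (auto simp: additive_maps_def semilinear_def)

lemma additive_maps_zero:
  assumes "abelian_group A" "abelian_group B" "f \<in> additive_maps A B"
  shows "f \<zero>\<^bsub>A\<^esub> = \<zero>\<^bsub>B\<^esub>"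
proof -
  interpret A: abelian_group A by fact
  interpret B: abelian_group B by fact
  have "f \<zero>\<^bsub>A\<^esub> \<oplus>\<^bsub>B\<^esub> f \<zero>\<^bsub>A\<^esub> = f \<zero>\<^bsub>A\<^esub>"
    using additive_mapsD(2)[OF assms(3), of "\<zero>\<^bsub>A\<^esub>" "\<zero>\<^bsub>A\<^esub>"] by simp
  then show ?thesis
    using B.add.l_cancel_one' additive_mapsD(1)[OF assms(3)] by (metis A.zero_closed)
qed

lemma additive_maps_uminus:
  assumes "abelian_group A" "abelian_group B" "f \<in> additive_maps A B" "x \<in> carrier A"
  shows "f (\<ominus>\<^bsub>A\<^esub> x) = \<ominus>\<^bsub>B\<^esub> f x"
proof -
  interpret A: abelian_group A by fact
  interpret B: abelian_group B by fact
  have "f (\<ominus>\<^bsub>A\<^esub> x) \<oplus>\<^bsub>B\<^esub> f x = \<zero>\<^bsub>B\<^esub>"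
    using additive_mapsD(2)[OF assms(3), of "\<ominus>\<^bsub>A\<^esub> x" x] additive_maps_zero[OF assms(1-3)] assms(4)
    by (simp add: A.l_neg)
  then show ?thesis
    using B.minus_equality[of "f (\<ominus>\<^bsub>A\<^esub> x)" "f x"] additive_mapsD(1)[OF assms(3)] assms(4) by simp
qed

lemma additive_maps_minus:
  assumes "abelian_group A" "abelian_group B" "f \<in> additive_maps A B" "x \<in> carrier A" "y \<in> carrier A"
  shows "f (x \<ominus>\<^bsub>A\<^esub> y) = f x \<ominus>\<^bsub>B\<^esub> f y"
proof -
  interpret A: abelian_group A by fact
  show ?thesis using assms
    by (simp add: a_minus_def additive_mapsD additive_maps_uminus)
qed

text \<open>\<open>tensor_lift\<close> is such a sum over a chosen representative of a tensor; on
  arbitrary lists it can be studied by induction before independence of the representative is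
  known.\<close>

definition list_sum :: "('m, 'x) ring_scheme \<Rightarrow> ('p \<Rightarrow> 'm) \<Rightarrow> 'p list \<Rightarrow> 'm" where
  "list_sum M f xs = foldr (\<lambda>p v. f p \<oplus>\<^bsub>M\<^esub> v) xs \<zero>\<^bsub>M\<^esub>"

lemma list_sum_simps [simp]:
  "list_sum M f [] = \<zero>\<^bsub>M\<^esub>"
  "list_sum M f (p # xs) = f p \<oplus>\<^bsub>M\<^esub> list_sum M f xs"
  by (simp_all add: list_sum_def)

lemma list_sum_map: "list_sum M f (map g xs) = list_sum M (\<lambda>p. f (g p)) xs"
  by (induction xs) auto

lemma list_sum_cong: "(\<And>p. p \<in> set xs \<Longrightarrow> f p = g p) \<Longrightarrow> list_sum M f xs = list_sum M g xs"
  by (induction xs) auto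

context abelian_group
begin

lemma list_sum_closed [intro]: "(\<And>p. p \<in> set xs \<Longrightarrow> f p \<in> carrier G) \<Longrightarrow> list_sum G f xs \<in> carrier G"
  by (induction xs) auto

lemma list_sum_append:
  "(\<And>p. p \<in> set xs \<union> set ys \<Longrightarrow> f p \<in> carrier G) \<Longrightarrow>
   list_sum G f (xs @ ys) = list_sum G f xs \<oplus> list_sum G f ys"
  by (induction xs) (auto simp: list_sum_closed a_assoc)

lemma list_sum_add:
  "(\<And>p. p \<in> set xs \<Longrightarrow> f p \<in> carrier G) \<Longrightarrow> (\<And>p. p \<in> set xs \<Longrightarrow> g p \<in> carrier G) \<Longrightarrow>
   list_sum G (\<lambda>p. f p \<oplus> g p) xs = list_sum G f xs \<oplus> list_sum G g xs"
proof (induction xs)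
  case (Cons p xs)
  then have "list_sum G f xs \<in> carrier G" "list_sum G g xs \<in> carrier G" "f p \<in> carrier G" "g p \<in> carrier G"
    by auto
  with Cons show ?case by (simp add: a_ac)
qed simp

lemma list_sum_zero: "list_sum G (\<lambda>p. \<zero>) xs = \<zero>"
  by (induction xs) auto

lemma list_sum_swap:
  "(\<And>p q. p \<in> set xs \<Longrightarrow> q \<in> set ys \<Longrightarrow> f p q \<in> carrier G) \<Longrightarrow>
   list_sum G (\<lambda>p. list_sum G (\<lambda>q. f p q) ys) xs = list_sum G (\<lambda>q. list_sum G (\<lambda>p. f p q) xs) ys"
proof (induction xs)
  case Nil then show ?case by (simp add: list_sum_zero)
next
  case (Cons p xs)
  have "list_sum G (\<lambda>q. list_sum G (\<lambda>p. f p q) (p # xs)) ys =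
    list_sum G (f p) ys \<oplus> list_sum G (\<lambda>q. list_sum G (\<lambda>p. f p q) xs) ys"
    by (subst list_sum_add[symmetric]) (use Cons.prems in auto)
  then show ?case using Cons by simp
qed

end

lemma additive_maps_list_sum:
  assumes "abelian_group A" "abelian_group B" "h \<in> additive_maps A B"
    "\<And>p. p \<in> set xs \<Longrightarrow> f p \<in> carrier A"
  shows "h (list_sum A f xs) = list_sum B (\<lambda>p. h (f p)) xs"
  using assms(4)
proof (induction xs)
  case Nil then show ?case using additive_maps_zero[OF assms(1-3)] by simp
next
  case (Cons p xs)
  interpret A: abelian_group A by fact
  show ?case using Cons additive_mapsD(2)[OF assms(3), of "f p" "list_sum A f xs"] by auto
qed

section \<open>The tensor product of modules\<close>

abbreviation tens :: "('r::comm_ring_1, 'a, 'x) module_scheme \<Rightarrow> ('r, 'b, 'y) module_scheme \<Rightarrow>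
    ('r, ('a, 'b) tensor) module" where
  "tens A B \<equiv> tensor univ_ring A B"

abbreviation tens_class :: "('r::comm_ring_1, 'a, 'x) module_scheme \<Rightarrow> ('r, 'b, 'y) module_scheme \<Rightarrow>
    ('a \<times> 'b) list \<Rightarrow> ('a, 'b) tensor" where
  "tens_class A B \<equiv> tensor_class univ_ring A B"

abbreviation pure :: "('r::comm_ring_1, 'a, 'x) module_scheme \<Rightarrow> ('r, 'b, 'y) module_scheme \<Rightarrow>
    'a \<Rightarrow> 'b \<Rightarrow> ('a, 'b) tensor" where
  "pure A B \<equiv> pure_tensor univ_ring A B"

abbreviation tmap :: "('r::comm_ring_1, 'a, 'x) module_scheme \<Rightarrow> ('r, 'b, 'y) module_scheme \<Rightarrow>
    ('c \<Rightarrow> 'a) \<Rightarrow> ('d \<Rightarrow> 'b) \<Rightarrow> ('c, 'd) tensor \<Rightarrow> ('a, 'b) tensor" where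
  "tmap A B \<equiv> tensor_map univ_ring A B"

text \<open>Only the addition of M enters, never scalars on M. The target may thus be a module over
  another ring, as happens for tensor products of semilinear maps.\<close>

definition balanced_map ::
  "('r::comm_ring_1, 'a, 'x) module_scheme \<Rightarrow> ('r, 'b, 'y) module_scheme \<Rightarrow> ('m, 'z) ring_scheme \<Rightarrow>
   ('a \<times> 'b \<Rightarrow> 'm) \<Rightarrow> bool" where
  "balanced_map A B M f \<longleftrightarrow>
     (\<forall>a\<in>carrier A. \<forall>b\<in>carrier B. f (a, b) \<in> carrier M) \<and>
     (\<forall>a\<in>carrier A. \<forall>a'\<in>carrier A. \<forall>b\<in>carrier B. f (a \<oplus>\<^bsub>A\<^esub> a', b) = f (a, b) \<oplus>\<^bsub>M\<^esub> f (a', b)) \<and>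
     (\<forall>a\<in>carrier A. \<forall>b\<in>carrier B. \<forall>b'\<in>carrier B. f (a, b \<oplus>\<^bsub>B\<^esub> b') = f (a, b) \<oplus>\<^bsub>M\<^esub> f (a, b')) \<and>
     (\<forall>r. \<forall>a\<in>carrier A. \<forall>b\<in>carrier B. f (r \<odot>\<^bsub>A\<^esub> a, b) = f (a, r \<odot>\<^bsub>B\<^esub> b))"

lemma balanced_mapI:
  assumes "\<And>a b. a \<in> carrier A \<Longrightarrow> b \<in> carrier B \<Longrightarrow> f (a, b) \<in> carrier M"
    "\<And>a a' b. a \<in> carrier A \<Longrightarrow> a' \<in> carrier A \<Longrightarrow> b \<in> carrier B \<Longrightarrow> f (a \<oplus>\<^bsub>A\<^esub> a', b) = f (a, b) \<oplus>\<^bsub>M\<^esub> f (a', b)"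
    "\<And>a b b'. a \<in> carrier A \<Longrightarrow> b \<in> carrier B \<Longrightarrow> b' \<in> carrier B \<Longrightarrow> f (a, b \<oplus>\<^bsub>B\<^esub> b') = f (a, b) \<oplus>\<^bsub>M\<^esub> f (a, b')"
    "\<And>r a b. a \<in> carrier A \<Longrightarrow> b \<in> carrier B \<Longrightarrow> f (r \<odot>\<^bsub>A\<^esub> a, b) = f (a, r \<odot>\<^bsub>B\<^esub> b)"
  shows "balanced_map A B M f"
  using assms by (simp add: balanced_map_def)

lemma balanced_mapD:
  assumes "balanced_map A B M f"
  shows "a \<in> carrier A \<Longrightarrow> b \<in> carrier B \<Longrightarrow> f (a, b) \<in> carrier M"
    "a \<in> carrier A \<Longrightarrow> a' \<in> carrier A \<Longrightarrow> b \<in> carrier B \<Longrightarrow> f (a \<oplus>\<^bsub>A\<^esub> a', b) = f (a, b) \<oplus>\<^bsub>M\<^esub> f (a', b)"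
    "a \<in> carrier A \<Longrightarrow> b \<in> carrier B \<Longrightarrow> b' \<in> carrier B \<Longrightarrow> f (a, b \<oplus>\<^bsub>B\<^esub> b') = f (a, b) \<oplus>\<^bsub>M\<^esub> f (a, b')"
    "a \<in> carrier A \<Longrightarrow> b \<in> carrier B \<Longrightarrow> f (r \<odot>\<^bsub>A\<^esub> a, b) = f (a, r \<odot>\<^bsub>B\<^esub> b)"
  using assms by (simp_all add: balanced_map_def)

locale tensor_modules = A: module univ_ring A + B: module univ_ring B
  for A :: "('r::comm_ring_1, 'a, 'x) module_scheme" and B :: "('r, 'b, 'y) module_scheme"
begin

definition valid :: "('a \<times> 'b) list \<Rightarrow> bool" where
  "valid x \<longleftrightarrow> set x \<subseteq> carrier A \<times> carrier B"

lemma valid_simps [simp]: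
  "valid []" "valid (p # x) \<longleftrightarrow> p \<in> carrier A \<times> carrier B \<and> valid x"
  "valid (x @ y) \<longleftrightarrow> valid x \<and> valid y"
  by (auto simp: valid_def)

lemma rel_valid: "tensor_rel univ_ring A B x y \<Longrightarrow> valid x \<and> valid y"
  by (induction rule: tensor_rel.induct) (auto simp: valid_def)

lemma rel_refl: "valid x \<Longrightarrow> tensor_rel univ_ring A B x x"
  by (auto simp: valid_def intro: tensor_rel.refl)

lemma class_eq_iff: "valid x \<Longrightarrow> tens_class A B x = tens_class A B y \<longleftrightarrow> tensor_rel univ_ring A B x y"
  unfolding tensor_class_def
  by (auto intro: tensor_rel.trans tensor_rel.sym dest: rel_refl)

lemma rel_class: "tensor_rel univ_ring A B x y \<Longrightarrow> tens_class A B x = tens_class A B y"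
  using class_eq_iff rel_valid by blast

lemma rel_rep: "valid x \<Longrightarrow> tensor_rel univ_ring A B x (rep (tens_class A B x))"
  unfolding rep_def tensor_class_def using someI[of "tensor_rel univ_ring A B x" x] rel_refl by simp

lemma class_rep: "valid x \<Longrightarrow> tens_class A B (rep (tens_class A B x)) = tens_class A B x"
  using rel_rep rel_class by metis

lemma valid_rep: "valid x \<Longrightarrow> valid (rep (tens_class A B x))"
  using rel_rep rel_valid by blast

lemma carrier_tens: "carrier (tens A B) = tens_class A B ` {x. valid x}"
  by (simp add: tensor_def valid_def)

lemma class_in_carrier [intro, simp]: "valid x \<Longrightarrow> tens_class A B x \<in> carrier (tens A B)"
  by (simp add: carrier_tens)

lemma in_carrierE:
  assumes "X \<in> carrier (tens A B)" obtains x where "valid x" "X = tens_class A B x"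
  using assms by (auto simp: carrier_tens)

lemma balanced_zero:
  assumes "abelian_group M" "balanced_map A B M f"
  shows "b \<in> carrier B \<Longrightarrow> f (\<zero>\<^bsub>A\<^esub>, b) = \<zero>\<^bsub>M\<^esub>" "a \<in> carrier A \<Longrightarrow> f (a, \<zero>\<^bsub>B\<^esub>) = \<zero>\<^bsub>M\<^esub>"
proof -
  have "b \<in> carrier B \<Longrightarrow> (\<lambda>a. f (a, b)) \<in> additive_maps A M"
    "a \<in> carrier A \<Longrightarrow> (\<lambda>b. f (a, b)) \<in> additive_maps B M"
    using balanced_mapD[OF assms(2)] by (auto intro!: additive_mapsI)
  then show "b \<in> carrier B \<Longrightarrow> f (\<zero>\<^bsub>A\<^esub>, b) = \<zero>\<^bsub>M\<^esub>" "a \<in> carrier A \<Longrightarrow> f (a, \<zero>\<^bsub>B\<^esub>) = \<zero>\<^bsub>M\<^esub>"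
    using additive_maps_zero[OF A.abelian_group_axioms assms(1)]
      additive_maps_zero[OF B.abelian_group_axioms assms(1)] by auto
qed

lemma balanced_closed:
  assumes "balanced_map A B M f" "valid x" "p \<in> set x"
  shows "f p \<in> carrier M"
  using assms balanced_mapD(1)[OF assms(1)] by (auto simp: valid_def)

text \<open>The universal property at the level of lists: each generator of the congruence
  corresponds to a clause of \<open>balanced_map\<close>, to additivity (the zero rules) or to
  commutativity of M.\<close>

lemma list_sum_rel:
  assumes M: "abelian_group M" and f: "balanced_map A B M f"
  shows "tensor_rel univ_ring A B x y \<Longrightarrow> list_sum M f x = list_sum M f y"
proof (induction rule: tensor_rel.induct)
  case (append x y x' y')
  interpret M: abelian_group M by fact
  have "valid (x @ y @ x' @ y')" using append rel_valid by auto
  then have c: "p \<in> set (x @ y @ x' @ y') \<Longrightarrow> f p \<in> carrier M" for p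
    using balanced_closed[OF f] by blast
  have "list_sum M f (x @ x') = list_sum M f x \<oplus>\<^bsub>M\<^esub> list_sum M f x'"
    "list_sum M f (y @ y') = list_sum M f y \<oplus>\<^bsub>M\<^esub> list_sum M f y'"
    by (rule M.list_sum_append, rule c, force)+
  then show ?case using append by simp
next
  case (commute x y)
  interpret M: abelian_group M by fact
  have c: "p \<in> set x \<union> set y \<Longrightarrow> f p \<in> carrier M" for p
    using balanced_mapD(1)[OF f] commute by auto
  have "list_sum M f (x @ y) = list_sum M f x \<oplus>\<^bsub>M\<^esub> list_sum M f y"
    "list_sum M f (y @ x) = list_sum M f y \<oplus>\<^bsub>M\<^esub> list_sum M f x"
    by (rule M.list_sum_append, rule c, force)+
  moreover have "list_sum M f x \<in> carrier M" "list_sum M f y \<in> carrier M"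
    by (rule M.list_sum_closed, rule c, force)+
  ultimately show ?case by (simp add: M.a_comm)
next
  case (add_left a a' b)
  interpret M: abelian_group M by fact
  show ?case using balanced_mapD[OF f] add_left by (auto simp: M.a_ac)
next
  case (add_right a b b')
  interpret M: abelian_group M by fact
  show ?case using balanced_mapD[OF f] add_right by (auto simp: M.a_ac)
next
  case (zero_left b)
  interpret M: abelian_group M by fact
  show ?case using balanced_zero[OF M f] zero_left by auto
next
  case (zero_right b)
  interpret M: abelian_group M by fact
  show ?case using balanced_zero[OF M f] zero_right by auto
next
  case (balanced r a b)
  show ?case using balanced_mapD(4)[OF f] balanced by auto
qed auto

lemma tensor_lift_class:
  assumes "abelian_group M" "balanced_map A B M f" "valid x"
  shows "tensor_lift M f (tens_class A B x) = list_sum M f x"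
  using list_sum_rel[OF assms(1,2) rel_rep[OF assms(3)]]
  by (simp add: tensor_lift_def list_sum_def)

lemma add_class: "valid x \<Longrightarrow> valid y \<Longrightarrow>
    tens_class A B x \<oplus>\<^bsub>tens A B\<^esub> tens_class A B y = tens_class A B (x @ y)"
  by (simp add: tensor_def) (metis rel_class rel_rep tensor_rel.append)

lemma zero_class: "\<zero>\<^bsub>tens A B\<^esub> = tens_class A B []"
  by (simp add: tensor_def)

lemma pure_class: "pure A B a b = tens_class A B [(a, b)]"
  by (simp add: pure_tensor_def)

lemma pure_closed [simp, intro]: "a \<in> carrier A \<Longrightarrow> b \<in> carrier B \<Longrightarrow> pure A B a b \<in> carrier (tens A B)"
  by (simp add: pure_class)

lemma abelian_group_tens: "abelian_group (tens A B)"
proof (rule abelian_groupI)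
  fix X Y Z
  assume "X \<in> carrier (tens A B)" "Y \<in> carrier (tens A B)"
  then obtain x y where *: "valid x" "X = tens_class A B x" "valid y" "Y = tens_class A B y"
    by (auto elim!: in_carrierE)
  then show "X \<oplus>\<^bsub>tens A B\<^esub> Y \<in> carrier (tens A B)" by (simp add: add_class)
  show "X \<oplus>\<^bsub>tens A B\<^esub> Y = Y \<oplus>\<^bsub>tens A B\<^esub> X"
    using * by (simp add: add_class rel_class tensor_rel.commute valid_def)
  assume "Z \<in> carrier (tens A B)"
  then obtain z where "valid z" "Z = tens_class A B z" by (auto elim!: in_carrierE)
  then show "X \<oplus>\<^bsub>tens A B\<^esub> Y \<oplus>\<^bsub>tens A B\<^esub> Z = X \<oplus>\<^bsub>tens A B\<^esub> (Y \<oplus>\<^bsub>tens A B\<^esub> Z)"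
    using * by (simp add: add_class)
next
  show "\<zero>\<^bsub>tens A B\<^esub> \<in> carrier (tens A B)" by (simp add: zero_class)
next
  fix X assume "X \<in> carrier (tens A B)"
  then obtain x where x: "valid x" "X = tens_class A B x" by (auto elim!: in_carrierE)
  then show "\<zero>\<^bsub>tens A B\<^esub> \<oplus>\<^bsub>tens A B\<^esub> X = X" by (simp add: zero_class add_class)
  have neg: "valid x \<Longrightarrow> \<exists>y. valid y \<and> tens_class A B (y @ x) = tens_class A B []" for x
  proof (induction x)
    case Nil show ?case by (rule exI[of _ "[]"]) simp
  next
    case (Cons p x)
    obtain a b where p: "p = (a, b)" by force
    from Cons obtain y where y: "valid y" "tens_class A B (y @ x) = tens_class A B []" by auto
    have ab: "a \<in> carrier A" "b \<in> carrier B" using Cons.prems p by auto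
    \<comment> \<open>The inverse is appended at the end, so that in \<open>?y @ p # x\<close> the
      cancelling pair is adjacent and the induction hypothesis applies to the rest.\<close>
    let ?y = "y @ [(\<ominus>\<^bsub>A\<^esub> a, b)]"
    have "tensor_rel univ_ring A B [(\<ominus>\<^bsub>A\<^esub> a, b), (a, b)] [(\<ominus>\<^bsub>A\<^esub> a \<oplus>\<^bsub>A\<^esub> a, b)]"
      using ab by (intro tensor_rel.sym[OF tensor_rel.add_left]) auto
    moreover have "tensor_rel univ_ring A B [(\<ominus>\<^bsub>A\<^esub> a \<oplus>\<^bsub>A\<^esub> a, b)] []"
      using ab by (simp add: A.M.l_neg tensor_rel.zero_left)
    ultimately have r: "tensor_rel univ_ring A B [(\<ominus>\<^bsub>A\<^esub> a, b), (a, b)] []"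
      by (rule tensor_rel.trans)
    have "tensor_rel univ_ring A B (y @ [(\<ominus>\<^bsub>A\<^esub> a, b), (a, b)] @ x) (y @ [] @ x)"
      using Cons.prems y(1) by (intro tensor_rel.append r rel_refl) auto
    then have "tens_class A B (?y @ p # x) = tens_class A B (y @ x)" by (simp add: p rel_class)
    then show ?case using y ab by (intro exI[of _ ?y]) auto
  qed
  then show "\<exists>Y\<in>carrier (tens A B). Y \<oplus>\<^bsub>tens A B\<^esub> X = \<zero>\<^bsub>tens A B\<^esub>"
    using x by (auto simp: zero_class add_class carrier_tens)
qed

sublocale T: abelian_group "tens A B" by (rule abelian_group_tens)

lemma list_sum_class:
  assumes "\<And>p. p \<in> set xs \<Longrightarrow> valid (g p)"
  shows "list_sum (tens A B) (\<lambda>p. tens_class A B (g p)) xs = tens_class A B (concat (map g xs))"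
proof -
  have "(\<forall>p\<in>set xs. valid (g p)) \<Longrightarrow> valid (concat (map g xs)) \<and>
     list_sum (tens A B) (\<lambda>p. tens_class A B (g p)) xs = tens_class A B (concat (map g xs))"
    by (induction xs) (auto simp: zero_class add_class)
  then show ?thesis using assms by auto
qed

lemma list_sum_pure:
  "(\<And>p. p \<in> set xs \<Longrightarrow> g p \<in> carrier A) \<Longrightarrow> (\<And>p. p \<in> set xs \<Longrightarrow> h p \<in> carrier B) \<Longrightarrow>
    list_sum (tens A B) (\<lambda>p. pure A B (g p) (h p)) xs = tens_class A B (map (\<lambda>p. (g p, h p)) xs)"
  unfolding pure_class using list_sum_class[of xs "\<lambda>p. [(g p, h p)]"] by simp

text \<open>Reduces most later statements about tensors to pure tensors and sums, without lists or
  representatives.\<close>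

lemma tensor_induct [consumes 1, case_names zero pure add]:
  assumes "X \<in> carrier (tens A B)" "P \<zero>\<^bsub>tens A B\<^esub>"
    "\<And>a b. a \<in> carrier A \<Longrightarrow> b \<in> carrier B \<Longrightarrow> P (pure A B a b)"
    "\<And>X Y. X \<in> carrier (tens A B) \<Longrightarrow> Y \<in> carrier (tens A B) \<Longrightarrow> P X \<Longrightarrow> P Y \<Longrightarrow> P (X \<oplus>\<^bsub>tens A B\<^esub> Y)"
  shows "P X"
proof -
  have "valid x \<Longrightarrow> P (tens_class A B x)" for x
  proof (induction x)
    case Nil then show ?case using assms(2) by (simp add: zero_class)
  next
    case (Cons p x)
    obtain a b where p: "p = (a, b)" by force
    have "tens_class A B (p # x) = pure A B a b \<oplus>\<^bsub>tens A B\<^esub> tens_class A B x"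
      using Cons.prems p by (simp add: pure_class add_class)
    then show ?case using Cons assms(3,4) p by auto
  qed
  then show ?thesis using assms(1) by (auto elim: in_carrierE)
qed

lemma additive_maps_tensor_eqI:
  assumes "abelian_group M" "f \<in> additive_maps (tens A B) M" "g \<in> additive_maps (tens A B) M"
    "\<And>a b. a \<in> carrier A \<Longrightarrow> b \<in> carrier B \<Longrightarrow> f (pure A B a b) = g (pure A B a b)"
    "X \<in> carrier (tens A B)"
  shows "f X = g X"
  using assms(5)
  by (induction rule: tensor_induct)
     (simp_all add: assms(4) additive_mapsD[OF assms(2)] additive_mapsD[OF assms(3)]
       additive_maps_zero[OF abelian_group_tens assms(1)] assms(2,3))

lemma tensor_lift_additive:
  assumes "abelian_group M" "balanced_map A B M f"
  shows "tensor_lift M f \<in> additive_maps (tens A B) M"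
proof (rule additive_mapsI)
  interpret M: abelian_group M by fact
  fix X Y assume "X \<in> carrier (tens A B)"
  then obtain x where x: "valid x" "X = tens_class A B x" by (auto elim: in_carrierE)
  show "tensor_lift M f X \<in> carrier M"
    using x balanced_closed[OF assms(2)] by (auto simp: tensor_lift_class[OF assms])
  assume "Y \<in> carrier (tens A B)"
  then obtain y where y: "valid y" "Y = tens_class A B y" by (auto elim: in_carrierE)
  then show "tensor_lift M f (X \<oplus>\<^bsub>tens A B\<^esub> Y) = tensor_lift M f X \<oplus>\<^bsub>M\<^esub> tensor_lift M f Y"
    using x balanced_closed[OF assms(2)] M.list_sum_append[of x y f]
    by (auto simp: tensor_lift_class[OF assms] add_class)
qed

lemma tensor_lift_pure:
  assumes "abelian_group M" "balanced_map A B M f" "a \<in> carrier A" "b \<in> carrier B"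
  shows "tensor_lift M f (pure A B a b) = f (a, b)"
proof -
  interpret M: abelian_group M by fact
  show ?thesis using assms balanced_mapD(1)[OF assms(2-4)] by (simp add: pure_class tensor_lift_class)
qed

lemma pure_balanced: "balanced_map A B (tens A B) (\<lambda>(a, b). pure A B a b)"
proof (rule balanced_mapI; clarsimp)
  show "\<And>a a' b. a \<in> carrier A \<Longrightarrow> a' \<in> carrier A \<Longrightarrow> b \<in> carrier B \<Longrightarrow>
      pure A B (a \<oplus>\<^bsub>A\<^esub> a') b = pure A B a b \<oplus>\<^bsub>tens A B\<^esub> pure A B a' b"
    by (simp add: pure_class add_class rel_class tensor_rel.add_left)
  show "\<And>a b b'. a \<in> carrier A \<Longrightarrow> b \<in> carrier B \<Longrightarrow> b' \<in> carrier B \<Longrightarrow>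
      pure A B a (b \<oplus>\<^bsub>B\<^esub> b') = pure A B a b \<oplus>\<^bsub>tens A B\<^esub> pure A B a b'"
    by (simp add: pure_class add_class rel_class tensor_rel.add_right)
  show "\<And>r a b. a \<in> carrier A \<Longrightarrow> b \<in> carrier B \<Longrightarrow> pure A B (r \<odot>\<^bsub>A\<^esub> a) b = pure A B a (r \<odot>\<^bsub>B\<^esub> b)"
    by (simp add: pure_class rel_class tensor_rel.balanced)
qed

lemmas pure_add_left = balanced_mapD(2)[OF pure_balanced, simplified]
lemmas pure_add_right = balanced_mapD(3)[OF pure_balanced, simplified]
lemmas pure_smult_swap = balanced_mapD(4)[OF pure_balanced, simplified]
lemmas pure_zero_left = balanced_zero(1)[OF abelian_group_tens pure_balanced, simplified]
lemmas pure_zero_right = balanced_zero(2)[OF abelian_group_tens pure_balanced, simplified]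

lemma pure_uminus_left:
  "a \<in> carrier A \<Longrightarrow> b \<in> carrier B \<Longrightarrow> pure A B (\<ominus>\<^bsub>A\<^esub> a) b = \<ominus>\<^bsub>tens A B\<^esub> pure A B a b"
  by (rule additive_maps_uminus[OF A.abelian_group_axioms abelian_group_tens, of "\<lambda>a. pure A B a b"])
     (auto intro!: additive_mapsI simp: pure_add_left)

lemma pure_uminus_right:
  "a \<in> carrier A \<Longrightarrow> b \<in> carrier B \<Longrightarrow> pure A B a (\<ominus>\<^bsub>B\<^esub> b) = \<ominus>\<^bsub>tens A B\<^esub> pure A B a b"
  by (rule additive_maps_uminus[OF B.abelian_group_axioms abelian_group_tens, of "\<lambda>b. pure A B a b"])
     (auto intro!: additive_mapsI simp: pure_add_right)

text \<open>Scalar multiplication of a tensor is computed on \<open>rep\<close>. Since r (s a) = s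
  (r a) over a commutative ring, (a, b) -> r a \<otimes> b is balanced, so the value does not depend
  on the representative.\<close>

lemma smult_class:
  assumes "valid x"
  shows "r \<odot>\<^bsub>tens A B\<^esub> tens_class A B x = tens_class A B (map (\<lambda>(a, b). (r \<odot>\<^bsub>A\<^esub> a, b)) x)"
proof -
  let ?f = "\<lambda>(a, b). pure A B (r \<odot>\<^bsub>A\<^esub> a) b"
  have bal: "balanced_map A B (tens A B) ?f"
  proof (rule balanced_mapI; clarsimp)
    fix s a b assume "a \<in> carrier A" "b \<in> carrier B"
    then show "pure A B (r \<odot>\<^bsub>A\<^esub> (s \<odot>\<^bsub>A\<^esub> a)) b = pure A B (r \<odot>\<^bsub>A\<^esub> a) (s \<odot>\<^bsub>B\<^esub> b)"
      using A.smult_assoc1[of r s a] A.smult_assoc1[of s r a]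
      by (simp add: pure_smult_swap[symmetric] mult.commute)
  qed (simp_all add: pure_add_left pure_add_right A.smult_r_distr)
  have "list_sum (tens A B) ?f x = tens_class A B (map (\<lambda>(a, b). (r \<odot>\<^bsub>A\<^esub> a, b)) x)" if "valid x" for x
    unfolding split_def using that by (intro list_sum_pure) (auto simp: valid_def intro!: A.smult_closed)
  then show ?thesis
    using list_sum_rel[OF abelian_group_tens bal rel_rep[OF assms]] assms valid_rep[OF assms]
    by (simp add: tensor_def)
qed

lemma smult_pure:
  "a \<in> carrier A \<Longrightarrow> b \<in> carrier B \<Longrightarrow> r \<odot>\<^bsub>tens A B\<^esub> pure A B a b = pure A B (r \<odot>\<^bsub>A\<^esub> a) b"
  by (simp add: pure_class smult_class)

lemma smult_tens_additive: "(\<lambda>X. r \<odot>\<^bsub>tens A B\<^esub> X) \<in> additive_maps (tens A B) (tens A B)"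
proof (rule additive_mapsI)
  have v: "valid x \<Longrightarrow> valid (map (\<lambda>(a, b). (r \<odot>\<^bsub>A\<^esub> a, b)) x)" for x by (auto simp: valid_def)
  fix X Y assume "X \<in> carrier (tens A B)"
  then obtain x where x: "valid x" "X = tens_class A B x" by (auto elim: in_carrierE)
  then show "r \<odot>\<^bsub>tens A B\<^esub> X \<in> carrier (tens A B)" using v by (simp add: smult_class)
  assume "Y \<in> carrier (tens A B)"
  then obtain y where "valid y" "Y = tens_class A B y" by (auto elim: in_carrierE)
  with x v show "r \<odot>\<^bsub>tens A B\<^esub> (X \<oplus>\<^bsub>tens A B\<^esub> Y) = r \<odot>\<^bsub>tens A B\<^esub> X \<oplus>\<^bsub>tens A B\<^esub> r \<odot>\<^bsub>tens A B\<^esub> Y"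
    by (simp add: smult_class add_class)
qed

lemma module_tens: "module univ_ring (tens A B)"
proof -
  note add = additive_mapsD[OF smult_tens_additive]
  note zero = additive_maps_zero[OF abelian_group_tens abelian_group_tens smult_tens_additive]
  show ?thesis
  proof (rule moduleI; (simp add: abelian_group_tens add)?)
    fix r s X assume X: "X \<in> carrier (tens A B)"
    show "(r + s) \<odot>\<^bsub>tens A B\<^esub> X = r \<odot>\<^bsub>tens A B\<^esub> X \<oplus>\<^bsub>tens A B\<^esub> s \<odot>\<^bsub>tens A B\<^esub> X"
      using X
    proof (induction rule: tensor_induct)
      case (pure a b)
      then show ?case using A.smult_l_distr[of r s a] by (simp add: smult_pure pure_add_left)
    qed (simp_all add: zero add T.a_ac)
    show "(r * s) \<odot>\<^bsub>tens A B\<^esub> X = r \<odot>\<^bsub>tens A B\<^esub> (s \<odot>\<^bsub>tens A B\<^esub> X)"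
      using X
    proof (induction rule: tensor_induct)
      case (pure a b)
      then show ?case using A.smult_assoc1[of r s a] by (simp add: smult_pure)
    qed (simp_all add: zero add)
    show "1 \<odot>\<^bsub>tens A B\<^esub> X = X"
      using X
    proof (induction rule: tensor_induct)
      case (pure a b)
      then show ?case using A.smult_one[of a] by (simp add: smult_pure)
    qed (simp_all add: zero add)
  qed
qed

text \<open>\<open>tensor_map\<close> rewrites a representative of X term by term, so as a class it
  is the sum of the pure tensors f a \<otimes> g b. As a lift it becomes accessible to the universal
  property.\<close>

lemma tensor_map_eq_lift:
  assumes "X \<in> carrier (tens A B)" "module univ_ring C" "module univ_ring D"
    "f \<in> carrier A \<rightarrow> carrier C" "g \<in> carrier B \<rightarrow> carrier D"
  shows "tmap C D f g X = tensor_lift (tens C D) (\<lambda>(a, b). pure C D (f a) (g b)) X"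
proof -
  interpret CD: tensor_modules C D by (intro tensor_modules.intro assms)
  obtain x where x: "valid x" "X = tens_class A B x" using assms(1) by (auto elim: in_carrierE)
  have "valid (rep X)" using x valid_rep by simp
  then show ?thesis using assms(4,5)
    unfolding tensor_map_def tensor_lift_def
    using CD.list_sum_pure[of "rep X" "\<lambda>p. f (fst p)" "\<lambda>p. g (snd p)"]
    by (auto simp: valid_def list_sum_def map_prod_def split_def Pi_def subset_iff)
qed

end

section \<open>Tensor products of semilinear maps\<close>

lemma semilinear_pure_balanced:
  assumes "module univ_ring A" "module univ_ring B" "module univ_ring C" "module univ_ring D"
    "f \<in> semilinear \<phi> A C" "g \<in> semilinear \<phi> B D"
  shows "balanced_map A B (tens C D) (\<lambda>(a, b). pure C D (f a) (g b))"
proof -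
  interpret CD: tensor_modules C D by (intro tensor_modules.intro assms)
  note f = semilinearD[OF assms(5)] and g = semilinearD[OF assms(6)]
  show ?thesis
    by (rule balanced_mapI) (auto simp: f g CD.pure_add_left CD.pure_add_right CD.pure_smult_swap)
qed

lemma tensor_map_pure:
  assumes "module univ_ring A" "module univ_ring B" "module univ_ring C" "module univ_ring D"
    "f \<in> semilinear \<phi> A C" "g \<in> semilinear \<phi> B D" "a \<in> carrier A" "b \<in> carrier B"
  shows "tmap C D f g (pure A B a b) = pure C D (f a) (g b)"
proof -
  interpret AB: tensor_modules A B by (intro tensor_modules.intro assms)
  interpret CD: tensor_modules C D by (intro tensor_modules.intro assms)
  note f = semilinearD[OF assms(5)] and g = semilinearD[OF assms(6)]
  show ?thesis
    using assms f(1) g(1)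
    by (subst AB.tensor_map_eq_lift)
       (auto simp: AB.tensor_lift_pure[OF CD.abelian_group_tens semilinear_pure_balanced[OF assms(1-6)]])
qed

lemma tensor_map_semilinear:
  assumes "module univ_ring A" "module univ_ring B" "module univ_ring C" "module univ_ring D"
    "f \<in> semilinear \<phi> A C" "g \<in> semilinear \<phi> B D"
  shows "tmap C D f g \<in> semilinear \<phi> (tens A B) (tens C D)"
proof -
  interpret AB: tensor_modules A B by (intro tensor_modules.intro assms)
  interpret CD: tensor_modules C D by (intro tensor_modules.intro assms)
  note f = semilinearD[OF assms(5)] and g = semilinearD[OF assms(6)]
  note lift = AB.tensor_lift_additive[OF CD.abelian_group_tens semilinear_pure_balanced[OF assms(1-6)]]
  have eq: "X \<in> carrier (tens A B) \<Longrightarrow> tmap C D f g X = tensor_lift (tens C D) (\<lambda>(a, b). pure C D (f a) (g b)) X" for X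
    using AB.tensor_map_eq_lift[OF _ assms(3,4)] f g by auto
  have add: "tmap C D f g \<in> additive_maps (tens A B) (tens C D)"
    using additive_mapsD[OF lift] by (auto simp: eq intro!: additive_mapsI)
  have "tmap C D f g (r \<odot>\<^bsub>tens A B\<^esub> X) = \<phi> r \<odot>\<^bsub>tens C D\<^esub> tmap C D f g X" if X: "X \<in> carrier (tens A B)" for r X
    using X
  proof (induction rule: AB.tensor_induct)
    case zero
    then show ?case
      using additive_maps_zero[OF AB.abelian_group_tens AB.abelian_group_tens AB.smult_tens_additive]
        additive_maps_zero[OF AB.abelian_group_tens CD.abelian_group_tens add]
        additive_maps_zero[OF CD.abelian_group_tens CD.abelian_group_tens CD.smult_tens_additive]
      by simp
  next
    case (pure a b)
    then show ?case using AB.A.smult_closed[of r a]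
      by (simp add: AB.smult_pure tensor_map_pure[OF assms] f g CD.smult_pure)
  next
    case (add X Y)
    then show ?case using additive_mapsD[OF AB.smult_tens_additive] additive_mapsD[OF \<open>tmap C D f g \<in> _\<close>]
      additive_mapsD[OF CD.smult_tens_additive] by simp
  qed
  with add show ?thesis by (simp add: semilinear_def)
qed

lemma tensor_map_comp:
  assumes "module univ_ring A" "module univ_ring B" "module univ_ring C" "module univ_ring D"
    "module univ_ring E" "module univ_ring F"
    "f \<in> semilinear \<phi> A C" "g \<in> semilinear \<phi> B D" "f' \<in> semilinear \<psi> C E" "g' \<in> semilinear \<psi> D F"
    "X \<in> carrier (tens A B)"
  shows "tmap E F f' g' (tmap C D f g X) = tmap E F (\<lambda>a. f' (f a)) (\<lambda>b. g' (g b)) X"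
proof -
  interpret AB: tensor_modules A B by (intro tensor_modules.intro assms)
  interpret CD: tensor_modules C D by (intro tensor_modules.intro assms)
  interpret EF: tensor_modules E F by (intro tensor_modules.intro assms)
  note f = semilinearD[OF assms(7)] and g = semilinearD[OF assms(8)]
    and f' = semilinearD[OF assms(9)] and g' = semilinearD[OF assms(10)]
  have ff: "(\<lambda>a. f' (f a)) \<in> semilinear (\<lambda>r. \<psi> (\<phi> r)) A E" "(\<lambda>a. g' (g a)) \<in> semilinear (\<lambda>r. \<psi> (\<phi> r)) B F"
    by (auto intro!: semilinearI simp: f f' g g')
  note m1 = tensor_map_semilinear[OF assms(1-4,7,8)] and m2 = tensor_map_semilinear[OF assms(3-6,9,10)]
    and m3 = tensor_map_semilinear[OF assms(1,2,5,6) ff]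
  show ?thesis
  proof (rule AB.additive_maps_tensor_eqI[OF EF.abelian_group_tens _ semilinearD(4)[OF m3] _ assms(11)])
    show "(\<lambda>X. tmap E F f' g' (tmap C D f g X)) \<in> additive_maps (tens A B) (tens E F)"
      using semilinearD[OF m1] semilinearD[OF m2] by (auto intro!: additive_mapsI)
  qed (simp add: tensor_map_pure[OF assms(1-4,7,8)] tensor_map_pure[OF assms(3-6,9,10)] f g
      tensor_map_pure[OF assms(1,2,5,6) ff])
qed

lemma tensor_map_cong:
  assumes "module univ_ring A" "module univ_ring B"
    "\<And>a. a \<in> carrier A \<Longrightarrow> f a = f' a" "\<And>b. b \<in> carrier B \<Longrightarrow> g b = g' b" "X \<in> carrier (tens A B)"
  shows "tmap C D f g X = tmap C D f' g' X"
proof -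
  interpret AB: tensor_modules A B by (intro tensor_modules.intro assms)
  have "AB.valid (rep X)" using assms(5) AB.valid_rep by (auto elim: AB.in_carrierE)
  then have "map (map_prod f g) (rep X) = map (map_prod f' g') (rep X)"
    using assms(3,4) by (auto simp: AB.valid_def)
  then show ?thesis by (simp only: tensor_map_def)
qed

lemma tensor_map_id:
  assumes "module univ_ring A" "module univ_ring B"
    "\<And>a. a \<in> carrier A \<Longrightarrow> f a = a" "\<And>b. b \<in> carrier B \<Longrightarrow> g b = b" "X \<in> carrier (tens A B)"
  shows "tmap A B f g X = X"
proof -
  interpret AB: tensor_modules A B by (intro tensor_modules.intro assms)
  have "tmap A B f g X = tmap A B id id X" by (rule tensor_map_cong) (use assms in auto)
  also have "\<dots> = X" using assms(5) AB.class_rep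
    by (auto simp only: tensor_map_def map_prod.id list.map_id elim!: AB.in_carrierE)
  finally show ?thesis .
qed

section \<open>The tensor product of algebras\<close>

locale tensor_algebras = A: algebra univ_ring A + B: algebra univ_ring B
  for A :: "('r::comm_ring_1, 'a, 'x) module_scheme" and B :: "('r, 'b, 'y) module_scheme"
begin

sublocale tensor_modules A B ..

text \<open>With a fixed list y as right factor, the product is balanced in the left factor;
  independence of the left representative is then an instance of the universal property.\<close>

lemma mult_balanced:
  "balanced_map A B (tens A B) (\<lambda>p. list_sum (tens A B) (\<lambda>q. pure A B (fst p \<otimes>\<^bsub>A\<^esub> fst q) (snd p \<otimes>\<^bsub>B\<^esub> snd q)) y)"
  if "valid y"
proof -
  have c: "q \<in> set y \<Longrightarrow> fst q \<in> carrier A \<and> snd q \<in> carrier B" for q using that by (auto simp: valid_def)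
  show ?thesis
  proof (rule balanced_mapI)
    fix a b assume ab: "a \<in> carrier A" "b \<in> carrier B"
    show "list_sum (tens A B) (\<lambda>q. pure A B (fst (a, b) \<otimes>\<^bsub>A\<^esub> fst q) (snd (a, b) \<otimes>\<^bsub>B\<^esub> snd q)) y \<in> carrier (tens A B)"
      using ab c by (intro T.list_sum_closed) simp
    fix r
    show "list_sum (tens A B) (\<lambda>q. pure A B (fst (r \<odot>\<^bsub>A\<^esub> a, b) \<otimes>\<^bsub>A\<^esub> fst q) (snd (r \<odot>\<^bsub>A\<^esub> a, b) \<otimes>\<^bsub>B\<^esub> snd q)) y =
      list_sum (tens A B) (\<lambda>q. pure A B (fst (a, r \<odot>\<^bsub>B\<^esub> b) \<otimes>\<^bsub>A\<^esub> fst q) (snd (a, r \<odot>\<^bsub>B\<^esub> b) \<otimes>\<^bsub>B\<^esub> snd q)) y"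
      using ab c by (intro list_sum_cong) (simp add: A.smult_assoc2 B.smult_assoc2 pure_smult_swap)
  next
    fix a a' b assume "a \<in> carrier A" "a' \<in> carrier A" "b \<in> carrier B"
    then show "list_sum (tens A B) (\<lambda>q. pure A B (fst (a \<oplus>\<^bsub>A\<^esub> a', b) \<otimes>\<^bsub>A\<^esub> fst q) (snd (a \<oplus>\<^bsub>A\<^esub> a', b) \<otimes>\<^bsub>B\<^esub> snd q)) y =
       list_sum (tens A B) (\<lambda>q. pure A B (fst (a, b) \<otimes>\<^bsub>A\<^esub> fst q) (snd (a, b) \<otimes>\<^bsub>B\<^esub> snd q)) y \<oplus>\<^bsub>tens A B\<^esub>
       list_sum (tens A B) (\<lambda>q. pure A B (fst (a', b) \<otimes>\<^bsub>A\<^esub> fst q) (snd (a', b) \<otimes>\<^bsub>B\<^esub> snd q)) y"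
      using c by (subst T.list_sum_add[symmetric]) (auto simp: A.l_distr pure_add_left intro!: list_sum_cong)
  next
    fix a b b' assume "a \<in> carrier A" "b \<in> carrier B" "b' \<in> carrier B"
    then show "list_sum (tens A B) (\<lambda>q. pure A B (fst (a, b \<oplus>\<^bsub>B\<^esub> b') \<otimes>\<^bsub>A\<^esub> fst q) (snd (a, b \<oplus>\<^bsub>B\<^esub> b') \<otimes>\<^bsub>B\<^esub> snd q)) y =
       list_sum (tens A B) (\<lambda>q. pure A B (fst (a, b) \<otimes>\<^bsub>A\<^esub> fst q) (snd (a, b) \<otimes>\<^bsub>B\<^esub> snd q)) y \<oplus>\<^bsub>tens A B\<^esub>
       list_sum (tens A B) (\<lambda>q. pure A B (fst (a, b') \<otimes>\<^bsub>A\<^esub> fst q) (snd (a, b') \<otimes>\<^bsub>B\<^esub> snd q)) y"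
      using c by (subst T.list_sum_add[symmetric]) (auto simp: B.l_distr pure_add_right intro!: list_sum_cong)
  qed
qed

abbreviation "mul_list x y \<equiv> [(fst p \<otimes>\<^bsub>A\<^esub> fst q, snd p \<otimes>\<^bsub>B\<^esub> snd q). p \<leftarrow> x, q \<leftarrow> y]"

lemma class_mul_list:
  assumes "valid x" "valid y"
  shows "tens_class A B (mul_list x y) =
    list_sum (tens A B) (\<lambda>p. list_sum (tens A B) (\<lambda>q. pure A B (fst p \<otimes>\<^bsub>A\<^esub> fst q) (snd p \<otimes>\<^bsub>B\<^esub> snd q)) y) x"
proof -
  have c: "\<And>p. p \<in> set x \<Longrightarrow> fst p \<in> carrier A \<and> snd p \<in> carrier B"
    "\<And>p. p \<in> set y \<Longrightarrow> fst p \<in> carrier A \<and> snd p \<in> carrier B"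
    using assms by (auto simp: valid_def)
  have "list_sum (tens A B) (\<lambda>p. list_sum (tens A B) (\<lambda>q. pure A B (fst p \<otimes>\<^bsub>A\<^esub> fst q) (snd p \<otimes>\<^bsub>B\<^esub> snd q)) y) x
     = list_sum (tens A B) (\<lambda>p. tens_class A B (map (\<lambda>q. (fst p \<otimes>\<^bsub>A\<^esub> fst q, snd p \<otimes>\<^bsub>B\<^esub> snd q)) y)) x"
    using c by (intro list_sum_cong list_sum_pure) auto
  also have "\<dots> = tens_class A B (mul_list x y)"
    using c by (subst list_sum_class) (auto simp: valid_def)
  finally show ?thesis ..
qed

lemma class_mul_list_commute:
  assumes "valid x" "valid y"
  shows "tens_class A B (mul_list x y) = tens_class A B (mul_list y x)"
proof -
  have c: "\<And>p. p \<in> set x \<Longrightarrow> fst p \<in> carrier A \<and> snd p \<in> carrier B"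
    "\<And>p. p \<in> set y \<Longrightarrow> fst p \<in> carrier A \<and> snd p \<in> carrier B"
    using assms by (auto simp: valid_def)
  show ?thesis
    unfolding class_mul_list[OF assms] class_mul_list[OF assms(2,1)]
    using c by (subst T.list_sum_swap) (auto intro!: list_sum_cong simp: A.m_comm B.m_comm)
qed

lemma mult_class:
  assumes "valid x" "valid y"
  shows "tens_class A B x \<otimes>\<^bsub>tens A B\<^esub> tens_class A B y = tens_class A B (mul_list x y)"
proof -
  let ?x = "rep (tens_class A B x)" and ?y = "rep (tens_class A B y)"
  have v: "valid ?x" "valid ?y" using assms valid_rep by auto
  have left: "tens_class A B (mul_list x' z) = tens_class A B (mul_list x z)"
    if "valid x'" "valid z" "valid x" "tensor_rel univ_ring A B x x'" for x x' z
    using that list_sum_rel[OF abelian_group_tens mult_balanced[OF that(2)] that(4)]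
    by (simp only: class_mul_list)
  have "tens_class A B x \<otimes>\<^bsub>tens A B\<^esub> tens_class A B y = tens_class A B (mul_list ?x ?y)"
    by (simp add: tensor_def)
  also have "\<dots> = tens_class A B (mul_list x ?y)" using v assms rel_rep by (intro left) auto
  \<comment> \<open>Only the left representative can be exchanged directly; the right one is
    exchanged after commuting the factors.\<close>
  also have "\<dots> = tens_class A B (mul_list ?y x)" using v assms by (intro class_mul_list_commute) auto
  also have "\<dots> = tens_class A B (mul_list y x)" using v assms rel_rep by (intro left) auto
  also have "\<dots> = tens_class A B (mul_list x y)" using v assms by (intro class_mul_list_commute) auto
  finally show ?thesis .
qed

lemma mult_pure:
  "a \<in> carrier A \<Longrightarrow> b \<in> carrier B \<Longrightarrow> a' \<in> carrier A \<Longrightarrow> b' \<in> carrier B \<Longrightarrow>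
   pure A B a b \<otimes>\<^bsub>tens A B\<^esub> pure A B a' b' = pure A B (a \<otimes>\<^bsub>A\<^esub> a') (b \<otimes>\<^bsub>B\<^esub> b')"
  by (simp add: pure_class mult_class)

lemma one_tens: "\<one>\<^bsub>tens A B\<^esub> = pure A B \<one>\<^bsub>A\<^esub> \<one>\<^bsub>B\<^esub>"
  by (simp add: tensor_def)

lemma valid_mul_list: "valid x \<Longrightarrow> valid y \<Longrightarrow> valid (mul_list x y)"
  by (auto simp: valid_def intro!: A.m_closed B.m_closed)

lemma algebra_tens: "algebra univ_ring (tens A B)"
proof -
  let ?T = "tens A B"
  have closed: "X \<otimes>\<^bsub>?T\<^esub> Y \<in> carrier ?T" if "X \<in> carrier ?T" "Y \<in> carrier ?T" for X Y
    using that valid_mul_list by (auto elim!: in_carrierE simp: mult_class)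
  have comm: "X \<otimes>\<^bsub>?T\<^esub> Y = Y \<otimes>\<^bsub>?T\<^esub> X" if "X \<in> carrier ?T" "Y \<in> carrier ?T" for X Y
    using that class_mul_list_commute by (auto elim!: in_carrierE simp: mult_class)
  have ldistr: "(X \<oplus>\<^bsub>?T\<^esub> Y) \<otimes>\<^bsub>?T\<^esub> Z = X \<otimes>\<^bsub>?T\<^esub> Z \<oplus>\<^bsub>?T\<^esub> Y \<otimes>\<^bsub>?T\<^esub> Z"
    if "X \<in> carrier ?T" "Y \<in> carrier ?T" "Z \<in> carrier ?T" for X Y Z
    using that valid_mul_list by (auto elim!: in_carrierE simp: mult_class add_class)
  have rdistr: "Z \<otimes>\<^bsub>?T\<^esub> (X \<oplus>\<^bsub>?T\<^esub> Y) = Z \<otimes>\<^bsub>?T\<^esub> X \<oplus>\<^bsub>?T\<^esub> Z \<otimes>\<^bsub>?T\<^esub> Y"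
    if "X \<in> carrier ?T" "Y \<in> carrier ?T" "Z \<in> carrier ?T" for X Y Z
    using that comm ldistr by (metis T.a_closed)
  have zero: "\<zero>\<^bsub>?T\<^esub> \<otimes>\<^bsub>?T\<^esub> X = \<zero>\<^bsub>?T\<^esub>" "X \<otimes>\<^bsub>?T\<^esub> \<zero>\<^bsub>?T\<^esub> = \<zero>\<^bsub>?T\<^esub>" if "X \<in> carrier ?T" for X
  proof -
    show "\<zero>\<^bsub>?T\<^esub> \<otimes>\<^bsub>?T\<^esub> X = \<zero>\<^bsub>?T\<^esub>" using that by (auto elim!: in_carrierE simp: mult_class zero_class)
    then show "X \<otimes>\<^bsub>?T\<^esub> \<zero>\<^bsub>?T\<^esub> = \<zero>\<^bsub>?T\<^esub>" using comm that T.zero_closed by metis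
  qed
  \<comment> \<open>Additivity in each variable reduces associativity to pure tensors, by one
    induction per factor.\<close>
  have assoc: "X \<otimes>\<^bsub>?T\<^esub> Y \<otimes>\<^bsub>?T\<^esub> Z = X \<otimes>\<^bsub>?T\<^esub> (Y \<otimes>\<^bsub>?T\<^esub> Z)"
    if "X \<in> carrier ?T" "Y \<in> carrier ?T" "Z \<in> carrier ?T" for X Y Z
    using that(1)
  proof (induction rule: tensor_induct)
    case (pure a b)
    show ?case using that(2)
    proof (induction rule: tensor_induct)
      case (pure a' b')
      show ?case using that(3)
      proof (induction rule: tensor_induct)
        case (pure a'' b'')
        show ?case using \<open>a \<in> _\<close> \<open>b \<in> _\<close> \<open>a' \<in> _\<close> \<open>b' \<in> _\<close> pure
          by (simp add: mult_pure A.m_assoc B.m_assoc)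
      qed (use pure \<open>a \<in> _\<close> \<open>b \<in> _\<close> in \<open>simp_all add: zero closed rdistr\<close>)
    qed (use pure that in \<open>simp_all add: zero closed rdistr ldistr\<close>)
  qed (use that in \<open>simp_all add: zero closed ldistr\<close>)
  have one: "\<one>\<^bsub>?T\<^esub> \<in> carrier ?T" "X \<in> carrier ?T \<Longrightarrow> \<one>\<^bsub>?T\<^esub> \<otimes>\<^bsub>?T\<^esub> X = X" for X
  proof -
    show o: "\<one>\<^bsub>?T\<^esub> \<in> carrier ?T" by (simp add: one_tens)
    show "X \<in> carrier ?T \<Longrightarrow> \<one>\<^bsub>?T\<^esub> \<otimes>\<^bsub>?T\<^esub> X = X"
    proof (induction rule: tensor_induct)
      case zero then show ?case using o by (simp add: \<open>\<And>X. X \<in> _ \<Longrightarrow> X \<otimes>\<^bsub>_\<^esub> \<zero>\<^bsub>_\<^esub> = _\<close>)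
    next
      case (pure a b) then show ?case by (simp add: one_tens mult_pure)
    next
      case (add X Y) then show ?case using o by (simp add: rdistr)
    qed
  qed
  have "cring ?T"
    by (intro cringI abelian_group_tens comm_monoidI) (erule (2) assoc comm one ldistr closed | rule closed comm one | assumption)+
  moreover have "(r \<odot>\<^bsub>?T\<^esub> X) \<otimes>\<^bsub>?T\<^esub> Y = r \<odot>\<^bsub>?T\<^esub> (X \<otimes>\<^bsub>?T\<^esub> Y)"
    if X: "X \<in> carrier ?T" and Y: "Y \<in> carrier ?T" for r X Y
  proof -
    obtain x where x: "valid x" "X = tens_class A B x" using X by (rule in_carrierE)
    obtain y where "valid y" "Y = tens_class A B y" using Y by (rule in_carrierE)
    note xy = x this
    let ?r = "\<lambda>(a, b). (r \<odot>\<^bsub>A\<^esub> a, b)"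
    have v: "valid (map ?r x)" using xy by (auto simp: valid_def)
    have e: "fst (?r p) = r \<odot>\<^bsub>A\<^esub> fst p \<and> snd (?r p) = snd p" for p by (cases p) auto
    have "mul_list (map ?r x) y = map ?r (mul_list x y)"
      using xy by (auto simp: map_concat valid_def comp_def subset_iff A.smult_assoc2 split_def
          intro!: arg_cong[where f=concat])
    then show ?thesis using xy v valid_mul_list by (simp add: smult_class mult_class)
  qed
  ultimately show ?thesis
    using module_tens by (intro algebra.intro algebra_axioms.intro) auto
qed

sublocale TA: algebra univ_ring "tens A B" by (rule algebra_tens)

text \<open>Both sides of the multiplicativity condition are biadditive, so pure tensors
  suffice.\<close>

lemma tens_ring_homI:
  assumes "ring M" "f \<in> additive_maps (tens A B) M" "f (pure A B \<one>\<^bsub>A\<^esub> \<one>\<^bsub>B\<^esub>) = \<one>\<^bsub>M\<^esub>"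
    "\<And>a b a' b'. a \<in> carrier A \<Longrightarrow> b \<in> carrier B \<Longrightarrow> a' \<in> carrier A \<Longrightarrow> b' \<in> carrier B \<Longrightarrow>
       f (pure A B (a \<otimes>\<^bsub>A\<^esub> a') (b \<otimes>\<^bsub>B\<^esub> b')) = f (pure A B a b) \<otimes>\<^bsub>M\<^esub> f (pure A B a' b')"
  shows "f \<in> ring_hom (tens A B) M"
proof (rule ring_hom_memI)
  interpret M: ring M by fact
  note f = additive_mapsD[OF assms(2)] and f0 = additive_maps_zero[OF abelian_group_tens M.abelian_group_axioms assms(2)]
  fix X Y assume X: "X \<in> carrier (tens A B)" and Y: "Y \<in> carrier (tens A B)"
  show "f X \<in> carrier M" "f (X \<oplus>\<^bsub>tens A B\<^esub> Y) = f X \<oplus>\<^bsub>M\<^esub> f Y" using f X Y by auto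
  show "f (X \<otimes>\<^bsub>tens A B\<^esub> Y) = f X \<otimes>\<^bsub>M\<^esub> f Y" using X
  proof (induction rule: tensor_induct)
    case (pure a b)
    show ?case using Y
    proof (induction rule: tensor_induct)
      case (pure a' b') then show ?case using \<open>a \<in> _\<close> \<open>b \<in> _\<close> by (simp add: mult_pure assms(4))
    qed (use pure in \<open>simp_all add: f f0 TA.r_distr M.r_distr\<close>)
  qed (use Y in \<open>simp_all add: f f0 TA.l_distr M.l_distr\<close>)
qed (simp_all add: one_tens assms)

end

lemma tensor_map_ring_hom:
  assumes "algebra univ_ring A" "algebra univ_ring B" "algebra univ_ring C" "algebra univ_ring D"
    "f \<in> semilinear \<phi> A C" "g \<in> semilinear \<phi> B D" "f \<in> ring_hom A C" "g \<in> ring_hom B D"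
  shows "tmap C D f g \<in> ring_hom (tens A B) (tens C D)"
proof -
  interpret AB: tensor_algebras A B by (intro tensor_algebras.intro assms)
  interpret CD: tensor_algebras C D by (intro tensor_algebras.intro assms)
  have m: "module univ_ring A" "module univ_ring B" "module univ_ring C" "module univ_ring D" by unfold_locales
  note p = tensor_map_pure[OF m assms(5,6)]
  show ?thesis
    by (rule AB.tens_ring_homI[OF CD.TA.ring_axioms semilinearD(4)[OF tensor_map_semilinear[OF m assms(5,6)]]])
       (simp_all add: p CD.one_tens ring_hom_one[OF assms(7)] ring_hom_one[OF assms(8)]
         ring_hom_mult[OF assms(7)] ring_hom_mult[OF assms(8)] CD.mult_pure
         ring_hom_closed[OF assms(7)] ring_hom_closed[OF assms(8)])
qed

section \<open>Hopf algebras along semilinear maps\<close>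

text \<open>Hopf algebras, their underlying algebras and base changes are records with different
  further fields. The tensor product depends only on these six fields, and on the base ring only
  through its carrier.\<close>

definition same_algebra :: "('r, 'a, 'x) module_scheme \<Rightarrow> ('r, 'a, 'y) module_scheme \<Rightarrow> bool" where
  "same_algebra A A' \<longleftrightarrow> carrier A = carrier A' \<and> monoid.mult A = monoid.mult A' \<and> one A = one A' \<and>
     zero A = zero A' \<and> add A = add A' \<and> module.smult A = module.smult A'"

lemma tensor_rel_mono:
  assumes "tensor_rel R A B x y" "carrier R = carrier R'" "same_algebra A A'" "same_algebra B B'"
  shows "tensor_rel R' A' B' x y"
  using assms(1)
proof (induction rule: tensor_rel.induct)
  case (trans x y z) then show ?case by (blast intro: tensor_rel.trans)
next
  case (sym x y) show ?case by (rule tensor_rel.sym[OF sym(2)])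
next
  case (append x y x' y') then show ?case by (blast intro: tensor_rel.append)
qed (use assms(2-) in \<open>auto simp: same_algebra_def intro: tensor_rel.intros\<close>)

lemma same_algebra_sym: "same_algebra A A' \<Longrightarrow> same_algebra A' A"
  by (simp add: same_algebra_def)

lemma tensor_class_cong:
  assumes "carrier R = carrier R'" "same_algebra A A'" "same_algebra B B'"
  shows "tensor_class R A B = tensor_class R' A' B'"
  using tensor_rel_mono assms tensor_rel_mono[OF _ assms(1)[symmetric] same_algebra_sym[OF assms(2)] same_algebra_sym[OF assms(3)]]
  by (intro ext) (auto simp: tensor_class_def)

lemma tensor_cong:
  assumes "carrier R = carrier R'" "same_algebra A A'" "same_algebra B B'"
  shows "tensor R A B = tensor R' A' B'" "pure_tensor R A B = pure_tensor R' A' B'"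
    "tensor_map R A B = tensor_map R' A' B'"
  using assms(2,3) tensor_class_cong[OF assms]
  by (simp_all add: tensor_def pure_tensor_def tensor_map_def same_algebra_def fun_eq_iff)

lemma same_algebra_algebra:
  assumes "same_algebra A A'" "algebra univ_ring A"
  shows "algebra univ_ring A'"
proof -
  have e: "carrier A' = carrier A" "monoid.mult A' = monoid.mult A" "one A' = one A"
     "zero A' = zero A" "add A' = add A" "module.smult A' = module.smult A"
    using assms(1) by (auto simp: same_algebra_def)
  show ?thesis
    using assms(2)
    unfolding algebra_def module_def module_axioms_def algebra_axioms_def cring_def ring_def ring_axioms_def
      abelian_group_def abelian_group_axioms_def abelian_monoid_def comm_monoid_def comm_monoid_axioms_def
      comm_group_def group_def group_axioms_def Units_def monoid_def partial_object.select_convs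
      monoid.select_convs e .
qed

text \<open>The associator, written as the nested lift that occurs in the coassociativity axiom, so
  that the axiom unfolds to it literally.\<close>

definition assoc_map ::
  "('r::comm_ring_1, 'a, 'x) module_scheme \<Rightarrow> ('r, 'b, 'y) module_scheme \<Rightarrow> ('r, 'c, 'z) module_scheme \<Rightarrow>
   (('a, 'b) tensor, 'c) tensor \<Rightarrow> ('a, ('b, 'c) tensor) tensor" where
  "assoc_map A B C = tensor_lift (tens A (tens B C))
     (\<lambda>(Y, c). tensor_lift (tens A (tens B C)) (\<lambda>(a, b). pure A (tens B C) a (pure B C b c)) Y)"

locale three_modules = A: module univ_ring A + B: module univ_ring B + C: module univ_ring C
  for A :: "('r::comm_ring_1, 'a, 'x) module_scheme" and B :: "('r, 'b, 'y) module_scheme"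
    and C :: "('r, 'c, 'z) module_scheme"
begin

sublocale AB: tensor_modules A B ..
sublocale BC: tensor_modules B C ..
sublocale AB': module univ_ring "tens A B" by (rule AB.module_tens)
sublocale BC': module univ_ring "tens B C" by (rule BC.module_tens)
sublocale AB_C: tensor_modules "tens A B" C ..
sublocale A_BC: tensor_modules A "tens B C" ..
sublocale A_BC': module univ_ring "tens A (tens B C)" by (rule A_BC.module_tens)

lemma assoc_inner: "c \<in> carrier C \<Longrightarrow>
  balanced_map A B (tens A (tens B C)) (\<lambda>(a, b). pure A (tens B C) a (pure B C b c))"
  by (rule balanced_mapI)
     (simp_all add: A_BC.pure_add_left A_BC.pure_add_right BC.pure_add_left A_BC.pure_smult_swap BC.smult_pure)

text \<open>The outer map takes a whole tensor Y as argument, so its balancedness is itself shown by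
  induction over Y.\<close>

lemma assoc_balanced: "balanced_map (tens A B) C (tens A (tens B C))
   (\<lambda>(Y, c). tensor_lift (tens A (tens B C)) (\<lambda>(a, b). pure A (tens B C) a (pure B C b c)) Y)"
proof -
  note gr = A_BC.abelian_group_tens
  note lift = additive_mapsD[OF AB.tensor_lift_additive[OF gr assoc_inner]]
  note lp = AB.tensor_lift_pure[OF gr assoc_inner]
  note lz = additive_maps_zero[OF AB.abelian_group_tens gr AB.tensor_lift_additive[OF gr assoc_inner]]
  show ?thesis
  proof (rule balanced_mapI)
    fix Y c c' assume Y: "Y \<in> carrier (tens A B)" and c: "c \<in> carrier C" "c' \<in> carrier C"
    show "(case (Y, c \<oplus>\<^bsub>C\<^esub> c') of (Y, c) \<Rightarrow> tensor_lift (tens A (tens B C)) (\<lambda>(a, b). pure A (tens B C) a (pure B C b c)) Y) =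
     (case (Y, c) of (Y, c) \<Rightarrow> tensor_lift (tens A (tens B C)) (\<lambda>(a, b). pure A (tens B C) a (pure B C b c)) Y) \<oplus>\<^bsub>tens A (tens B C)\<^esub>
     (case (Y, c') of (Y, c) \<Rightarrow> tensor_lift (tens A (tens B C)) (\<lambda>(a, b). pure A (tens B C) a (pure B C b c)) Y)"
      using Y
      by (induction rule: AB.tensor_induct)
         (use c in \<open>simp_all add: lift lp lz BC.pure_add_right A_BC.pure_add_right A_BC.T.a_ac\<close>)
  next
    fix Y c r assume Y: "Y \<in> carrier (tens A B)" and c: "c \<in> carrier C"
    show "(case (r \<odot>\<^bsub>tens A B\<^esub> Y, c) of (Y, c) \<Rightarrow> tensor_lift (tens A (tens B C)) (\<lambda>(a, b). pure A (tens B C) a (pure B C b c)) Y) =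
     (case (Y, r \<odot>\<^bsub>C\<^esub> c) of (Y, c) \<Rightarrow> tensor_lift (tens A (tens B C)) (\<lambda>(a, b). pure A (tens B C) a (pure B C b c)) Y)"
      using Y
      by (induction rule: AB.tensor_induct)
         (use c in \<open>simp_all add: lift lp lz AB'.smult_r_distr AB.smult_pure A_BC.pure_smult_swap
            BC.smult_pure BC.pure_smult_swap\<close>)
  qed (simp_all add: lift)
qed

lemma assoc_pure: "a \<in> carrier A \<Longrightarrow> b \<in> carrier B \<Longrightarrow> c \<in> carrier C \<Longrightarrow>
  assoc_map A B C (pure (tens A B) C (pure A B a b) c) = pure A (tens B C) a (pure B C b c)"
  unfolding assoc_map_def
  by (subst AB_C.tensor_lift_pure[OF A_BC.abelian_group_tens assoc_balanced])
     (simp_all add: AB.tensor_lift_pure[OF A_BC.abelian_group_tens assoc_inner])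

text \<open>The iterated tensor product is spanned by the tensors a \<otimes> b \<otimes> c, on
  which maps out of it can be compared.\<close>

lemma triple_induct [consumes 1, case_names zero pure add]:
  assumes "X \<in> carrier (tens (tens A B) C)" "P \<zero>\<^bsub>tens (tens A B) C\<^esub>"
    "\<And>a b c. a \<in> carrier A \<Longrightarrow> b \<in> carrier B \<Longrightarrow> c \<in> carrier C \<Longrightarrow> P (pure (tens A B) C (pure A B a b) c)"
    "\<And>X Y. X \<in> carrier (tens (tens A B) C) \<Longrightarrow> Y \<in> carrier (tens (tens A B) C) \<Longrightarrow> P X \<Longrightarrow> P Y \<Longrightarrow> P (X \<oplus>\<^bsub>tens (tens A B) C\<^esub> Y)"
  shows "P X"
  using assms(1)
proof (induction rule: AB_C.tensor_induct)
  case (pure Y c)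
  from pure(1) show ?case
    by (induction rule: AB.tensor_induct)
       (use pure(2) assms in \<open>simp_all add: AB_C.pure_zero_left AB_C.pure_add_left\<close>)
qed (use assms in auto)

lemma assoc_additive: "assoc_map A B C \<in> additive_maps (tens (tens A B) C) (tens A (tens B C))"
  unfolding assoc_map_def by (rule AB_C.tensor_lift_additive[OF A_BC.abelian_group_tens assoc_balanced])

lemma assoc_linear: "assoc_map A B C \<in> semilinear id (tens (tens A B) C) (tens A (tens B C))"
proof -
  note s = additive_mapsD[OF assoc_additive]
    and z = additive_maps_zero[OF AB_C.abelian_group_tens A_BC.abelian_group_tens assoc_additive]
  interpret AB_C': module univ_ring "tens (tens A B) C" by (rule AB_C.module_tens)
  have "assoc_map A B C (r \<odot>\<^bsub>tens (tens A B) C\<^esub> X) = r \<odot>\<^bsub>tens A (tens B C)\<^esub> assoc_map A B C X"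
    if X: "X \<in> carrier (tens (tens A B) C)" for r X
    using X
  proof (induction rule: triple_induct)
    case (pure a b c)
    then show ?case using A.smult_closed[of r a]
      by (simp add: assoc_pure AB_C.smult_pure AB.smult_pure A_BC.smult_pure)
  qed (simp_all add: z s AB_C'.smult_r_distr A_BC'.smult_r_distr)
  then show ?thesis using assoc_additive by (simp add: semilinear_def)
qed

end

lemma assoc_natural:
  assumes "module univ_ring A" "module univ_ring B" "module univ_ring C"
    "module univ_ring A'" "module univ_ring B'" "module univ_ring C'"
    and f: "f \<in> semilinear \<phi> A A'" and g: "g \<in> semilinear \<phi> B B'" and h: "h \<in> semilinear \<phi> C C'"
    and X: "X \<in> carrier (tens (tens A B) C)"
  shows "assoc_map A' B' C' (tmap (tens A' B') C' (tmap A' B' f g) h X) =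
    tmap A' (tens B' C') f (tmap B' C' g h) (assoc_map A B C X)"
proof -
  interpret S: three_modules A B C by (intro three_modules.intro assms)
  interpret T: three_modules A' B' C' by (intro three_modules.intro assms)
  note fg = tensor_map_semilinear[OF assms(1,2,4,5) f g]
  note gh = tensor_map_semilinear[OF assms(2,3,5,6) g h]
  note l = tensor_map_semilinear[OF S.AB'.module_axioms assms(3) T.AB'.module_axioms assms(6) fg h]
  note r = tensor_map_semilinear[OF assms(1) S.BC'.module_axioms assms(4) T.BC'.module_axioms f gh]
  note lp = tensor_map_pure[OF S.AB'.module_axioms assms(3) T.AB'.module_axioms assms(6) fg h]
    tensor_map_pure[OF assms(1) S.BC'.module_axioms assms(4) T.BC'.module_axioms f gh]
    tensor_map_pure[OF assms(1,2,4,5) f g] tensor_map_pure[OF assms(2,3,5,6) g h]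
  note z = additive_maps_zero[OF S.AB_C.abelian_group_tens T.AB_C.abelian_group_tens semilinearD(4)[OF l]]
    additive_maps_zero[OF S.A_BC.abelian_group_tens T.A_BC.abelian_group_tens semilinearD(4)[OF r]]
    additive_maps_zero[OF S.AB_C.abelian_group_tens S.A_BC.abelian_group_tens S.assoc_additive]
    additive_maps_zero[OF T.AB_C.abelian_group_tens T.A_BC.abelian_group_tens T.assoc_additive]
  show ?thesis using X
  proof (induction rule: S.triple_induct)
    case (pure a b c)
    then show ?case
      by (simp add: lp S.assoc_pure T.assoc_pure semilinearD(1)[OF f] semilinearD(1)[OF g] semilinearD(1)[OF h])
  qed (simp_all add: z semilinearD[OF l] semilinearD[OF r] additive_mapsD[OF S.assoc_additive] additive_mapsD[OF T.assoc_additive])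
qed

section \<open>The Hopf axioms as equalities between linear maps\<close>

definition pre_hopf :: "('r::comm_ring_1, 'a) hopf \<Rightarrow> bool" where
  "pre_hopf H \<longleftrightarrow> algebra univ_ring H \<and>
     comult H \<in> ring_hom H (tens H H) \<inter> semilinear id H (tens H H) \<and>
     counit H \<in> ring_hom H univ_ring \<and>
     (\<forall>r. \<forall>x\<in>carrier H. counit H (r \<odot>\<^bsub>H\<^esub> x) = r * counit H x) \<and>
     antipode H \<in> ring_hom H H \<inter> semilinear id H H"

text \<open>The sides of the axioms are named as functions of x: their linearity and naturality
  follow from \<open>pre_hopf\<close> alone, before it is known that they agree.\<close>

definition "coassoc_lhs H x = assoc_map H H H (tmap (tens H H) H (comult H) id (comult H x))"
definition "coassoc_rhs H x = tmap H (tens H H) id (comult H) (comult H x)"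
definition "counit_lhs H x = tensor_lift H (\<lambda>(a, b). counit H a \<odot>\<^bsub>H\<^esub> b) (comult H x)"
definition "counit_rhs H x = tensor_lift H (\<lambda>(a, b). counit H b \<odot>\<^bsub>H\<^esub> a) (comult H x)"
definition "antipode_lhs H x = tensor_lift H (\<lambda>(a, b). antipode H a \<otimes>\<^bsub>H\<^esub> b) (comult H x)"
definition "antipode_rhs H x = tensor_lift H (\<lambda>(a, b). a \<otimes>\<^bsub>H\<^esub> antipode H b) (comult H x)"

lemma alg_hom_univ: "alg_hom univ_ring A B = ring_hom A B \<inter> semilinear id A B"
  by (auto simp: alg_hom_def semilinear_def additive_maps_def ring_hom_def)

lemma hopf_algebra_iff:
  "hopf_algebra univ_ring H \<longleftrightarrow> pre_hopf H \<and> (\<forall>x\<in>carrier H. coassoc_lhs H x = coassoc_rhs H x \<and>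
     counit_lhs H x = x \<and> counit_rhs H x = x \<and>
     antipode_lhs H x = counit H x \<odot>\<^bsub>H\<^esub> \<one>\<^bsub>H\<^esub> \<and> antipode_rhs H x = counit H x \<odot>\<^bsub>H\<^esub> \<one>\<^bsub>H\<^esub>)"
  unfolding hopf_algebra_def hopf_algebra_axioms_def pre_hopf_def alg_hom_univ univ_ring_simps
    coassoc_lhs_def coassoc_rhs_def counit_lhs_def counit_rhs_def antipode_lhs_def antipode_rhs_def assoc_map_def
  by auto

lemma semilinear_comp: "f \<in> semilinear \<phi> A B \<Longrightarrow> g \<in> semilinear \<psi> B C \<Longrightarrow> (\<lambda>x. g (f x)) \<in> semilinear (\<lambda>r. \<psi> (\<phi> r)) A C"
  by (auto intro!: semilinearI simp: semilinearD)

lemma semilinear_id: "id \<in> semilinear id A A" by (auto intro: semilinearI)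

text \<open>The common pattern behind the naturality of the counit and antipode axioms: \<beta> and
  \<gamma> are the same formula in the source and in the target, intertwined by h. It is applied
  with f, g and h all equal to one map of Hopf algebras.\<close>

lemma tensor_lift_natural:
  assumes "module univ_ring A" "module univ_ring B" "module univ_ring C" "module univ_ring D"
    "abelian_group M" "abelian_group N"
    "f \<in> semilinear \<phi> A C" "g \<in> semilinear \<phi> B D" "h \<in> additive_maps M N"
    "balanced_map A B M \<beta>" "balanced_map C D N \<gamma>"
    "\<And>a b. a \<in> carrier A \<Longrightarrow> b \<in> carrier B \<Longrightarrow> \<gamma> (f a, g b) = h (\<beta> (a, b))"
    "X \<in> carrier (tens A B)"
  shows "tensor_lift N \<gamma> (tmap C D f g X) = h (tensor_lift M \<beta> X)"
proof -
  interpret AB: tensor_modules A B by (intro tensor_modules.intro assms)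
  interpret CD: tensor_modules C D by (intro tensor_modules.intro assms)
  note t = tensor_map_semilinear[OF assms(1-4,7,8)]
  show ?thesis
  proof (rule AB.additive_maps_tensor_eqI[OF assms(6) _ _ _ assms(13)])
    show "(\<lambda>X. tensor_lift N \<gamma> (tmap C D f g X)) \<in> additive_maps (tens A B) N"
      by (intro additive_mapsI)
         (simp_all add: semilinearD[OF t] additive_mapsD[OF CD.tensor_lift_additive[OF assms(6,11)]])
    show "(\<lambda>X. h (tensor_lift M \<beta> X)) \<in> additive_maps (tens A B) N"
      by (intro additive_mapsI)
         (simp_all add: additive_mapsD[OF assms(9)] additive_mapsD[OF AB.tensor_lift_additive[OF assms(5,10)]])
  qed (simp add: tensor_map_pure[OF assms(1-4,7,8)] semilinearD[OF assms(7)] semilinearD[OF assms(8)]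
     AB.tensor_lift_pure[OF assms(5,10)] CD.tensor_lift_pure[OF assms(6,11)] assms(12))
qed

locale pre_hopf_algebra = algebra univ_ring H for H :: "('r::comm_ring_1, 'a) hopf" +
  assumes pre_hopf: "pre_hopf H"
begin

sublocale HH: tensor_algebras H H by unfold_locales

lemma comult_hom: "comult H \<in> ring_hom H (tens H H)" "comult H \<in> semilinear id H (tens H H)"
  and counit_hom: "counit H \<in> ring_hom H univ_ring" "x \<in> carrier H \<Longrightarrow> counit H (r \<odot>\<^bsub>H\<^esub> x) = r * counit H x"
  and antipode_hom: "antipode H \<in> ring_hom H H" "antipode H \<in> semilinear id H H"
  using pre_hopf by (auto simp: pre_hopf_def)

lemmas comult_simps = semilinearD(1-3)[OF comult_hom(2), unfolded id_apply]
lemmas antipode_simps = semilinearD(1-3)[OF antipode_hom(2), unfolded id_apply]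

lemma counit_add: "x \<in> carrier H \<Longrightarrow> y \<in> carrier H \<Longrightarrow> counit H (x \<oplus>\<^bsub>H\<^esub> y) = counit H x + counit H y"
  using ring_hom_add[OF counit_hom(1)] by simp

lemma balanced_structure:
  "balanced_map H H H (\<lambda>(a, b). counit H a \<odot>\<^bsub>H\<^esub> b)"
  "balanced_map H H H (\<lambda>(a, b). counit H b \<odot>\<^bsub>H\<^esub> a)"
  "balanced_map H H H (\<lambda>(a, b). antipode H a \<otimes>\<^bsub>H\<^esub> b)"
  "balanced_map H H H (\<lambda>(a, b). a \<otimes>\<^bsub>H\<^esub> antipode H b)"
proof -
  have sm: "(r * s) \<odot>\<^bsub>H\<^esub> x = s \<odot>\<^bsub>H\<^esub> (r \<odot>\<^bsub>H\<^esub> x)" if "x \<in> carrier H" for r s x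
    using smult_assoc1[of s r x] that by (simp add: mult.commute)
  have sm2: "a \<otimes>\<^bsub>H\<^esub> (r \<odot>\<^bsub>H\<^esub> b) = r \<odot>\<^bsub>H\<^esub> (a \<otimes>\<^bsub>H\<^esub> b)" if "a \<in> carrier H" "b \<in> carrier H" for a b r
    using smult_assoc2[of r b a] that by (simp add: m_comm)
  have ld: "(r + s) \<odot>\<^bsub>H\<^esub> x = r \<odot>\<^bsub>H\<^esub> x \<oplus>\<^bsub>H\<^esub> s \<odot>\<^bsub>H\<^esub> x" if "x \<in> carrier H" for r s x
    using smult_l_distr[of r s x] that by simp
  show "balanced_map H H H (\<lambda>(a, b). counit H a \<odot>\<^bsub>H\<^esub> b)"
    by (rule balanced_mapI) (simp_all add: counit_add counit_hom ld smult_r_distr sm)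
  show "balanced_map H H H (\<lambda>(a, b). counit H b \<odot>\<^bsub>H\<^esub> a)"
    by (rule balanced_mapI) (simp_all add: counit_add counit_hom ld smult_r_distr sm)
  show "balanced_map H H H (\<lambda>(a, b). antipode H a \<otimes>\<^bsub>H\<^esub> b)"
    by (rule balanced_mapI) (simp_all add: antipode_simps l_distr r_distr smult_assoc2 sm2)
  show "balanced_map H H H (\<lambda>(a, b). a \<otimes>\<^bsub>H\<^esub> antipode H b)"
    by (rule balanced_mapI) (simp_all add: antipode_simps l_distr r_distr smult_assoc2 sm2)
qed

lemma linear_lift:
  assumes "balanced_map H H H \<beta>" "\<And>a b r. a \<in> carrier H \<Longrightarrow> b \<in> carrier H \<Longrightarrow> \<beta> (r \<odot>\<^bsub>H\<^esub> a, b) = r \<odot>\<^bsub>H\<^esub> \<beta> (a, b)"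
  shows "tensor_lift H \<beta> \<in> semilinear id (tens H H) H"
proof -
  note l = HH.tensor_lift_additive[OF M.abelian_group_axioms assms(1)]
  have "tensor_lift H \<beta> (r \<odot>\<^bsub>tens H H\<^esub> X) = r \<odot>\<^bsub>H\<^esub> tensor_lift H \<beta> X" if X: "X \<in> carrier (tens H H)" for r X
    using X
  proof (induction rule: HH.tensor_induct)
    case zero then show ?case using additive_maps_zero[OF HH.abelian_group_tens M.abelian_group_axioms l] by simp
  next
    case (pure a b) then show ?case
      using smult_closed[of r a]
      by (simp add: HH.smult_pure HH.tensor_lift_pure[OF M.abelian_group_axioms assms(1)] assms(2))
  qed (simp add: additive_mapsD[OF l] smult_r_distr HH.TA.smult_r_distr)
  with l show ?thesis by (simp add: semilinear_def)
qed

text \<open>Linearity allows an axiom to be tested on generators of the module; for a base change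
  these are the elements 1 \<otimes> a.\<close>

lemma sides_linear:
  "coassoc_lhs H \<in> semilinear id H (tens H (tens H H))" "coassoc_rhs H \<in> semilinear id H (tens H (tens H H))"
  "counit_lhs H \<in> semilinear id H H" "counit_rhs H \<in> semilinear id H H"
  "antipode_lhs H \<in> semilinear id H H" "antipode_rhs H \<in> semilinear id H H"
  "(\<lambda>x. counit H x \<odot>\<^bsub>H\<^esub> \<one>\<^bsub>H\<^esub>) \<in> semilinear id H H"
proof -
  note m = module_axioms and m2 = HH.module_tens
  note assoc = three_modules.assoc_linear[OF three_modules.intro[OF m m m]]
  have comp: "f \<in> semilinear id (tens H H) B \<Longrightarrow> (\<lambda>x. f (comult H x)) \<in> semilinear id H B" for f and B :: "('r, 'd) module"
    using semilinear_comp[OF comult_hom(2), of f id B] by (simp add: id_def)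
  have comp': "f \<in> semilinear id (tens H H) H \<Longrightarrow> (\<lambda>x. f (comult H x)) \<in> semilinear id H H" for f
    using semilinear_comp[OF comult_hom(2), of f id H] by (simp add: id_def)
  have "(\<lambda>x. assoc_map H H H (tmap (tens H H) H (comult H) id x)) \<in> semilinear id (tens H H) (tens H (tens H H))"
    using semilinear_comp[OF tensor_map_semilinear[OF m m m2 m comult_hom(2) semilinear_id] assoc]
    by (simp add: id_def)
  from comp[OF this] show "coassoc_lhs H \<in> semilinear id H (tens H (tens H H))"
    unfolding coassoc_lhs_def[abs_def] .
  show "coassoc_rhs H \<in> semilinear id H (tens H (tens H H))"
    unfolding coassoc_rhs_def[abs_def]
    by (rule comp[OF tensor_map_semilinear[OF m m m m2 semilinear_id comult_hom(2)]])
  have sm: "(r * s) \<odot>\<^bsub>H\<^esub> x = r \<odot>\<^bsub>H\<^esub> (s \<odot>\<^bsub>H\<^esub> x)" "(r * s) \<odot>\<^bsub>H\<^esub> x = s \<odot>\<^bsub>H\<^esub> (r \<odot>\<^bsub>H\<^esub> x)" if "x \<in> carrier H" for r s x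
    using smult_assoc1[of s r x] smult_assoc1[of r s x] that by (simp_all add: mult.commute)
  show "counit_lhs H \<in> semilinear id H H"
    unfolding counit_lhs_def[abs_def]
    by (rule comp'[OF linear_lift[OF balanced_structure(1)]]) (simp add: counit_hom sm(1))
  show "counit_rhs H \<in> semilinear id H H"
    unfolding counit_rhs_def[abs_def]
    by (rule comp'[OF linear_lift[OF balanced_structure(2)]]) (simp, metis sm)
  show "antipode_lhs H \<in> semilinear id H H"
    unfolding antipode_lhs_def[abs_def]
    by (rule comp'[OF linear_lift[OF balanced_structure(3)]]) (simp add: antipode_simps smult_assoc2)
  show "antipode_rhs H \<in> semilinear id H H"
    unfolding antipode_rhs_def[abs_def]
    by (rule comp'[OF linear_lift[OF balanced_structure(4)]]) (simp add: antipode_simps smult_assoc2)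
  show "(\<lambda>x. counit H x \<odot>\<^bsub>H\<^esub> \<one>\<^bsub>H\<^esub>) \<in> semilinear id H H"
    using smult_l_distr[of _ _ "\<one>\<^bsub>H\<^esub>"] by (intro semilinearI) (simp_all add: counit_add counit_hom sm)
qed

end

lemma pre_hopf_algebraI: "pre_hopf H \<Longrightarrow> pre_hopf_algebra H"
  by (simp add: pre_hopf_algebra_def pre_hopf_algebra_axioms_def pre_hopf_def)

definition hopf_semilinear ::
  "('r \<Rightarrow> 's) \<Rightarrow> ('r::comm_ring_1, 'a) hopf \<Rightarrow> ('s::comm_ring_1, 'b) hopf \<Rightarrow> ('a \<Rightarrow> 'b) set" where
  "hopf_semilinear \<phi> H K = {f \<in> ring_hom H K \<inter> semilinear \<phi> H K. \<forall>x\<in>carrier H.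
     comult K (f x) = tmap K K f f (comult H x) \<and> counit K (f x) = \<phi> (counit H x) \<and>
     antipode K (f x) = f (antipode H x)}"

text \<open>Each side is composed of structure maps that f intertwines, and \<open>pre_hopf\<close>
  is enough on both ends. This serves in both directions: forward from A to its base change, and
  backward along an injective f.\<close>

lemma sides_natural:
  assumes H: "pre_hopf H" and K: "pre_hopf K" and f: "f \<in> hopf_semilinear \<phi> H K" and x: "x \<in> carrier H"
  shows "coassoc_lhs K (f x) = tmap K (tens K K) f (tmap K K f f) (coassoc_lhs H x)"
    "coassoc_rhs K (f x) = tmap K (tens K K) f (tmap K K f f) (coassoc_rhs H x)"
    "counit_lhs K (f x) = f (counit_lhs H x)" "counit_rhs K (f x) = f (counit_rhs H x)"
    "antipode_lhs K (f x) = f (antipode_lhs H x)" "antipode_rhs K (f x) = f (antipode_rhs H x)"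
    "counit K (f x) \<odot>\<^bsub>K\<^esub> \<one>\<^bsub>K\<^esub> = f (counit H x \<odot>\<^bsub>H\<^esub> \<one>\<^bsub>H\<^esub>)"
proof -
  interpret H: pre_hopf_algebra H by (rule pre_hopf_algebraI[OF H])
  interpret K: pre_hopf_algebra K by (rule pre_hopf_algebraI[OF K])
  have fr: "f \<in> ring_hom H K" and fs: "f \<in> semilinear \<phi> H K"
    and c: "\<And>x. x \<in> carrier H \<Longrightarrow> comult K (f x) = tmap K K f f (comult H x)"
      "\<And>x. x \<in> carrier H \<Longrightarrow> counit K (f x) = \<phi> (counit H x)"
      "\<And>x. x \<in> carrier H \<Longrightarrow> antipode K (f x) = f (antipode H x)"
    using f by (auto simp: hopf_semilinear_def)
  note mH = H.module_axioms and mK = K.module_axioms and mHH = H.HH.module_tens and mKK = K.HH.module_tens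
  note ff = tensor_map_semilinear[OF mH mH mK mK fs fs]
  have dx: "comult H x \<in> carrier (tens H H)" using x by (rule H.comult_simps)
  have cl: "(\<lambda>x. comult K (f x)) \<in> semilinear \<phi> H (tens K K)"
    using semilinear_comp[OF fs K.comult_hom(2)] by (simp add: id_def)
  show "coassoc_lhs K (f x) = tmap K (tens K K) f (tmap K K f f) (coassoc_lhs H x)"
  proof -
    \<comment> \<open>All maps are collected in a single \<open>tmap\<close> applied to
      \<open>comult H x\<close>; there f is moved past the comultiplication, and the result is
      expanded in the other order.\<close>
    have "tmap (tens K K) K (comult K) id (comult K (f x)) = tmap (tens K K) K (\<lambda>x. comult K (f x)) (\<lambda>x. id (f x)) (comult H x)"
      by (simp only: c(1)[OF x]) (rule tensor_map_comp[OF mH mH mK mK mKK mK fs fs K.comult_hom(2) semilinear_id dx])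
    also have "\<dots> = tmap (tens K K) K (\<lambda>x. tmap K K f f (comult H x)) (\<lambda>x. f (id x)) (comult H x)"
      by (rule tensor_map_cong[OF mH mH]) (simp_all add: c dx)
    also have "\<dots> = tmap (tens K K) K (tmap K K f f) f (tmap (tens H H) H (comult H) id (comult H x))"
      by (rule tensor_map_comp[symmetric, OF mH mH mHH mH mKK mK H.comult_hom(2) semilinear_id ff fs dx])
    finally have e: "tmap (tens K K) K (comult K) id (comult K (f x)) =
      tmap (tens K K) K (tmap K K f f) f (tmap (tens H H) H (comult H) id (comult H x))" .
    show ?thesis
      unfolding coassoc_lhs_def e
      by (rule assoc_natural[OF mH mH mH mK mK mK fs fs fs])
         (rule semilinearD(1)[OF tensor_map_semilinear[OF mH mH mHH mH H.comult_hom(2) semilinear_id] dx])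
  qed
  show "coassoc_rhs K (f x) = tmap K (tens K K) f (tmap K K f f) (coassoc_rhs H x)"
  proof -
    have "coassoc_rhs K (f x) = tmap K (tens K K) (\<lambda>x. id (f x)) (\<lambda>x. comult K (f x)) (comult H x)"
      by (simp only: c(1)[OF x] coassoc_rhs_def) (rule tensor_map_comp[OF mH mH mK mK mK mKK fs fs semilinear_id K.comult_hom(2) dx])
    also have "\<dots> = tmap K (tens K K) (\<lambda>x. f (id x)) (\<lambda>x. tmap K K f f (comult H x)) (comult H x)"
      by (rule tensor_map_cong[OF mH mH]) (simp_all add: c dx)
    also have "\<dots> = tmap K (tens K K) f (tmap K K f f) (coassoc_rhs H x)"
      unfolding coassoc_rhs_def
      by (rule tensor_map_comp[symmetric, OF mH mH mH mHH mK mKK semilinear_id H.comult_hom(2) fs ff dx])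
    finally show ?thesis .
  qed
  note nat = tensor_lift_natural[OF mH mH mK mK H.M.abelian_group_axioms K.M.abelian_group_axioms fs fs semilinearD(4)[OF fs] _ _ _ dx]
  show "counit_lhs K (f x) = f (counit_lhs H x)"
    unfolding counit_lhs_def c(1)[OF x]
    by (rule nat[OF H.balanced_structure(1) K.balanced_structure(1)]) (simp add: c semilinearD[OF fs])
  show "counit_rhs K (f x) = f (counit_rhs H x)"
    unfolding counit_rhs_def c(1)[OF x]
    by (rule nat[OF H.balanced_structure(2) K.balanced_structure(2)]) (simp add: c semilinearD[OF fs])
  show "antipode_lhs K (f x) = f (antipode_lhs H x)"
    unfolding antipode_lhs_def c(1)[OF x]
    by (rule nat[OF H.balanced_structure(3) K.balanced_structure(3)]) (simp add: c ring_hom_mult[OF fr] H.antipode_simps)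
  show "antipode_rhs K (f x) = f (antipode_rhs H x)"
    unfolding antipode_rhs_def c(1)[OF x]
    by (rule nat[OF H.balanced_structure(4) K.balanced_structure(4)]) (simp add: c ring_hom_mult[OF fr] H.antipode_simps)
  show "counit K (f x) \<odot>\<^bsub>K\<^esub> \<one>\<^bsub>K\<^esub> = f (counit H x \<odot>\<^bsub>H\<^esub> \<one>\<^bsub>H\<^esub>)"
    by (simp add: c x semilinearD[OF fs] ring_hom_one[OF fr])
qed

text \<open>Hopf algebra axioms are inherited along maps that stay injective on tensor squares and cubes.\<close>

lemma hopf_algebra_reflect:
  fixes \<phi> :: "'r::comm_ring_1 \<Rightarrow> 's::comm_ring_1"
  assumes \<phi>: "\<phi> \<in> ring_hom univ_ring univ_ring" "inj \<phi>"
    and H: "algebra univ_ring H" and K: "hopf_algebra univ_ring K"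
    and f: "f \<in> hopf_semilinear \<phi> H K"
    and closed: "\<And>x. x \<in> carrier H \<Longrightarrow> comult H x \<in> carrier (tens H H)"
      "\<And>x. x \<in> carrier H \<Longrightarrow> antipode H x \<in> carrier H"
    and inj: "inj_on f (carrier H)" "inj_on (tmap K K f f) (carrier (tens H H))"
      "inj_on (tmap K (tens K K) f (tmap K K f f)) (carrier (tens H (tens H H)))"
  shows "hopf_algebra univ_ring H"
proof -
  have pK: "pre_hopf K" using K by (simp add: hopf_algebra_iff)
  interpret H: algebra univ_ring H by fact
  interpret K: pre_hopf_algebra K by (rule pre_hopf_algebraI[OF pK])
  interpret HH: tensor_algebras H H by unfold_locales
  have fr: "f \<in> ring_hom H K" and fs: "f \<in> semilinear \<phi> H K"
    and c: "\<And>x. x \<in> carrier H \<Longrightarrow> tmap K K f f (comult H x) = comult K (f x)"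
      "\<And>x. x \<in> carrier H \<Longrightarrow> \<phi> (counit H x) = counit K (f x)"
      "\<And>x. x \<in> carrier H \<Longrightarrow> f (antipode H x) = antipode K (f x)"
    using f by (auto simp: hopf_semilinear_def)
  note mH = H.module_axioms and mK = K.module_axioms
  note ff = tensor_map_semilinear[OF mH mH mK mK fs fs]
  note ffr = tensor_map_ring_hom[OF H H K.algebra_axioms K.algebra_axioms fs fs fr fr]
  note rh = ring_hom_mult[OF fr] ring_hom_one[OF fr]
  note rhf = ring_hom_mult[OF ffr] ring_hom_one[OF ffr]
  note ih = inj_onD[OF inj(1)] and ihh = inj_onD[OF inj(2)]
  have ph: "\<phi> (x + y) = \<phi> x + \<phi> y" "\<phi> (x * y) = \<phi> x * \<phi> y" "\<phi> 1 = 1" for x y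
    using ring_hom_add[OF \<phi>(1), of x y] ring_hom_mult[OF \<phi>(1), of x y] ring_hom_one[OF \<phi>(1)] by simp_all
  \<comment> \<open>Of \<open>comult H\<close> only closedness and compatibility with f are known;
    each identity in \<open>tens H H\<close> is verified in \<open>tens K K\<close>, where it holds
    for \<open>comult K\<close>.\<close>
  have "comult H \<in> ring_hom H (tens H H)"
    by (rule ring_hom_memI; (rule ihh)?)
       (simp_all add: closed c rhf rh semilinearD[OF fs] semilinearD[OF ff] ring_hom_closed[OF fr]
         ring_hom_mult[OF K.comult_hom(1)] ring_hom_one[OF K.comult_hom(1)] K.comult_simps)
  moreover have "comult H \<in> semilinear id H (tens H H)"
    by (rule semilinearI; (rule ihh)?)
       (simp_all add: closed c semilinearD[OF fs] semilinearD[OF ff] K.comult_simps)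
  moreover have "antipode H \<in> ring_hom H H"
    by (rule ring_hom_memI; (rule ih)?)
       (simp_all add: closed c rh semilinearD[OF fs]
         ring_hom_mult[OF K.antipode_hom(1)] ring_hom_one[OF K.antipode_hom(1)] K.antipode_simps)
  moreover have "antipode H \<in> semilinear id H H"
    by (rule semilinearI; (rule ih)?)
       (simp_all add: closed c semilinearD[OF fs] K.antipode_simps)
  moreover have "counit H \<in> ring_hom H univ_ring"
    by (rule ring_hom_memI; (rule injD[OF \<phi>(2)])?)
       (simp_all add: c ph rh semilinearD[OF fs] K.counit_add
          ring_hom_mult[OF K.counit_hom(1), simplified] ring_hom_one[OF K.counit_hom(1), simplified])
  moreover have "counit H (r \<odot>\<^bsub>H\<^esub> x) = r * counit H x" if "x \<in> carrier H" for r x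
    using that by (intro injD[OF \<phi>(2)]) (simp add: c ph semilinearD[OF fs] K.counit_hom)
  ultimately have pH: "pre_hopf H" using H by (simp add: pre_hopf_def)
  interpret H: pre_hopf_algebra H by (rule pre_hopf_algebraI[OF pH])
  \<comment> \<open>Each side of an axiom of H is sent to the corresponding side for K, by f or, for
    coassociativity, by its cube; both are injective.\<close>
  note n = sides_natural[OF pH pK f]
  note l = semilinearD(1)[OF H.sides_linear(1)] semilinearD(1)[OF H.sides_linear(2)] semilinearD(1)[OF H.sides_linear(3)]
    semilinearD(1)[OF H.sides_linear(4)] semilinearD(1)[OF H.sides_linear(5)] semilinearD(1)[OF H.sides_linear(6)]
    semilinearD(1)[OF H.sides_linear(7)]
  have k: "coassoc_lhs K y = coassoc_rhs K y" "counit_lhs K y = y" "counit_rhs K y = y"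
     "antipode_lhs K y = counit K y \<odot>\<^bsub>K\<^esub> \<one>\<^bsub>K\<^esub>" "antipode_rhs K y = counit K y \<odot>\<^bsub>K\<^esub> \<one>\<^bsub>K\<^esub>"
    if "y \<in> carrier K" for y
    using K that by (simp_all add: hopf_algebra_iff)
  show ?thesis
    unfolding hopf_algebra_iff
  proof (intro conjI ballI pH)
    fix x assume x: "x \<in> carrier H"
    then have fx: "f x \<in> carrier K" by (rule semilinearD(1)[OF fs])
    show "coassoc_lhs H x = coassoc_rhs H x"
      by (rule inj_onD[OF inj(3)]) (use k(1)[OF fx] n(1,2)[OF x] l x in simp_all)
    show "counit_lhs H x = x" by (rule ih) (use k(2)[OF fx] n(3)[OF x] l x in simp_all)
    show "counit_rhs H x = x" by (rule ih) (use k(3)[OF fx] n(4)[OF x] l x in simp_all)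
    show "antipode_lhs H x = counit H x \<odot>\<^bsub>H\<^esub> \<one>\<^bsub>H\<^esub>"
      by (rule ih) (use k(4)[OF fx] n(5,7)[OF x] l x in simp_all)
    show "antipode_rhs H x = counit H x \<odot>\<^bsub>H\<^esub> \<one>\<^bsub>H\<^esub>"
      by (rule ih) (use k(5)[OF fx] n(6,7)[OF x] l x in simp_all)
  qed
qed

section \<open>Base change\<close>

lemma univ_alg_simps [simp]:
  "carrier (univ_alg \<phi>) = UNIV" "x \<oplus>\<^bsub>univ_alg \<phi>\<^esub> y = x + y" "x \<otimes>\<^bsub>univ_alg \<phi>\<^esub> y = x * y"
  "\<zero>\<^bsub>univ_alg \<phi>\<^esub> = 0" "\<one>\<^bsub>univ_alg \<phi>\<^esub> = 1" "r \<odot>\<^bsub>univ_alg \<phi>\<^esub> x = \<phi> r * x"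
  by (simp_all add: univ_alg_def ring_of_type_algebra_def ring.defs module.defs)

lemma univ_alg_add: "add (univ_alg \<phi>) = (+)"
  by (simp add: fun_eq_iff)

lemma univ_homD:
  assumes "\<phi> \<in> ring_hom univ_ring univ_ring"
  shows "\<phi> (x + y) = \<phi> x + \<phi> y" "\<phi> (x * y) = \<phi> x * \<phi> y" "\<phi> 1 = 1" "\<phi> 0 = 0" "\<phi> (- x) = - \<phi> x" "\<phi> (x - y) = \<phi> x - \<phi> y"
proof -
  show a: "\<phi> (x + y) = \<phi> x + \<phi> y" "\<phi> (x * y) = \<phi> x * \<phi> y" "\<phi> 1 = 1" for x y
    using ring_hom_add[OF assms, of x y] ring_hom_mult[OF assms, of x y] ring_hom_one[OF assms] by simp_all
  show z: "\<phi> 0 = 0" using a(1)[of 0 0] by simp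
  have "\<phi> (- x) + \<phi> x = 0" for x using a(1)[of "- x" x] z by simp
  then show m: "\<phi> (- x) = - \<phi> x" for x by (simp add: eq_neg_iff_add_eq_0)
  show "\<phi> (x - y) = \<phi> x - \<phi> y" using a(1)[of x "- y"] m by simp
qed

lemma univ_homI:
  "(\<And>x y. \<phi> (x + y) = \<phi> x + \<phi> y) \<Longrightarrow> (\<And>x y. \<phi> (x * y) = \<phi> x * \<phi> y) \<Longrightarrow> \<phi> 1 = 1 \<Longrightarrow>
   \<phi> \<in> ring_hom univ_ring univ_ring"
  by (auto intro!: ring_hom_memI)

lemma algebra_univ_alg:
  fixes \<phi> :: "'r::comm_ring_1 \<Rightarrow> 's::comm_ring_1"
  assumes "\<phi> \<in> ring_hom univ_ring univ_ring" shows "algebra univ_ring (univ_alg \<phi>)"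
proof -
  have "\<exists>y. y + x = 0" for x :: 's by (rule exI[of _ "- x"]) simp
  then have "cring (univ_alg \<phi>)"
    by (intro cringI abelian_groupI comm_monoidI) (auto simp: algebra_simps)
  then show ?thesis
    by (intro algebraI) (auto simp: univ_homD[OF assms] algebra_simps)
qed

lemma algebra_abelian_group: "algebra R M \<Longrightarrow> abelian_group M"
  and algebra_module: "algebra R M \<Longrightarrow> module R M"
  and algebra_cring: "algebra R M \<Longrightarrow> cring M"
  by (simp_all add: algebra_def module_def)

lemma cring_cong:
  assumes "carrier A' = carrier A" "monoid.mult A' = monoid.mult A" "one A' = one A" "zero A' = zero A" "add A' = add A"
    "cring A"
  shows "cring A'"
  using assms(6)
  unfolding cring_def ring_def ring_axioms_def
      abelian_group_def abelian_group_axioms_def abelian_monoid_def comm_monoid_def comm_monoid_axioms_def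
      comm_group_def group_def group_axioms_def Units_def monoid_def partial_object.select_convs
      monoid.select_convs assms(1-5) .

lemma ring_hom_cong:
  assumes "ring A" "\<And>x. x \<in> carrier A \<Longrightarrow> f x = g x"
  shows "f \<in> ring_hom A B \<longleftrightarrow> g \<in> ring_hom A B"
proof -
  interpret ring A by fact
  show ?thesis using assms(2) by (auto simp: ring_hom_def Pi_iff)
qed

locale base_changed =
  fixes \<phi> :: "'r::comm_ring_1 \<Rightarrow> 's::comm_ring_1" and A :: "('r, 'a) hopf"
  assumes hom: "\<phi> \<in> ring_hom univ_ring univ_ring" and pre_hopf: "pre_hopf A"
begin

sublocale A: pre_hopf_algebra A by (rule pre_hopf_algebraI[OF pre_hopf])
sublocale S: algebra univ_ring "univ_alg \<phi>" by (rule algebra_univ_alg[OF hom])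
sublocale SA: tensor_algebras "univ_alg \<phi>" A ..

definition L where "L = base_change univ_ring (univ_alg \<phi>) A"
abbreviation P where "P \<equiv> pure (univ_alg \<phi>) A"

lemma base_change_alg_simps:
  "carrier (base_change_alg univ_ring (univ_alg \<phi>) A) = carrier (tens (univ_alg \<phi>) A)"
  "monoid.mult (base_change_alg univ_ring (univ_alg \<phi>) A) = monoid.mult (tens (univ_alg \<phi>) A)"
  "one (base_change_alg univ_ring (univ_alg \<phi>) A) = one (tens (univ_alg \<phi>) A)"
  "zero (base_change_alg univ_ring (univ_alg \<phi>) A) = zero (tens (univ_alg \<phi>) A)"
  "add (base_change_alg univ_ring (univ_alg \<phi>) A) = add (tens (univ_alg \<phi>) A)"
  "s \<odot>\<^bsub>base_change_alg univ_ring (univ_alg \<phi>) A\<^esub> X = tmap (univ_alg \<phi>) A ((*) s) id X"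
  by (simp_all add: base_change_alg_def ring.defs module.defs tensor_map_def map_prod_def)

lemma same_algebra_L: "same_algebra L (base_change_alg univ_ring (univ_alg \<phi>) A)"
  by (simp add: same_algebra_def L_def base_change_def Let_def module.defs hopf.defs)

lemma L_simps:
  "carrier L = carrier (tens (univ_alg \<phi>) A)"
  "monoid.mult L = monoid.mult (tens (univ_alg \<phi>) A)"
  "one L = one (tens (univ_alg \<phi>) A)"
  "zero L = zero (tens (univ_alg \<phi>) A)"
  "add L = add (tens (univ_alg \<phi>) A)"
  "s \<odot>\<^bsub>L\<^esub> X = tmap (univ_alg \<phi>) A ((*) s) id X"
  using same_algebra_L by (simp_all add: same_algebra_def base_change_alg_simps)

lemma mult_semilinear: "(*) s \<in> semilinear id (univ_alg \<phi>) (univ_alg \<phi>)"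
  by (rule semilinearI) (simp_all add: algebra_simps)

lemma smult_L_tens: "tmap (univ_alg \<phi>) A ((*) s) id \<in> semilinear id (tens (univ_alg \<phi>) A) (tens (univ_alg \<phi>) A)"
  by (rule tensor_map_semilinear[OF S.module_axioms A.module_axioms S.module_axioms A.module_axioms mult_semilinear semilinear_id])

lemma smult_L_pure: "a \<in> carrier A \<Longrightarrow> s \<odot>\<^bsub>L\<^esub> P s' a = P (s * s') a"
  by (simp add: L_simps tensor_map_pure[OF S.module_axioms A.module_axioms S.module_axioms A.module_axioms mult_semilinear semilinear_id])

lemma cring_L: "cring L"
  by (rule cring_cong[OF L_simps(1-5)]) (rule SA.TA.is_cring)

lemma algebra_L: "algebra univ_ring L"
proof -
  interpret L: cring L by (rule cring_L)
  note sm = semilinearD(1,2)[OF smult_L_tens, folded L_simps]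
  have z: "s \<odot>\<^bsub>L\<^esub> \<zero>\<^bsub>L\<^esub> = \<zero>\<^bsub>L\<^esub>" for s
    using additive_maps_zero[OF SA.abelian_group_tens SA.abelian_group_tens semilinearD(4)[OF smult_L_tens]]
    by (simp add: L_simps)
  note ind = SA.tensor_induct[folded L_simps, consumes 1, case_names zero pure add]
  note pL = SA.pure_closed[folded L_simps] SA.pure_add_left[folded L_simps]
  show ?thesis
  proof (rule algebraI)
    fix s s' X assume X: "X \<in> carrier L"
    show "s \<odot>\<^bsub>L\<^esub> X \<in> carrier L" by (rule sm[OF X])
    show "(s \<oplus>\<^bsub>univ_ring\<^esub> s') \<odot>\<^bsub>L\<^esub> X = s \<odot>\<^bsub>L\<^esub> X \<oplus>\<^bsub>L\<^esub> s' \<odot>\<^bsub>L\<^esub> X"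
      using X by (induction rule: ind)
       (simp_all add: z smult_L_pure distrib_right pL(2)[of "_ * _" "_ * _", simplified] sm L.a_ac)
    show "(s \<otimes>\<^bsub>univ_ring\<^esub> s') \<odot>\<^bsub>L\<^esub> X = s \<odot>\<^bsub>L\<^esub> (s' \<odot>\<^bsub>L\<^esub> X)"
      using X by (induction rule: ind) (simp_all add: z smult_L_pure sm mult.assoc)
    show "\<one>\<^bsub>univ_ring\<^esub> \<odot>\<^bsub>L\<^esub> X = X"
      using X by (induction rule: ind) (simp_all add: z smult_L_pure sm)
    fix Y assume Y: "Y \<in> carrier L"
    show "s \<odot>\<^bsub>L\<^esub> (X \<oplus>\<^bsub>L\<^esub> Y) = s \<odot>\<^bsub>L\<^esub> X \<oplus>\<^bsub>L\<^esub> s \<odot>\<^bsub>L\<^esub> Y" by (rule sm(2)[OF X Y])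
    show "(s \<odot>\<^bsub>L\<^esub> X) \<otimes>\<^bsub>L\<^esub> Y = s \<odot>\<^bsub>L\<^esub> (X \<otimes>\<^bsub>L\<^esub> Y)"
      using X
    proof (induction rule: ind)
      case (pure t a)
      show ?case using Y
        by (induction rule: ind)
           (use pure in \<open>simp_all add: z smult_L_pure sm L.r_distr pL SA.mult_pure[folded L_simps] mult.assoc\<close>)
    qed (use Y in \<open>simp_all add: z sm L.l_distr\<close>)
  qed (auto intro: cring_L)
qed

sublocale L: algebra univ_ring L by (rule algebra_L)
sublocale LL: tensor_algebras L L ..

lemmas P_closed = SA.pure_closed[folded L_simps, simplified]
lemmas L_induct = SA.tensor_induct[folded L_simps, consumes 1, case_names zero pure add]

lemma L_one: "\<one>\<^bsub>L\<^esub> = P 1 \<one>\<^bsub>A\<^esub>" by (simp add: L_simps SA.one_tens)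

lemma L_mult: "a \<in> carrier A \<Longrightarrow> b \<in> carrier A \<Longrightarrow> P s a \<otimes>\<^bsub>L\<^esub> P t b = P (s * t) (a \<otimes>\<^bsub>A\<^esub> b)"
  using SA.mult_pure[folded L_simps, of s a t b] by simp

lemma P_smult: "a \<in> carrier A \<Longrightarrow> P s (r \<odot>\<^bsub>A\<^esub> a) = P (\<phi> r * s) a"
  using SA.pure_smult_swap[of s a r] by simp

lemma P_eq: "a \<in> carrier A \<Longrightarrow> P s a = s \<odot>\<^bsub>L\<^esub> P 1 a"
  by (simp add: smult_L_pure)

lemma P_add: "a \<in> carrier A \<Longrightarrow> b \<in> carrier A \<Longrightarrow> P s (a \<oplus>\<^bsub>A\<^esub> b) = P s a \<oplus>\<^bsub>L\<^esub> P s b"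
  using SA.pure_add_right[of s a b] by (simp add: L_simps)

lemma unit_semilinear: "P 1 \<in> semilinear \<phi> A L"
  by (rule semilinearI) (simp_all add: P_closed P_add P_smult smult_L_pure)

lemma unit_ring_hom: "P 1 \<in> ring_hom A L"
  by (rule ring_hom_memI) (simp_all add: P_closed P_add L_mult L_one)

text \<open>Because s \<otimes> a = s (1 \<otimes> a), the image of A generates L over S.\<close>

lemma semilinear_eqI:
  assumes "abelian_group M" "f \<in> semilinear \<tau> L M" "g \<in> semilinear \<tau> L M"
    "\<And>a. a \<in> carrier A \<Longrightarrow> f (P 1 a) = g (P 1 a)" "X \<in> carrier L"
  shows "f X = g X"
  using assms(5)
proof (induction rule: L_induct)
  case zero
  show ?case
    using additive_maps_zero[OF L.M.abelian_group_axioms assms(1) semilinearD(4)[OF assms(2)]]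
      additive_maps_zero[OF L.M.abelian_group_axioms assms(1) semilinearD(4)[OF assms(3)]] by simp
next
  case (pure s a)
  then show ?case using assms(4)[of a] P_closed[of a 1]
    by (simp add: P_eq[of a s] semilinearD(3)[OF assms(2)] semilinearD(3)[OF assms(3)])
qed (simp add: semilinearD(2)[OF assms(2)] semilinearD(2)[OF assms(3)])

text \<open>The universal property of extension of scalars: (s, a) -> s g(a) is balanced because g
  is semilinear along \<phi>.\<close>

lemma extension:
  assumes "module univ_ring M" and g: "g \<in> semilinear \<phi> A M"
  shows "tensor_lift M (\<lambda>(s, a). s \<odot>\<^bsub>M\<^esub> g a) \<in> semilinear id L M"
    "a \<in> carrier A \<Longrightarrow> tensor_lift M (\<lambda>(s, a). s \<odot>\<^bsub>M\<^esub> g a) (P s a) = s \<odot>\<^bsub>M\<^esub> g a"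
proof -
  interpret M: module univ_ring M by fact
  have d: "(s + t) \<odot>\<^bsub>M\<^esub> x = s \<odot>\<^bsub>M\<^esub> x \<oplus>\<^bsub>M\<^esub> t \<odot>\<^bsub>M\<^esub> x" "(s * t) \<odot>\<^bsub>M\<^esub> x = s \<odot>\<^bsub>M\<^esub> (t \<odot>\<^bsub>M\<^esub> x)" if "x \<in> carrier M" for s t x
    using M.smult_l_distr[of s t x] M.smult_assoc1[of s t x] that by simp_all
  have b: "balanced_map (univ_alg \<phi>) A M (\<lambda>(s, a). s \<odot>\<^bsub>M\<^esub> g a)"
    by (rule balanced_mapI) (simp_all add: semilinearD[OF g] d M.smult_r_distr mult.commute[of "\<phi> _"])
  note l = SA.tensor_lift_additive[OF M.M.abelian_group_axioms b]
  show p: "a \<in> carrier A \<Longrightarrow> tensor_lift M (\<lambda>(s, a). s \<odot>\<^bsub>M\<^esub> g a) (P s a) = s \<odot>\<^bsub>M\<^esub> g a" for s a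
    using SA.tensor_lift_pure[OF M.M.abelian_group_axioms b, of s a] by simp
  have "tensor_lift M (\<lambda>(s, a). s \<odot>\<^bsub>M\<^esub> g a) (r \<odot>\<^bsub>L\<^esub> X) = r \<odot>\<^bsub>M\<^esub> tensor_lift M (\<lambda>(s, a). s \<odot>\<^bsub>M\<^esub> g a) X"
    if X: "X \<in> carrier L" for r X
    using X
  proof (induction rule: L_induct)
    case zero
    then show ?case using additive_maps_zero[OF SA.abelian_group_tens M.M.abelian_group_axioms l]
      by (simp add: L_simps(4)[symmetric])
  next
    case (add X Y)
    then show ?case using additive_mapsD[OF l] by (simp add: L.smult_r_distr L_simps(1,5)[symmetric] M.smult_r_distr)
  qed (simp add: p smult_L_pure d semilinearD[OF g])
  then show "tensor_lift M (\<lambda>(s, a). s \<odot>\<^bsub>M\<^esub> g a) \<in> semilinear id L M"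
    using l by (simp add: semilinear_def additive_maps_def L_simps)
qed

text \<open>On s \<otimes> a a semilinear map is \<tau>(s) times its value on 1 \<otimes> a, so
  multiplicativity of \<tau> and of the restriction to A is enough.\<close>

lemma L_ring_homI:
  assumes "algebra univ_ring M" "f \<in> semilinear \<tau> L M" "\<tau> \<in> ring_hom univ_ring univ_ring" "(\<lambda>a. f (P 1 a)) \<in> ring_hom A M"
  shows "f \<in> ring_hom L M"
proof -
  interpret M: algebra univ_ring M by fact
  note t = univ_homD[OF assms(3)]
  have p: "f (P s a) = \<tau> s \<odot>\<^bsub>M\<^esub> f (P 1 a)" "f (P 1 a) \<in> carrier M" if "a \<in> carrier A" for s a
    using P_closed[of a 1] that by (simp_all add: P_eq[of a s] semilinearD(1,3)[OF assms(2)])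
  have "f \<in> ring_hom (tens (univ_alg \<phi>) A) M"
  proof (rule SA.tens_ring_homI[OF M.ring_axioms])
    show "f \<in> additive_maps (tens (univ_alg \<phi>) A) M"
      using semilinearD(4)[OF assms(2)] by (simp add: additive_maps_def L_simps)
    show "f (P \<one>\<^bsub>univ_alg \<phi>\<^esub> \<one>\<^bsub>A\<^esub>) = \<one>\<^bsub>M\<^esub>" using ring_hom_one[OF assms(4)] by simp
    fix s a s' a' assume a: "a \<in> carrier A" "a' \<in> carrier A"
    have "\<tau> s \<odot>\<^bsub>M\<^esub> x \<otimes>\<^bsub>M\<^esub> (\<tau> s' \<odot>\<^bsub>M\<^esub> y) = (\<tau> s * \<tau> s') \<odot>\<^bsub>M\<^esub> (x \<otimes>\<^bsub>M\<^esub> y)" if "x \<in> carrier M" "y \<in> carrier M" for x y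
    proof -
      have "x \<otimes>\<^bsub>M\<^esub> (\<tau> s' \<odot>\<^bsub>M\<^esub> y) = \<tau> s' \<odot>\<^bsub>M\<^esub> (x \<otimes>\<^bsub>M\<^esub> y)"
        using M.smult_assoc2[of "\<tau> s'" y x] that by (simp add: M.m_comm)
      then show ?thesis using that M.smult_assoc1[of "\<tau> s" "\<tau> s'" "x \<otimes>\<^bsub>M\<^esub> y"] by (simp add: M.smult_assoc2)
    qed
    then show "f (P (s \<otimes>\<^bsub>univ_alg \<phi>\<^esub> s') (a \<otimes>\<^bsub>A\<^esub> a')) = f (P s a) \<otimes>\<^bsub>M\<^esub> f (P s' a')"
      using a ring_hom_mult[OF assms(4), of a a'] p(2)[of a] p(2)[of a']
      by (simp add: p(1)[of _ "s * s'"] p(1)[of _ s] p(1)[of _ s'] t)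
  qed
  then show ?thesis by (simp add: ring_hom_def L_simps)
qed

text \<open>The definition forms the tensor product over \<open>univ_alg \<phi>\<close> as base ring
  and with the bare algebra in place of L. Only the carrier of the base and the algebra fields
  matter, so both can be replaced.\<close>

lemma comult_L: "comult L = tensor_lift (tens L L) (\<lambda>(s, a). s \<odot>\<^bsub>tens L L\<^esub> tmap L L (P 1) (P 1) (comult A a))"
proof -
  have c: "carrier (univ_alg \<phi>) = carrier (univ_ring :: 's ring)" by simp
  note t = tensor_cong[OF c same_algebra_sym[OF same_algebra_L] same_algebra_sym[OF same_algebra_L]]
  let ?B = "base_change_alg univ_ring (univ_alg \<phi>) A"
  have "comult L = tensor_lift (tensor (univ_alg \<phi>) ?B ?B)
      (\<lambda>(s, a). s \<odot>\<^bsub>tensor (univ_alg \<phi>) ?B ?B\<^esub> tensor_map (univ_alg \<phi>) ?B ?B (P 1) (P 1) (comult A a))"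
    by (simp add: L_def base_change_def Let_def module.defs hopf.defs)
  then show ?thesis unfolding t .
qed

lemma counit_L: "counit L = tensor_lift (univ_alg id) (\<lambda>(s, a). s \<odot>\<^bsub>univ_alg id\<^esub> \<phi> (counit A a))"
  by (simp add: L_def base_change_def Let_def module.defs hopf.defs tensor_lift_def[abs_def] univ_alg_add mult.commute)

lemma antipode_L: "antipode L = tmap (univ_alg \<phi>) A id (antipode A)"
  by (simp add: L_def base_change_def Let_def module.defs hopf.defs)

lemma unit_comult_semilinear: "(\<lambda>a. tmap L L (P 1) (P 1) (comult A a)) \<in> semilinear \<phi> A (tens L L)"
  using semilinear_comp[OF A.comult_hom(2) tensor_map_semilinear[OF A.module_axioms A.module_axioms
    L.module_axioms L.module_axioms unit_semilinear unit_semilinear]] by simp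

lemma univ_hom_id: "id \<in> ring_hom univ_ring univ_ring" by (auto intro: univ_homI)

lemma counit_A_semilinear: "(\<lambda>a. \<phi> (counit A a)) \<in> semilinear \<phi> A (univ_alg id)"
  by (rule semilinearI) (simp_all add: A.counit_add A.counit_hom univ_homD[OF hom])

lemma structure_L:
  "comult L \<in> semilinear id L (tens L L)" "counit L \<in> semilinear id L (univ_alg id)" "antipode L \<in> semilinear id L L"
  "a \<in> carrier A \<Longrightarrow> comult L (P 1 a) = tmap L L (P 1) (P 1) (comult A a)"
  "a \<in> carrier A \<Longrightarrow> counit L (P 1 a) = \<phi> (counit A a)"
  "a \<in> carrier A \<Longrightarrow> antipode L (P 1 a) = P 1 (antipode A a)"
proof -
  interpret U: algebra univ_ring "univ_alg id :: ('s, 's) module" by (rule algebra_univ_alg[OF univ_hom_id])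
  show "comult L \<in> semilinear id L (tens L L)"
    unfolding comult_L by (rule extension[OF LL.module_tens unit_comult_semilinear])
  show "counit L \<in> semilinear id L (univ_alg id)"
    unfolding counit_L by (rule extension[OF U.module_axioms counit_A_semilinear])
  show "a \<in> carrier A \<Longrightarrow> comult L (P 1 a) = tmap L L (P 1) (P 1) (comult A a)"
    unfolding comult_L by (subst extension(2)[OF LL.module_tens unit_comult_semilinear])
      (simp_all add: LL.TA.smult_one[simplified] semilinearD(1)[OF unit_comult_semilinear])
  show "a \<in> carrier A \<Longrightarrow> counit L (P 1 a) = \<phi> (counit A a)"
    unfolding counit_L by (subst extension(2)[OF U.module_axioms counit_A_semilinear]) simp_all
  note m = S.module_axioms A.module_axioms S.module_axioms A.module_axioms semilinear_id A.antipode_hom(2)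
  note sp = tensor_map_pure[OF m, simplified]
  note sl = tensor_map_semilinear[OF m]
  show "a \<in> carrier A \<Longrightarrow> antipode L (P 1 a) = P 1 (antipode A a)"
    by (simp add: antipode_L sp)
  have "antipode L (s \<odot>\<^bsub>L\<^esub> X) = s \<odot>\<^bsub>L\<^esub> antipode L X" if X: "X \<in> carrier L" for s X
    using X
  proof (induction rule: L_induct)
    case zero
    then show ?case
      using additive_maps_zero[OF SA.abelian_group_tens SA.abelian_group_tens semilinearD(4)[OF sl]]
      by (simp add: antipode_L L_simps(4)[symmetric])
  next
    case (add X Y)
    then show ?case using semilinearD(1,2)[OF sl]
      by (simp add: L.smult_r_distr L_simps(1,5)[symmetric] antipode_L)
  qed (simp add: smult_L_pure antipode_L sp A.antipode_simps)
  then show "antipode L \<in> semilinear id L L"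
    using sl by (simp add: semilinear_def antipode_L additive_maps_def L_simps(1,5))
qed

lemma pre_hopf_L: "pre_hopf L"
proof -
  interpret U: algebra univ_ring "univ_alg id :: ('s, 's) module" by (rule algebra_univ_alg[OF univ_hom_id])
  have "comult L \<in> ring_hom L (tens L L)"
  proof (rule L_ring_homI[OF LL.algebra_tens structure_L(1) univ_hom_id])
    have "(\<lambda>a. tmap L L (P 1) (P 1) (comult A a)) \<in> ring_hom A (tens L L)"
      using ring_hom_trans[OF A.comult_hom(1) tensor_map_ring_hom[OF A.algebra_axioms A.algebra_axioms
        L.algebra_axioms L.algebra_axioms unit_semilinear unit_semilinear unit_ring_hom unit_ring_hom]]
      by (simp add: comp_def)
    then show "(\<lambda>a. comult L (P 1 a)) \<in> ring_hom A (tens L L)"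
      by (subst ring_hom_cong[of _ _ "\<lambda>a. tmap L L (P 1) (P 1) (comult A a)"]) (simp_all add: A.ring_axioms structure_L)
  qed
  moreover have "counit L \<in> ring_hom L (univ_alg id)"
  proof (rule L_ring_homI[OF U.algebra_axioms structure_L(2) univ_hom_id])
    show "(\<lambda>a. counit L (P 1 a)) \<in> ring_hom A (univ_alg id)"
      by (rule ring_hom_memI) (simp_all add: structure_L A.counit_add univ_homD[OF hom]
        ring_hom_mult[OF A.counit_hom(1), simplified] ring_hom_one[OF A.counit_hom(1), simplified])
  qed
  then have "counit L \<in> ring_hom L univ_ring" by (simp add: ring_hom_def)
  moreover have "antipode L \<in> ring_hom L L"
  proof (rule L_ring_homI[OF L.algebra_axioms structure_L(3) univ_hom_id])
    show "(\<lambda>a. antipode L (P 1 a)) \<in> ring_hom A L"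
      by (rule ring_hom_memI) (simp_all add: structure_L semilinearD(2)[OF structure_L(3)] P_closed A.antipode_simps P_add L_mult L_one
        ring_hom_mult[OF A.antipode_hom(1)] ring_hom_one[OF A.antipode_hom(1)])
  qed
  ultimately show ?thesis
    using structure_L(1,3) semilinearD(3)[OF structure_L(2)] by (simp add: pre_hopf_def algebra_L)
qed

lemma unit_hopf: "P 1 \<in> hopf_semilinear \<phi> A L"
  by (simp add: hopf_semilinear_def unit_semilinear unit_ring_hom structure_L)

text \<open>Both sides of each axiom are linear over S, hence determined by their values on 1
  \<otimes> a, where naturality along the unit A -> L reduces them to the axiom of A.\<close>

lemma hopf_algebra_L:
  assumes "hopf_algebra univ_ring A"
  shows "hopf_algebra univ_ring L"
proof -
  interpret L: pre_hopf_algebra L by (rule pre_hopf_algebraI[OF pre_hopf_L])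
  note n = sides_natural[OF pre_hopf pre_hopf_L unit_hopf]
  have a: "coassoc_lhs A x = coassoc_rhs A x" "counit_lhs A x = x" "counit_rhs A x = x"
     "antipode_lhs A x = counit A x \<odot>\<^bsub>A\<^esub> \<one>\<^bsub>A\<^esub>" "antipode_rhs A x = counit A x \<odot>\<^bsub>A\<^esub> \<one>\<^bsub>A\<^esub>" if "x \<in> carrier A" for x
    using assms that by (simp_all add: hopf_algebra_iff)
  have i: "(\<lambda>x. x) \<in> semilinear id L L" using semilinear_id by (simp add: id_def)
  note l = L.sides_linear
  show ?thesis
    unfolding hopf_algebra_iff
  proof (intro conjI ballI pre_hopf_L)
    fix X assume X: "X \<in> carrier L"
    show "coassoc_lhs L X = coassoc_rhs L X"
      by (rule semilinear_eqI[OF tensor_modules.abelian_group_tens[OF tensor_modules.intro[OF L.module_axioms LL.module_tens]] l(1,2) _ X]) (simp add: n a)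
    show "counit_lhs L X = X" by (rule semilinear_eqI[OF L.M.abelian_group_axioms l(3) i _ X]) (simp add: n a)
    show "counit_rhs L X = X" by (rule semilinear_eqI[OF L.M.abelian_group_axioms l(4) i _ X]) (simp add: n a)
    show "antipode_lhs L X = counit L X \<odot>\<^bsub>L\<^esub> \<one>\<^bsub>L\<^esub>"
      by (rule semilinear_eqI[OF L.M.abelian_group_axioms l(5,7) _ X]) (simp add: n a)
    show "antipode_rhs L X = counit L X \<odot>\<^bsub>L\<^esub> \<one>\<^bsub>L\<^esub>"
      by (rule semilinear_eqI[OF L.M.abelian_group_axioms l(6,7) _ X]) (simp add: n a)
  qed
qed

end

section \<open>Functoriality of base change in the ring and in the Hopf algebra\<close>

locale base_change_morphism = A: base_changed \<phi> A + B: base_changed \<psi> B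
  for \<phi> :: "'r::comm_ring_1 \<Rightarrow> 's::comm_ring_1" and A :: "('r, 'a) hopf"
    and \<psi> :: "'p::comm_ring_1 \<Rightarrow> 'q::comm_ring_1" and B :: "('p, 'b) hopf" +
  fixes \<rho> :: "'r \<Rightarrow> 'p" and \<tau> :: "'s \<Rightarrow> 'q" and g :: "'a \<Rightarrow> 'b"
  assumes \<tau>: "\<tau> \<in> ring_hom univ_ring univ_ring" and compat: "\<And>r. \<tau> (\<phi> r) = \<psi> (\<rho> r)"
    and g: "g \<in> hopf_semilinear \<rho> A B"
begin

text \<open>\<tau> acts on the scalars and g on the Hopf algebra. This one construction yields every
  symmetry used for descent as well as the inclusion of the real Laurent Hopf algebra in the complex
  one.\<close>

definition F where "F = tmap (univ_alg \<psi>) B \<tau> g"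

lemma g_simps: "g \<in> semilinear \<rho> A B" "g \<in> ring_hom A B"
  "a \<in> carrier A \<Longrightarrow> comult B (g a) = tmap B B g g (comult A a)"
  "a \<in> carrier A \<Longrightarrow> counit B (g a) = \<rho> (counit A a)"
  "a \<in> carrier A \<Longrightarrow> antipode B (g a) = g (antipode A a)"
  using g by (auto simp: hopf_semilinear_def)

lemma g_closed: "a \<in> carrier A \<Longrightarrow> g a \<in> carrier B"
  by (rule semilinearD(1)[OF g_simps(1)])

lemma \<tau>_semilinear: "\<tau> \<in> semilinear \<rho> (univ_alg \<phi>) (univ_alg \<psi>)"
  by (rule semilinearI) (simp_all add: univ_homD[OF \<tau>] compat)

lemma F_pure: "a \<in> carrier A \<Longrightarrow> F (A.P s a) = B.P (\<tau> s) (g a)"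
  unfolding F_def
  by (rule tensor_map_pure[OF A.S.module_axioms A.A.module_axioms B.S.module_axioms B.A.module_axioms \<tau>_semilinear g_simps(1)]) simp_all

lemma F_semilinear: "F \<in> semilinear \<tau> A.L B.L"
proof -
  note sl = tensor_map_semilinear[OF A.S.module_axioms A.A.module_axioms B.S.module_axioms B.A.module_axioms \<tau>_semilinear g_simps(1)]
  have a: "F \<in> additive_maps A.L B.L"
    using semilinearD(4)[OF sl] by (simp add: F_def additive_maps_def A.L_simps(1,5) B.L_simps(1,5))
  note a' = additive_mapsD[OF a] additive_maps_zero[OF A.L.M.abelian_group_axioms B.L.M.abelian_group_axioms a]
  have "F (s \<odot>\<^bsub>A.L\<^esub> X) = \<tau> s \<odot>\<^bsub>B.L\<^esub> F X" if X: "X \<in> carrier A.L" for s X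
    using X
  proof (induction rule: A.L_induct)
    case zero
    then show ?case using a'(3) by simp
  next
    case (pure t x)
    then show ?case using univ_homD(2)[OF \<tau>, of s t] g_closed[of x]
      by (simp add: A.smult_L_pure F_pure B.smult_L_pure)
  next
    case (add X Y)
    then have "s \<odot>\<^bsub>A.L\<^esub> X \<in> carrier A.L" "s \<odot>\<^bsub>A.L\<^esub> Y \<in> carrier A.L" "F X \<in> carrier B.L" "F Y \<in> carrier B.L"
      by (simp_all add: a'(1))
    with add show ?case by (simp add: a'(2) A.L.smult_r_distr B.L.smult_r_distr)
  qed
  with a show ?thesis by (simp add: semilinear_def)
qed

lemma F_unit: "a \<in> carrier A \<Longrightarrow> F (A.P 1 a) = B.P 1 (g a)"
  by (simp add: F_pure univ_homD[OF \<tau>])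

lemma F_ring_hom: "F \<in> ring_hom A.L B.L"
proof (rule A.L_ring_homI[OF B.algebra_L F_semilinear \<tau>])
  show "(\<lambda>a. F (A.P 1 a)) \<in> ring_hom A B.L"
    by (rule ring_hom_memI)
       (simp_all add: F_unit B.P_closed g_closed B.P_add B.L_mult B.L_one
         semilinearD[OF g_simps(1)] ring_hom_mult[OF g_simps(2)] ring_hom_one[OF g_simps(2)])
qed

text \<open>Each compatibility is an equality of maps semilinear along \<tau>, hence checked on 1
  \<otimes> a, where it is the compatibility of g.\<close>

lemma F_hopf: "F \<in> hopf_semilinear \<tau> A.L B.L"
proof -
  note mA = A.A.module_axioms and mL = A.L.module_axioms and mB = B.A.module_axioms and mL' = B.L.module_axioms
  note FF = tensor_map_semilinear[OF mL mL mL' mL' F_semilinear F_semilinear]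
  {
    fix X assume X: "X \<in> carrier A.L"
    have "comult B.L (F X) = tmap B.L B.L F F (comult A.L X)"
    proof (rule A.semilinear_eqI[OF B.LL.abelian_group_tens _ _ _ X])
      show "(\<lambda>X. comult B.L (F X)) \<in> semilinear \<tau> A.L (tens B.L B.L)"
        using semilinear_comp[OF F_semilinear B.structure_L(1)] by simp
      show "(\<lambda>X. tmap B.L B.L F F (comult A.L X)) \<in> semilinear \<tau> A.L (tens B.L B.L)"
        using semilinear_comp[OF A.structure_L(1) FF] by simp
      fix a assume a: "a \<in> carrier A"
      then have da: "comult A a \<in> carrier (tens A A)" by (rule A.A.comult_simps)
      have "comult B.L (F (A.P 1 a)) = tmap B.L B.L (B.P 1) (B.P 1) (tmap B B g g (comult A a))"
        using a by (simp add: F_unit B.structure_L g_closed g_simps)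
      also have "\<dots> = tmap B.L B.L (\<lambda>a. B.P 1 (g a)) (\<lambda>a. B.P 1 (g a)) (comult A a)"
        by (rule tensor_map_comp[OF mA mA mB mB mL' mL' g_simps(1) g_simps(1) B.unit_semilinear B.unit_semilinear da])
      also have "\<dots> = tmap B.L B.L (\<lambda>a. F (A.P 1 a)) (\<lambda>a. F (A.P 1 a)) (comult A a)"
        by (rule tensor_map_cong[OF mA mA]) (simp_all add: F_unit da)
      also have "\<dots> = tmap B.L B.L F F (tmap A.L A.L (A.P 1) (A.P 1) (comult A a))"
        by (rule tensor_map_comp[symmetric, OF mA mA mL mL mL' mL' A.unit_semilinear A.unit_semilinear F_semilinear F_semilinear da])
      also have "\<dots> = tmap B.L B.L F F (comult A.L (A.P 1 a))"
        using a by (simp add: A.structure_L)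
      finally show "comult B.L (F (A.P 1 a)) = tmap B.L B.L F F (comult A.L (A.P 1 a))" .
    qed
    moreover have "counit B.L (F X) = \<tau> (counit A.L X)"
    proof (rule A.semilinear_eqI[OF algebra_abelian_group[OF algebra_univ_alg[OF B.univ_hom_id]] _ _ _ X])
      show "(\<lambda>X. counit B.L (F X)) \<in> semilinear \<tau> A.L (univ_alg id)"
        using semilinear_comp[OF F_semilinear B.structure_L(2)] by simp
      show "(\<lambda>X. \<tau> (counit A.L X)) \<in> semilinear \<tau> A.L (univ_alg id)"
        using A.structure_L(2) by (intro semilinearI) (simp_all add: semilinearD univ_homD[OF \<tau>])
    qed (simp add: F_unit B.structure_L A.structure_L g_closed g_simps compat)
    moreover have "antipode B.L (F X) = F (antipode A.L X)"
    proof (rule A.semilinear_eqI[OF B.L.M.abelian_group_axioms _ _ _ X])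
      show "(\<lambda>X. antipode B.L (F X)) \<in> semilinear \<tau> A.L B.L"
        using semilinear_comp[OF F_semilinear B.structure_L(3)] by simp
      show "(\<lambda>X. F (antipode A.L X)) \<in> semilinear \<tau> A.L B.L"
        using semilinear_comp[OF A.structure_L(3) F_semilinear] by simp
    qed (simp add: F_unit B.structure_L A.structure_L g_closed g_simps A.A.antipode_simps)
    ultimately have "comult B.L (F X) = tmap B.L B.L F F (comult A.L X) \<and> counit B.L (F X) = \<tau> (counit A.L X) \<and>
      antipode B.L (F X) = F (antipode A.L X)" by simp
  }
  then show ?thesis by (simp add: hopf_semilinear_def F_semilinear F_ring_hom)
qed

end

section \<open>Separation by functionals\<close>

lemma additive_maps_finsum:
  assumes "abelian_group A" "abelian_group B" "h \<in> additive_maps A B" "finite I" "f \<in> I \<rightarrow> carrier A"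
  shows "h (finsum A f I) = finsum B (\<lambda>i. h (f i)) I"
  using assms(4,5)
proof (induction I)
  case empty
  interpret A: abelian_group A by fact
  interpret B: abelian_group B by fact
  show ?case using additive_maps_zero[OF assms(1-3)] by simp
next
  case (insert i I)
  interpret A: abelian_group A by fact
  interpret B: abelian_group B by fact
  have "f \<in> I \<rightarrow> carrier A" "f i \<in> carrier A" "(\<lambda>i. h (f i)) \<in> I \<rightarrow> carrier B" "h (f i) \<in> carrier B"
    using insert.prems additive_mapsD(1)[OF assms(3)] by auto
  then show ?case using insert additive_mapsD(2)[OF assms(3)] by simp
qed

abbreviation functionals :: "('r::comm_ring_1, 'a, 'x) module_scheme \<Rightarrow> ('a \<Rightarrow> 'r) set" where
  "functionals V \<equiv> semilinear id V (univ_alg id)"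

text \<open>By Zorn's lemma there is a subspace W maximal among those avoiding x. It is a complement
  of the line through x, and the functional is the coordinate along that line.\<close>

lemma functional_exists:
  fixes V :: "('f::field, 'a, 'x) module_scheme"
  assumes "module univ_ring V" and x: "x \<in> carrier V" "x \<noteq> \<zero>\<^bsub>V\<^esub>"
  shows "\<exists>l\<in>functionals V. l x = 1"
proof -
  interpret V: module univ_ring V by fact
  define sub where "sub W \<longleftrightarrow> W \<subseteq> carrier V \<and> \<zero>\<^bsub>V\<^esub> \<in> W \<and> (\<forall>u\<in>W. \<forall>v\<in>W. u \<oplus>\<^bsub>V\<^esub> v \<in> W) \<and>
    (\<forall>c. \<forall>u\<in>W. c \<odot>\<^bsub>V\<^esub> u \<in> W)" for W
  define \<A> where "\<A> = {W. sub W \<and> x \<notin> W}"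
  have "\<exists>W\<in>\<A>. \<forall>W'\<in>\<A>. W \<subseteq> W' \<longrightarrow> W' = W"
  proof (rule subset_Zorn_nonempty)
    have "{\<zero>\<^bsub>V\<^esub>} \<in> \<A>" using x by (simp add: \<A>_def sub_def)
    then show "\<A> \<noteq> {}" by blast
  next
    fix \<C> assume C: "\<C> \<noteq> {}" "subset.chain \<A> \<C>"
    then have mem: "W \<in> \<C> \<Longrightarrow> sub W \<and> x \<notin> W" and tot: "W \<in> \<C> \<Longrightarrow> W' \<in> \<C> \<Longrightarrow> W \<subseteq> W' \<or> W' \<subseteq> W" for W W'
      by (auto simp: subset_chain_def \<A>_def)
    have "sub (\<Union>\<C>)"
      unfolding sub_def
    proof (intro conjI ballI allI)
      show "\<Union>\<C> \<subseteq> carrier V" using mem unfolding sub_def by blast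
      obtain W where "W \<in> \<C>" using C(1) by blast
      then show "\<zero>\<^bsub>V\<^esub> \<in> \<Union>\<C>" using mem[of W] unfolding sub_def by blast
    next
      fix u v assume "u \<in> \<Union>\<C>" "v \<in> \<Union>\<C>"
      then obtain W where "W \<in> \<C>" "u \<in> W" "v \<in> W" using tot by (metis UnionE subsetD)
      then show "u \<oplus>\<^bsub>V\<^esub> v \<in> \<Union>\<C>" using mem[of W] unfolding sub_def by blast
    next
      fix c u assume "u \<in> \<Union>\<C>"
      then obtain W where "W \<in> \<C>" "u \<in> W" by blast
      then show "c \<odot>\<^bsub>V\<^esub> u \<in> \<Union>\<C>" using mem[of W] unfolding sub_def by blast
    qed
    moreover have "x \<notin> \<Union>\<C>" using mem by auto
    ultimately show "\<Union>\<C> \<in> \<A>" unfolding \<A>_def mem_Collect_eq by (rule conjI)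
  qed
  then obtain W where WA: "W \<in> \<A>" and "\<forall>W'\<in>\<A>. W \<subseteq> W' \<longrightarrow> W' = W" by (rule bexE)
  then have max: "\<And>W'. sub W' \<Longrightarrow> x \<notin> W' \<Longrightarrow> W \<subseteq> W' \<Longrightarrow> W' = W" by (simp add: \<A>_def)
  have W: "sub W" "x \<notin> W" using WA by (simp_all add: \<A>_def)
  have Wc: "u \<in> W \<Longrightarrow> u \<in> carrier V" "u \<in> W \<Longrightarrow> v \<in> W \<Longrightarrow> u \<oplus>\<^bsub>V\<^esub> v \<in> W" "u \<in> W \<Longrightarrow> c \<odot>\<^bsub>V\<^esub> u \<in> W" "\<zero>\<^bsub>V\<^esub> \<in> W" for u v c
    using W(1) by (auto simp: sub_def)
  have neg: "\<ominus>\<^bsub>V\<^esub> u = (-1) \<odot>\<^bsub>V\<^esub> u" if "u \<in> carrier V" for u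
    using V.smult_l_minus[of 1 u] V.smult_one[of u] that by simp
  have ld: "(c + d) \<odot>\<^bsub>V\<^esub> u = c \<odot>\<^bsub>V\<^esub> u \<oplus>\<^bsub>V\<^esub> d \<odot>\<^bsub>V\<^esub> u" and as: "c \<odot>\<^bsub>V\<^esub> (d \<odot>\<^bsub>V\<^esub> u) = (c * d) \<odot>\<^bsub>V\<^esub> u"
    and one: "1 \<odot>\<^bsub>V\<^esub> u = u" and null: "0 \<odot>\<^bsub>V\<^esub> u = \<zero>\<^bsub>V\<^esub>" if "u \<in> carrier V" for c d u
    using V.smult_l_distr[of c d u] V.smult_assoc1[of c d u] V.smult_one[of u] V.smult_l_null[of u] that by simp_all
  \<comment> \<open>\<open>good c y\<close> says that y lies in the coset of c x modulo W.\<close>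
  define good where "good c y \<longleftrightarrow> y \<oplus>\<^bsub>V\<^esub> (- c) \<odot>\<^bsub>V\<^esub> x \<in> W" for c y
  have ex: "\<exists>c. good c y" if y: "y \<in> carrier V" for y
  proof (cases "y \<in> W")
    case True then show ?thesis using y x by (auto simp: good_def null intro!: exI[of _ 0])
  next
    case False
    \<comment> \<open>The span of W and y contains x by maximality; solving x = w + c y for y puts y
      in the coset of (1/c) x.\<close>
    define W' where "W' = {w \<oplus>\<^bsub>V\<^esub> c \<odot>\<^bsub>V\<^esub> y | w c. w \<in> W}"
    have "sub W'"
    proof -
      have a: "(w \<oplus>\<^bsub>V\<^esub> c \<odot>\<^bsub>V\<^esub> y) \<oplus>\<^bsub>V\<^esub> (w' \<oplus>\<^bsub>V\<^esub> c' \<odot>\<^bsub>V\<^esub> y) = (w \<oplus>\<^bsub>V\<^esub> w') \<oplus>\<^bsub>V\<^esub> (c + c') \<odot>\<^bsub>V\<^esub> y"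
        if "w \<in> W" "w' \<in> W" for w w' c c'
        using that Wc y by (simp add: ld V.M.a_ac)
      have b: "d \<odot>\<^bsub>V\<^esub> (w \<oplus>\<^bsub>V\<^esub> c \<odot>\<^bsub>V\<^esub> y) = d \<odot>\<^bsub>V\<^esub> w \<oplus>\<^bsub>V\<^esub> (d * c) \<odot>\<^bsub>V\<^esub> y" if "w \<in> W" for w d c
        using that Wc y by (simp add: V.smult_r_distr as)
      have z: "\<zero>\<^bsub>V\<^esub> = \<zero>\<^bsub>V\<^esub> \<oplus>\<^bsub>V\<^esub> 0 \<odot>\<^bsub>V\<^esub> y" using y by (simp add: null)
      show ?thesis unfolding sub_def W'_def
      proof (intro conjI ballI allI)
        show "{w \<oplus>\<^bsub>V\<^esub> c \<odot>\<^bsub>V\<^esub> y |w c. w \<in> W} \<subseteq> carrier V" using Wc y by auto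
        show "\<zero>\<^bsub>V\<^esub> \<in> {w \<oplus>\<^bsub>V\<^esub> c \<odot>\<^bsub>V\<^esub> y |w c. w \<in> W}" using z Wc(4) by blast
      next
        fix u v assume "u \<in> {w \<oplus>\<^bsub>V\<^esub> c \<odot>\<^bsub>V\<^esub> y |w c. w \<in> W}" "v \<in> {w \<oplus>\<^bsub>V\<^esub> c \<odot>\<^bsub>V\<^esub> y |w c. w \<in> W}"
        then show "u \<oplus>\<^bsub>V\<^esub> v \<in> {w \<oplus>\<^bsub>V\<^esub> c \<odot>\<^bsub>V\<^esub> y |w c. w \<in> W}" using a Wc(2) by blast
      next
        fix d u assume "u \<in> {w \<oplus>\<^bsub>V\<^esub> c \<odot>\<^bsub>V\<^esub> y |w c. w \<in> W}"
        then show "d \<odot>\<^bsub>V\<^esub> u \<in> {w \<oplus>\<^bsub>V\<^esub> c \<odot>\<^bsub>V\<^esub> y |w c. w \<in> W}" using b Wc(3) by blast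
      qed
    qed
    moreover have "W \<subseteq> W'"
    proof
      fix w assume "w \<in> W"
      moreover from this have "w = w \<oplus>\<^bsub>V\<^esub> 0 \<odot>\<^bsub>V\<^esub> y" using y Wc by (simp add: null)
      ultimately show "w \<in> W'" unfolding W'_def by blast
    qed
    moreover have "y \<in> W'"
    proof -
      have "y = \<zero>\<^bsub>V\<^esub> \<oplus>\<^bsub>V\<^esub> 1 \<odot>\<^bsub>V\<^esub> y" using y by (simp add: one)
      then show ?thesis unfolding W'_def using Wc(4) by blast
    qed
    ultimately have "x \<in> W'" using max False by blast
    then obtain w c where wc: "x = w \<oplus>\<^bsub>V\<^esub> c \<odot>\<^bsub>V\<^esub> y" "w \<in> W" by (auto simp: W'_def)
    have "c \<noteq> 0" using wc W(2) y Wc by (auto simp: null)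
    have wV: "w \<in> carrier V" using wc Wc by auto
    have "y \<oplus>\<^bsub>V\<^esub> (- inverse c) \<odot>\<^bsub>V\<^esub> x = y \<oplus>\<^bsub>V\<^esub> ((- inverse c) \<odot>\<^bsub>V\<^esub> w \<oplus>\<^bsub>V\<^esub> (-1) \<odot>\<^bsub>V\<^esub> y)"
      using wc y wV \<open>c \<noteq> 0\<close> by (simp add: V.smult_r_distr as)
    also have "\<dots> = (- inverse c) \<odot>\<^bsub>V\<^esub> w"
      using y wV V.M.a_lcomm[of y "(- inverse c) \<odot>\<^bsub>V\<^esub> w" "\<ominus>\<^bsub>V\<^esub> y"] by (simp add: neg[symmetric] V.M.r_neg)
    also have "\<dots> \<in> W" using wc Wc by simp
    finally show ?thesis unfolding good_def by blast
  qed
  \<comment> \<open>Otherwise W would contain (d - c) x, hence x.\<close>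
  have uniq: "c = d" if "good c y" "good d y" "y \<in> carrier V" for c d y
  proof (rule ccontr)
    assume "c \<noteq> d"
    let ?e = "inverse (d - c)"
    have "(y \<oplus>\<^bsub>V\<^esub> (- c) \<odot>\<^bsub>V\<^esub> x) \<oplus>\<^bsub>V\<^esub> (-1) \<odot>\<^bsub>V\<^esub> (y \<oplus>\<^bsub>V\<^esub> (- d) \<odot>\<^bsub>V\<^esub> x) \<in> W" (is "?u \<in> W")
      using that Wc(2,3) by (simp add: good_def)
    moreover have "?u = (y \<oplus>\<^bsub>V\<^esub> \<ominus>\<^bsub>V\<^esub> y) \<oplus>\<^bsub>V\<^esub> ((- c) \<odot>\<^bsub>V\<^esub> x \<oplus>\<^bsub>V\<^esub> d \<odot>\<^bsub>V\<^esub> x)"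
      using x that by (simp add: V.smult_r_distr as neg V.M.a_ac)
    moreover have "\<dots> = (d - c) \<odot>\<^bsub>V\<^esub> x" using x that by (simp add: V.M.r_neg ld[symmetric])
    ultimately have "?e \<odot>\<^bsub>V\<^esub> ((d - c) \<odot>\<^bsub>V\<^esub> x) \<in> W" using Wc(3) by metis
    then show False using \<open>c \<noteq> d\<close> x W(2) by (simp add: as one)
  qed
  define l where "l y = (THE c. good c y)" for y
  have l: "good (l y) y" if "y \<in> carrier V" for y
    unfolding l_def using ex[OF that] uniq that by (metis theI')
  have leq: "l y = c" if "good c y" "y \<in> carrier V" for y c using l uniq that by blast
  have "l \<in> functionals V"
  proof (rule semilinearI)
    fix y z assume yz: "y \<in> carrier V" "z \<in> carrier V"
    have "(y \<oplus>\<^bsub>V\<^esub> (- l y) \<odot>\<^bsub>V\<^esub> x) \<oplus>\<^bsub>V\<^esub> (z \<oplus>\<^bsub>V\<^esub> (- l z) \<odot>\<^bsub>V\<^esub> x) \<in> W"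
      using l yz Wc(2) by (simp add: good_def)
    also have "(y \<oplus>\<^bsub>V\<^esub> (- l y) \<odot>\<^bsub>V\<^esub> x) \<oplus>\<^bsub>V\<^esub> (z \<oplus>\<^bsub>V\<^esub> (- l z) \<odot>\<^bsub>V\<^esub> x) = (y \<oplus>\<^bsub>V\<^esub> z) \<oplus>\<^bsub>V\<^esub> (- l y + - l z) \<odot>\<^bsub>V\<^esub> x"
      unfolding ld[OF x(1)] using x yz by (simp add: V.M.a_ac)
    finally have "good (l y + l z) (y \<oplus>\<^bsub>V\<^esub> z)" by (simp add: good_def)
    then show "l (y \<oplus>\<^bsub>V\<^esub> z) = l y \<oplus>\<^bsub>univ_alg id\<^esub> l z" using yz leq by simp
  next
    fix c y assume y: "y \<in> carrier V"
    have "c \<odot>\<^bsub>V\<^esub> (y \<oplus>\<^bsub>V\<^esub> (- l y) \<odot>\<^bsub>V\<^esub> x) \<in> W" using l y Wc(3) by (simp add: good_def)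
    also have "c \<odot>\<^bsub>V\<^esub> (y \<oplus>\<^bsub>V\<^esub> (- l y) \<odot>\<^bsub>V\<^esub> x) = c \<odot>\<^bsub>V\<^esub> y \<oplus>\<^bsub>V\<^esub> (- (c * l y)) \<odot>\<^bsub>V\<^esub> x"
      using x y by (simp add: V.smult_r_distr as)
    finally have "good (c * l y) (c \<odot>\<^bsub>V\<^esub> y)" by (simp add: good_def)
    then show "l (c \<odot>\<^bsub>V\<^esub> y) = id c \<odot>\<^bsub>univ_alg id\<^esub> l y" using y leq by simp
  qed simp
  moreover have "l x = 1"
    using x by (intro leq) (simp_all add: good_def neg[symmetric] V.M.r_neg Wc)
  ultimately show ?thesis by blast
qed

text \<open>Its lift is the slice \<open>id\<close> \<otimes> l from M \<otimes> V to M.\<close>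

lemma functional_balanced:
  assumes "module univ_ring M" "module univ_ring V" "l \<in> functionals V"
  shows "balanced_map M V M (\<lambda>(m, a). l a \<odot>\<^bsub>M\<^esub> m)"
proof -
  interpret M: module univ_ring M by fact
  have d: "(s + t) \<odot>\<^bsub>M\<^esub> x = s \<odot>\<^bsub>M\<^esub> x \<oplus>\<^bsub>M\<^esub> t \<odot>\<^bsub>M\<^esub> x" "(s * t) \<odot>\<^bsub>M\<^esub> x = s \<odot>\<^bsub>M\<^esub> (t \<odot>\<^bsub>M\<^esub> x)" if "x \<in> carrier M" for s t x
    using M.smult_l_distr[of s t x] M.smult_assoc1[of s t x] that by simp_all
  show ?thesis
  proof (rule balanced_mapI)
    fix r m a assume "m \<in> carrier M" "a \<in> carrier V"
    then show "(case (r \<odot>\<^bsub>M\<^esub> m, a) of (m, a) \<Rightarrow> l a \<odot>\<^bsub>M\<^esub> m) = (case (m, r \<odot>\<^bsub>V\<^esub> a) of (m, a) \<Rightarrow> l a \<odot>\<^bsub>M\<^esub> m)"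
      using d(2)[of m "l a" r] by (simp add: semilinearD(3)[OF assms(3)] mult.commute)
  qed (simp_all add: semilinearD(2)[OF assms(3)] M.smult_r_distr d(1))
qed

text \<open>Elimination of the head (m, a) of the list. With l0 a = 1, the hypothesis for l0 gives m
  = - \<Sum> l0(a') m', so m \<otimes> a is absorbed into the tail by replacing each a' with a' -
  l0(a') a. The shorter list again has vanishing slices.\<close>

lemma functionals_separate_list:
  fixes M :: "('f::field, 'm, 'x) module_scheme" and V :: "('f, 'a, 'y) module_scheme"
  assumes M: "module univ_ring M" and V: "module univ_ring V"
  shows "set xs \<subseteq> carrier M \<times> carrier V \<Longrightarrow>
    (\<And>l. l \<in> functionals V \<Longrightarrow> list_sum M (\<lambda>(m, a). l a \<odot>\<^bsub>M\<^esub> m) xs = \<zero>\<^bsub>M\<^esub>) \<Longrightarrow>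
    tens_class M V xs = \<zero>\<^bsub>tens M V\<^esub>"
proof (induction xs rule: length_induct)
  case (1 xs)
  interpret M: module univ_ring M by fact
  interpret V: module univ_ring V by fact
  interpret MV: tensor_modules M V ..
  show ?case
  proof (cases xs)
    case Nil then show ?thesis by (simp add: MV.zero_class)
  next
    case (Cons p ys)
    obtain m a where p: "p = (m, a)" by force
    have ma: "m \<in> carrier M" "a \<in> carrier V" and ys: "set ys \<subseteq> carrier M \<times> carrier V" using 1(2) Cons p by auto
    then have vys: "MV.valid ys" by (simp add: MV.valid_def)
    have split: "tens_class M V xs = pure M V m a \<oplus>\<^bsub>tens M V\<^esub> tens_class M V ys"
      using ma vys by (simp add: Cons p MV.pure_class MV.add_class)
    have lc: "l a' \<odot>\<^bsub>M\<^esub> m' \<in> carrier M" if "(m', a') \<in> set ys" for l m' a'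
      using that ys by auto
    have lsc: "list_sum M (\<lambda>(m, a). l a \<odot>\<^bsub>M\<^esub> m) ys \<in> carrier M" for l
      using lc by (intro M.list_sum_closed) auto
    show ?thesis
    proof (cases "a = \<zero>\<^bsub>V\<^esub>")
      \<comment> \<open>The head then contributes neither to the tensor nor to any slice.\<close>
      case True
      have "list_sum M (\<lambda>(m, a). l a \<odot>\<^bsub>M\<^esub> m) ys = \<zero>\<^bsub>M\<^esub>" if "l \<in> functionals V" for l
      proof -
        have "l \<zero>\<^bsub>V\<^esub> = 0"
          using semilinearD(3)[OF that, of "\<zero>\<^bsub>V\<^esub>" 0] V.smult_l_null[of "\<zero>\<^bsub>V\<^esub>"] by simp
        then show ?thesis using 1(3)[OF that] True ma M.smult_l_null[of m] lsc[of l] by (simp add: Cons p)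
      qed
      then have "tens_class M V ys = \<zero>\<^bsub>tens M V\<^esub>" by (intro 1(1)[rule_format, OF _ ys]) (simp_all add: Cons)
      then show ?thesis using split True ma by (simp add: MV.pure_zero_right)
    next
      case False
      then obtain l0 where l0: "l0 \<in> functionals V" "l0 a = 1" using functional_exists[OF V ma(2)] by blast
      define t where "t = list_sum M (\<lambda>(m, a). l0 a \<odot>\<^bsub>M\<^esub> m) ys"
      have tM: "t \<in> carrier M" unfolding t_def by (rule lsc)
      have mt: "m \<oplus>\<^bsub>M\<^esub> t = \<zero>\<^bsub>M\<^esub>"
        using 1(3)[OF l0(1)] ma M.smult_one[of m] l0(2) by (simp add: Cons p t_def)
      \<comment> \<open>Each a' is projected along a to the kernel of \<open>l0\<close>.\<close>
      define zs where "zs = map (\<lambda>(m', a'). (m', a' \<oplus>\<^bsub>V\<^esub> (- l0 a') \<odot>\<^bsub>V\<^esub> a)) ys"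
      have zs: "set zs \<subseteq> carrier M \<times> carrier V" using ys ma by (auto simp: zs_def)
      have "tens_class M V zs = \<zero>\<^bsub>tens M V\<^esub>"
      proof (rule 1(1)[rule_format, OF _ zs])
        show "length zs < length xs" by (simp add: zs_def Cons)
        fix l assume l: "l \<in> functionals V"
        have "list_sum M (\<lambda>(m, a). l a \<odot>\<^bsub>M\<^esub> m) zs =
          list_sum M (\<lambda>p. (case p of (m, a) \<Rightarrow> l a \<odot>\<^bsub>M\<^esub> m) \<oplus>\<^bsub>M\<^esub> (- l a) \<odot>\<^bsub>M\<^esub> (case p of (m, a) \<Rightarrow> l0 a \<odot>\<^bsub>M\<^esub> m)) ys"
          unfolding zs_def list_sum_map
        proof (rule list_sum_cong)
          fix p assume p: "p \<in> set ys"
          obtain m' a' where [simp]: "p = (m', a')" by force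
          have c: "m' \<in> carrier M" "a' \<in> carrier V" using p ys by auto
          show "(case case p of (m', a') \<Rightarrow> (m', a' \<oplus>\<^bsub>V\<^esub> (- l0 a') \<odot>\<^bsub>V\<^esub> a) of (m, a) \<Rightarrow> l a \<odot>\<^bsub>M\<^esub> m) =
            (case p of (m, a) \<Rightarrow> l a \<odot>\<^bsub>M\<^esub> m) \<oplus>\<^bsub>M\<^esub> (- l a) \<odot>\<^bsub>M\<^esub> (case p of (m, a) \<Rightarrow> l0 a \<odot>\<^bsub>M\<^esub> m)"
            using c ma M.smult_l_distr[of "l a'" "- (l0 a' * l a)" m'] M.smult_assoc1[of "- l a" "l0 a'" m']
            by (simp add: semilinearD(2,3)[OF l] mult.commute)
        qed
        also have "\<dots> = list_sum M (\<lambda>(m, a). l a \<odot>\<^bsub>M\<^esub> m) ys \<oplus>\<^bsub>M\<^esub>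
            list_sum M (\<lambda>p. (- l a) \<odot>\<^bsub>M\<^esub> (case p of (m, a) \<Rightarrow> l0 a \<odot>\<^bsub>M\<^esub> m)) ys"
          using lc by (intro M.list_sum_add) auto
        also have "list_sum M (\<lambda>p. (- l a) \<odot>\<^bsub>M\<^esub> (case p of (m, a) \<Rightarrow> l0 a \<odot>\<^bsub>M\<^esub> m)) ys = (- l a) \<odot>\<^bsub>M\<^esub> t"
          unfolding t_def
          by (rule additive_maps_list_sum[symmetric, OF M.abelian_group_axioms M.abelian_group_axioms])
             (use lc in \<open>auto intro!: additive_mapsI simp: M.smult_r_distr\<close>)
        also have "(- l a) \<odot>\<^bsub>M\<^esub> t = l a \<odot>\<^bsub>M\<^esub> m"
        proof -
          have "t = \<ominus>\<^bsub>M\<^esub> m" using mt ma tM M.M.minus_equality[of t m] by (simp add: M.M.a_comm)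
          then show ?thesis using ma M.smult_l_minus[of "l a" m] M.smult_r_minus[of "- l a" m] by simp
        qed
        finally show "list_sum M (\<lambda>(m, a). l a \<odot>\<^bsub>M\<^esub> m) zs = \<zero>\<^bsub>M\<^esub>"
          using 1(3)[OF l] ma lsc[of l] by (simp add: Cons p M.M.a_comm)
      qed
      moreover have "tens_class M V zs = tens_class M V ys \<oplus>\<^bsub>tens M V\<^esub> pure M V m a"
      proof -
        have pc: "pure M V m' a' \<in> carrier (tens M V)" "pure M V (l0 a' \<odot>\<^bsub>M\<^esub> m') a \<in> carrier (tens M V)" if "(m', a') \<in> set ys" for m' a'
          using that ys ma by auto
        have "tens_class M V zs = list_sum (tens M V) (\<lambda>p. pure M V (fst p) (snd p)) zs"
          using zs by (subst MV.list_sum_pure) auto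
        also have "\<dots> = list_sum (tens M V) (\<lambda>p. pure M V (fst p) (snd p) \<oplus>\<^bsub>tens M V\<^esub>
            \<ominus>\<^bsub>tens M V\<^esub> pure M V (l0 (snd p) \<odot>\<^bsub>M\<^esub> fst p) a) ys"
          unfolding zs_def list_sum_map
        proof (rule list_sum_cong)
          fix p assume p: "p \<in> set ys"
          obtain m' a' where [simp]: "p = (m', a')" by force
          have c: "m' \<in> carrier M" "a' \<in> carrier V" using p ys by auto
          then show "pure M V (fst (case p of (m', a') \<Rightarrow> (m', a' \<oplus>\<^bsub>V\<^esub> (- l0 a') \<odot>\<^bsub>V\<^esub> a)))
              (snd (case p of (m', a') \<Rightarrow> (m', a' \<oplus>\<^bsub>V\<^esub> (- l0 a') \<odot>\<^bsub>V\<^esub> a))) =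
            pure M V (fst p) (snd p) \<oplus>\<^bsub>tens M V\<^esub> \<ominus>\<^bsub>tens M V\<^esub> pure M V (l0 (snd p) \<odot>\<^bsub>M\<^esub> fst p) a"
            using ma V.smult_l_minus[of "l0 a'" a]
            by (simp add: MV.pure_add_right MV.pure_uminus_right MV.pure_smult_swap)
        qed
        also have "\<dots> = tens_class M V ys \<oplus>\<^bsub>tens M V\<^esub>
            list_sum (tens M V) (\<lambda>p. \<ominus>\<^bsub>tens M V\<^esub> pure M V (l0 (snd p) \<odot>\<^bsub>M\<^esub> fst p) a) ys"
        proof -
          have "list_sum (tens M V) (\<lambda>p. pure M V (fst p) (snd p)) ys = tens_class M V ys"
            using ys by (subst MV.list_sum_pure) auto
          then show ?thesis using pc by (subst MV.T.list_sum_add) auto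
        qed
        also have "list_sum (tens M V) (\<lambda>p. \<ominus>\<^bsub>tens M V\<^esub> pure M V (l0 (snd p) \<odot>\<^bsub>M\<^esub> fst p) a) ys = \<ominus>\<^bsub>tens M V\<^esub> pure M V t a"
        proof -
          have h: "(\<lambda>x. \<ominus>\<^bsub>tens M V\<^esub> pure M V x a) \<in> additive_maps M (tens M V)"
            using ma by (intro additive_mapsI) (simp_all add: MV.pure_add_left MV.T.minus_add)
          show ?thesis unfolding t_def split_def
            by (rule additive_maps_list_sum[symmetric, OF M.abelian_group_axioms MV.abelian_group_tens h])
               (use lc in force)
        qed
        also have "\<ominus>\<^bsub>tens M V\<^esub> pure M V t a = pure M V m a"
        proof -
          have "m = \<ominus>\<^bsub>M\<^esub> t" using mt ma tM M.M.minus_equality[of m t] by simp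
          then show ?thesis using ma tM by (simp add: MV.pure_uminus_left)
        qed
        finally show ?thesis .
      qed
      ultimately show ?thesis using split ma vys by (simp add: MV.T.a_comm)
    qed
  qed
qed

lemma functionals_separate:
  fixes M :: "('f::field, 'm, 'x) module_scheme" and V :: "('f, 'a, 'y) module_scheme"
  assumes M: "module univ_ring M" and V: "module univ_ring V" and X: "X \<in> carrier (tens M V)"
    "\<And>l. l \<in> functionals V \<Longrightarrow> tensor_lift M (\<lambda>(m, a). l a \<odot>\<^bsub>M\<^esub> m) X = \<zero>\<^bsub>M\<^esub>"
  shows "X = \<zero>\<^bsub>tens M V\<^esub>"
proof -
  interpret M: module univ_ring M by fact
  interpret MV: tensor_modules M V by (intro tensor_modules.intro M V)
  obtain xs where xs: "MV.valid xs" "X = tens_class M V xs" using X(1) by (rule MV.in_carrierE)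
  then show ?thesis
    using functionals_separate_list[OF M V, of xs] X(2)
      MV.tensor_lift_class[OF M.abelian_group_axioms functional_balanced[OF M V] xs(1)]
    by (simp add: MV.valid_def)
qed

section \<open>Functionals on a base change and on its tensor square\<close>

context base_changed
begin

definition extend_functional :: "('a \<Rightarrow> 'r) \<Rightarrow> ('s, 'a) tensor \<Rightarrow> 's" where
  "extend_functional l = tensor_lift (univ_alg id) (\<lambda>(s, a). s \<odot>\<^bsub>univ_alg id\<^esub> \<phi> (l a))"

lemma functional_semilinear: "l \<in> functionals A \<Longrightarrow> (\<lambda>a. \<phi> (l a)) \<in> semilinear \<phi> A (univ_alg id)"
  by (rule semilinearI) (simp_all add: semilinearD univ_homD[OF hom])

lemma extend_functional:
  assumes "l \<in> functionals A"
  shows "extend_functional l \<in> functionals L" "a \<in> carrier A \<Longrightarrow> extend_functional l (P s a) = s * \<phi> (l a)"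
  unfolding extend_functional_def
  using extension[OF algebra_module[OF algebra_univ_alg[OF univ_hom_id]] functional_semilinear[OF assms]] by simp_all

end

locale base_changed_field = base_changed \<phi> A
  for \<phi> :: "'f::field \<Rightarrow> 's::comm_ring_1" and A :: "('f, 'a) hopf"
begin

text \<open>The scalar extension of l is the slice of S \<otimes> A along l: the two formulas differ
  by the order of a product in the commutative ring S.\<close>

lemma extended_functionals_separate:
  assumes X: "X \<in> carrier L" "\<And>l. l \<in> functionals A \<Longrightarrow> extend_functional l X = 0"
  shows "X = \<zero>\<^bsub>L\<^esub>"
proof -
  have "extend_functional l X = tensor_lift (univ_alg \<phi>) (\<lambda>(s, a). l a \<odot>\<^bsub>univ_alg \<phi>\<^esub> s) X" for l
    by (simp add: extend_functional_def tensor_lift_def univ_alg_add mult.commute)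
  then have "X = \<zero>\<^bsub>tens (univ_alg \<phi>) A\<^esub>"
    using X by (intro functionals_separate[OF S.module_axioms A.module_axioms]) (simp_all add: L_simps(1))
  then show ?thesis by (simp add: L_simps)
qed

lemma L_separated:
  assumes X: "X \<in> carrier L" "X \<noteq> \<zero>\<^bsub>L\<^esub>"
  shows "\<exists>m\<in>functionals L. m X \<noteq> 0"
  using extended_functionals_separate[OF X(1)] extend_functional(1) X(2) by blast

text \<open>A functional that is nonzero at X takes its values in S, where s is not a zero
  divisor.\<close>

lemma L_torsion_free:
  assumes "X \<in> carrier L" "s \<odot>\<^bsub>L\<^esub> X = \<zero>\<^bsub>L\<^esub>" "\<And>s'. s * s' = 0 \<Longrightarrow> s' = 0"
  shows "X = \<zero>\<^bsub>L\<^esub>"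
proof (rule ccontr)
  assume "X \<noteq> \<zero>\<^bsub>L\<^esub>"
  then obtain m where m: "m \<in> functionals L" "m X \<noteq> 0" using L_separated assms(1) by blast
  have "s * m X = m (s \<odot>\<^bsub>L\<^esub> X)" using semilinearD(3)[OF m(1) assms(1)] by simp
  also have "\<dots> = 0"
    using additive_maps_zero[OF L.M.abelian_group_axioms algebra_abelian_group[OF algebra_univ_alg[OF univ_hom_id]]
      semilinearD(4)[OF m(1)]] assms(2) by simp
  finally show False using assms(3) m(2) by blast
qed

text \<open>L as a vector space over the field F. The tensor product \<open>tens L' A\<close> is
  then formed over a field, so that \<open>functionals_separate\<close> applies to it, and it covers
  \<open>tens L L\<close>.\<close>

definition L' where "L' = restrict_alg \<phi> L (carrier L)"

lemma L'_simps: "carrier L' = carrier L" "\<zero>\<^bsub>L'\<^esub> = \<zero>\<^bsub>L\<^esub>" "x \<oplus>\<^bsub>L'\<^esub> y = x \<oplus>\<^bsub>L\<^esub> y" "r \<odot>\<^bsub>L'\<^esub> x = \<phi> r \<odot>\<^bsub>L\<^esub> x"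
  by (simp_all add: L'_def restrict_alg_def)

lemma module_L': "module univ_ring L'"
proof -
  have d: "(s + t) \<odot>\<^bsub>L\<^esub> x = s \<odot>\<^bsub>L\<^esub> x \<oplus>\<^bsub>L\<^esub> t \<odot>\<^bsub>L\<^esub> x" "(s * t) \<odot>\<^bsub>L\<^esub> x = s \<odot>\<^bsub>L\<^esub> (t \<odot>\<^bsub>L\<^esub> x)" "1 \<odot>\<^bsub>L\<^esub> x = x" if "x \<in> carrier L" for s t x
    using L.smult_l_distr[of s t x] L.smult_assoc1[of s t x] L.smult_one[of x] that by simp_all
  show ?thesis
    by (intro moduleI abelian_groupI)
       (simp_all add: L'_simps univ_homD[OF hom] d L.smult_r_distr L.M.a_ac L.M.add.l_inv_ex cring_univ)
qed

text \<open>A tensor X killed by all functionals has vanishing slices along all extended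
  functionals, because functionals separate the points of L. If X is the image of Y in the tensor
  product of L and A over F, these are the slices of Y along the functionals of A, so Y = 0.\<close>

lemma LL_separated:
  assumes X: "X \<in> carrier (tens L L)" "X \<noteq> \<zero>\<^bsub>tens L L\<^esub>"
  shows "\<exists>m\<in>functionals (tens L L). m X \<noteq> 0"
proof (rule ccontr)
  assume c: "\<not> (\<exists>m\<in>functionals (tens L L). m X \<noteq> 0)"
  interpret L': module univ_ring L' by (rule module_L')
  interpret L'A: tensor_modules L' A ..
  define slice where "slice l = tensor_lift L (\<lambda>(m, a). extend_functional l a \<odot>\<^bsub>L\<^esub> m)" for l
  have bal: "l \<in> functionals A \<Longrightarrow> balanced_map L L L (\<lambda>(m, a). extend_functional l a \<odot>\<^bsub>L\<^esub> m)" for l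
    using functional_balanced[OF L.module_axioms L.module_axioms extend_functional(1)] by simp
  have slice: "slice l \<in> semilinear id (tens L L) L" if l: "l \<in> functionals A" for l
  proof -
    interpret L: pre_hopf_algebra L by (rule pre_hopf_algebraI[OF pre_hopf_L])
    have "(s * t) \<odot>\<^bsub>L\<^esub> x = s \<odot>\<^bsub>L\<^esub> (t \<odot>\<^bsub>L\<^esub> x)" if "x \<in> carrier L" for s t x
      using L.smult_assoc1[of s t x] that by simp
    then show ?thesis unfolding slice_def
      by (intro L.linear_lift[OF bal[OF l]]) (simp, metis mult.commute)
  qed
  have slice0: "slice l X = \<zero>\<^bsub>L\<^esub>" if l: "l \<in> functionals A" for l
  proof (rule ccontr)
    assume "slice l X \<noteq> \<zero>\<^bsub>L\<^esub>"
    then obtain m where m: "m \<in> functionals L" "m (slice l X) \<noteq> 0"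
      using L_separated[OF semilinearD(1)[OF slice[OF l] X(1)]] by blast
    have "(\<lambda>X. m (slice l X)) \<in> functionals (tens L L)"
      using semilinear_comp[OF slice[OF l] m(1)] by (simp add: id_def)
    with c have "m (slice l X) = 0" by (simp only: bex_simps not_not) (erule (1) bspec)
    then show False using m(2) by simp
  qed
  \<comment> \<open>G sends m \<otimes> a, formed over F, to m \<otimes> (1 \<otimes> a), formed
    over S.\<close>
  define G where "G = tensor_lift (tens L L) (\<lambda>(m, a). pure L L m (P 1 a))"
  have balG: "balanced_map L' A (tens L L) (\<lambda>(m, a). pure L L m (P 1 a))"
  proof (rule balanced_mapI; unfold split_conv L'_simps)
    note u = semilinearD[OF unit_semilinear]
    show "pure L L m (P 1 a) \<in> carrier (tens L L)" if "m \<in> carrier L" "a \<in> carrier A" for m a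
      by (rule LL.pure_closed[OF that(1) u(1)[OF that(2)]])
    show "pure L L (m \<oplus>\<^bsub>L\<^esub> m') (P 1 a) = pure L L m (P 1 a) \<oplus>\<^bsub>tens L L\<^esub> pure L L m' (P 1 a)"
      if "m \<in> carrier L" "m' \<in> carrier L" "a \<in> carrier A" for m m' a
      by (rule LL.pure_add_left[OF that(1,2) u(1)[OF that(3)]])
    show "pure L L m (P 1 (a \<oplus>\<^bsub>A\<^esub> b)) = pure L L m (P 1 a) \<oplus>\<^bsub>tens L L\<^esub> pure L L m (P 1 b)"
      if "m \<in> carrier L" "a \<in> carrier A" "b \<in> carrier A" for m a b
      unfolding u(2)[OF that(2,3)] by (rule LL.pure_add_right[OF that(1) u(1)[OF that(2)] u(1)[OF that(3)]])
    show "pure L L (\<phi> r \<odot>\<^bsub>L\<^esub> m) (P 1 a) = pure L L m (P 1 (r \<odot>\<^bsub>A\<^esub> a))"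
      if "m \<in> carrier L" "a \<in> carrier A" for m a r
      unfolding u(3)[OF that(2)] by (rule LL.pure_smult_swap[OF that(1) u(1)[OF that(2)]])
  qed
  note Ga = L'A.tensor_lift_additive[OF LL.abelian_group_tens balG, folded G_def]
  note Gp = L'A.tensor_lift_pure[OF LL.abelian_group_tens balG, folded G_def, simplified, unfolded L'_simps]
  note Gz = additive_maps_zero[OF L'A.abelian_group_tens LL.abelian_group_tens Ga]
  \<comment> \<open>G is onto because the scalar s of s \<otimes> a can be moved to the left
    factor.\<close>
  have "\<exists>Y\<in>carrier (tens L' A). G Y = X" using X(1)
  proof (induction rule: LL.tensor_induct)
    case zero show ?case using Gz by (intro bexI[of _ "\<zero>\<^bsub>tens L' A\<^esub>"]) auto
  next
    case (pure m n)
    from pure(2) show ?case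
    proof (induction rule: L_induct)
      case zero show ?case using Gz pure(1) by (intro bexI[of _ "\<zero>\<^bsub>tens L' A\<^esub>"]) (auto simp: LL.pure_zero_right)
    next
      case (pure s a)
      then show ?case using \<open>m \<in> carrier L\<close> P_closed[of a 1]
        by (intro bexI[of _ "pure L' A (s \<odot>\<^bsub>L\<^esub> m) a"]) (simp_all add: Gp P_eq[of a s] LL.pure_smult_swap L'_simps(1))
    next
      case (add Y Z)
      then obtain Y' Z' where "Y' \<in> carrier (tens L' A)" "Z' \<in> carrier (tens L' A)" "G Y' = pure L L m Y" "G Z' = pure L L m Z" by blast
      then show ?case using add pure(1)
        by (intro bexI[of _ "Y' \<oplus>\<^bsub>tens L' A\<^esub> Z'"]) (simp_all add: additive_mapsD[OF Ga] LL.pure_add_right)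
    qed
  next
    case (add Y Z)
    then obtain Y' Z' where "Y' \<in> carrier (tens L' A)" "Z' \<in> carrier (tens L' A)" "G Y' = Y" "G Z' = Z" by blast
    then show ?case
      by (intro bexI[of _ "Y' \<oplus>\<^bsub>tens L' A\<^esub> Z'"]) (simp_all add: additive_mapsD[OF Ga])
  qed
  then obtain Y where Y: "Y \<in> carrier (tens L' A)" "G Y = X" by blast
  have "Y = \<zero>\<^bsub>tens L' A\<^esub>"
  proof (rule functionals_separate[OF module_L' A.module_axioms Y(1)])
    fix l assume l: "l \<in> functionals A"
    note bl = functional_balanced[OF module_L' A.module_axioms l]
    have "tensor_lift L' (\<lambda>(m, a). l a \<odot>\<^bsub>L'\<^esub> m) Y = slice l (G Y)"
    proof (rule L'A.additive_maps_tensor_eqI[OF L'.abelian_group_axioms L'A.tensor_lift_additive[OF L'.abelian_group_axioms bl] _ _ Y(1)])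
      show "(\<lambda>Y. slice l (G Y)) \<in> additive_maps (tens L' A) L'"
        using semilinearD[OF slice[OF l]] additive_mapsD[OF Ga] by (intro additive_mapsI) (simp_all add: L'_simps)
      fix m a assume "m \<in> carrier L'" "a \<in> carrier A"
      then show "tensor_lift L' (\<lambda>(m, a). l a \<odot>\<^bsub>L'\<^esub> m) (pure L' A m a) = slice l (G (pure L' A m a))"
        by (subst L'A.tensor_lift_pure[OF L'.abelian_group_axioms bl])
           (simp_all add: L'_simps Gp slice_def P_closed
             LL.tensor_lift_pure[OF L.M.abelian_group_axioms bal[OF l]] extend_functional(2)[OF l])
    qed
    then show "tensor_lift L' (\<lambda>(m, a). l a \<odot>\<^bsub>L'\<^esub> m) Y = \<zero>\<^bsub>L'\<^esub>"
      using slice0[OF l] Y(2) by (simp add: L'_simps)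
  qed
  then show False using Gz Y(2) X(2) by simp
qed

end

section \<open>Injectivity of tensor products of embeddings over a Euclidean domain\<close>

lemma (in abelian_monoid) finsum_split2:
  assumes "finite I" "i \<in> I" "j \<in> I" "i \<noteq> j" "f \<in> I \<rightarrow> carrier G"
  shows "finsum G f I = f i \<oplus> (f j \<oplus> finsum G f (I - {i, j}))"
proof -
  have "I = insert i (insert j (I - {i, j}))" using assms by auto
  then have "finsum G f I = finsum G f (insert i (insert j (I - {i, j})))" by simp
  also have "\<dots> = f i \<oplus> finsum G f (insert j (I - {i, j}))"
    using assms by (intro finsum_insert) auto
  also have "finsum G f (insert j (I - {i, j})) = f j \<oplus> finsum G f (I - {i, j})"
    using assms by (intro finsum_insert) auto
  finally show ?thesis .
qed

section \<open>Removal of summands from a tensor\<close>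

context tensor_modules
begin

text \<open>An index set replaces the list: the elementary operations below change two chosen
  summands, and the final induction counts indices.\<close>

lemma tensor_finsum_form:
  assumes "X \<in> carrier (tens A B)"
  shows "\<exists>(I::nat set) b c. finite I \<and> b \<in> I \<rightarrow> carrier A \<and> c \<in> I \<rightarrow> carrier B \<and>
    X = finsum (tens A B) (\<lambda>i. pure A B (b i) (c i)) I"
proof -
  obtain x where x: "valid x" "X = tens_class A B x" using assms by (rule in_carrierE)
  have "valid x \<Longrightarrow> \<exists>(I::nat set) b c. finite I \<and> b \<in> I \<rightarrow> carrier A \<and> c \<in> I \<rightarrow> carrier B \<and>
    tens_class A B x = finsum (tens A B) (\<lambda>i. pure A B (b i) (c i)) I"
  proof (induction x)
    case Nil
    show ?case by (rule exI[of _ "{}"]) (simp add: zero_class)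
  next
    case (Cons p x)
    obtain a a' where p: "p = (a, a')" "a \<in> carrier A" "a' \<in> carrier B" using Cons.prems by (cases p) auto
    obtain I :: "nat set" and b c where I: "finite I" "b \<in> I \<rightarrow> carrier A" "c \<in> I \<rightarrow> carrier B"
      "tens_class A B x = finsum (tens A B) (\<lambda>i. pure A B (b i) (c i)) I" using Cons by auto
    obtain k where k: "k \<notin> I" using ex_new_if_finite[OF _ I(1)] by auto
    have s: "finsum (tens A B) (\<lambda>i. pure A B ((b(k := a)) i) ((c(k := a')) i)) I = finsum (tens A B) (\<lambda>i. pure A B (b i) (c i)) I"
      using I k by (intro T.finsum_cong') auto
    have "finsum (tens A B) (\<lambda>i. pure A B ((b(k := a)) i) ((c(k := a')) i)) (insert k I) =
       pure A B a a' \<oplus>\<^bsub>tens A B\<^esub> finsum (tens A B) (\<lambda>i. pure A B (b i) (c i)) I"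
      using I k p by (subst T.finsum_insert) (auto simp: s simp del: fun_upd_apply, auto)
    also have "\<dots> = tens_class A B (p # x)" using Cons.prems unfolding I(4)[symmetric] by (simp add: p(1) pure_class add_class)
    finally have "tens_class A B (p # x) = finsum (tens A B) (\<lambda>i. pure A B ((b(k := a)) i) ((c(k := a')) i)) (insert k I)" ..
    moreover have "b(k := a) \<in> insert k I \<rightarrow> carrier A" "c(k := a') \<in> insert k I \<rightarrow> carrier B" "finite (insert k I)"
      using I p by auto
    ultimately show ?case by blast
  qed
  with x show ?thesis by blast
qed

end

text \<open>A relation between the left factors allows one summand to be removed: the Euclidean algorithm on the
  coefficients of the relation is carried out by elementary operations on the summands.\<close>

lemma tensor_shorten:
  fixes A :: "('r::euclidean_ring, 'a, 'x) module_scheme" and B :: "('r, 'b, 'y) module_scheme"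
    and r :: "nat \<Rightarrow> 'r"
  assumes A: "module univ_ring A" and B: "module univ_ring B"
    and tf: "\<And>r x. r \<noteq> 0 \<Longrightarrow> x \<in> carrier A \<Longrightarrow> r \<odot>\<^bsub>A\<^esub> x = \<zero>\<^bsub>A\<^esub> \<Longrightarrow> x = \<zero>\<^bsub>A\<^esub>"
    and "finite I" "b \<in> I \<rightarrow> carrier A" "c \<in> I \<rightarrow> carrier B"
    and "i0 \<in> I" "r i0 \<noteq> 0" "finsum A (\<lambda>i. r i \<odot>\<^bsub>A\<^esub> b i) I = \<zero>\<^bsub>A\<^esub>"
  shows "\<exists>j b' c'. j \<in> I \<and> b' \<in> I - {j} \<rightarrow> carrier A \<and> c' \<in> I - {j} \<rightarrow> carrier B \<and>
    finsum (tens A B) (\<lambda>i. pure A B (b i) (c i)) I = finsum (tens A B) (\<lambda>i. pure A B (b' i) (c' i)) (I - {j})"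
  using assms(5-)
\<comment> \<open>The measure is the total Euclidean size of the coefficients; the index set stays
  the same until a single coefficient is nonzero.\<close>
proof (induction "\<Sum>i\<in>I. euclidean_size (r i)" arbitrary: r b c i0 rule: less_induct)
  case less
  interpret A: module univ_ring A by fact
  interpret B: module univ_ring B by fact
  interpret AB: tensor_modules A B ..
  have pc: "(\<lambda>i. pure A B (b i) (c i)) \<in> I \<rightarrow> carrier (tens A B)" and rc: "(\<lambda>i. r i \<odot>\<^bsub>A\<^esub> b i) \<in> I \<rightarrow> carrier A"
    using less.prems by auto
  show ?case
  proof (cases "\<exists>j\<in>I. j \<noteq> i0 \<and> r j \<noteq> 0")
    case False
    have "finsum A (\<lambda>i. r i \<odot>\<^bsub>A\<^esub> b i) I = r i0 \<odot>\<^bsub>A\<^esub> b i0 \<oplus>\<^bsub>A\<^esub> finsum A (\<lambda>i. r i \<odot>\<^bsub>A\<^esub> b i) (I - {i0})"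
      using less.prems(3) rc assms(4) by (subst A.M.finsum_insert[symmetric]) (auto simp: insert_absorb)
    also have "finsum A (\<lambda>i. r i \<odot>\<^bsub>A\<^esub> b i) (I - {i0}) = finsum A (\<lambda>i. \<zero>\<^bsub>A\<^esub>) (I - {i0})"
    proof (rule A.M.finsum_cong')
      fix i assume "i \<in> I - {i0}"
      then have "r i = 0" "b i \<in> carrier A" using False less.prems(1) by auto
      then show "r i \<odot>\<^bsub>A\<^esub> b i = \<zero>\<^bsub>A\<^esub>" using A.smult_l_null[of "b i"] by simp
    qed auto
    finally have "\<zero>\<^bsub>A\<^esub> = r i0 \<odot>\<^bsub>A\<^esub> b i0 \<oplus>\<^bsub>A\<^esub> \<zero>\<^bsub>A\<^esub>" using less.prems by (simp add: A.M.finsum_zero)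
    moreover have "r i0 \<odot>\<^bsub>A\<^esub> b i0 \<in> carrier A" using rc less.prems(3) by auto
    ultimately have "r i0 \<odot>\<^bsub>A\<^esub> b i0 = \<zero>\<^bsub>A\<^esub>" by simp
    then have "b i0 = \<zero>\<^bsub>A\<^esub>" using tf less.prems by blast
    moreover have "c i0 \<in> carrier B" using less.prems by auto
    moreover have "finsum (tens A B) (\<lambda>i. pure A B (b i) (c i)) I =
       pure A B (b i0) (c i0) \<oplus>\<^bsub>tens A B\<^esub> finsum (tens A B) (\<lambda>i. pure A B (b i) (c i)) (I - {i0})"
      using less.prems(3) pc assms(4) by (subst AB.T.finsum_insert[symmetric]) (auto simp: insert_absorb)
    moreover have "finsum (tens A B) (\<lambda>i. pure A B (b i) (c i)) (I - {i0}) \<in> carrier (tens A B)"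
      using pc by (intro AB.T.finsum_closed) auto
    ultimately have "finsum (tens A B) (\<lambda>i. pure A B (b i) (c i)) I = finsum (tens A B) (\<lambda>i. pure A B (b i) (c i)) (I - {i0})"
      by (simp add: AB.pure_zero_left)
    then show ?thesis using less.prems by (intro exI[of _ i0] exI[of _ b] exI[of _ c]) auto
  next
    case True
    then obtain j0 where j0: "j0 \<in> I" "j0 \<noteq> i0" "r j0 \<noteq> 0" by blast
    \<comment> \<open>Of two nonzero coefficients, the one of larger or equal size will be divided
      by the other.\<close>
    obtain i j where ij: "i \<in> I" "j \<in> I" "i \<noteq> j" "r i \<noteq> 0" "r j \<noteq> 0" "euclidean_size (r i) \<le> euclidean_size (r j)"
      using j0 less.prems(3,4) by (metis nle_le)
    \<comment> \<open>Since r j = q r i + r j mod r i, the relation becomes one with b i + q b j at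
      i and the remainder at j. The sum of pure tensors is preserved by the opposite change c j - q
      c i, because q b j \<otimes> c i = b j \<otimes> q c i.\<close>
    define q where "q = r j div r i"
    define r' where "r' = r(j := r j mod r i)"
    define b' where "b' = b(i := b i \<oplus>\<^bsub>A\<^esub> q \<odot>\<^bsub>A\<^esub> b j)"
    define c' where "c' = c(j := c j \<oplus>\<^bsub>B\<^esub> (- q) \<odot>\<^bsub>B\<^esub> c i)"
    have bc: "b i \<in> carrier A" "b j \<in> carrier A" "c i \<in> carrier B" "c j \<in> carrier B" using less.prems ij by auto
    have b': "b' \<in> I \<rightarrow> carrier A" "c' \<in> I \<rightarrow> carrier B" using less.prems bc ij by (auto simp: b'_def c'_def)
    have lt: "(\<Sum>k\<in>I. euclidean_size (r' k)) < (\<Sum>k\<in>I. euclidean_size (r k))"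
      using ij mod_size_less[of "r i" "r j"] assms(4)
      by (intro sum_strict_mono_ex1) (auto simp: r'_def intro!: bexI[of _ j])
    have s1: "finsum A (\<lambda>k. r' k \<odot>\<^bsub>A\<^esub> b' k) I = \<zero>\<^bsub>A\<^esub>"
    proof -
      have c1: "(\<lambda>k. r' k \<odot>\<^bsub>A\<^esub> b' k) \<in> I \<rightarrow> carrier A" using b' by auto
      have rest: "finsum A (\<lambda>k. r' k \<odot>\<^bsub>A\<^esub> b' k) (I - {i, j}) = finsum A (\<lambda>k. r k \<odot>\<^bsub>A\<^esub> b k) (I - {i, j})"
        using rc by (intro A.M.finsum_cong') (auto simp: r'_def b'_def)
      have rcl: "finsum A (\<lambda>k. r k \<odot>\<^bsub>A\<^esub> b k) (I - {i, j}) \<in> carrier A" using rc by (intro A.M.finsum_closed) auto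
      have rj: "r j = q * r i + r j mod r i" by (simp add: q_def)
      have "r i \<odot>\<^bsub>A\<^esub> b i \<oplus>\<^bsub>A\<^esub> (r j \<odot>\<^bsub>A\<^esub> b j \<oplus>\<^bsub>A\<^esub> z) = r' i \<odot>\<^bsub>A\<^esub> b' i \<oplus>\<^bsub>A\<^esub> (r' j \<odot>\<^bsub>A\<^esub> b' j \<oplus>\<^bsub>A\<^esub> z)" if "z \<in> carrier A" for z
      proof -
        have "r j \<odot>\<^bsub>A\<^esub> b j = r i \<odot>\<^bsub>A\<^esub> (q \<odot>\<^bsub>A\<^esub> b j) \<oplus>\<^bsub>A\<^esub> (r j mod r i) \<odot>\<^bsub>A\<^esub> b j"
          using A.smult_l_distr[of "q * r i" "r j mod r i" "b j"] A.smult_assoc1[of "r i" q "b j"] bc rj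
          by (simp add: mult.commute)
        then show ?thesis using bc that ij(3)
          by (simp add: r'_def b'_def A.smult_r_distr A.M.a_ac)
      qed
      from this[OF rcl] show ?thesis
        using A.M.finsum_split2[OF assms(4) ij(1-3) rc] A.M.finsum_split2[OF assms(4) ij(1-3) c1] less.prems(5)
        by (simp add: rest)
    qed
    have s2: "finsum (tens A B) (\<lambda>k. pure A B (b k) (c k)) I = finsum (tens A B) (\<lambda>k. pure A B (b' k) (c' k)) I"
    proof -
      have c1: "(\<lambda>k. pure A B (b' k) (c' k)) \<in> I \<rightarrow> carrier (tens A B)" using b' by auto
      have rest: "finsum (tens A B) (\<lambda>k. pure A B (b' k) (c' k)) (I - {i, j}) = finsum (tens A B) (\<lambda>k. pure A B (b k) (c k)) (I - {i, j})"
        using pc by (intro AB.T.finsum_cong') (auto simp: b'_def c'_def)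
      have rcl: "finsum (tens A B) (\<lambda>k. pure A B (b k) (c k)) (I - {i, j}) \<in> carrier (tens A B)" using pc by (intro AB.T.finsum_closed) auto
      have "pure A B (b i) (c i) \<oplus>\<^bsub>tens A B\<^esub> (pure A B (b j) (c j) \<oplus>\<^bsub>tens A B\<^esub> Z) =
         pure A B (b' i) (c' i) \<oplus>\<^bsub>tens A B\<^esub> (pure A B (b' j) (c' j) \<oplus>\<^bsub>tens A B\<^esub> Z)" if "Z \<in> carrier (tens A B)" for Z
      proof -
        have neg: "pure A B (b j) ((- q) \<odot>\<^bsub>B\<^esub> c i) = \<ominus>\<^bsub>tens A B\<^esub> pure A B (q \<odot>\<^bsub>A\<^esub> b j) (c i)"
          using bc B.smult_l_minus[of q "c i"] by (simp add: AB.pure_uminus_right AB.pure_smult_swap)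
        have swap: "X \<oplus>\<^bsub>tens A B\<^esub> (Y \<oplus>\<^bsub>tens A B\<^esub> Z) = (X \<oplus>\<^bsub>tens A B\<^esub> V) \<oplus>\<^bsub>tens A B\<^esub> ((Y \<oplus>\<^bsub>tens A B\<^esub> \<ominus>\<^bsub>tens A B\<^esub> V) \<oplus>\<^bsub>tens A B\<^esub> Z)"
          if "X \<in> carrier (tens A B)" "Y \<in> carrier (tens A B)" "Z \<in> carrier (tens A B)" "V \<in> carrier (tens A B)" for X Y Z V
        proof -
          have "(X \<oplus>\<^bsub>tens A B\<^esub> V) \<oplus>\<^bsub>tens A B\<^esub> ((Y \<oplus>\<^bsub>tens A B\<^esub> \<ominus>\<^bsub>tens A B\<^esub> V) \<oplus>\<^bsub>tens A B\<^esub> Z) =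
            (V \<oplus>\<^bsub>tens A B\<^esub> \<ominus>\<^bsub>tens A B\<^esub> V) \<oplus>\<^bsub>tens A B\<^esub> (X \<oplus>\<^bsub>tens A B\<^esub> (Y \<oplus>\<^bsub>tens A B\<^esub> Z))"
            using that by (simp add: AB.T.a_ac)
          then show ?thesis using that by (simp add: AB.T.r_neg)
        qed
        show ?thesis using bc that ij(3)
            swap[of "pure A B (b i) (c i)" "pure A B (b j) (c j)" Z "pure A B (q \<odot>\<^bsub>A\<^esub> b j) (c i)"]
          by (simp add: b'_def c'_def AB.pure_add_left AB.pure_add_right neg)
      qed
      from this[OF rcl] show ?thesis
        using AB.T.finsum_split2[OF assms(4) ij(1-3) pc] AB.T.finsum_split2[OF assms(4) ij(1-3) c1]
        by (simp add: rest)
    qed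
    have "r' i \<noteq> 0" using ij by (simp add: r'_def)
    from less.hyps[OF lt b' ij(1) this s1] show ?thesis unfolding s2 .
  qed
qed

text \<open>Induction on the number of summands b i \<otimes> c i. If some c i is nonzero, a
  functional of N that does not vanish at g (c i) turns the zero image into a nontrivial relation
  between the f (b k) over the target ring; \<open>descent\<close> brings it down to the source ring
  and \<open>tensor_shorten\<close> removes a summand. Descent concerns the left factor and
  separation the right one, which fits cubes bracketed as H \<otimes> (H \<otimes> H).\<close>

lemma tensor_map_injective:
  fixes A :: "('r::euclidean_ring, 'a, 'x) module_scheme" and B :: "('r, 'b, 'y) module_scheme"
    and M :: "('s::comm_ring_1, 'm, 'z) module_scheme" and N :: "('s, 'n, 'w) module_scheme"
  assumes A: "module univ_ring A" and B: "module univ_ring B" and M: "module univ_ring M" and N: "module univ_ring N"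
    and f: "f \<in> semilinear \<phi> A M" and g: "g \<in> semilinear \<phi> B N"
    and tf: "\<And>r x. r \<noteq> 0 \<Longrightarrow> x \<in> carrier A \<Longrightarrow> r \<odot>\<^bsub>A\<^esub> x = \<zero>\<^bsub>A\<^esub> \<Longrightarrow> x = \<zero>\<^bsub>A\<^esub>"
    and descent: "\<And>(I::nat set) b s i. finite I \<Longrightarrow> b \<in> I \<rightarrow> carrier A \<Longrightarrow> i \<in> I \<Longrightarrow> s i \<noteq> 0 \<Longrightarrow>
       finsum M (\<lambda>i. s i \<odot>\<^bsub>M\<^esub> f (b i)) I = \<zero>\<^bsub>M\<^esub> \<Longrightarrow>
       \<exists>r j. j \<in> I \<and> r j \<noteq> 0 \<and> finsum A (\<lambda>i. r i \<odot>\<^bsub>A\<^esub> b i) I = \<zero>\<^bsub>A\<^esub>"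
    and separated: "\<And>y. y \<in> carrier B \<Longrightarrow> y \<noteq> \<zero>\<^bsub>B\<^esub> \<Longrightarrow> \<exists>m\<in>functionals N. m (g y) \<noteq> 0"
  shows "inj_on (tmap M N f g) (carrier (tens A B))"
proof -
  interpret A: module univ_ring A by fact
  interpret B: module univ_ring B by fact
  interpret M: module univ_ring M by fact
  interpret N: module univ_ring N by fact
  interpret AB: tensor_modules A B ..
  interpret MN: tensor_modules M N ..
  note fg = tensor_map_semilinear[OF A B M N f g]
  have main: "finsum (tens A B) (\<lambda>i. pure A B (b i) (c i)) I = \<zero>\<^bsub>tens A B\<^esub>"
    if "finite I" "b \<in> I \<rightarrow> carrier A" "c \<in> I \<rightarrow> carrier B"
      "tmap M N f g (finsum (tens A B) (\<lambda>i. pure A B (b i) (c i)) I) = \<zero>\<^bsub>tens M N\<^esub>" for I :: "nat set" and b c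
    using that
  proof (induction "card I" arbitrary: I b c rule: less_induct)
    case less
    have pc: "(\<lambda>i. pure A B (b i) (c i)) \<in> I \<rightarrow> carrier (tens A B)" using less.prems by auto
    show ?case
    proof (cases "\<exists>i\<in>I. c i \<noteq> \<zero>\<^bsub>B\<^esub>")
      case False
      have "pure A B (b i) (c i) = \<zero>\<^bsub>tens A B\<^esub>" if "i \<in> I" for i
        using False less.prems(2) that AB.pure_zero_right[of "b i"] by (simp add: Pi_iff)
      then have "finsum (tens A B) (\<lambda>i. pure A B (b i) (c i)) I = finsum (tens A B) (\<lambda>i. \<zero>\<^bsub>tens A B\<^esub>) I"
        by (intro AB.T.finsum_cong') simp_all
      then show ?thesis by (simp add: AB.T.finsum_zero)
    next
      case True
      then obtain i where i: "i \<in> I" "c i \<noteq> \<zero>\<^bsub>B\<^esub>" by blast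
      then obtain m where m: "m \<in> functionals N" "m (g (c i)) \<noteq> 0" using separated[of "c i"] less.prems by auto
      note bal = functional_balanced[OF M N m(1)]
      note la = MN.tensor_lift_additive[OF M.abelian_group_axioms bal]
      let ?h = "\<lambda>X. tensor_lift M (\<lambda>(x, y). m y \<odot>\<^bsub>M\<^esub> x) (tmap M N f g X)"
      have h: "?h \<in> additive_maps (tens A B) M"
        using semilinearD[OF fg] additive_mapsD[OF la] by (intro additive_mapsI) simp_all
      have "\<zero>\<^bsub>M\<^esub> = ?h (finsum (tens A B) (\<lambda>i. pure A B (b i) (c i)) I)"
        using less.prems(4) additive_maps_zero[OF MN.abelian_group_tens M.abelian_group_axioms la] by simp
      also have "\<dots> = finsum M (\<lambda>i. ?h (pure A B (b i) (c i))) I"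
        by (rule additive_maps_finsum[OF AB.abelian_group_tens M.abelian_group_axioms h less.prems(1) pc])
      also have "\<dots> = finsum M (\<lambda>i. m (g (c i)) \<odot>\<^bsub>M\<^esub> f (b i)) I"
      proof (rule M.M.finsum_cong')
        fix i assume "i \<in> I"
        then have "b i \<in> carrier A" "c i \<in> carrier B" using less.prems by auto
        then show "?h (pure A B (b i) (c i)) = m (g (c i)) \<odot>\<^bsub>M\<^esub> f (b i)"
          using MN.tensor_lift_pure[OF M.abelian_group_axioms bal, of "f (b i)" "g (c i)"]
          by (simp add: tensor_map_pure[OF A B M N f g] semilinearD(1)[OF f] semilinearD(1)[OF g])
      qed (use less.prems semilinearD(1)[OF f] in \<open>auto intro!: M.smult_closed simp: Pi_iff\<close>)
      finally obtain r j where r: "j \<in> I" "r j \<noteq> 0" "finsum A (\<lambda>i. r i \<odot>\<^bsub>A\<^esub> b i) I = \<zero>\<^bsub>A\<^esub>"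
        using descent[of I b i "\<lambda>i. m (g (c i))"] less.prems i m(2) by metis
      have "\<exists>j b' c'. j \<in> I \<and> b' \<in> I - {j} \<rightarrow> carrier A \<and> c' \<in> I - {j} \<rightarrow> carrier B \<and>
        finsum (tens A B) (\<lambda>i. pure A B (b i) (c i)) I = finsum (tens A B) (\<lambda>i. pure A B (b' i) (c' i)) (I - {j})"
        by (rule tensor_shorten[where r = r and ?i0.0 = j]) (rule A B less.prems r | erule (2) tf)+
      then obtain k b' c' where
        k: "k \<in> I" "b' \<in> I - {k} \<rightarrow> carrier A" "c' \<in> I - {k} \<rightarrow> carrier B"
        "finsum (tens A B) (\<lambda>i. pure A B (b i) (c i)) I = finsum (tens A B) (\<lambda>i. pure A B (b' i) (c' i)) (I - {k})"
        by blast
      have "card (I - {k}) < card I" using k(1) less.prems(1) by (rule card_Diff1_less[rotated])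
      from less.hyps[OF this _ k(2,3)] show ?thesis using k(4) less.prems by simp
    qed
  qed
  have ker: "X = \<zero>\<^bsub>tens A B\<^esub>" if X: "X \<in> carrier (tens A B)" "tmap M N f g X = \<zero>\<^bsub>tens M N\<^esub>" for X
    using AB.tensor_finsum_form[OF X(1)] main X(2) by blast
  show ?thesis
  proof (rule inj_onI)
    fix X Y assume XY: "X \<in> carrier (tens A B)" "Y \<in> carrier (tens A B)" "tmap M N f g X = tmap M N f g Y"
    have "tmap M N f g (X \<ominus>\<^bsub>tens A B\<^esub> Y) = \<zero>\<^bsub>tens M N\<^esub>"
      using XY semilinearD(1)[OF fg XY(2)]
      by (simp add: additive_maps_minus[OF AB.abelian_group_tens MN.abelian_group_tens semilinearD(4)[OF fg]] MN.T.r_neg MN.T.minus_eq)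
    then have "X \<ominus>\<^bsub>tens A B\<^esub> Y = \<zero>\<^bsub>tens A B\<^esub>" using XY by (intro ker) simp_all
    then show "X = Y" using XY AB.T.minus_equality[of X "\<ominus>\<^bsub>tens A B\<^esub> Y"] by (simp add: a_minus_def)
  qed
qed

section \<open>Restriction of scalars and quotients\<close>

lemma restrict_alg_simps [simp]:
  "carrier (restrict_alg \<phi> L B) = B" "monoid.mult (restrict_alg \<phi> L B) = monoid.mult L"
  "one (restrict_alg \<phi> L B) = one L" "zero (restrict_alg \<phi> L B) = zero L" "add (restrict_alg \<phi> L B) = add L"
  "r \<odot>\<^bsub>restrict_alg \<phi> L B\<^esub> x = \<phi> r \<odot>\<^bsub>L\<^esub> x"
  by (simp_all add: restrict_alg_def)

lemma algebra_univD:
  assumes "algebra univ_ring L" "x \<in> carrier L"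
  shows "(r + s) \<odot>\<^bsub>L\<^esub> x = r \<odot>\<^bsub>L\<^esub> x \<oplus>\<^bsub>L\<^esub> s \<odot>\<^bsub>L\<^esub> x" "(r * s) \<odot>\<^bsub>L\<^esub> x = r \<odot>\<^bsub>L\<^esub> (s \<odot>\<^bsub>L\<^esub> x)" "1 \<odot>\<^bsub>L\<^esub> x = x" "0 \<odot>\<^bsub>L\<^esub> x = \<zero>\<^bsub>L\<^esub>"
    "(- r) \<odot>\<^bsub>L\<^esub> x = \<ominus>\<^bsub>L\<^esub> (r \<odot>\<^bsub>L\<^esub> x)"
    "r \<odot>\<^bsub>L\<^esub> x \<in> carrier L"
    "y \<in> carrier L \<Longrightarrow> x \<otimes>\<^bsub>L\<^esub> (r \<odot>\<^bsub>L\<^esub> y) = r \<odot>\<^bsub>L\<^esub> (x \<otimes>\<^bsub>L\<^esub> y)"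
proof -
  interpret L: algebra univ_ring L by fact
  show "(r + s) \<odot>\<^bsub>L\<^esub> x = r \<odot>\<^bsub>L\<^esub> x \<oplus>\<^bsub>L\<^esub> s \<odot>\<^bsub>L\<^esub> x" "(r * s) \<odot>\<^bsub>L\<^esub> x = r \<odot>\<^bsub>L\<^esub> (s \<odot>\<^bsub>L\<^esub> x)" "1 \<odot>\<^bsub>L\<^esub> x = x" "0 \<odot>\<^bsub>L\<^esub> x = \<zero>\<^bsub>L\<^esub>"
     "(- r) \<odot>\<^bsub>L\<^esub> x = \<ominus>\<^bsub>L\<^esub> (r \<odot>\<^bsub>L\<^esub> x)" "r \<odot>\<^bsub>L\<^esub> x \<in> carrier L"
    using L.smult_l_distr[of r s x] L.smult_assoc1[of r s x] L.smult_one[of x] L.smult_l_null[of x]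
      L.smult_l_minus[of r x] assms(2) by simp_all
  show "y \<in> carrier L \<Longrightarrow> x \<otimes>\<^bsub>L\<^esub> (r \<odot>\<^bsub>L\<^esub> y) = r \<odot>\<^bsub>L\<^esub> (x \<otimes>\<^bsub>L\<^esub> y)"
    using L.smult_assoc2[of r y x] assms(2) by (simp add: L.m_comm)
qed

lemma smult_eq_mult:
  assumes "algebra univ_ring L" "x \<in> carrier L"
  shows "r \<odot>\<^bsub>L\<^esub> x = (r \<odot>\<^bsub>L\<^esub> \<one>\<^bsub>L\<^esub>) \<otimes>\<^bsub>L\<^esub> x"
proof -
  interpret L: algebra univ_ring L by fact
  show ?thesis using L.smult_assoc2[of r "\<one>\<^bsub>L\<^esub>" x] assms(2) by simp
qed

text \<open>An algebra is a commutative ring with a ring homomorphism from the base; for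
  restrictions and quotients this is quicker to verify than the module laws.\<close>

lemma univ_algebraI:
  fixes H :: "('r::comm_ring_1, 'a, 'x) module_scheme"
  assumes "cring H" "\<And>r x. x \<in> carrier H \<Longrightarrow> r \<odot>\<^bsub>H\<^esub> x = u r \<otimes>\<^bsub>H\<^esub> x" "u \<in> ring_hom univ_ring H"
  shows "algebra univ_ring H"
proof -
  interpret H: cring H by fact
  note u = ring_hom_closed[OF assms(3), simplified] ring_hom_add[OF assms(3), simplified]
    ring_hom_mult[OF assms(3), simplified] ring_hom_one[OF assms(3), simplified]
  show ?thesis
    by (rule algebraI) (simp_all add: assms(1,2) u H.l_distr H.r_distr H.m_assoc)
qed

lemma smult_one_hom: "algebra univ_ring L \<Longrightarrow> (\<lambda>r. r \<odot>\<^bsub>L\<^esub> \<one>\<^bsub>L\<^esub>) \<in> ring_hom univ_ring L"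
proof (rule ring_hom_memI)
  assume a: "algebra univ_ring L"
  interpret L: algebra univ_ring L by fact
  note d = algebra_univD[OF a]
  fix x y :: 'a
  show "(x \<otimes>\<^bsub>univ_ring\<^esub> y) \<odot>\<^bsub>L\<^esub> \<one>\<^bsub>L\<^esub> = x \<odot>\<^bsub>L\<^esub> \<one>\<^bsub>L\<^esub> \<otimes>\<^bsub>L\<^esub> (y \<odot>\<^bsub>L\<^esub> \<one>\<^bsub>L\<^esub>)"
    by (simp add: d(7) d(2)[symmetric] mult.commute)
qed (simp_all add: algebra_univD algebra_cring cring.cring_simprules(6))

lemma is_subalgebraD:
  assumes "is_subalgebra univ_ring A B"
  shows "B \<subseteq> carrier A" "\<one>\<^bsub>A\<^esub> \<in> B" "x \<in> B \<Longrightarrow> y \<in> B \<Longrightarrow> x \<oplus>\<^bsub>A\<^esub> y \<in> B" "x \<in> B \<Longrightarrow> y \<in> B \<Longrightarrow> x \<otimes>\<^bsub>A\<^esub> y \<in> B"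
    "x \<in> B \<Longrightarrow> \<ominus>\<^bsub>A\<^esub> x \<in> B" "x \<in> B \<Longrightarrow> r \<odot>\<^bsub>A\<^esub> x \<in> B"
  using assms subringE[of B A] by (auto simp: is_subalgebra_def)

lemma algebra_restrict:
  assumes L: "algebra univ_ring L" and \<phi>: "\<phi> \<in> ring_hom univ_ring univ_ring"
    and B: "is_subalgebra univ_ring (restrict_alg \<phi> L (carrier L)) B"
  shows "algebra univ_ring (restrict_alg \<phi> L B)"
proof (rule univ_algebraI)
  interpret L: algebra univ_ring L by fact
  note d = algebra_univD[OF L] and p = univ_homD[OF \<phi>]
  note b = is_subalgebraD[OF B, simplified]
  have b1: "x \<in> B \<Longrightarrow> x \<in> carrier L" for x using b(1) by auto
  have z: "\<zero>\<^bsub>L\<^esub> \<in> B" using b(6)[OF b(2), of 0] by (simp add: p d)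
  have neg: "\<exists>y\<in>B. y \<oplus>\<^bsub>L\<^esub> x = \<zero>\<^bsub>L\<^esub>" if "x \<in> B" for x
    using b(6)[OF that, of "-1"] b1[OF that] by (intro bexI[of _ "\<ominus>\<^bsub>L\<^esub> x"]) (simp_all add: p d L.M.l_neg)
  show "cring (restrict_alg \<phi> L B)"
    by (intro cringI abelian_groupI comm_monoidI)
       (simp_all add: b(2-4) z neg b1 L.M.a_assoc L.m_assoc L.l_distr, simp_all add: b1 L.M.a_comm L.m_comm)
  show "(\<lambda>r. \<phi> r \<odot>\<^bsub>L\<^esub> \<one>\<^bsub>L\<^esub>) \<in> ring_hom univ_ring (restrict_alg \<phi> L B)"
    using ring_hom_trans[OF \<phi> smult_one_hom[OF L]] b(6)[OF b(2)] by (simp add: comp_def ring_hom_def Pi_iff)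
  show "x \<in> carrier (restrict_alg \<phi> L B) \<Longrightarrow> r \<odot>\<^bsub>restrict_alg \<phi> L B\<^esub> x = (\<phi> r \<odot>\<^bsub>L\<^esub> \<one>\<^bsub>L\<^esub>) \<otimes>\<^bsub>restrict_alg \<phi> L B\<^esub> x" for r x
    using smult_eq_mult[OF L, of x "\<phi> r"] b1 by simp
qed

lemma is_subalgebraI:
  assumes L: "algebra univ_ring L" and "B \<subseteq> carrier L" "\<one>\<^bsub>L\<^esub> \<in> B" "\<And>x y. x \<in> B \<Longrightarrow> y \<in> B \<Longrightarrow> x \<oplus>\<^bsub>L\<^esub> y \<in> B"
    "\<And>x y. x \<in> B \<Longrightarrow> y \<in> B \<Longrightarrow> x \<otimes>\<^bsub>L\<^esub> y \<in> B" "\<And>r x. x \<in> B \<Longrightarrow> r \<odot>\<^bsub>L\<^esub> x \<in> B"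
  shows "is_subalgebra univ_ring L B"
proof -
  interpret L: algebra univ_ring L by fact
  have "\<ominus>\<^bsub>L\<^esub> x \<in> B" if "x \<in> B" for x
    using assms(6)[OF that, of "-1"] that assms(2) by (simp add: algebra_univD[OF L] subset_iff)
  then show ?thesis using assms by (auto simp: is_subalgebra_def intro!: L.subringI)
qed

lemma is_subalgebra_carrier: "algebra univ_ring L \<Longrightarrow> is_subalgebra univ_ring L (carrier L)"
proof -
  assume a: "algebra univ_ring L"
  interpret algebra univ_ring L by fact
  show ?thesis by (rule is_subalgebraI[OF a]) simp_all
qed

lemma algebra_restrict_carrier:
  assumes L: "algebra univ_ring L" and \<phi>: "\<phi> \<in> ring_hom univ_ring univ_ring"
  shows "algebra univ_ring (restrict_alg \<phi> L (carrier L))"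
proof -
  interpret L: algebra univ_ring L by fact
  note d = algebra_univD[OF L] and p = univ_homD[OF \<phi>]
  show ?thesis
  proof (rule univ_algebraI)
    show "cring (restrict_alg \<phi> L (carrier L))" by (rule cring_cong[where A = L]) (simp_all add: L.is_cring)
    show "(\<lambda>r. \<phi> r \<odot>\<^bsub>L\<^esub> \<one>\<^bsub>L\<^esub>) \<in> ring_hom univ_ring (restrict_alg \<phi> L (carrier L))"
      using ring_hom_trans[OF \<phi> smult_one_hom[OF L]] by (simp add: comp_def ring_hom_def)
  qed (simp, rule smult_eq_mult[OF L])
qed

lemma generated_subalgebra_mono:
  assumes "is_subalgebra R A B" "X \<subseteq> B" shows "generated_subalgebra R A X \<subseteq> B"
  using assms by (auto simp: generated_subalgebra_def)

lemma generated_subalgebra_incl: "X \<subseteq> generated_subalgebra R A X"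
  by (auto simp: generated_subalgebra_def)

lemma generated_subalgebra:
  assumes L: "algebra univ_ring L" and X: "X \<subseteq> carrier L"
  shows "is_subalgebra univ_ring L (generated_subalgebra univ_ring L X)"
proof (rule is_subalgebraI[OF L])
  show "generated_subalgebra univ_ring L X \<subseteq> carrier L"
    using is_subalgebra_carrier[OF L] X by (auto simp: generated_subalgebra_def)
qed (auto simp: generated_subalgebra_def is_subalgebraD)

section \<open>Quotient algebras\<close>

lemma quot_alg_simps [simp]:
  "carrier (quot_alg A I) = carrier (A Quot I)" "monoid.mult (quot_alg A I) = monoid.mult (A Quot I)"
  "one (quot_alg A I) = one (A Quot I)" "zero (quot_alg A I) = zero (A Quot I)" "add (quot_alg A I) = add (A Quot I)"
  "r \<odot>\<^bsub>quot_alg A I\<^esub> X = (I +>\<^bsub>A\<^esub> (r \<odot>\<^bsub>A\<^esub> \<one>\<^bsub>A\<^esub>)) \<otimes>\<^bsub>A Quot I\<^esub> X"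
  by (simp_all add: quot_alg_def ring.defs module.defs)

locale quotient_algebra = algebra univ_ring A + I: ideal I A
  for A :: "('r::comm_ring_1, 'a, 'x) module_scheme" and I :: "'a set"
begin

abbreviation proj where "proj \<equiv> (\<lambda>x. I +>\<^bsub>A\<^esub> x)"

lemma proj_ring_hom: "proj \<in> ring_hom A (quot_alg A I)"
  using I.rcos_ring_hom by (simp add: ring_hom_def)

lemma algebra_quot: "algebra univ_ring (quot_alg A I)"
proof (rule univ_algebraI)
  show "cring (quot_alg A I)"
    by (rule cring_cong[where A = "A Quot I"]) (simp_all add: I.quotient_is_cring is_cring)
  show "(\<lambda>r. proj (r \<odot>\<^bsub>A\<^esub> \<one>\<^bsub>A\<^esub>)) \<in> ring_hom univ_ring (quot_alg A I)"
    using ring_hom_trans[OF smult_one_hom[OF algebra_axioms] proj_ring_hom] by (simp add: comp_def)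
qed simp

lemma proj_semilinear: "proj \<in> semilinear id A (quot_alg A I)"
proof (rule semilinearI)
  note p = ring_hom_closed[OF proj_ring_hom] ring_hom_add[OF proj_ring_hom] ring_hom_mult[OF proj_ring_hom]
  fix x y assume x: "x \<in> carrier A"
  show "proj x \<in> carrier (quot_alg A I)" by (rule p(1)[OF x])
  show "proj (r \<odot>\<^bsub>A\<^esub> x) = id r \<odot>\<^bsub>quot_alg A I\<^esub> proj x" for r
    using p(3)[of "r \<odot>\<^bsub>A\<^esub> \<one>\<^bsub>A\<^esub>" x] x smult_eq_mult[OF algebra_axioms x, of r] by simp
  assume y: "y \<in> carrier A"
  show "proj (x \<oplus>\<^bsub>A\<^esub> y) = proj x \<oplus>\<^bsub>quot_alg A I\<^esub> proj y" by (rule p(2)[OF x y])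
qed

lemma carrier_quot: "carrier (quot_alg A I) = proj ` carrier A"
  by (auto simp: FactRing_def A_RCOSETS_def' A_RCOSETS_def)

lemma proj_eq_iff: "x \<in> carrier A \<Longrightarrow> y \<in> carrier A \<Longrightarrow> proj x = proj y \<longleftrightarrow> x \<ominus>\<^bsub>A\<^esub> y \<in> I"
  using I.a_rcos_module_minus[OF ring_axioms, of y x] I.a_rcos_self[of x] I.a_repr_independence'[of x y] by auto

lemma rep_proj:
  assumes x: "x \<in> carrier A" shows "rep (proj x) \<in> carrier A" "proj (rep (proj x)) = proj x"
proof -
  have "x \<in> proj x" using I.a_rcos_self x by blast
  then have r: "rep (proj x) \<in> proj x" unfolding rep_def by (rule someI)
  then show c: "rep (proj x) \<in> carrier A" using x I.Icarr by (auto simp: a_r_coset_def')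
  show "proj (rep (proj x)) = proj x" using I.a_repr_independence'[OF r x] by simp
qed

lemma rep_quot:
  assumes "X \<in> carrier (quot_alg A I)" shows "rep X \<in> carrier A" "proj (rep X) = X"
  using assms rep_proj by (auto simp: carrier_quot simp del: quot_alg_simps)

text \<open>Maps on a quotient are computed on \<open>rep\<close>; a map that kills I does not see
  the choice.\<close>

lemma hom_rep_proj:
  assumes h: "h \<in> additive_maps A M" and M: "abelian_group M" and k: "\<And>x. x \<in> I \<Longrightarrow> h x = \<zero>\<^bsub>M\<^esub>" and x: "x \<in> carrier A"
  shows "h (rep (proj x)) = h x"
proof -
  interpret N: abelian_group M by fact
  note r = rep_proj[OF x]
  have "rep (proj x) \<ominus>\<^bsub>A\<^esub> x \<in> I" using r x proj_eq_iff by blast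
  then have "h (rep (proj x)) \<ominus>\<^bsub>M\<^esub> h x = \<zero>\<^bsub>M\<^esub>"
    using k additive_maps_minus[OF abelian_group_axioms M h r(1) x] by simp
  then show ?thesis using additive_mapsD(1)[OF h] r(1) x
      N.minus_equality[of "h (rep (proj x))" "\<ominus>\<^bsub>M\<^esub> h x"] by (simp add: a_minus_def)
qed

end

section \<open>Finitely supported functions as type-class rings\<close>

lemma poly_mapping_induct [case_names single add]:
  fixes p :: "'k \<Rightarrow>\<^sub>0 'a::comm_monoid_add"
  assumes "\<And>k c. P (Poly_Mapping.single k c)" "\<And>p q. P p \<Longrightarrow> P q \<Longrightarrow> P (p + q)"
  shows "P p"
proof (induction p rule: update_induct)
  case const
  show ?case using assms(1)[of _ 0] by simp
next
  case (update f a b)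
  have "Poly_Mapping.update a b f = f + Poly_Mapping.single a b"
    using update(1) by (intro poly_mapping_eqI) (auto simp: Poly_Mapping.lookup_update lookup_add lookup_single not_in_keys_iff_lookup_eq_zero when_def)
  then show ?case using update assms by simp
qed

text \<open>Multiplicativity is a biadditive condition, so monomials suffice.\<close>

lemma poly_mapping_hom_multI:
  fixes f :: "('k::comm_monoid_add \<Rightarrow>\<^sub>0 'a::comm_ring_1) \<Rightarrow> 'b::comm_ring_1"
  assumes add: "\<And>p q. f (p + q) = f p + f q"
    and mon: "\<And>k l a b. f (Poly_Mapping.single (k + l) (a * b)) = f (Poly_Mapping.single k a) * f (Poly_Mapping.single l b)"
    and one: "f (Poly_Mapping.single 0 1) = 1"
  shows "f \<in> ring_hom univ_ring univ_ring"
proof (rule univ_homI)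
  show "f (p * q) = f p * f q" for p q
  proof (induction p rule: poly_mapping_induct)
    case (single k a)
    show ?case by (induction q rule: poly_mapping_induct) (simp_all add: mult_single mon add distrib_left)
  qed (simp add: add algebra_simps)
qed (use add one in simp_all)

lemma single_hom: "Poly_Mapping.single 0 \<in> ring_hom univ_ring (univ_ring :: ('k::comm_monoid_add \<Rightarrow>\<^sub>0 'a::comm_ring_1) ring)"
  by (rule univ_homI) (simp_all add: single_add mult_single)

lemma lookup_map: "f 0 = 0 \<Longrightarrow> Poly_Mapping.lookup (Poly_Mapping.map f p) k = f (Poly_Mapping.lookup p k)"
  by (simp add: map.rep_eq when_def)

lemma map_hom:
  fixes f :: "'a::comm_ring_1 \<Rightarrow> 'b::comm_ring_1"
  assumes "f \<in> ring_hom univ_ring univ_ring"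
  shows "(Poly_Mapping.map f :: ('k::comm_monoid_add \<Rightarrow>\<^sub>0 'a) \<Rightarrow> _) \<in> ring_hom univ_ring univ_ring"
  by (rule poly_mapping_hom_multI)
     (auto intro!: poly_mapping_eqI simp: lookup_map univ_homD[OF assms] lookup_add mult_single map_single simp flip: single_one)

section \<open>Evaluation of polynomials at matrices\<close>

locale matrix_evaluation = algebra univ_ring T
  for T :: "('r::comm_ring_1, 't, 'x) module_scheme" and v :: "'m \<Rightarrow> 'm \<Rightarrow> 't" +
  assumes v_closed: "v i j \<in> carrier T"
begin

definition monom_eval :: "('m \<times> 'm \<Rightarrow>\<^sub>0 nat) \<Rightarrow> 't" where
  "monom_eval e = finprod T (\<lambda>(i, j). v i j [^]\<^bsub>T\<^esub> Poly_Mapping.lookup e (i, j)) (Poly_Mapping.keys e)"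

text \<open>The support of a sum can differ from the supports of its terms; over a common finite
  superset the factors can be compared index by index.\<close>

lemma monom_eval_superset:
  assumes "finite S" "Poly_Mapping.keys e \<subseteq> S"
  shows "monom_eval e = finprod T (\<lambda>(i, j). v i j [^]\<^bsub>T\<^esub> Poly_Mapping.lookup e (i, j)) S"
  unfolding monom_eval_def
  by (rule finprod_mono_neutral_cong_left) (use assms v_closed in \<open>auto simp: in_keys_iff\<close>)

lemma monom_eval_closed [simp]: "monom_eval e \<in> carrier T"
  unfolding monom_eval_def using v_closed by (intro finprod_closed) auto

lemma monom_eval_add: "monom_eval (e + e') = monom_eval e \<otimes>\<^bsub>T\<^esub> monom_eval e'"
proof -
  let ?S = "Poly_Mapping.keys e \<union> Poly_Mapping.keys e'"
  have k: "Poly_Mapping.keys (e + e') \<subseteq> ?S" by (rule keys_add)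
  have "monom_eval (e + e') = finprod T (\<lambda>p. (case p of (i, j) \<Rightarrow> v i j [^]\<^bsub>T\<^esub> Poly_Mapping.lookup e (i, j)) \<otimes>\<^bsub>T\<^esub>
      (case p of (i, j) \<Rightarrow> v i j [^]\<^bsub>T\<^esub> Poly_Mapping.lookup e' (i, j))) ?S"
    unfolding monom_eval_superset[OF _ k, simplified]
    by (rule finprod_cong') (use v_closed in \<open>auto simp: lookup_add nat_pow_mult\<close>)
  also have "\<dots> = monom_eval e \<otimes>\<^bsub>T\<^esub> monom_eval e'"
    using v_closed by (subst finprod_multf) (auto simp: monom_eval_superset[of ?S])
  finally show ?thesis .
qed

lemma monom_eval_single: "monom_eval (Poly_Mapping.single (i, j) n) = v i j [^]\<^bsub>T\<^esub> n"
  using v_closed monom_eval_superset[of "{(i, j)}" "Poly_Mapping.single (i, j) n"] by simp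

lemma monom_eval_zero: "monom_eval 0 = \<one>\<^bsub>T\<^esub>"
  by (simp add: monom_eval_def)

abbreviation "ev \<equiv> mat_poly_eval T v"

lemma ev_def': "ev p = finsum T (\<lambda>e. Poly_Mapping.lookup p e \<odot>\<^bsub>T\<^esub> monom_eval e) (Poly_Mapping.keys p)"
  by (simp add: mat_poly_eval_def monom_eval_def)

lemma ev_superset:
  assumes "finite S" "Poly_Mapping.keys p \<subseteq> S"
  shows "ev p = finsum T (\<lambda>e. Poly_Mapping.lookup p e \<odot>\<^bsub>T\<^esub> monom_eval e) S"
  unfolding ev_def'
  by (rule add.finprod_mono_neutral_cong_left[folded finsum_def])
     (use assms in \<open>auto simp: in_keys_iff algebra_univD(4)[OF algebra_axioms] intro!: smult_closed\<close>)

lemma ev_closed [simp]: "ev p \<in> carrier T"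
  unfolding ev_def' by (rule M.finsum_closed) auto

lemma ev_add: "ev (p + q) = ev p \<oplus>\<^bsub>T\<^esub> ev q"
proof -
  let ?S = "Poly_Mapping.keys p \<union> Poly_Mapping.keys q"
  have k: "Poly_Mapping.keys (p + q) \<subseteq> ?S" by (rule keys_add)
  have "ev (p + q) = finsum T (\<lambda>e. Poly_Mapping.lookup p e \<odot>\<^bsub>T\<^esub> monom_eval e \<oplus>\<^bsub>T\<^esub> Poly_Mapping.lookup q e \<odot>\<^bsub>T\<^esub> monom_eval e) ?S"
    unfolding ev_superset[OF _ k, simplified]
    by (rule M.finsum_cong') (auto simp: lookup_add algebra_univD[OF algebra_axioms])
  also have "\<dots> = ev p \<oplus>\<^bsub>T\<^esub> ev q"
    by (subst M.finsum_addf) (auto simp: ev_superset[of ?S])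
  finally show ?thesis .
qed

lemma ev_single: "ev (Poly_Mapping.single e c) = c \<odot>\<^bsub>T\<^esub> monom_eval e"
  using ev_superset[of "{e}" "Poly_Mapping.single e c"] by simp

lemma ev_mult: "ev (p * q) = ev p \<otimes>\<^bsub>T\<^esub> ev q"
proof (induction p rule: poly_mapping_induct)
  case (single k a)
  show ?case
  proof (induction q rule: poly_mapping_induct)
    case (single l b)
    show ?case
      by (simp add: mult_single ev_single monom_eval_add smult_assoc2 algebra_univD(7)[OF algebra_axioms]
        algebra_univD(2)[OF algebra_axioms, symmetric] mult.commute)
  qed (simp add: ev_add r_distr distrib_left)
qed (simp add: ev_add l_distr distrib_right)

lemma ev_const: "ev (Poly_Mapping.single 0 c) = c \<odot>\<^bsub>T\<^esub> \<one>\<^bsub>T\<^esub>"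
  by (simp add: ev_single monom_eval_zero)

lemma ev_hom: "ev \<in> ring_hom univ_ring T"
  using ev_const[of 1] by (intro ring_hom_memI) (simp_all add: ev_add ev_mult algebra_univD[OF algebra_axioms])

lemma ev_var: "ev (mat_var i j) = v i j"
  using v_closed by (simp add: mat_var_def ev_single monom_eval_single algebra_univD[OF algebra_axioms])

text \<open>The universal property of the polynomial ring, by which evaluations obtained along
  different routes are identified.\<close>

lemma ev_unique:
  assumes h: "h \<in> ring_hom univ_ring T" and c: "\<And>c. h (Poly_Mapping.single 0 c) = c \<odot>\<^bsub>T\<^esub> \<one>\<^bsub>T\<^esub>"
    and var: "\<And>i j. h (mat_var i j) = v i j"
  shows "h p = ev p"
proof -
  note h' = ring_hom_closed[OF h, simplified] ring_hom_add[OF h, simplified] ring_hom_mult[OF h, simplified] ring_hom_one[OF h, simplified]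
  have n: "h (Poly_Mapping.single (Poly_Mapping.single (i, j) n) 1) = v i j [^]\<^bsub>T\<^esub> n" for i j n
  proof (induction n)
    case 0 then show ?case using h'(4) by simp
  next
    case (Suc n)
    have "Poly_Mapping.single (Poly_Mapping.single (i, j) (Suc n)) 1 =
      Poly_Mapping.single (Poly_Mapping.single (i, j) n) 1 * (mat_var i j :: ('m, 'r) mat_poly)"
      by (simp add: mat_var_def mult_single flip: single_add)
    then show ?case using Suc by (simp add: h' var)
  qed
  have m: "h (Poly_Mapping.single e 1) = monom_eval e" for e
  proof (induction e rule: poly_mapping_induct)
    case (single p n)
    obtain i j where "p = (i, j)" by force
    then show ?case by (simp add: n monom_eval_single)
  next
    case (add e e')
    have "Poly_Mapping.single (e + e') 1 = Poly_Mapping.single e 1 * (Poly_Mapping.single e' 1 :: ('m, 'r) mat_poly)"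
      by (simp add: mult_single)
    then show ?case using add by (simp add: h' monom_eval_add)
  qed
  show ?thesis
  proof (induction p rule: poly_mapping_induct)
    case (single e a)
    have "Poly_Mapping.single e a = Poly_Mapping.single 0 a * (Poly_Mapping.single e 1 :: ('m, 'r) mat_poly)"
      by (simp add: mult_single)
    then have "h (Poly_Mapping.single e a) = h (Poly_Mapping.single 0 a) \<otimes>\<^bsub>T\<^esub> h (Poly_Mapping.single e 1)"
      using h'(3) by metis
    then show ?case by (simp add: c m ev_single smult_assoc2)
  qed (simp add: h' ev_add)
qed

end

lemma matrix_evaluationI: "algebra univ_ring T \<Longrightarrow> (\<And>i j. v i j \<in> carrier T) \<Longrightarrow> matrix_evaluation T v"
  by (simp add: matrix_evaluation_def matrix_evaluation_axioms_def)

text \<open>The coefficients of p lie in the base ring of T, so T' is given scalars through \<phi>.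
  Both sides are then homomorphisms over that ring which agree on the variables.\<close>

lemma mat_poly_eval_semilinear:
  fixes T :: "('r::comm_ring_1, 't, 'x) module_scheme" and T' :: "('s::comm_ring_1, 'u, 'y) module_scheme"
  assumes T: "algebra univ_ring T" and T': "algebra univ_ring T'" and \<phi>: "\<phi> \<in> ring_hom univ_ring univ_ring"
    and f: "f \<in> ring_hom T T'" "f \<in> semilinear \<phi> T T'" and v: "\<And>i j. v i j \<in> carrier T"
  shows "f (mat_poly_eval T v p) = mat_poly_eval (restrict_alg \<phi> T' (carrier T')) (\<lambda>i j. f (v i j)) p"
proof -
  interpret E: matrix_evaluation T v by (rule matrix_evaluationI[OF T v])
  interpret E': matrix_evaluation "restrict_alg \<phi> T' (carrier T')" "\<lambda>i j. f (v i j)"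
    by (rule matrix_evaluationI[OF algebra_restrict_carrier[OF T' \<phi>]]) (simp add: semilinearD(1)[OF f(2) v])
  show ?thesis
  proof (rule E'.ev_unique)
    show "(\<lambda>p. f (mat_poly_eval T v p)) \<in> ring_hom univ_ring (restrict_alg \<phi> T' (carrier T'))"
      using ring_hom_trans[OF E.ev_hom f(1)] by (simp add: comp_def ring_hom_def)
  qed (simp_all add: E.ev_const E.ev_var semilinearD(3)[OF f(2)] ring_hom_one[OF f(1)])
qed

lemma mat_poly_eval_map:
  fixes T :: "('s::comm_ring_1, 't, 'x) module_scheme" and \<phi> :: "'r::comm_ring_1 \<Rightarrow> 's"
  assumes T: "algebra univ_ring T" and \<phi>: "\<phi> \<in> ring_hom univ_ring univ_ring" and v: "\<And>i j. v i j \<in> carrier T"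
  shows "mat_poly_eval T v (Poly_Mapping.map \<phi> p) = mat_poly_eval (restrict_alg \<phi> T (carrier T)) v p"
proof -
  interpret E: matrix_evaluation T v by (rule matrix_evaluationI[OF T v])
  interpret E': matrix_evaluation "restrict_alg \<phi> T (carrier T)" v
    by (rule matrix_evaluationI[OF algebra_restrict_carrier[OF T \<phi>]]) (simp add: v)
  show ?thesis
  proof (rule E'.ev_unique)
    show "(\<lambda>p. mat_poly_eval T v (Poly_Mapping.map \<phi> p)) \<in> ring_hom univ_ring (restrict_alg \<phi> T (carrier T))"
      using ring_hom_trans[OF map_hom[OF \<phi>] E.ev_hom] by (simp add: comp_def ring_hom_def)
    show "mat_poly_eval T v (Poly_Mapping.map \<phi> (mat_var i j)) = v i j" for i j
      using E.ev_var[of i j] univ_homD[OF \<phi>] by (simp add: mat_var_def map_single)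
  qed (simp add: E.ev_const univ_homD[OF \<phi>] map_single)
qed

text \<open>The polynomial ring as the ring generated by constants and variables; this form compares
  the range of an evaluation with a subalgebra.\<close>

lemma mat_poly_induct [case_names const var add mult]:
  fixes p :: "('m, 'r::comm_ring_1) mat_poly"
  assumes "\<And>c. P (Poly_Mapping.single 0 c)" "\<And>i j. P (mat_var i j)"
    "\<And>p q. P p \<Longrightarrow> P q \<Longrightarrow> P (p + q)" "\<And>p q. P p \<Longrightarrow> P q \<Longrightarrow> P (p * q)"
  shows "P p"
proof -
  have m: "P (Poly_Mapping.single e 1)" for e
  proof (induction e rule: poly_mapping_induct)
    case (single k n)
    obtain i j where k: "k = (i, j)" by force
    show ?case
    proof (induction n)
      case 0 then show ?case using assms(1)[of 1] by simp
    next
      case (Suc n)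
      have "Poly_Mapping.single (Poly_Mapping.single k (Suc n)) 1 = Poly_Mapping.single (Poly_Mapping.single k n) 1 * (mat_var i j :: ('m, 'r) mat_poly)"
        by (simp add: k mat_var_def mult_single flip: single_add)
      then show ?case using Suc assms(2,4) by simp
    qed
  next
    case (add e e')
    have "Poly_Mapping.single (e + e') 1 = Poly_Mapping.single e 1 * (Poly_Mapping.single e' 1 :: ('m, 'r) mat_poly)"
      by (simp add: mult_single)
    then show ?case using add assms(4) by simp
  qed
  show ?thesis
  proof (induction p rule: poly_mapping_induct)
    case (single e a)
    have "Poly_Mapping.single e a = Poly_Mapping.single 0 a * (Poly_Mapping.single e 1 :: ('m, 'r) mat_poly)"
      by (simp add: mult_single)
    then show ?case using m assms(1,4) by simp
  qed (rule assms(3))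
qed

section \<open>Laurent polynomials\<close>

lemma lookup_laurent_t_to_u:
  "Poly_Mapping.lookup (laurent_t_to_u p) m = (if even m then Poly_Mapping.lookup p (m div 2) else 0)"
proof -
  have "Poly_Mapping.lookup (laurent_t_to_u p) m = (\<Sum>k\<in>Poly_Mapping.keys p. if k = m div 2 \<and> even m then Poly_Mapping.lookup p k else 0)"
    unfolding laurent_t_to_u_def lookup_sum by (intro sum.cong) (auto simp: lookup_single when_def)
  then show ?thesis by (auto simp: in_keys_iff)
qed

lemma lookup_poly_to_laurent:
  "Poly_Mapping.lookup (poly_to_laurent p) m = (if m \<ge> 0 then coeff p (nat m) else 0)"
proof -
  have "Poly_Mapping.lookup (poly_to_laurent p) m = (\<Sum>i\<le>degree p. if i = nat m \<and> m \<ge> 0 then coeff p i else 0)"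
    unfolding poly_to_laurent_def lookup_sum by (intro sum.cong) (auto simp: lookup_single when_def)
  then show ?thesis by (auto simp: coeff_eq_0)
qed

lemma lookup_poly_t_to_u:
  "Poly_Mapping.lookup (poly_t_to_u p) m = (if even m \<and> m \<ge> 0 then coeff p (nat (m div 2)) else 0)"
  by (auto simp: poly_t_to_u_def lookup_laurent_t_to_u lookup_poly_to_laurent)

lemma laurent_t_to_u_single: "laurent_t_to_u (Poly_Mapping.single k c) = Poly_Mapping.single (2 * k) c"
proof (rule poly_mapping_eqI)
  fix m :: int
  have "odd m \<Longrightarrow> 2 * (m div 2) \<noteq> m" by presburger
  then show "Poly_Mapping.lookup (laurent_t_to_u (Poly_Mapping.single k c)) m = Poly_Mapping.lookup (Poly_Mapping.single (2 * k) c) m"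
    by (auto simp: lookup_laurent_t_to_u lookup_single when_def)
qed

lemma laurent_t_to_u_hom: "laurent_t_to_u \<in> ring_hom univ_ring univ_ring"
  by (rule poly_mapping_hom_multI)
     (auto intro: poly_mapping_eqI simp: lookup_laurent_t_to_u lookup_add laurent_t_to_u_single mult_single algebra_simps simp flip: single_one)

lemma lookup_monom_mult:
  fixes q :: "'a::comm_ring_1 laurent"
  shows "Poly_Mapping.lookup (Poly_Mapping.single n c * q) m = c * Poly_Mapping.lookup q (m - n)"
  by (induction q rule: poly_mapping_induct)
     (auto simp: mult_single lookup_single when_def distrib_left lookup_add)

lemma poly_to_laurent_hom: "poly_to_laurent \<in> ring_hom univ_ring univ_ring"
proof (rule univ_homI)
  show add: "poly_to_laurent (p + q) = poly_to_laurent p + poly_to_laurent q" for p q :: "'a poly"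
    by (rule poly_mapping_eqI) (auto simp: lookup_poly_to_laurent lookup_add)
  have smult: "poly_to_laurent (smult a q) = Poly_Mapping.single 0 a * poly_to_laurent q" for a and q :: "'a poly"
    by (rule poly_mapping_eqI) (auto simp: lookup_poly_to_laurent lookup_monom_mult)
  have shift: "poly_to_laurent (pCons 0 q) = Poly_Mapping.single 1 1 * poly_to_laurent q" for q :: "'a poly"
    by (rule poly_mapping_eqI) (auto simp: lookup_poly_to_laurent lookup_monom_mult coeff_pCons nat_diff_distrib split: nat.split)
  have const: "poly_to_laurent [:a:] = Poly_Mapping.single 0 a" for a :: 'a
    by (rule poly_mapping_eqI) (auto simp: lookup_poly_to_laurent lookup_single when_def coeff_pCons split: nat.split)
  show "poly_to_laurent (p * q) = poly_to_laurent p * poly_to_laurent q" for p q :: "'a poly"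
  \<comment> \<open>Horner recursion: \<open>pCons a p\<close> is the constant a plus the variable
    times p.\<close>
  proof (induction p)
    case 0 show ?case by (simp add: poly_to_laurent_def)
  next
    case (pCons a p)
    have "pCons a p = [:a:] + pCons 0 p" by simp
    then have "poly_to_laurent (pCons a p) = Poly_Mapping.single 0 a + Poly_Mapping.single 1 1 * poly_to_laurent p"
      by (metis add const shift)
    then show ?case using pCons by (simp add: add smult shift distrib_right mult.assoc)
  qed
  show "poly_to_laurent (1 :: 'a poly) = 1" using const[of 1] by (simp add: one_pCons)
qed

lemma poly_t_to_u_hom: "poly_t_to_u \<in> ring_hom univ_ring univ_ring"
  using ring_hom_trans[OF poly_to_laurent_hom laurent_t_to_u_hom] by (simp add: comp_def poly_t_to_u_def[abs_def])

lemma inj_poly_t_to_u: "inj poly_t_to_u"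
proof (rule injI)
  fix p q :: "'a poly" assume "poly_t_to_u p = poly_t_to_u q"
  then have "Poly_Mapping.lookup (poly_t_to_u p) (2 * int n) = Poly_Mapping.lookup (poly_t_to_u q) (2 * int n)" for n by simp
  then show "p = q" by (simp add: lookup_poly_t_to_u poly_eq_iff)
qed

lemma poly_t_to_u_const: "poly_t_to_u [:c:] = Poly_Mapping.single 0 c"
  by (rule poly_mapping_eqI) (auto simp: lookup_poly_t_to_u lookup_single when_def coeff_pCons split: nat.split)

lemma poly_t_to_u_t: "poly_t_to_u [:0, 1:] = Poly_Mapping.single 2 1"
proof (rule poly_mapping_eqI)
  fix m :: int
  have "nat (m div 2) = 1 \<longleftrightarrow> m = 2" if "even m" using that by (auto elim!: evenE)
  then show "Poly_Mapping.lookup (poly_t_to_u [:0, 1:]) m = Poly_Mapping.lookup (Poly_Mapping.single 2 (1::'a)) m"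
    by (auto simp: lookup_poly_t_to_u lookup_single when_def coeff_pCons split: nat.split)
qed

lemma map_poly_t_to_u:
  assumes "f 0 = 0"
  shows "Poly_Mapping.map f (poly_t_to_u p) = poly_t_to_u (map_poly f p)"
  by (rule poly_mapping_eqI) (auto simp: lookup_poly_t_to_u lookup_map assms coeff_map_poly)

text \<open>The involution \<open>u \<mapsto> -u\<close>.\<close>

definition laurent_sign :: "'f::comm_ring_1 laurent \<Rightarrow> 'f laurent" where
  "laurent_sign = Poly_Mapping.mapp (\<lambda>k c. if even k then c else - c)"

lemma lookup_laurent_sign:
  "Poly_Mapping.lookup (laurent_sign p) k = (if even k then Poly_Mapping.lookup p k else - Poly_Mapping.lookup p k)"
  by (auto simp: laurent_sign_def lookup_mapp when_def in_keys_iff)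

lemma laurent_sign_single: "laurent_sign (Poly_Mapping.single k c) = Poly_Mapping.single k (if even k then c else - c)"
  by (rule poly_mapping_eqI) (auto simp: lookup_laurent_sign lookup_single when_def)

lemma laurent_sign_hom: "laurent_sign \<in> ring_hom univ_ring univ_ring"
  by (rule poly_mapping_hom_multI)
     (auto intro: poly_mapping_eqI simp: lookup_laurent_sign lookup_add laurent_sign_single mult_single simp flip: single_one)

lemma laurent_sign_t_to_u: "laurent_sign (poly_t_to_u p) = poly_t_to_u p"
  by (rule poly_mapping_eqI) (auto simp: lookup_laurent_sign lookup_poly_t_to_u)

lemma laurent_sign_involution: "laurent_sign (laurent_sign p) = p"
  by (rule poly_mapping_eqI) (auto simp: lookup_laurent_sign)

text \<open>An odd coefficient equals its negative, hence is zero in characteristic 0; what remains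
  are nonnegative even powers of u, that is, powers of t.\<close>

lemma even_laurent_poly:
  fixes s :: "'f::{comm_ring_1, ring_char_0, idom} laurent"
  assumes "laurent_sign s = s" "\<And>m. m < 0 \<Longrightarrow> Poly_Mapping.lookup s m = 0"
  shows "\<exists>r. s = poly_t_to_u r"
proof -
  let ?r = "Abs_poly (\<lambda>i. Poly_Mapping.lookup s (2 * int i))"
  have "finite {i. Poly_Mapping.lookup s (2 * int i) \<noteq> 0}"
    by (rule finite_imageD[of "\<lambda>i. 2 * int i", OF finite_subset[of _ "Poly_Mapping.keys s"]]) (auto simp: in_keys_iff inj_on_def)
  then have c: "coeff ?r i = Poly_Mapping.lookup s (2 * int i)" for i
    by (subst Abs_poly_inverse) (simp_all add: MOST_iff_cofinite)
  have o: "Poly_Mapping.lookup s m = 0" if "odd m" for m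
  proof -
    have "- Poly_Mapping.lookup s m = Poly_Mapping.lookup s m"
      using arg_cong[OF assms(1), of "\<lambda>s. Poly_Mapping.lookup s m"] that by (simp add: lookup_laurent_sign)
    then have "2 * Poly_Mapping.lookup s m = 0" by (metis mult_2 add.left_inverse)
    then show ?thesis by simp
  qed
  have "s = poly_t_to_u ?r"
  proof (rule poly_mapping_eqI)
    fix m show "Poly_Mapping.lookup s m = Poly_Mapping.lookup (poly_t_to_u ?r) m"
      using o[of m] assms(2)[of m] by (auto simp: lookup_poly_t_to_u c)
  qed
  then show ?thesis ..
qed

text \<open>Finitely many Laurent polynomials have bounded pole order. The factor is an even power
  of u, so it preserves invariance under u -> -u.\<close>

lemma common_denominator:
  fixes s :: "'i \<Rightarrow> 'f::{comm_ring_1, ring_char_0, idom} laurent"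
  assumes "finite I" "\<And>i. i \<in> I \<Longrightarrow> laurent_sign (s i) = s i"
  shows "\<exists>n r. \<forall>i\<in>I. Poly_Mapping.single (2 * int n) 1 * s i = poly_t_to_u (r i)"
proof -
  let ?K = "\<Union>i\<in>I. Poly_Mapping.keys (s i)"
  have "finite ?K" using assms(1) by simp
  then obtain n where n: "\<And>k. k \<in> ?K \<Longrightarrow> - k \<le> 2 * int n"
  proof -
    assume f: "finite ?K" and th: "\<And>n. (\<And>k. k \<in> ?K \<Longrightarrow> - k \<le> 2 * int n) \<Longrightarrow> thesis"
    \<comment> \<open>The sum of all pole orders is a crude bound for each of them.\<close>
    have "- k \<le> 2 * int (\<Sum>k\<in>?K. nat (- k))" if "k \<in> ?K" for k
    proof -
      have "nat (- k) \<le> (\<Sum>k\<in>?K. nat (- k))" using that f by (intro member_le_sum) auto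
      then show ?thesis by linarith
    qed
    then show thesis by (rule th)
  qed
  have "\<exists>r. Poly_Mapping.single (2 * int n) 1 * s i = poly_t_to_u r" if i: "i \<in> I" for i
  proof (rule even_laurent_poly)
    show "laurent_sign (Poly_Mapping.single (2 * int n) 1 * s i) = Poly_Mapping.single (2 * int n) 1 * s i"
      by (simp add: univ_homD(2)[OF laurent_sign_hom] laurent_sign_single assms(2)[OF i])
    fix m :: int assume "m < 0"
    then have "m - 2 * int n \<notin> Poly_Mapping.keys (s i)" using n[of "m - 2 * int n"] i by fastforce
    then show "Poly_Mapping.lookup (Poly_Mapping.single (2 * int n) 1 * s i) m = 0"
      by (simp add: lookup_monom_mult in_keys_iff)
  qed
  then show ?thesis by metis
qed

section \<open>Determinants\<close>

lemma univ_hom_sum: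
  assumes "cring T" "h \<in> ring_hom univ_ring T" "finite I"
  shows "h (\<Sum>i\<in>I. f i) = finsum T (\<lambda>i. h (f i)) I" "h (\<Prod>i\<in>I. f i) = finprod T (\<lambda>i. h (f i)) I"
proof -
  interpret cring T by fact
  note h = ring_hom_closed[OF assms(2), simplified] ring_hom_add[OF assms(2), simplified]
    ring_hom_mult[OF assms(2), simplified] ring_hom_one[OF assms(2), simplified]
  have z: "h 0 = \<zero>\<^bsub>T\<^esub>"
    using h(2)[of 0 0] h(1)[of 0] by (metis add.r_cancel_one add_0)
  show "h (\<Sum>i\<in>I. f i) = finsum T (\<lambda>i. h (f i)) I"
    using assms(3) by (induction I) (simp_all add: z h finsum_insert Pi_def)
  show "h (\<Prod>i\<in>I. f i) = finprod T (\<lambda>i. h (f i)) I"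
    using assms(3) by (induction I) (simp_all add: h Pi_def)
qed

text \<open>T is a record ring while \<open>det\<close> lives on type-class rings, so the image is
  spelled out by the Leibniz formula in T.\<close>

lemma univ_hom_det:
  fixes P :: "'a::comm_ring_1^'n^'n"
  assumes T: "cring T" and k: "k \<in> ring_hom univ_ring T"
  shows "k (det P) = finsum T (\<lambda>p. (if sign p = 1 then \<one>\<^bsub>T\<^esub> else \<ominus>\<^bsub>T\<^esub> \<one>\<^bsub>T\<^esub>) \<otimes>\<^bsub>T\<^esub> finprod T (\<lambda>i. k (P $ i $ p i)) UNIV) {p. p permutes UNIV}"
proof -
  interpret cring T by fact
  have u: "k (of_int (sign p)) = (if sign p = 1 then \<one>\<^bsub>T\<^esub> else \<ominus>\<^bsub>T\<^esub> \<one>\<^bsub>T\<^esub>)" for p :: "'n \<Rightarrow> 'n"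
  proof (cases p rule: sign_cases)
    case even then show ?thesis using ring_hom_one[OF k] by simp
  next
    case odd
    have z: "k 0 = \<zero>\<^bsub>T\<^esub>" using univ_hom_sum(1)[OF T k, of "{}"] by simp
    have "k (-1) \<oplus>\<^bsub>T\<^esub> k 1 = \<zero>\<^bsub>T\<^esub>" using ring_hom_add[OF k, of "-1" 1] z by simp
    then have "k (-1) = \<ominus>\<^bsub>T\<^esub> \<one>\<^bsub>T\<^esub>"
      using minus_equality[of "k (-1)" "k 1"] ring_hom_closed[OF k] ring_hom_one[OF k] by simp
    then show ?thesis using odd by simp
  qed
  show ?thesis
    unfolding det_def univ_hom_sum(1)[OF T k finite_permutations[OF finite]]
    using ring_hom_mult[OF k]
    by (intro finsum_cong') (auto simp: u univ_hom_sum(2)[OF T k] intro!: finprod_closed ring_hom_closed[OF k])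
qed

text \<open>Compares determinants over two type-class rings through their images in T. Identities
  are proved for generic matrices over polynomial rings and transferred to T in this way.\<close>

lemma det_hom_cong:
  fixes M :: "'a::comm_ring_1^'n^'n" and N :: "'b::comm_ring_1^'n^'n"
  assumes "cring T" "g \<in> ring_hom univ_ring T" "h \<in> ring_hom univ_ring T"
    "\<And>i j. g (M $ i $ j) = h (N $ i $ j)"
  shows "g (det M) = h (det N)"
  using assms by (simp add: univ_hom_det)

text \<open>Rows outside the range of f are rows of the identity matrix, so a permutation
  contributes only if it fixes all indices outside this range. These permutations correspond to
  those of the smaller index type, with the same sign.\<close>

lemma det_embedded:
  fixes M :: "'a::comm_ring_1^'m^'m" and X :: "'a^'n^'n" and f :: "'n \<Rightarrow> 'm"
  assumes "inj f" "\<And>i j. i \<notin> range f \<Longrightarrow> M $ i $ j = (if i = j then 1 else 0)" "\<And>a b. M $ f a $ f b = X $ a $ b"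
  shows "det M = det X"
proof -
  let ?t = "\<lambda>p. of_int (sign p) * (\<Prod>i\<in>UNIV. M $ i $ p i)"
  let ?e = "map_permutation UNIV f"
  have b: "bij_betw f UNIV (range f)" using assms(1) by (simp add: bij_betw_def)
  have b': "bij_betw (inv_into UNIV f) (range f) UNIV" using assms(1) by (simp add: bij_betw_inv_into[OF b])
  have bij: "bij_betw ?e {p. p permutes UNIV} {p. p permutes range f}"
  proof (rule bij_betwI[where g = "map_permutation (range f) (inv_into UNIV f)"])
    show "?e \<in> {p. p permutes UNIV} \<rightarrow> {p. p permutes range f}"
      using map_permutation_permutes[OF b] by auto
    show "map_permutation (range f) (inv_into UNIV f) \<in> {p. p permutes range f} \<rightarrow> {p. p permutes UNIV}"
      using map_permutation_permutes[OF b'] by auto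
    show "map_permutation (range f) (inv_into UNIV f) (?e p) = p" if "p \<in> {p. p permutes UNIV}" for p
      using that assms(1) by (intro map_permutation_compose_inv[OF b]) auto
    show "?e (map_permutation (range f) (inv_into UNIV f) p) = p" if "p \<in> {p. p permutes range f}" for p
      using that by (intro map_permutation_compose_inv[OF b']) (auto simp: f_inv_into_f)
  qed
  have "det M = (\<Sum>p\<in>{p. p permutes range f}. ?t p)"
    unfolding det_def
  proof (rule sum.mono_neutral_right)
    show "\<forall>p\<in>{p. p permutes UNIV} - {p. p permutes range f}. ?t p = 0"
    proof
      fix p assume p: "p \<in> {p. p permutes UNIV} - {p. p permutes range f}"
      have "\<exists>i. i \<notin> range f \<and> p i \<noteq> i"
      proof (rule ccontr)
        assume "\<not> ?thesis"
        then have "p permutes range f" using p unfolding permutes_def by auto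
        then show False using p by simp
      qed
      then obtain i where "i \<notin> range f" "p i \<noteq> i" by blast
      then have "M $ i $ p i = 0" using assms(2) by simp
      then have "(\<Prod>i\<in>UNIV. M $ i $ p i) = 0" by (intro prod_zero) auto
      then show "?t p = 0" by simp
    qed
  qed (auto intro: permutes_subset)
  also have "\<dots> = (\<Sum>p\<in>{p. p permutes UNIV}. ?t (?e p))"
    using sum.reindex_bij_betw[OF bij, of ?t] by simp
  also have "\<dots> = det X"
    unfolding det_def
  proof (rule sum.cong[OF HOL.refl])
    fix p :: "'n \<Rightarrow> 'n" assume "p \<in> {p. p permutes UNIV}"
    then have p: "p permutes UNIV" by simp
    have ef: "?e p (f a) = f (p a)" for a
      using assms(1) by (simp add: map_permutation_def)
    have en: "?e p i = i" if "i \<notin> range f" for i using that by (simp add: map_permutation_def)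
    have "(\<Prod>i\<in>UNIV. M $ i $ ?e p i) = (\<Prod>i\<in>range f. M $ i $ ?e p i)"
      by (rule prod.mono_neutral_right) (auto simp: en assms(2))
    also have "\<dots> = (\<Prod>a\<in>UNIV. X $ a $ p a)"
      using assms(1) by (subst prod.reindex) (auto simp: ef assms(3))
    finally show "?t (?e p) = of_int (sign p) * (\<Prod>i\<in>UNIV. X $ i $ p i)"
      using sign_map_permutation[OF _ p, of f] assms(1) by simp
  qed
  finally show ?thesis .
qed

section \<open>Block matrices\<close>

fun block :: "('n \<Rightarrow> 'n \<Rightarrow> 'a) \<Rightarrow> ('n \<Rightarrow> 'n \<Rightarrow> 'a) \<Rightarrow> ('n \<Rightarrow> 'n \<Rightarrow> 'a) \<Rightarrow> ('n \<Rightarrow> 'n \<Rightarrow> 'a) \<Rightarrow> 'n + 'n \<Rightarrow> 'n + 'n \<Rightarrow> 'a" where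
  "block A B C D (Inl i) (Inl j) = A i j"
| "block A B C D (Inl i) (Inr j) = B i j"
| "block A B C D (Inr i) (Inl j) = C i j"
| "block A B C D (Inr i) (Inr j) = D i j"

definition block_matrix :: "('n::finite \<Rightarrow> 'n \<Rightarrow> 'a) \<Rightarrow> ('n \<Rightarrow> 'n \<Rightarrow> 'a) \<Rightarrow> ('n \<Rightarrow> 'n \<Rightarrow> 'a) \<Rightarrow> ('n \<Rightarrow> 'n \<Rightarrow> 'a) \<Rightarrow> 'a^('n + 'n)^('n + 'n)" where
  "block_matrix A B C D = (\<chi> i j. block A B C D i j)"

lemma sum_plus_UNIV: "(\<Sum>k\<in>(UNIV :: ('n::finite + 'n) set). f k) = (\<Sum>k\<in>UNIV. f (Inl k)) + (\<Sum>k\<in>UNIV. f (Inr k))"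
  by (simp add: UNIV_Plus_UNIV[symmetric] sum.Plus del: UNIV_Plus_UNIV)

lemma block_matrix_mult:
  "block_matrix A B C D ** block_matrix A' B' C' D' = block_matrix
     (\<lambda>i j. (\<Sum>k\<in>UNIV. A i k * A' k j) + (\<Sum>k\<in>UNIV. B i k * C' k j))
     (\<lambda>i j. (\<Sum>k\<in>UNIV. A i k * B' k j) + (\<Sum>k\<in>UNIV. B i k * D' k j))
     (\<lambda>i j. (\<Sum>k\<in>UNIV. C i k * A' k j) + (\<Sum>k\<in>UNIV. D i k * C' k j))
     (\<lambda>i j. (\<Sum>k\<in>UNIV. C i k * B' k j) + (\<Sum>k\<in>UNIV. D i k * D' k j))"
proof -
  have "(\<Sum>k\<in>UNIV. block A B C D i k * block A' B' C' D' k j) = block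
     (\<lambda>i j. (\<Sum>k\<in>UNIV. A i k * A' k j) + (\<Sum>k\<in>UNIV. B i k * C' k j))
     (\<lambda>i j. (\<Sum>k\<in>UNIV. A i k * B' k j) + (\<Sum>k\<in>UNIV. B i k * D' k j))
     (\<lambda>i j. (\<Sum>k\<in>UNIV. C i k * A' k j) + (\<Sum>k\<in>UNIV. D i k * C' k j))
     (\<lambda>i j. (\<Sum>k\<in>UNIV. C i k * B' k j) + (\<Sum>k\<in>UNIV. D i k * D' k j)) i j" for i j
    unfolding sum_plus_UNIV by (cases i; cases j) simp_all
  then show ?thesis by (simp add: block_matrix_def matrix_matrix_mult_def vec_eq_iff)
qed

lemma delta_sums:
  fixes c :: "'a::comm_ring_1" and F :: "'n::finite \<Rightarrow> 'a"
  shows "(\<Sum>k\<in>UNIV. (if i = k then c else 0) * F k) = c * F i" "(\<Sum>k\<in>UNIV. F k * (if k = i then c else 0)) = F i * c"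
  by (simp_all add: if_distrib if_distribR cong: if_cong)

text \<open>The matrix is the product of diag(X, 1) and diag(1, Y), to each of which
  \<open>det_embedded\<close> applies.\<close>

lemma det_block_diagonal:
  fixes X Y :: "'n::finite \<Rightarrow> 'n \<Rightarrow> 'a::comm_ring_1"
  shows "det (block_matrix X (\<lambda>i j. 0) (\<lambda>i j. 0) Y) = det (\<chi> i j. X i j) * det (\<chi> i j. Y i j)"
proof -
  let ?I = "\<lambda>i j. if i = j then 1 else 0 :: 'a"
  let ?Z = "\<lambda>i j. 0 :: 'a"
  have "block_matrix X ?Z ?Z Y = block_matrix X ?Z ?Z ?I ** block_matrix ?I ?Z ?Z Y"
    unfolding block_matrix_mult delta_sums by simp
  then have "det (block_matrix X ?Z ?Z Y) = det (block_matrix X ?Z ?Z ?I) * det (block_matrix ?I ?Z ?Z Y)"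
    by (simp add: det_mul)
  moreover have "det (block_matrix X ?Z ?Z ?I) = det (\<chi> i j. X i j)"
  proof (rule det_embedded[of Inl])
    fix i j :: "'n + 'n" assume "i \<notin> range Inl"
    then obtain k where "i = Inr k" by (cases i) auto
    then show "block_matrix X ?Z ?Z ?I $ i $ j = (if i = j then 1 else 0)"
      by (cases j) (auto simp: block_matrix_def)
  qed (auto simp: block_matrix_def)
  moreover have "det (block_matrix ?I ?Z ?Z Y) = det (\<chi> i j. Y i j)"
  proof (rule det_embedded[of Inr])
    fix i j :: "'n + 'n" assume "i \<notin> range Inr"
    then obtain k where "i = Inl k" by (cases i) auto
    then show "block_matrix ?I ?Z ?Z Y $ i $ j = (if i = j then 1 else 0)"
      by (cases j) (auto simp: block_matrix_def)
  qed (auto simp: block_matrix_def)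
  ultimately show ?thesis by simp
qed

text \<open>Conjugation of the block diagonal matrix of X and Y by P, whose inverse uses that u and 2 are units.\<close>

lemma det_conjugated:
  fixes X Y :: "'n::finite \<Rightarrow> 'n \<Rightarrow> 'a::comm_ring_1"
  assumes u: "u * w = 1" and h: "h + h = 1"
  shows "det (block_matrix (\<lambda>i j. h * (X i j + Y i j)) (\<lambda>i j. h * u * (X i j - Y i j))
      (\<lambda>i j. h * w * (X i j - Y i j)) (\<lambda>i j. h * (X i j + Y i j))) = det (\<chi> i j. X i j) * det (\<chi> i j. Y i j)"
    (is "det ?M = _")
proof -
  let ?Z = "\<lambda>i j. 0 :: 'a"
  let ?I = "\<lambda>(c::'a) (i::'n) j. if i = j then c else 0"
  \<comment> \<open>P and its inverse, where w and h stand for the inverses of u and of 2.\<close>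
  let ?P = "block_matrix (?I u) (?I (-u)) (?I 1) (?I 1)"
  let ?Q = "block_matrix (?I (h * w)) (?I h) (?I (- h * w)) (?I h)"
  let ?D = "block_matrix X ?Z ?Z Y"
  have e: "h * a + h * a = a" for a using h by (metis distrib_right mult_1)
  have e2: "a * h + a * h = a" "h * (a * b) + h * (a * b) = a * b" "u * (h * w) + u * (h * w) = 1" for a b
    using e[of a] e[of "a * b"] e[of "u * w"] u by (simp_all add: mult.commute mult.left_commute)
  have "(?P ** ?Q) $ i $ j = mat 1 $ i $ j" for i j
    unfolding block_matrix_mult delta_sums
    by (cases i; cases j) (use e2 h in \<open>auto simp: block_matrix_def mat_def\<close>)
  then have "?P ** ?Q = mat 1" by (simp add: vec_eq_iff)
  then have "det (?P ** ?Q) = 1" by simp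
  then have PQ: "det ?P * det ?Q = 1" unfolding det_mul .
  \<comment> \<open>M = P D P^-1 in the form M P = P D, which asks for one block product on each
    side.\<close>
  have "?M ** ?P = ?P ** ?D"
  proof -
    have k1: "h * (x + y) * u + h * u * (x - y) = u * x" "h * u * (x - y) - h * (x + y) * u = - (u * y)"
      "h * w * (x - y) * u + h * (x + y) = x" "h * (x + y) - h * w * (x - y) * u = y" for x y
    proof -
      have "h * (x + y) * u + h * u * (x - y) = (h + h) * u * x" by (simp add: algebra_simps)
      then show "h * (x + y) * u + h * u * (x - y) = u * x" using h by simp
      have "h * u * (x - y) - h * (x + y) * u = - ((h + h) * u * y)" by (simp add: algebra_simps)
      then show "h * u * (x - y) - h * (x + y) * u = - (u * y)" using h by simp
      have "h * w * (x - y) * u = h * (u * w) * (x - y)" by (simp add: algebra_simps)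
      then have w: "h * w * (x - y) * u = h * (x - y)" using u by simp
      have "h * (x - y) + h * (x + y) = (h + h) * x" by (simp add: algebra_simps)
      then show "h * w * (x - y) * u + h * (x + y) = x" using h w by simp
      have "h * (x + y) - h * (x - y) = (h + h) * y" by (simp add: algebra_simps)
      then show "h * (x + y) - h * w * (x - y) * u = y" using h w by simp
    qed
    show ?thesis unfolding block_matrix_mult delta_sums by (simp add: k1)
  qed
  then have "det (?M ** ?P) = det (?P ** ?D)" by (rule arg_cong)
  then have "det ?M * det ?P = det ?P * det ?D" unfolding det_mul .
  then have "(det ?M * det ?P) * det ?Q = (det ?P * det ?D) * det ?Q" by (rule arg_cong)
  also have "(det ?P * det ?D) * det ?Q = det ?D * (det ?P * det ?Q)" by (simp only: mult.commute mult.left_commute mult.assoc)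
  finally have "det ?M = det ?D" unfolding mult.assoc PQ mult_1_right .
  then show ?thesis unfolding det_block_diagonal .
qed

text \<open>Cramer's rule: by linearity in column i, the sum is the determinant of the generic
  matrix with column i replaced by column l. For i different from l, two columns coincide.\<close>

lemma adjugate_mult:
  "(\<Sum>j\<in>UNIV. adjugate_entry i j * mat_var j l) = (if i = l then det (\<chi> i j. mat_var i j) else (0 :: ('m::finite, 'r::comm_ring_1) mat_poly))"
proof -
  \<comment> \<open>Transposed, because linearity and the vanishing for repeated entries are applied
    to rows.\<close>
  have t: "adjugate_entry i j = det (\<chi> k. if k = i then axis j 1 else (\<chi> l. mat_var l k) :: (('m, 'r) mat_poly)^'m^'m)" for j
    unfolding adjugate_entry_def
    by (subst det_transpose[symmetric]) (auto simp: transpose_def vec_eq_iff axis_def intro!: arg_cong[where f = det])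
  have "(\<Sum>j\<in>UNIV. adjugate_entry i j * mat_var j l) =
    (\<Sum>j\<in>UNIV. det (\<chi> k. if k = i then mat_var j l *s axis j 1 else (\<chi> l. mat_var l k) :: (('m, 'r) mat_poly)^'m^'m))"
    unfolding t det_row_mul by (simp add: mult.commute)
  also have "\<dots> = det (\<chi> k. if k = i then (\<Sum>j\<in>UNIV. mat_var j l *s axis j 1) else (\<chi> l. mat_var l k) :: (('m, 'r) mat_poly)^'m^'m)"
    by (rule det_linear_row_sum[symmetric]) simp
  also have "(\<Sum>j\<in>UNIV. mat_var j l *s axis j 1) = (\<chi> j. mat_var j l :: (('m, 'r) mat_poly)^'m)"
    by (simp add: vec_eq_iff axis_def if_distrib cong: if_cong)
  also have "det (\<chi> k. if k = i then (\<chi> j. mat_var j l) else (\<chi> l. mat_var l k) :: (('m, 'r) mat_poly)^'m^'m) =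
    (if i = l then det (\<chi> i j. mat_var i j) else 0)"
  proof (cases "i = l")
    case True
    then have "(\<chi> k. if k = i then (\<chi> j. mat_var j l) else (\<chi> l. mat_var l k) :: (('m, 'r) mat_poly)^'m^'m) = transpose (\<chi> i j. mat_var i j)"
      by (auto simp: vec_eq_iff transpose_def)
    then show ?thesis using True by simp
  next
    case False
    then have "row i (\<chi> k. if k = i then (\<chi> j. mat_var j l) else (\<chi> l. mat_var l k) :: (('m, 'r) mat_poly)^'m^'m) =
      row l (\<chi> k. if k = i then (\<chi> j. mat_var j l) else (\<chi> l. mat_var l k) :: (('m, 'r) mat_poly)^'m^'m)"
      by (auto simp: row_def vec_eq_iff)
    from det_identical_rows[OF False this] show ?thesis using False by simp
  qed
  finally show ?thesis .
qed

section \<open>The coordinate ring of SL and its Hopf quotients\<close>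

lemma algebra_mat_poly: "algebra univ_ring (mat_poly_alg :: ('r::comm_ring_1, ('m, 'r) mat_poly) module)"
  unfolding mat_poly_alg_def by (rule algebra_univ_alg[OF single_hom])

lemma mat_poly_alg_simps [simp]:
  "carrier mat_poly_alg = UNIV" "x \<oplus>\<^bsub>mat_poly_alg\<^esub> y = x + y" "x \<otimes>\<^bsub>mat_poly_alg\<^esub> y = x * y"
  "\<zero>\<^bsub>mat_poly_alg\<^esub> = 0" "\<one>\<^bsub>mat_poly_alg\<^esub> = 1" "r \<odot>\<^bsub>mat_poly_alg\<^esub> x = Poly_Mapping.single 0 r * x"
  by (simp_all add: mat_poly_alg_def)

lemma SL_ideal_iff: "x \<in> (SL_ideal :: ('m::finite, 'r::comm_ring_1) mat_poly set) \<longleftrightarrow> (\<exists>z. x = z * (det (\<chi> i j. mat_var i j) - 1))"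
  by (auto simp: SL_ideal_def cgenideal_def)

lemma quotient_algebra_SL: "quotient_algebra (mat_poly_alg :: ('r::comm_ring_1, ('m::finite, 'r) mat_poly) module) SL_ideal"
proof -
  interpret P: algebra univ_ring "mat_poly_alg :: ('r, ('m, 'r) mat_poly) module" by (rule algebra_mat_poly)
  show ?thesis unfolding SL_ideal_def
    by (intro quotient_algebra.intro algebra_mat_poly P.cgenideal_ideal) simp
qed

lemma SL_class_eq: "SL_class = (\<lambda>p. SL_ideal +>\<^bsub>mat_poly_alg\<^esub> p)"
  by (simp add: SL_class_def fun_eq_iff)

lemma same_algebraD:
  assumes "same_algebra A A'"
  shows "carrier A = carrier A'" "monoid.mult A = monoid.mult A'" "one A = one A'"
    "zero A = zero A'" "add A = add A'" "module.smult A = module.smult A'"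
  using assms by (simp_all only: same_algebra_def)

lemma same_algebra_SL: "same_algebra SL SL_alg"
  by (simp add: same_algebra_def SL_def Let_def module.defs hopf.defs)

lemma algebra_SL_alg: "algebra univ_ring SL_alg"
  unfolding SL_alg_def by (rule quotient_algebra.algebra_quot[OF quotient_algebra_SL])

lemma algebra_SL: "algebra univ_ring SL"
  by (rule same_algebra_algebra[OF same_algebra_sym[OF same_algebra_SL] algebra_SL_alg])

lemma SL_simps: "carrier SL = carrier SL_alg" "monoid.mult SL = monoid.mult SL_alg" "one SL = one SL_alg"
  "zero SL = zero SL_alg" "add SL = add SL_alg" "module.smult SL = module.smult SL_alg"
  by (rule same_algebraD[OF same_algebra_SL])+

lemma SL_class_hom: "SL_class \<in> ring_hom mat_poly_alg SL" "SL_class \<in> semilinear id mat_poly_alg SL"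
  using quotient_algebra.proj_ring_hom[OF quotient_algebra_SL] quotient_algebra.proj_semilinear[OF quotient_algebra_SL]
  by (simp_all add: ring_hom_def semilinear_def additive_maps_def SL_simps SL_alg_def SL_class_eq)

lemma SL_class_closed [simp]: "SL_class p \<in> carrier SL"
  using semilinearD(1)[OF SL_class_hom(2), of p] by simp

lemma SL_ops:
  fixes p q :: "('m::finite, 'r::comm_ring_1) mat_poly"
  shows "SL_class p \<oplus>\<^bsub>SL\<^esub> SL_class q = SL_class (p + q)" "SL_class p \<otimes>\<^bsub>SL\<^esub> SL_class q = SL_class (p * q)"
    "\<one>\<^bsub>SL\<^esub> = SL_class (1 :: ('m, 'r) mat_poly)" "r \<odot>\<^bsub>SL\<^esub> SL_class p = SL_class (Poly_Mapping.single 0 r * p)"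
proof -
  have h: "SL_class \<in> ring_hom mat_poly_alg (SL :: ('r, ('m, 'r) mat_poly set) hopf)" by (rule SL_class_hom)
  show "SL_class p \<oplus>\<^bsub>SL\<^esub> SL_class q = SL_class (p + q)" "SL_class p \<otimes>\<^bsub>SL\<^esub> SL_class q = SL_class (p * q)"
    "\<one>\<^bsub>SL\<^esub> = SL_class (1 :: ('m, 'r) mat_poly)" "r \<odot>\<^bsub>SL\<^esub> SL_class p = SL_class (Poly_Mapping.single 0 r * p)"
    using ring_hom_add[OF h, of p q] ring_hom_mult[OF h, of p q] ring_hom_one[OF h]
      semilinearD(3)[OF SL_class_hom(2), of p r] by simp_all
qed

text \<open>Functions on the coordinate ring are defined through \<open>rep\<close>, so the case
  rule supplies the polynomial \<open>rep X\<close> itself rather than an arbitrary member of the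
  class.\<close>

lemma SL_cases:
  assumes "X \<in> carrier SL" obtains p where "X = SL_class p" "rep X = p"
proof (rule that[of "rep X"])
  show "X = SL_class (rep X)"
    using quotient_algebra.rep_quot(2)[OF quotient_algebra_SL, of X] assms
    by (simp add: SL_simps SL_alg_def SL_class_eq)
qed simp

lemma comult_SL: "comult SL X = mat_poly_eval (tens SL SL)
    (\<lambda>i j. finsum (tens SL SL) (\<lambda>k. pure SL SL (SL_class (mat_var i k)) (SL_class (mat_var k j))) UNIV) (rep X)"
  unfolding tensor_cong(1,2)[OF HOL.refl same_algebra_SL same_algebra_SL]
  by (simp add: SL_def Let_def module.defs hopf.defs)

lemma counit_SL: "counit SL X = mat_poly_eval (univ_alg id) (\<lambda>i j. if i = j then 1 else 0) (rep X)"
  by (simp add: SL_def Let_def module.defs hopf.defs)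

lemma mat_poly_eval_same:
  assumes "same_algebra T T'" shows "mat_poly_eval T = mat_poly_eval T'"
proof -
  note e = same_algebraD[OF assms]
  have p: "([^]\<^bsub>T\<^esub>) = (([^]\<^bsub>T'\<^esub>) :: _ \<Rightarrow> nat \<Rightarrow> _)"
    unfolding nat_pow_def e ..
  have f2: "finsum T f I = finsum T' f I" "finprod T g K = finprod T' g K"
    for f :: "_ \<Rightarrow> _" and I and g :: "_ \<Rightarrow> _" and K
    unfolding finsum_def finprod_def e partial_object.select_convs monoid.select_convs by simp_all
  show ?thesis unfolding mat_poly_eval_def[abs_def] p e f2 ..
qed

lemma antipode_SL: "antipode SL X = mat_poly_eval SL (\<lambda>i j. SL_class (adjugate_entry i j)) (rep X)"
  unfolding mat_poly_eval_same[OF same_algebra_SL]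
  by (simp add: SL_def Let_def module.defs hopf.defs)

lemma (in abelian_monoid) finsum_swap:
  assumes "finite I" "finite J" "\<And>i j. i \<in> I \<Longrightarrow> j \<in> J \<Longrightarrow> f i j \<in> carrier G"
  shows "finsum G (\<lambda>i. finsum G (f i) J) I = finsum G (\<lambda>j. finsum G (\<lambda>i. f i j) I) J"
  using assms(1,3)
proof (induction I)
  case empty show ?case by (simp add: finsum_zero)
next
  case (insert i I)
  have "finsum G (\<lambda>j. finsum G (\<lambda>i. f i j) (insert i I)) J = finsum G (\<lambda>j. f i j \<oplus> finsum G (\<lambda>i. f i j) I) J"
    using insert by (intro finsum_cong') (auto simp: finsum_insert Pi_iff intro!: finsum_closed)
  also have "\<dots> = finsum G (f i) J \<oplus> finsum G (\<lambda>j. finsum G (\<lambda>i. f i j) I) J"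
    using insert by (subst finsum_addf) (auto intro!: finsum_closed)
  finally show ?case using insert by (subst finsum_insert) (auto intro!: finsum_closed)
qed

lemma (in cring) finsum_delta:
  assumes "finite I" "i \<in> I" "f \<in> I \<rightarrow> carrier R"
  shows "finsum R (\<lambda>k. if k = i then f k else \<zero>) I = f i"
proof -
  have "finsum R (\<lambda>k. if k = i then f k else \<zero>) (insert i (I - {i})) = f i \<oplus> finsum R (\<lambda>k. if k = i then f k else \<zero>) (I - {i})"
    using assms by (subst finsum_insert) auto
  also have "finsum R (\<lambda>k. if k = i then f k else \<zero>) (I - {i}) = finsum R (\<lambda>k. \<zero>) (I - {i})"
    by (rule finsum_cong') auto
  finally show ?thesis using assms funcset_mem[OF assms(3,2)] by (simp add: insert_absorb finsum_zero)
qed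

lemma (in cring) matrix_inverse_unique:
  fixes a b c :: "'m::finite \<Rightarrow> 'm \<Rightarrow> 'a"
  assumes cl: "\<And>i j. a i j \<in> carrier R" "\<And>i j. b i j \<in> carrier R" "\<And>i j. c i j \<in> carrier R"
    and l: "\<And>i j. finsum R (\<lambda>k. a i k \<otimes> b k j) UNIV = (if i = j then \<one> else \<zero>)"
    and r: "\<And>i j. finsum R (\<lambda>k. b i k \<otimes> c k j) UNIV = (if i = j then \<one> else \<zero>)"
  shows "a i j = c i j"
proof -
  have "c i j = finsum R (\<lambda>k. if k = i then c k j else \<zero>) UNIV" using cl by (simp add: finsum_delta)
  also have "\<dots> = finsum R (\<lambda>k. finsum R (\<lambda>l. a i l \<otimes> b l k \<otimes> c k j) UNIV) UNIV"
    using cl by (intro finsum_cong') (auto simp: finsum_ldistr[symmetric] l)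
  also have "\<dots> = finsum R (\<lambda>l. finsum R (\<lambda>k. a i l \<otimes> b l k \<otimes> c k j) UNIV) UNIV"
    using cl by (intro finsum_swap) auto
  also have "\<dots> = finsum R (\<lambda>l. if l = j then a i l else \<zero>) UNIV"
  proof (rule finsum_cong')
    fix l
    have "finsum R (\<lambda>k. a i l \<otimes> b l k \<otimes> c k j) UNIV = finsum R (\<lambda>k. a i l \<otimes> (b l k \<otimes> c k j)) UNIV"
      using cl by (intro finsum_cong') (auto simp: m_assoc)
    also have "\<dots> = a i l \<otimes> finsum R (\<lambda>k. b l k \<otimes> c k j) UNIV"
      using cl by (intro finsum_rdistr[symmetric]) auto
    finally show "finsum R (\<lambda>k. a i l \<otimes> b l k \<otimes> c k j) UNIV = (if l = j then a i l else \<zero>)"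
      using cl by (simp add: r)
  qed (use cl in auto)
  also have "\<dots> = a i j" using cl by (simp add: finsum_delta)
  finally show ?thesis ..
qed

section \<open>The closure of the image of a matrix representation\<close>

lemma quotient_algebra_kernel:
  assumes "algebra univ_ring A" "ring L" "h \<in> ring_hom A L"
  shows "quotient_algebra A {x \<in> carrier A. h x = \<zero>\<^bsub>L\<^esub>}"
proof -
  have "ring_hom_ring A L h"
    by (rule ring_hom_ringI2[OF cring.axioms(1)[OF algebra_cring[OF assms(1)]] assms(2,3)])
  then have "ideal (a_kernel A L h) A" by (rule ring_hom_ring.kernel_is_ideal)
  then have "ideal {x \<in> carrier A. h x = \<zero>\<^bsub>L\<^esub>} A" unfolding a_kernel_def' .
  with assms(1) show ?thesis by (rule quotient_algebra.intro)
qed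

text \<open>A homomorphism from the group scheme of L to SL, given by its matrix E of functions. The
  polynomials may have coefficients in another ring, mapped to the base ring of L by \<phi>; this
  makes the image over C[u, 1/u] and the Zariski closure over C[t] instances of one
  construction.\<close>

locale matrix_representation =
  fixes \<phi> :: "'r::comm_ring_1 \<Rightarrow> 's::comm_ring_1" and L :: "('s, 'b) hopf" and E :: "'m::finite \<Rightarrow> 'm \<Rightarrow> 'b"
  assumes hom: "\<phi> \<in> ring_hom univ_ring univ_ring" and hopf: "hopf_algebra univ_ring L"
    and E_closed: "\<And>i j. E i j \<in> carrier L"
    and E_det: "mat_poly_eval (restrict_alg \<phi> L (carrier L)) E (det (\<chi> i j. mat_var i j)) = \<one>\<^bsub>L\<^esub>"
    and E_comult: "\<And>i j. comult L (E i j) = finsum (tens L L) (\<lambda>k. pure L L (E i k) (E k j)) UNIV"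
    and E_counit: "\<And>i j. counit L (E i j) = (if i = j then 1 else 0)"
begin

lemma pre_hopf_L: "pre_hopf L" using hopf by (simp add: hopf_algebra_iff)

sublocale L: pre_hopf_algebra L by (rule pre_hopf_algebraI[OF pre_hopf_L])

definition L\<phi> where "L\<phi> = restrict_alg \<phi> L (carrier L)"

lemma algebra_L\<phi>: "algebra univ_ring L\<phi>"
  unfolding L\<phi>_def by (rule algebra_restrict_carrier[OF L.algebra_axioms hom])

sublocale E: matrix_evaluation L\<phi> E
  by (rule matrix_evaluationI[OF algebra_L\<phi>]) (simp add: L\<phi>_def E_closed)

abbreviation "ev \<equiv> mat_poly_eval L\<phi> E"

lemma ev_simps: "ev p \<in> carrier L" "ev (p + q) = ev p \<oplus>\<^bsub>L\<^esub> ev q" "ev (p * q) = ev p \<otimes>\<^bsub>L\<^esub> ev q"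
  "ev (Poly_Mapping.single 0 c) = \<phi> c \<odot>\<^bsub>L\<^esub> \<one>\<^bsub>L\<^esub>" "ev (mat_var i j) = E i j" "ev 1 = \<one>\<^bsub>L\<^esub>"
  using E.ev_closed[of p] E.ev_add[of p q] E.ev_mult[of p q] E.ev_const[of c] E.ev_var[of i j] ring_hom_one[OF E.ev_hom]
  by (simp_all add: L\<phi>_def)

lemma ev_hom: "ev \<in> ring_hom univ_ring L"
  by (rule ring_hom_memI) (simp_all add: ev_simps)

lemma ev_additive: "ev \<in> additive_maps mat_poly_alg L"
  by (rule additive_mapsI) (simp_all add: ev_simps)

lemma ev_SL_ideal: "p \<in> SL_ideal \<Longrightarrow> ev p = \<zero>\<^bsub>L\<^esub>"
proof -
  have "ev (det (\<chi> i j. mat_var i j) - 1) \<oplus>\<^bsub>L\<^esub> \<one>\<^bsub>L\<^esub> = \<one>\<^bsub>L\<^esub>"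
    using ev_simps(2)[of "det (\<chi> i j. mat_var i j) - 1" 1] E_det by (simp add: ev_simps(6) L\<phi>_def[symmetric])
  then have "ev (det (\<chi> i j. mat_var i j) - 1) = \<zero>\<^bsub>L\<^esub>"
    using L.M.add.r_cancel_one[of "\<one>\<^bsub>L\<^esub>" "ev (det (\<chi> i j. mat_var i j) - 1)"] ev_simps(1) by simp
  then show "p \<in> SL_ideal \<Longrightarrow> ev p = \<zero>\<^bsub>L\<^esub>"
    by (auto simp: SL_ideal_iff ev_simps)
qed

definition \<Phi> where "\<Phi> X = ev (rep X)"

lemma \<Phi>_class: "\<Phi> (SL_class p) = ev p"
  unfolding \<Phi>_def SL_class_eq
  by (rule quotient_algebra.hom_rep_proj[OF quotient_algebra_SL ev_additive L.M.abelian_group_axioms ev_SL_ideal]) simp_all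

lemma \<Phi>_ring_hom: "\<Phi> \<in> ring_hom SL L"
  by (rule ring_hom_memI) (auto elim!: SL_cases simp: SL_ops \<Phi>_class ev_simps)

lemma \<Phi>_semilinear: "\<Phi> \<in> semilinear \<phi> SL L"
  by (rule semilinearI) (auto elim!: SL_cases simp: SL_ops \<Phi>_class ev_simps L.smult_assoc2)

text \<open>J consists of the functions on SL, over the domain of \<phi>, that vanish at E;
  \<open>Q\<close> is the coordinate ring of the closed subscheme cut out by them, and \<Psi> its
  map into L.\<close>

definition J where "J = {X \<in> carrier SL. \<Phi> X = \<zero>\<^bsub>L\<^esub>}"
definition Q where "Q = quot_hopf univ_ring SL J"
definition \<Psi> where "\<Psi> Y = \<Phi> (rep Y)"

lemma quotient_algebra_J: "quotient_algebra SL J"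
  unfolding J_def by (rule quotient_algebra_kernel[OF algebra_SL L.ring_axioms \<Phi>_ring_hom])

sublocale J: quotient_algebra SL J by (rule quotient_algebra_J)

lemma same_algebra_Q: "same_algebra Q (quot_alg SL J)"
  by (simp add: same_algebra_def Q_def quot_hopf_def Let_def module.defs hopf.defs)

lemma algebra_Q: "algebra univ_ring Q"
  by (rule same_algebra_algebra[OF same_algebra_sym[OF same_algebra_Q] J.algebra_quot])

lemma Q_simps: "carrier Q = carrier (quot_alg SL J)" "monoid.mult Q = monoid.mult (quot_alg SL J)" "one Q = one (quot_alg SL J)"
  "zero Q = zero (quot_alg SL J)" "add Q = add (quot_alg SL J)" "module.smult Q = module.smult (quot_alg SL J)"
  using same_algebra_Q by (simp_all only: same_algebra_def)

lemma proj_Q: "J.proj \<in> ring_hom SL Q" "J.proj \<in> semilinear id SL Q"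
  using J.proj_ring_hom J.proj_semilinear
  by (simp_all only: ring_hom_def semilinear_def additive_maps_def Q_simps)

lemma Q_cases:
  assumes "Y \<in> carrier Q" obtains X where "X \<in> carrier SL" "Y = J.proj X" "rep Y = X"
  using J.rep_quot[of Y] assms by (metis Q_simps(1))

lemma J_zero: "X \<in> J \<Longrightarrow> \<Phi> X = \<zero>\<^bsub>L\<^esub>"
  unfolding J_def by blast

lemma \<Psi>_proj: "X \<in> carrier SL \<Longrightarrow> \<Psi> (J.proj X) = \<Phi> X"
  unfolding \<Psi>_def
  by (rule J.hom_rep_proj[OF semilinearD(4)[OF \<Phi>_semilinear] L.M.abelian_group_axioms J_zero])

lemma J_iff: "X \<in> J \<longleftrightarrow> X \<in> carrier SL \<and> \<Phi> X = \<zero>\<^bsub>L\<^esub>"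
  unfolding J_def by blast

lemma \<Psi>_ring_hom: "\<Psi> \<in> ring_hom Q L"
proof (rule ring_hom_memI)
  note p = ring_hom_add[OF proj_Q(1), symmetric] ring_hom_mult[OF proj_Q(1), symmetric] ring_hom_one[OF proj_Q(1), symmetric]
  note f = ring_hom_closed[OF \<Phi>_ring_hom] ring_hom_add[OF \<Phi>_ring_hom] ring_hom_mult[OF \<Phi>_ring_hom] ring_hom_one[OF \<Phi>_ring_hom]
  fix Y Z assume "Y \<in> carrier Q"
  then obtain X where X: "X \<in> carrier SL" "Y = J.proj X" "rep Y = X" by (rule Q_cases)
  then show "\<Psi> Y \<in> carrier L" by (simp add: \<Psi>_proj f)
  assume "Z \<in> carrier Q"
  then obtain X' where X': "X' \<in> carrier SL" "Z = J.proj X'" "rep Z = X'" by (rule Q_cases)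
  show "\<Psi> (Y \<otimes>\<^bsub>Q\<^esub> Z) = \<Psi> Y \<otimes>\<^bsub>L\<^esub> \<Psi> Z" "\<Psi> (Y \<oplus>\<^bsub>Q\<^esub> Z) = \<Psi> Y \<oplus>\<^bsub>L\<^esub> \<Psi> Z"
    unfolding X X' using X(1) X'(1) by (simp_all add: p f \<Psi>_proj)
next
  show "\<Psi> \<one>\<^bsub>Q\<^esub> = \<one>\<^bsub>L\<^esub>"
    unfolding ring_hom_one[OF proj_Q(1), symmetric]
    using \<Psi>_proj[of "\<one>\<^bsub>SL\<^esub>"] ring_hom_one[OF \<Phi>_ring_hom] by simp
qed

lemma \<Psi>_semilinear: "\<Psi> \<in> semilinear \<phi> Q L"
proof (rule semilinearI)
  note r = ring_hom_closed[OF \<Psi>_ring_hom] ring_hom_add[OF \<Psi>_ring_hom]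
  fix Y Z assume Y: "Y \<in> carrier Q" then show "\<Psi> Y \<in> carrier L" by (rule r)
  { assume "Z \<in> carrier Q" with Y show "\<Psi> (Y \<oplus>\<^bsub>Q\<^esub> Z) = \<Psi> Y \<oplus>\<^bsub>L\<^esub> \<Psi> Z" by (rule r) }
  fix c
  obtain X where X: "X \<in> carrier SL" "Y = J.proj X" "rep Y = X" using Y by (rule Q_cases)
  have "c \<odot>\<^bsub>Q\<^esub> Y = J.proj (c \<odot>\<^bsub>SL\<^esub> X)" using semilinearD(3)[OF proj_Q(2) X(1), of c] X(2) by simp
  then show "\<Psi> (c \<odot>\<^bsub>Q\<^esub> Y) = \<phi> c \<odot>\<^bsub>L\<^esub> \<Psi> Y"
    using X semilinearD(3)[OF \<Phi>_semilinear X(1), of c] algebra_univD(6)[OF algebra_SL X(1), of c] by (simp add: \<Psi>_proj)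
qed

lemma inj_\<Psi>: "inj_on \<Psi> (carrier Q)"
proof (rule inj_onI)
  fix Y Z assume "Y \<in> carrier Q" "Z \<in> carrier Q" and eq: "\<Psi> Y = \<Psi> Z"
  then obtain X X' where X: "X \<in> carrier SL" "Y = J.proj X" "rep Y = X" "X' \<in> carrier SL" "Z = J.proj X'" "rep Z = X'"
    by (elim Q_cases) blast
  have "\<Phi> X = \<Phi> X'" using eq unfolding X(2,5) \<Psi>_proj[OF X(1)] \<Psi>_proj[OF X(4)] .
  then have "\<Phi> (X \<ominus>\<^bsub>SL\<^esub> X') = \<zero>\<^bsub>L\<^esub>"
    using X additive_maps_minus[OF J.abelian_group_axioms L.M.abelian_group_axioms semilinearD(4)[OF \<Phi>_semilinear], of X X']
      semilinearD(1)[OF \<Phi>_semilinear] by (simp add: L.M.r_neg L.M.minus_eq)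
  then have "X \<ominus>\<^bsub>SL\<^esub> X' \<in> J" using X J_iff J.minus_closed by blast
  then show "Y = Z" using X J.proj_eq_iff by simp
qed

lemma image_\<Psi>: "\<Psi> ` carrier Q = range ev"
proof
  show "\<Psi> ` carrier Q \<subseteq> range ev" by (auto simp: \<Psi>_def \<Phi>_def)
  show "range ev \<subseteq> \<Psi> ` carrier Q"
  proof
    fix y assume "y \<in> range ev"
    then obtain p where "y = ev p" by blast
    then have "y = \<Psi> (J.proj (SL_class p))" by (simp add: \<Psi>_proj \<Phi>_class)
    moreover have "J.proj (SL_class p) \<in> carrier Q" by (rule semilinearD(1)[OF proj_Q(2)]) simp
    ultimately show "y \<in> \<Psi> ` carrier Q" by blast
  qed
qed

lemma comult_Q: "comult Q Y = tmap Q Q J.proj J.proj (comult SL (rep Y))"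
  unfolding tensor_cong(3)[OF HOL.refl same_algebra_Q same_algebra_Q]
  by (simp add: Q_def quot_hopf_def Let_def module.defs hopf.defs)

lemma counit_Q: "counit Q Y = counit SL (rep Y)"
  by (simp add: Q_def quot_hopf_def Let_def module.defs hopf.defs)

lemma antipode_Q: "antipode Q Y = J.proj (antipode SL (rep Y))"
  by (simp add: Q_def quot_hopf_def Let_def module.defs hopf.defs)

lemma module_SL: "module univ_ring SL" by (rule algebra_module[OF algebra_SL])
lemma module_Q: "module univ_ring Q" by (rule algebra_module[OF algebra_Q])

lemma comult_SL_entry_closed:
  "finsum (tens SL SL) (\<lambda>k. pure SL SL (SL_class (mat_var i k)) (SL_class (mat_var k j))) UNIV \<in> carrier (tens SL SL)"
proof -
  interpret SS: tensor_algebras SL SL by (intro tensor_algebras.intro algebra_SL)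
  show ?thesis by (intro SS.T.finsum_closed) auto
qed

lemma comult_SL_closed: "comult SL X \<in> carrier (tens (SL :: ('r, ('m, 'r) mat_poly set) hopf) SL)"
proof -
  interpret SS: tensor_algebras SL SL by (intro tensor_algebras.intro algebra_SL)
  interpret M: matrix_evaluation "tens SL SL" "\<lambda>i j. finsum (tens SL SL) (\<lambda>k. pure SL SL (SL_class (mat_var i k)) (SL_class (mat_var k j))) UNIV"
    by (rule matrix_evaluationI[OF SS.algebra_tens comult_SL_entry_closed])
  show ?thesis unfolding comult_SL by simp
qed

lemma antipode_SL_closed: "antipode SL X \<in> carrier (SL :: ('r, ('m, 'r) mat_poly set) hopf)"
proof -
  interpret M: matrix_evaluation "SL :: ('r, ('m, 'r) mat_poly set) hopf" "\<lambda>i j. SL_class (adjugate_entry i j)"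
    by (rule matrix_evaluationI[OF algebra_SL]) simp
  show ?thesis unfolding antipode_SL by simp
qed

lemma Q_structure_closed: "Y \<in> carrier Q \<Longrightarrow> comult Q Y \<in> carrier (tens Q Q)" "antipode Q Y \<in> carrier Q"
  unfolding comult_Q antipode_Q
  by (rule semilinearD(1)[OF tensor_map_semilinear[OF module_SL module_SL module_Q module_Q proj_Q(2) proj_Q(2)] comult_SL_closed])
     (rule semilinearD(1)[OF proj_Q(2) antipode_SL_closed])

lemma L\<phi>_semilinear: "f \<in> semilinear id L M \<Longrightarrow> f \<in> semilinear \<phi> L\<phi> M"
  and L\<phi>_ring_hom: "g \<in> ring_hom L M' \<Longrightarrow> g \<in> ring_hom L\<phi> M'"
  by (auto simp: semilinear_def additive_maps_def L\<phi>_def ring_hom_def)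

text \<open>Both matrices invert E: the adjugate from the left, because det E = 1, and the antipode
  from the right, by the antipode axiom of L applied to the entries.\<close>

lemma ev_antipode: "antipode L (E i j) = ev (adjugate_entry i j)"
proof (rule L.matrix_inverse_unique[symmetric, where b = E])
  show "ev (adjugate_entry i j) \<in> carrier L" "E i j \<in> carrier L" "antipode L (E i j) \<in> carrier L" for i j
    using E_closed by (simp_all add: ev_simps L.antipode_simps)
  have z: "ev 0 = \<zero>\<^bsub>L\<^esub>" using univ_hom_sum(1)[OF L.is_cring ev_hom, of "{}"] by simp
  have "finsum L (\<lambda>k. ev (adjugate_entry i k) \<otimes>\<^bsub>L\<^esub> E k j) UNIV = ev (\<Sum>k\<in>UNIV. adjugate_entry i k * mat_var k j)" for i j
    unfolding univ_hom_sum(1)[OF L.is_cring ev_hom finite] by (simp add: ev_simps)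
  then show "finsum L (\<lambda>k. ev (adjugate_entry i k) \<otimes>\<^bsub>L\<^esub> E k j) UNIV = (if i = j then \<one>\<^bsub>L\<^esub> else \<zero>\<^bsub>L\<^esub>)" for i j
    using E_det by (simp add: adjugate_mult z[unfolded L\<phi>_def] L\<phi>_def)
  show "finsum L (\<lambda>k. E i k \<otimes>\<^bsub>L\<^esub> antipode L (E k j)) UNIV = (if i = j then \<one>\<^bsub>L\<^esub> else \<zero>\<^bsub>L\<^esub>)" for i j
  proof -
    note la = L.HH.tensor_lift_additive[OF L.M.abelian_group_axioms L.balanced_structure(4)]
    have "antipode_rhs L (E i j) = finsum L (\<lambda>k. tensor_lift L (\<lambda>(a, b). a \<otimes>\<^bsub>L\<^esub> antipode L b) (pure L L (E i k) (E k j))) UNIV"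
      unfolding antipode_rhs_def E_comult
      by (rule additive_maps_finsum[OF L.HH.abelian_group_tens L.M.abelian_group_axioms la finite]) (simp add: E_closed)
    also have "\<dots> = finsum L (\<lambda>k. E i k \<otimes>\<^bsub>L\<^esub> antipode L (E k j)) UNIV"
      using E_closed by (simp add: L.HH.tensor_lift_pure[OF L.M.abelian_group_axioms L.balanced_structure(4)])
    finally have "finsum L (\<lambda>k. E i k \<otimes>\<^bsub>L\<^esub> antipode L (E k j)) UNIV = counit L (E i j) \<odot>\<^bsub>L\<^esub> \<one>\<^bsub>L\<^esub>"
      using hopf E_closed by (simp add: hopf_algebra_iff)
    then show ?thesis by (simp add: E_counit algebra_univD[OF L.algebra_axioms])
  qed
qed

text \<open>Lift Y to a polynomial p. Both sides are evaluations of p at matrices over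
  \<open>tens L L\<close>, and these matrices agree by \<open>E_comult\<close>. The Hopf axioms of Q
  are derived afterwards, from those of L through \<Psi>.\<close>

lemma \<Psi>_comult:
  assumes Y: "Y \<in> carrier Q" shows "comult L (\<Psi> Y) = tmap L L \<Psi> \<Psi> (comult Q Y)"
proof -
  let ?v = "\<lambda>i j. finsum (tens SL SL) (\<lambda>k. pure SL SL (SL_class (mat_var i k)) (SL_class (mat_var k j))) UNIV"
  interpret SS: tensor_algebras "SL :: ('r, ('m, 'r) mat_poly set) hopf" SL by (intro tensor_algebras.intro algebra_SL)
  note mS = module_SL and mQ = module_Q and mL = L.module_axioms
  note FF = tensor_map_semilinear[OF mS mS mL mL \<Phi>_semilinear \<Phi>_semilinear]
  obtain X where X: "X \<in> carrier SL" "Y = J.proj X" "rep Y = X" using Y by (rule Q_cases)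
  obtain p where p: "X = SL_class p" "rep X = p" using X(1) by (rule SL_cases)
  have "tmap L L \<Psi> \<Psi> (comult Q Y) = tmap L L (\<lambda>X. \<Psi> (J.proj X)) (\<lambda>X. \<Psi> (J.proj X)) (comult SL X)"
    unfolding comult_Q X(3)
    by (rule tensor_map_comp[OF mS mS mQ mQ mL mL proj_Q(2) proj_Q(2) \<Psi>_semilinear \<Psi>_semilinear comult_SL_closed])
  also have "\<dots> = tmap L L \<Phi> \<Phi> (comult SL X)"
    by (rule tensor_map_cong[OF mS mS]) (simp_all add: \<Psi>_proj comult_SL_closed)
  also have "\<dots> = mat_poly_eval (restrict_alg \<phi> (tens L L) (carrier (tens L L))) (\<lambda>i j. tmap L L \<Phi> \<Phi> (?v i j)) p"
    unfolding comult_SL p(2)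
    by (rule mat_poly_eval_semilinear[OF SS.algebra_tens L.HH.algebra_tens hom
        tensor_map_ring_hom[OF algebra_SL algebra_SL L.algebra_axioms L.algebra_axioms \<Phi>_semilinear \<Phi>_semilinear \<Phi>_ring_hom \<Phi>_ring_hom]
        FF comult_SL_entry_closed])
  also have "(\<lambda>i j. tmap L L \<Phi> \<Phi> (?v i j)) = (\<lambda>i j. comult L (E i j))"
  proof (intro ext)
    fix i j
    have "tmap L L \<Phi> \<Phi> (?v i j) = finsum (tens L L) (\<lambda>k. tmap L L \<Phi> \<Phi> (pure SL SL (SL_class (mat_var i k)) (SL_class (mat_var k j)))) UNIV"
      by (rule additive_maps_finsum[OF SS.abelian_group_tens L.HH.abelian_group_tens semilinearD(4)[OF FF] finite]) auto
    then show "tmap L L \<Phi> \<Phi> (?v i j) = comult L (E i j)"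
      by (simp add: tensor_map_pure[OF mS mS mL mL \<Phi>_semilinear \<Phi>_semilinear] \<Phi>_class ev_simps E_comult)
  qed
  also have "mat_poly_eval (restrict_alg \<phi> (tens L L) (carrier (tens L L))) (\<lambda>i j. comult L (E i j)) p = comult L (ev p)"
    by (rule mat_poly_eval_semilinear[symmetric, OF algebra_L\<phi> L.HH.algebra_tens hom
        L\<phi>_ring_hom[OF L.comult_hom(1)] L\<phi>_semilinear[OF L.comult_hom(2)]]) (simp add: L\<phi>_def E_closed)
  also have "ev p = \<Psi> Y" using X p by (simp add: \<Psi>_proj \<Phi>_class)
  finally show ?thesis ..
qed

lemma \<Psi>_counit:
  assumes Y: "Y \<in> carrier Q" shows "counit L (\<Psi> Y) = \<phi> (counit Q Y)"
proof -
  have idhom: "id \<in> ring_hom univ_ring univ_ring" by (auto intro: univ_homI)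
  note U = algebra_univ_alg[OF idhom]
  obtain X where X: "X \<in> carrier SL" "Y = J.proj X" "rep Y = X" using Y by (rule Q_cases)
  obtain p where p: "X = SL_class p" "rep X = p" using X(1) by (rule SL_cases)
  have "\<phi> (counit Q Y) = mat_poly_eval (restrict_alg \<phi> (univ_alg id) (carrier (univ_alg id))) (\<lambda>i j. \<phi> (if i = j then 1 else 0)) p"
    unfolding counit_Q X(3) counit_SL p(2)
  proof (rule mat_poly_eval_semilinear[OF U U hom])
    show "\<phi> \<in> ring_hom (univ_alg id) (univ_alg id)" using hom by (simp add: ring_hom_def)
    show "\<phi> \<in> semilinear \<phi> (univ_alg id) (univ_alg id)" by (rule semilinearI) (simp_all add: univ_homD[OF hom])
  qed simp
  also have "(\<lambda>i j. \<phi> (if i = j then 1 else 0)) = (\<lambda>i j :: 'm. counit L (E i j))"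
    by (simp add: E_counit univ_homD[OF hom] fun_eq_iff)
  also have "mat_poly_eval (restrict_alg \<phi> (univ_alg id) (carrier (univ_alg id))) (\<lambda>i j. counit L (E i j)) p = counit L (ev p)"
  proof (rule mat_poly_eval_semilinear[symmetric, OF algebra_L\<phi> U hom])
    have c: "counit L \<in> ring_hom L (univ_alg id)" using L.counit_hom(1) by (simp add: ring_hom_def)
    then show "counit L \<in> ring_hom L\<phi> (univ_alg id)" by (rule L\<phi>_ring_hom)
    show "counit L \<in> semilinear \<phi> L\<phi> (univ_alg id)"
      by (intro L\<phi>_semilinear semilinearI) (simp_all add: L.counit_add L.counit_hom)
  qed (simp add: L\<phi>_def E_closed)
  also have "ev p = \<Psi> Y" using X p by (simp add: \<Psi>_proj \<Phi>_class)
  finally show ?thesis ..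
qed

lemma \<Psi>_antipode:
  assumes Y: "Y \<in> carrier Q" shows "antipode L (\<Psi> Y) = \<Psi> (antipode Q Y)"
proof -
  obtain X where X: "X \<in> carrier SL" "Y = J.proj X" "rep Y = X" using Y by (rule Q_cases)
  obtain p where p: "X = SL_class p" "rep X = p" using X(1) by (rule SL_cases)
  have "\<Psi> (antipode Q Y) = \<Phi> (antipode SL X)" unfolding antipode_Q X(3) by (rule \<Psi>_proj[OF antipode_SL_closed])
  also have "\<dots> = mat_poly_eval (restrict_alg \<phi> L (carrier L)) (\<lambda>i j. \<Phi> (SL_class (adjugate_entry i j))) p"
    unfolding antipode_SL p(2)
    by (rule mat_poly_eval_semilinear[OF algebra_SL L.algebra_axioms hom \<Phi>_ring_hom \<Phi>_semilinear]) simp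
  also have "(\<lambda>i j. \<Phi> (SL_class (adjugate_entry i j))) = (\<lambda>i j. antipode L (E i j))"
    by (simp add: \<Phi>_class ev_antipode)
  also have "mat_poly_eval (restrict_alg \<phi> L (carrier L)) (\<lambda>i j. antipode L (E i j)) p = antipode L (ev p)"
    by (rule mat_poly_eval_semilinear[symmetric, OF algebra_L\<phi> L.algebra_axioms hom
        L\<phi>_ring_hom[OF L.antipode_hom(1)] L\<phi>_semilinear[OF L.antipode_hom(2)]]) (simp add: L\<phi>_def E_closed)
  also have "ev p = \<Psi> Y" using X p by (simp add: \<Psi>_proj \<Phi>_class)
  finally show ?thesis ..
qed

lemma \<Psi>_hopf: "\<Psi> \<in> hopf_semilinear \<phi> Q L"
  by (simp add: hopf_semilinear_def \<Psi>_ring_hom \<Psi>_semilinear \<Psi>_comult \<Psi>_counit \<Psi>_antipode)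

end

section \<open>Hopf algebras embedded in a common one\<close>

lemma hopf_semilinearD:
  assumes "f \<in> hopf_semilinear \<phi> H K"
  shows "f \<in> ring_hom H K" "f \<in> semilinear \<phi> H K"
    "x \<in> carrier H \<Longrightarrow> comult K (f x) = tmap K K f f (comult H x)"
    "x \<in> carrier H \<Longrightarrow> counit K (f x) = \<phi> (counit H x)"
    "x \<in> carrier H \<Longrightarrow> antipode K (f x) = f (antipode H x)"
    "x \<in> carrier H \<Longrightarrow> f x \<in> carrier K"
  using assms by (auto simp: hopf_semilinear_def semilinear_def additive_maps_def)

lemma hopf_semilinear_comp:
  assumes "algebra univ_ring H" "algebra univ_ring K" "algebra univ_ring L"
    "f \<in> hopf_semilinear \<phi> H K" "g \<in> hopf_semilinear \<psi> K L"
    "\<And>x. x \<in> carrier H \<Longrightarrow> comult H x \<in> carrier (tens H H)" "\<And>x. x \<in> carrier H \<Longrightarrow> antipode H x \<in> carrier H"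
  shows "(\<lambda>x. g (f x)) \<in> hopf_semilinear (\<lambda>r. \<psi> (\<phi> r)) H L"
proof -
  note f = hopf_semilinearD[OF assms(4)] and g = hopf_semilinearD[OF assms(5)]
  note m = algebra_module[OF assms(1)] algebra_module[OF assms(2)] algebra_module[OF assms(3)]
  have "(\<lambda>x. g (f x)) \<in> ring_hom H L" using ring_hom_trans[OF f(1) g(1)] by (simp add: comp_def)
  moreover have "(\<lambda>x. g (f x)) \<in> semilinear (\<lambda>r. \<psi> (\<phi> r)) H L" by (rule semilinear_comp[OF f(2) g(2)])
  moreover have "comult L (g (f x)) = tmap L L (\<lambda>x. g (f x)) (\<lambda>x. g (f x)) (comult H x)" if x: "x \<in> carrier H" for x
    unfolding g(3)[OF f(6)[OF x]] f(3)[OF x]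
    by (rule tensor_map_comp[OF m(1,1,2,2,3,3) f(2,2) g(2,2) assms(6)[OF x]])
  ultimately show ?thesis using f g assms(7) by (simp add: hopf_semilinear_def)
qed

text \<open>The data from which H inherits the axioms of K. Injectivity on squares determines the
  comultiplication of H by that of K, and injectivity on cubes yields coassociativity.\<close>

definition hopf_embedding ::
  "('r \<Rightarrow> 's) \<Rightarrow> ('r::comm_ring_1, 'a) hopf \<Rightarrow> ('s::comm_ring_1, 'b) hopf \<Rightarrow> ('a \<Rightarrow> 'b) \<Rightarrow> bool" where
  "hopf_embedding \<phi> H K f \<longleftrightarrow> algebra univ_ring H \<and> f \<in> hopf_semilinear \<phi> H K \<and>
     (\<forall>x\<in>carrier H. comult H x \<in> carrier (tens H H) \<and> antipode H x \<in> carrier H) \<and>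
     inj_on f (carrier H) \<and> inj_on (tmap K K f f) (carrier (tens H H)) \<and>
     inj_on (tmap K (tens K K) f (tmap K K f f)) (carrier (tens H (tens H H)))"

lemma hopf_embeddingD:
  assumes "hopf_embedding \<phi> H K f"
  shows "algebra univ_ring H" "f \<in> hopf_semilinear \<phi> H K"
    "x \<in> carrier H \<Longrightarrow> comult H x \<in> carrier (tens H H)" "x \<in> carrier H \<Longrightarrow> antipode H x \<in> carrier H"
    "inj_on f (carrier H)" "inj_on (tmap K K f f) (carrier (tens H H))"
    "inj_on (tmap K (tens K K) f (tmap K K f f)) (carrier (tens H (tens H H)))"
  using assms by (simp_all add: hopf_embedding_def)

lemma hopf_algebra_embedded:
  assumes "\<phi> \<in> ring_hom univ_ring univ_ring" "inj \<phi>" "hopf_algebra univ_ring K" "hopf_embedding \<phi> H K f"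
  shows "hopf_algebra univ_ring H"
  using hopf_algebra_reflect[OF assms(1,2) hopf_embeddingD(1)[OF assms(4)] assms(3)] hopf_embeddingD[OF assms(4)]
  by blast

text \<open>The isomorphism is h = f1^-1 f2. Its compatibility with comultiplication is tested in
  \<open>tens K K\<close>, where both sides become the comultiplication of f2 x.\<close>

lemma isomorphic_of_embeddings:
  assumes \<phi>: "\<phi> \<in> ring_hom univ_ring univ_ring" "inj \<phi>" and K: "hopf_algebra univ_ring K"
    and H1: "hopf_embedding \<phi> H1 K f1" and H2: "hopf_embedding \<phi> H2 K f2"
    and img: "f1 ` carrier H1 = f2 ` carrier H2"
  shows "group_schemes_isomorphic univ_ring H1 H2"
proof -
  note e1 = hopf_embeddingD[OF H1] and e2 = hopf_embeddingD[OF H2]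
  note f1 = hopf_semilinearD[OF e1(2)] and f2 = hopf_semilinearD[OF e2(2)]
  have h1: "hopf_algebra univ_ring H1" by (rule hopf_algebra_embedded[OF \<phi> K H1])
  have h2: "hopf_algebra univ_ring H2" by (rule hopf_algebra_embedded[OF \<phi> K H2])
  have aK: "algebra univ_ring K" using K by (simp add: hopf_algebra_iff pre_hopf_def)
  note m1 = algebra_module[OF e1(1)] and m2 = algebra_module[OF e2(1)] and mK = algebra_module[OF aK]
  interpret H1: algebra univ_ring H1 by (rule e1(1))
  interpret H2: algebra univ_ring H2 by (rule e2(1))
  define h where "h x = inv_into (carrier H1) f1 (f2 x)" for x
  have h: "h x \<in> carrier H1" "f1 (h x) = f2 x" if "x \<in> carrier H2" for x
    using that img unfolding h_def by (metis imageI inv_into_into, metis imageI f_inv_into_f)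
  have hr: "h \<in> ring_hom H2 H1"
    by (rule ring_hom_memI; (rule inj_onD[OF e1(5)])?)
       (simp_all add: h ring_hom_mult[OF f1(1)] ring_hom_mult[OF f2(1)] ring_hom_one[OF f1(1)] ring_hom_one[OF f2(1)]
          semilinearD(2)[OF f1(2)] semilinearD(2)[OF f2(2)])
  have hs: "h \<in> semilinear id H2 H1"
    by (rule semilinearI; (rule inj_onD[OF e1(5)])?) (simp_all add: h semilinearD(2,3)[OF f1(2)] semilinearD(2,3)[OF f2(2)])
  have "comult H1 (h x) = tmap H1 H1 h h (comult H2 x)" if x: "x \<in> carrier H2" for x
  proof (rule inj_onD[OF e1(6)])
    have "tmap K K f1 f1 (tmap H1 H1 h h (comult H2 x)) = tmap K K (\<lambda>x. f1 (h x)) (\<lambda>x. f1 (h x)) (comult H2 x)"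
      by (rule tensor_map_comp[OF m2 m2 m1 m1 mK mK hs hs f1(2) f1(2) e2(3)[OF x]])
    also have "\<dots> = tmap K K f2 f2 (comult H2 x)"
      by (rule tensor_map_cong[OF m2 m2]) (simp_all add: h e2(3)[OF x])
    also have "\<dots> = comult K (f1 (h x))" using x by (simp add: h f2)
    also have "\<dots> = tmap K K f1 f1 (comult H1 (h x))" by (rule f1(3)[OF h(1)[OF x]])
    finally show "tmap K K f1 f1 (comult H1 (h x)) = tmap K K f1 f1 (tmap H1 H1 h h (comult H2 x))" ..
  qed (use x h e1(3) e2(3) semilinearD(1)[OF tensor_map_semilinear[OF m2 m2 m1 m1 hs hs]] in simp_all)
  moreover have "counit H1 (h x) = counit H2 x" if x: "x \<in> carrier H2" for x
    using f1(4)[OF h(1)[OF x]] f2(4)[OF x] by (intro injD[OF \<phi>(2)]) (simp add: h x)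
  moreover have "antipode H1 (h x) = h (antipode H2 x)" if x: "x \<in> carrier H2" for x
    using f1(5)[OF h(1)[OF x]] f2(5)[OF x] x e1(4) e2(4) by (intro inj_onD[OF e1(5)]) (simp_all add: h)
  ultimately have "h \<in> hopf_hom univ_ring H2 H1"
    using hr hs by (simp add: hopf_hom_def alg_hom_univ)
  moreover have "bij_betw h (carrier H2) (carrier H1)"
  proof (rule bij_betwI[where g = "\<lambda>y. inv_into (carrier H2) f2 (f1 y)"])
    have g: "inv_into (carrier H2) f2 (f1 y) \<in> carrier H2" "f2 (inv_into (carrier H2) f2 (f1 y)) = f1 y" if "y \<in> carrier H1" for y
      using that img by (metis imageI inv_into_into, metis imageI f_inv_into_f)
    show "h \<in> carrier H2 \<rightarrow> carrier H1" using h by auto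
    show "(\<lambda>y. inv_into (carrier H2) f2 (f1 y)) \<in> carrier H1 \<rightarrow> carrier H2" using g by auto
    show "inv_into (carrier H2) f2 (f1 (h x)) = x" if "x \<in> carrier H2" for x
      using that by (simp add: h inv_into_f_f[OF e2(5)])
    show "h (inv_into (carrier H2) f2 (f1 y)) = y" if "y \<in> carrier H1" for y
      using that g by (simp add: h_def inv_into_f_f[OF e1(5)])
  qed
  ultimately show ?thesis using h1 h2 by (auto simp: group_schemes_isomorphic_def)
qed

text \<open>If \<open>comult K\<close> maps B into the image of the square of B, any preimage chosen
  by \<open>inv_into\<close> makes \<open>id\<close> compatible with the comultiplications. That the
  preimage is unique comes later, with \<open>hopf_embedding\<close>.\<close>

lemma restrict_hopf:
  fixes K :: "('s::comm_ring_1, 'a) hopf" and \<phi> :: "'r::comm_ring_1 \<Rightarrow> 's"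
  defines "H \<equiv> \<lambda>B. restrict_hopf univ_ring \<phi> univ_ring K B"
  assumes \<phi>: "\<phi> \<in> ring_hom univ_ring univ_ring" and K: "pre_hopf K"
    and B: "is_subalgebra univ_ring (restrict_alg \<phi> K (carrier K)) B"
    and comult: "\<And>x. x \<in> B \<Longrightarrow> comult K x \<in> tmap K K id id ` carrier (tens (restrict_alg \<phi> K B) (restrict_alg \<phi> K B))"
    and counit: "\<And>x. x \<in> B \<Longrightarrow> counit K x \<in> range \<phi>"
    and antipode: "\<And>x. x \<in> B \<Longrightarrow> antipode K x \<in> B"
  shows "same_algebra (H B) (restrict_alg \<phi> K B)" "algebra univ_ring (H B)" "id \<in> hopf_semilinear \<phi> (H B) K"
    "x \<in> carrier (H B) \<Longrightarrow> comult (H B) x \<in> carrier (tens (H B) (H B))"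
    "x \<in> carrier (H B) \<Longrightarrow> antipode (H B) x \<in> carrier (H B)"
proof -
  let ?B = "restrict_alg \<phi> K B"
  have aK: "algebra univ_ring K" using K by (simp add: pre_hopf_def)
  have aB: "algebra univ_ring ?B" by (rule algebra_restrict[OF aK \<phi> B])
  have s: "carrier (H B) = B" "monoid.mult (H B) = monoid.mult K" "one (H B) = one K" "zero (H B) = zero K" "add (H B) = add K"
    "module.smult (H B) = (\<lambda>r x. \<phi> r \<odot>\<^bsub>K\<^esub> x)"
    "comult (H B) = (\<lambda>x. inv_into (carrier (tens ?B ?B)) (tmap K K id id) (comult K x))"
    "counit (H B) = (\<lambda>x. inv_into UNIV \<phi> (counit K x))" "antipode (H B) = antipode K"
    by (simp_all add: H_def restrict_hopf_def Let_def module.defs hopf.defs restrict_alg_def ring_of_type_algebra_def)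
  show sa: "same_algebra (H B) ?B" by (simp add: same_algebra_def s fun_eq_iff)
  show "algebra univ_ring (H B)" by (rule same_algebra_algebra[OF same_algebra_sym[OF sa] aB])
  note t = tensor_cong[OF HOL.refl sa sa]
  show "x \<in> carrier (H B) \<Longrightarrow> comult (H B) x \<in> carrier (tens (H B) (H B))"
    unfolding t s by (rule inv_into_into[OF comult])
  show "x \<in> carrier (H B) \<Longrightarrow> antipode (H B) x \<in> carrier (H B)" unfolding s by (rule antipode)
  have BK: "x \<in> B \<Longrightarrow> x \<in> carrier K" for x using is_subalgebraD(1)[OF B] by auto
  have "id \<in> ring_hom (H B) K" by (rule ring_hom_memI) (simp_all add: s BK)
  moreover have "id \<in> semilinear \<phi> (H B) K" by (rule semilinearI) (simp_all add: s BK)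
  moreover have "comult K (id x) = tmap K K id id (comult (H B) x)" if "x \<in> carrier (H B)" for x
    using f_inv_into_f[OF comult] that by (simp add: s)
  moreover have "counit K (id x) = \<phi> (counit (H B) x)" if "x \<in> carrier (H B)" for x
    using f_inv_into_f[OF counit] that by (simp add: s)
  ultimately show "id \<in> hopf_semilinear \<phi> (H B) K" by (simp add: hopf_semilinear_def s)
qed

context base_changed_field
begin

text \<open>Descent is demanded for families in the image of f and serves squares and cubes alike,
  because H is the left factor in both; the right factor is separated by \<open>L_separated\<close>
  and \<open>LL_separated\<close> respectively.\<close>

lemma embedding_into_L:
  fixes H :: "('r::euclidean_ring, 'b) hopf" and \<theta> :: "'r \<Rightarrow> 's"
  assumes dom: "\<And>s s' :: 's. s * s' = 0 \<Longrightarrow> s = 0 \<or> s' = 0"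
    and \<theta>: "\<theta> \<in> ring_hom univ_ring univ_ring" "inj \<theta>"
    and H: "algebra univ_ring H" and f: "f \<in> hopf_semilinear \<theta> H L" and inj: "inj_on f (carrier H)"
    and closed: "\<And>x. x \<in> carrier H \<Longrightarrow> comult H x \<in> carrier (tens H H)" "\<And>x. x \<in> carrier H \<Longrightarrow> antipode H x \<in> carrier H"
    and descent: "\<And>(I::nat set) y s i. finite I \<Longrightarrow> y \<in> I \<rightarrow> f ` carrier H \<Longrightarrow> i \<in> I \<Longrightarrow> s i \<noteq> 0 \<Longrightarrow>
       finsum L (\<lambda>i. s i \<odot>\<^bsub>L\<^esub> y i) I = \<zero>\<^bsub>L\<^esub> \<Longrightarrow>
       \<exists>r j. j \<in> I \<and> r j \<noteq> 0 \<and> finsum L (\<lambda>i. \<theta> (r i) \<odot>\<^bsub>L\<^esub> y i) I = \<zero>\<^bsub>L\<^esub>"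
  shows "hopf_embedding \<theta> H L f"
proof -
  interpret H: algebra univ_ring H by fact
  interpret HH: tensor_algebras H H ..
  note fs = hopf_semilinearD(2)[OF f]
  have f0: "f \<zero>\<^bsub>H\<^esub> = \<zero>\<^bsub>L\<^esub>"
    by (rule additive_maps_zero[OF H.M.abelian_group_axioms L.M.abelian_group_axioms semilinearD(4)[OF fs]])
  have nz: "f x \<noteq> \<zero>\<^bsub>L\<^esub>" if "x \<in> carrier H" "x \<noteq> \<zero>\<^bsub>H\<^esub>" for x
    using inj_onD[OF inj, of x "\<zero>\<^bsub>H\<^esub>"] that f0 by auto
  \<comment> \<open>H inherits torsion freeness from L, as \<theta> is injective and the base ring
    of L has no zero divisors.\<close>
  have tf: "x = \<zero>\<^bsub>H\<^esub>" if "r \<noteq> 0" "x \<in> carrier H" "r \<odot>\<^bsub>H\<^esub> x = \<zero>\<^bsub>H\<^esub>" for r x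
  proof -
    have "\<theta> r \<noteq> 0" using \<theta> that(1) univ_homD(4)[OF \<theta>(1)] by (metis injD)
    moreover have "\<theta> r \<odot>\<^bsub>L\<^esub> f x = \<zero>\<^bsub>L\<^esub>" using semilinearD(3)[OF fs that(2), of r] that(3) f0 by simp
    ultimately have "f x = \<zero>\<^bsub>L\<^esub>" using L_torsion_free[OF semilinearD(1)[OF fs that(2)]] dom by blast
    then show ?thesis using nz that(2) by blast
  qed
  have desc: "\<exists>r j. j \<in> I \<and> r j \<noteq> 0 \<and> finsum H (\<lambda>i. r i \<odot>\<^bsub>H\<^esub> b i) I = \<zero>\<^bsub>H\<^esub>"
    if I: "finite I" "b \<in> I \<rightarrow> carrier H" "i \<in> I" "s i \<noteq> 0" "finsum L (\<lambda>i. s i \<odot>\<^bsub>L\<^esub> f (b i)) I = \<zero>\<^bsub>L\<^esub>"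
    for I :: "nat set" and b s i
  proof -
    obtain r j where r: "j \<in> I" "r j \<noteq> 0" "finsum L (\<lambda>i. \<theta> (r i) \<odot>\<^bsub>L\<^esub> f (b i)) I = \<zero>\<^bsub>L\<^esub>"
      using descent[of I "\<lambda>i. f (b i)" i s] I by auto
    have c: "(\<lambda>i. r i \<odot>\<^bsub>H\<^esub> b i) \<in> I \<rightarrow> carrier H" using I(2) by auto
    have "f (finsum H (\<lambda>i. r i \<odot>\<^bsub>H\<^esub> b i) I) = finsum L (\<lambda>i. f (r i \<odot>\<^bsub>H\<^esub> b i)) I"
      by (rule additive_maps_finsum[OF H.M.abelian_group_axioms L.M.abelian_group_axioms semilinearD(4)[OF fs] I(1) c])
    also have "\<dots> = finsum L (\<lambda>i. \<theta> (r i) \<odot>\<^bsub>L\<^esub> f (b i)) I"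
      using I(2) semilinearD(1,3)[OF fs] by (intro L.M.finsum_cong') (auto simp: Pi_iff)
    finally have "finsum H (\<lambda>i. r i \<odot>\<^bsub>H\<^esub> b i) I = \<zero>\<^bsub>H\<^esub>"
      using nz r(3) H.M.finsum_closed[OF c] by auto
    then show ?thesis using r by blast
  qed
  have mm: "module univ_ring H" "module univ_ring L" "module univ_ring (tens H H)" "module univ_ring (tens L L)"
    by (rule H.module_axioms L.module_axioms HH.module_tens LL.module_tens)+
  have inj2: "inj_on (tmap L L f f) (carrier (tens H H))"
    by (rule tensor_map_injective[OF mm(1,1,2,2) fs fs tf desc]) (use nz L_separated semilinearD(1)[OF fs] in auto)
  note ff = tensor_map_semilinear[OF mm(1,1,2,2) fs fs]
  have ff0: "tmap L L f f \<zero>\<^bsub>tens H H\<^esub> = \<zero>\<^bsub>tens L L\<^esub>"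
    by (rule additive_maps_zero[OF HH.abelian_group_tens LL.abelian_group_tens semilinearD(4)[OF ff]])
  have nz2: "tmap L L f f X \<noteq> \<zero>\<^bsub>tens L L\<^esub>" if "X \<in> carrier (tens H H)" "X \<noteq> \<zero>\<^bsub>tens H H\<^esub>" for X
    using inj_onD[OF inj2, of X "\<zero>\<^bsub>tens H H\<^esub>"] that ff0 by auto
  have "inj_on (tmap L (tens L L) f (tmap L L f f)) (carrier (tens H (tens H H)))"
    by (rule tensor_map_injective[OF mm(1,3,2,4) fs ff tf desc]) (use nz2 LL_separated semilinearD(1)[OF ff] in auto)
  then show ?thesis using H f closed inj inj2 by (simp add: hopf_embedding_def)
qed

end

section \<open>Decompositions under an involution\<close>

text \<open>The part of the wrong parity equals its own negative, hence vanishes, as 2 is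
  invertible.\<close>

lemma involution_parts:
  fixes M :: "('f::field_char_0, 'm, 'x) module_scheme"
  assumes M: "module univ_ring M" and T: "T \<in> additive_maps M M"
    and x: "x \<in> carrier M" "T x = x" and y: "y \<in> carrier M" "T y = \<ominus>\<^bsub>M\<^esub> y"
  shows "T (x \<oplus>\<^bsub>M\<^esub> y) = x \<oplus>\<^bsub>M\<^esub> y \<Longrightarrow> x \<oplus>\<^bsub>M\<^esub> y = x"
    "T (x \<oplus>\<^bsub>M\<^esub> y) = \<ominus>\<^bsub>M\<^esub> (x \<oplus>\<^bsub>M\<^esub> y) \<Longrightarrow> x \<oplus>\<^bsub>M\<^esub> y = y"
proof -
  interpret M: module univ_ring M by fact
  have zero: "z = \<zero>\<^bsub>M\<^esub>" if z: "z \<in> carrier M" "z = \<ominus>\<^bsub>M\<^esub> z" for z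
  proof -
    have "z \<oplus>\<^bsub>M\<^esub> z = \<zero>\<^bsub>M\<^esub>" using z M.M.r_neg[of z] by simp
    then have "2 \<odot>\<^bsub>M\<^esub> z = \<zero>\<^bsub>M\<^esub>" using z(1) M.smult_l_distr[of 1 1 z] M.smult_one[of z] by simp
    then show ?thesis using z(1) M.smult_assoc1[of "1/2" 2 z] M.smult_one[of z] by simp
  qed
  note t = additive_mapsD(2)[OF T x(1) y(1), unfolded x(2) y(2)]
  show "T (x \<oplus>\<^bsub>M\<^esub> y) = x \<oplus>\<^bsub>M\<^esub> y \<Longrightarrow> x \<oplus>\<^bsub>M\<^esub> y = x"
    unfolding t using x(1) y(1) zero[of y] by (metis M.M.a_inv_closed M.M.add.l_cancel M.M.r_zero)
  assume "T (x \<oplus>\<^bsub>M\<^esub> y) = \<ominus>\<^bsub>M\<^esub> (x \<oplus>\<^bsub>M\<^esub> y)"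
  then have "x \<oplus>\<^bsub>M\<^esub> \<ominus>\<^bsub>M\<^esub> y = \<ominus>\<^bsub>M\<^esub> x \<oplus>\<^bsub>M\<^esub> \<ominus>\<^bsub>M\<^esub> y" unfolding t using x(1) y(1) M.M.minus_add by simp
  then have "x = \<ominus>\<^bsub>M\<^esub> x" using x(1) y(1) by (metis M.M.a_inv_closed M.M.add.r_cancel)
  then show "x \<oplus>\<^bsub>M\<^esub> y = y" using zero[OF x(1)] y(1) by simp
qed

lemma involution_decomposition:
  fixes M :: "('f::field_char_0, 'm, 'x) module_scheme"
  assumes M: "module univ_ring M" and T: "T \<in> semilinear id M M" "T (T a) = a" and a: "a \<in> carrier M"
  obtains x y where "x \<in> carrier M" "y \<in> carrier M" "T x = x" "T y = \<ominus>\<^bsub>M\<^esub> y" "a = x \<oplus>\<^bsub>M\<^esub> y"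
    "x = (1/2) \<odot>\<^bsub>M\<^esub> (a \<oplus>\<^bsub>M\<^esub> T a)" "y = (1/2) \<odot>\<^bsub>M\<^esub> (a \<ominus>\<^bsub>M\<^esub> T a)"
proof -
  interpret M: module univ_ring M by fact
  note t = semilinearD[OF T(1)]
  have Ta: "T a \<in> carrier M" by (rule t(1)[OF a])
  have neg: "T (\<ominus>\<^bsub>M\<^esub> z) = \<ominus>\<^bsub>M\<^esub> T z" if "z \<in> carrier M" for z
    by (rule additive_maps_uminus[OF M.abelian_group_axioms M.abelian_group_axioms t(4) that])
  have "a \<oplus>\<^bsub>M\<^esub> T a \<oplus>\<^bsub>M\<^esub> (a \<ominus>\<^bsub>M\<^esub> T a) = a \<oplus>\<^bsub>M\<^esub> a"
    using a Ta by (simp add: M.M.minus_eq M.M.a_ac M.M.r_neg1 M.M.r_neg)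
  then have "(1/2) \<odot>\<^bsub>M\<^esub> (a \<oplus>\<^bsub>M\<^esub> T a) \<oplus>\<^bsub>M\<^esub> (1/2) \<odot>\<^bsub>M\<^esub> (a \<ominus>\<^bsub>M\<^esub> T a) = (1/2) \<odot>\<^bsub>M\<^esub> (a \<oplus>\<^bsub>M\<^esub> a)"
    using a Ta M.smult_r_distr[of "1/2" "a \<oplus>\<^bsub>M\<^esub> T a" "a \<ominus>\<^bsub>M\<^esub> T a"] by simp
  also have "\<dots> = a" using a M.smult_r_distr[of "1/2" a a] M.smult_l_distr[of "1/2" "1/2" a] M.smult_one[of a] by simp
  finally have s: "a = (1/2) \<odot>\<^bsub>M\<^esub> (a \<oplus>\<^bsub>M\<^esub> T a) \<oplus>\<^bsub>M\<^esub> (1/2) \<odot>\<^bsub>M\<^esub> (a \<ominus>\<^bsub>M\<^esub> T a)" ..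
  have "T a \<ominus>\<^bsub>M\<^esub> a = \<ominus>\<^bsub>M\<^esub> (a \<ominus>\<^bsub>M\<^esub> T a)" using a Ta by (simp add: M.M.minus_eq M.M.minus_add M.M.a_comm)
  then have o: "T ((1/2) \<odot>\<^bsub>M\<^esub> (a \<ominus>\<^bsub>M\<^esub> T a)) = \<ominus>\<^bsub>M\<^esub> ((1/2) \<odot>\<^bsub>M\<^esub> (a \<ominus>\<^bsub>M\<^esub> T a))"
    using a Ta by (simp add: t(2,3) neg T(2) M.smult_r_minus M.M.minus_eq)
  show ?thesis
    by (rule that[OF _ _ _ o s HOL.refl HOL.refl]) (use a Ta in \<open>simp_all add: t(2,3) T(2) M.M.a_comm\<close>)
qed

text \<open>Replacing the coefficients by their traces, or else by their multiples by an odd unit.\<close>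

lemma fixed_relation:
  assumes L: "algebra univ_ring L" and \<sigma>: "\<sigma> \<in> semilinear \<tau> L L" and \<tau>: "\<tau> \<in> ring_hom univ_ring univ_ring" "\<And>s. \<tau> (\<tau> s) = s"
    and w: "\<tau> w = - w" "\<And>s. w * s = 0 \<Longrightarrow> s = 0"
    and I: "finite I" "y \<in> I \<rightarrow> carrier L" "\<And>i. i \<in> I \<Longrightarrow> \<sigma> (y i) = y i" "i \<in> I" "s i \<noteq> 0"
    and rel: "finsum L (\<lambda>i. s i \<odot>\<^bsub>L\<^esub> y i) I = \<zero>\<^bsub>L\<^esub>"
  obtains s' j where "j \<in> I" "s' j \<noteq> 0" "\<forall>i\<in>I. \<tau> (s' i) = s' i" "finsum L (\<lambda>i. s' i \<odot>\<^bsub>L\<^esub> y i) I = \<zero>\<^bsub>L\<^esub>"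
    "s' = (\<lambda>i. s i + \<tau> (s i)) \<or> s' = (\<lambda>i. w * s i)"
proof -
  interpret L: algebra univ_ring L by fact
  note d = algebra_univD[OF L] and t = univ_homD[OF \<tau>(1)]
  have y: "i \<in> I \<Longrightarrow> y i \<in> carrier L" for i using I(2) by auto
  show thesis
  proof (cases "\<exists>j\<in>I. s j + \<tau> (s j) \<noteq> 0")
    case True
    then obtain j where j: "j \<in> I" "s j + \<tau> (s j) \<noteq> 0" by blast
    \<comment> \<open>Since \<sigma> fixes the y i, applying it to the relation replaces s i by
      \<tau> (s i); adding both relations gives the traces.\<close>
    have "finsum L (\<lambda>i. \<tau> (s i) \<odot>\<^bsub>L\<^esub> y i) I = finsum L (\<lambda>i. \<sigma> (s i \<odot>\<^bsub>L\<^esub> y i)) I"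
      using y I(3) by (intro L.M.finsum_cong') (auto simp: semilinearD[OF \<sigma>])
    also have "\<dots> = \<sigma> (finsum L (\<lambda>i. s i \<odot>\<^bsub>L\<^esub> y i) I)"
      by (rule additive_maps_finsum[symmetric, OF L.M.abelian_group_axioms L.M.abelian_group_axioms semilinearD(4)[OF \<sigma>] I(1)]) (use y in auto)
    also have "\<dots> = \<zero>\<^bsub>L\<^esub>"
      unfolding rel by (rule additive_maps_zero[OF L.M.abelian_group_axioms L.M.abelian_group_axioms semilinearD(4)[OF \<sigma>]])
    finally have "finsum L (\<lambda>i. s i \<odot>\<^bsub>L\<^esub> y i \<oplus>\<^bsub>L\<^esub> \<tau> (s i) \<odot>\<^bsub>L\<^esub> y i) I = \<zero>\<^bsub>L\<^esub>"
      using y rel by (subst L.M.finsum_addf) auto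
    moreover have "finsum L (\<lambda>i. s i \<odot>\<^bsub>L\<^esub> y i \<oplus>\<^bsub>L\<^esub> \<tau> (s i) \<odot>\<^bsub>L\<^esub> y i) I = finsum L (\<lambda>i. (s i + \<tau> (s i)) \<odot>\<^bsub>L\<^esub> y i) I"
      using y by (intro L.M.finsum_cong') (auto simp: d)
    ultimately show ?thesis by (intro that[of j "\<lambda>i. s i + \<tau> (s i)"]) (simp_all add: j t \<tau>(2) add.commute)
  next
    case False
    have "finsum L (\<lambda>i. (w * s i) \<odot>\<^bsub>L\<^esub> y i) I = finsum L (\<lambda>i. w \<odot>\<^bsub>L\<^esub> (s i \<odot>\<^bsub>L\<^esub> y i)) I"
      using y by (intro L.M.finsum_cong') (auto simp: d)
    also have "\<dots> = w \<odot>\<^bsub>L\<^esub> finsum L (\<lambda>i. s i \<odot>\<^bsub>L\<^esub> y i) I"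
      by (rule additive_maps_finsum[symmetric, OF L.M.abelian_group_axioms L.M.abelian_group_axioms _ I(1)])
         (use y in \<open>auto intro!: additive_mapsI simp: L.smult_r_distr\<close>)
    also have "\<dots> = \<zero>\<^bsub>L\<^esub>" unfolding rel by simp
    finally have rel': "finsum L (\<lambda>i. (w * s i) \<odot>\<^bsub>L\<^esub> y i) I = \<zero>\<^bsub>L\<^esub>" .
    \<comment> \<open>All traces vanish, so the s k are anti-invariant, as is w.\<close>
    have "\<tau> (w * s k) = w * s k" if "k \<in> I" for k
    proof -
      have "\<tau> (s k) = - s k" using False that by (simp add: eq_neg_iff_add_eq_0 add.commute)
      then show ?thesis by (simp add: t w(1))
    qed
    then show ?thesis
      using that[of i "\<lambda>i. w * s i"] I(4,5) w(2) rel' by blast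
  qed
qed

section \<open>The contraction inside the Laurent Hopf algebra\<close>

locale involution_laurent =
  fixes A :: "('f::field_char_0, 'a) hopf" and \<theta> :: "'a \<Rightarrow> 'a"
  assumes hopf: "hopf_algebra univ_ring A" and involution: "hopf_involution univ_ring A \<theta>"
begin

sublocale base_changed_field "Poly_Mapping.single 0 :: 'f \<Rightarrow> 'f laurent" A
  using hopf by (intro base_changed_field.intro base_changed.intro single_hom) (simp add: hopf_algebra_iff)

abbreviation R where "R \<equiv> restrict_alg poly_t_to_u L (carrier L)"
abbreviation B where "B \<equiv> contraction_carrier A \<theta>"
abbreviation BB where "BB \<equiv> restrict_alg poly_t_to_u L B"

lemma L_eq: "laurent_hopf A = L"
  by (simp add: L_def laurent_hopf_def laurent_alg_def)

lemma hopf_L: "hopf_algebra univ_ring L"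
  by (rule hopf_algebra_L[OF hopf])

lemma laurent_monom_eq: "laurent_monom A c k a = P (Poly_Mapping.single k c) a"
  by (simp add: laurent_monom_def laurent_alg_def)

lemma \<theta>_hopf: "\<theta> \<in> hopf_semilinear id A A" "a \<in> carrier A \<Longrightarrow> \<theta> (\<theta> a) = a"
  using involution by (auto simp: hopf_involution_def hopf_hom_def hopf_semilinear_def alg_hom_univ)

lemmas \<theta> = hopf_semilinearD[OF \<theta>_hopf(1)]

lemma algebra_R: "algebra univ_ring R"
  by (rule algebra_restrict_carrier[OF algebra_L poly_t_to_u_hom])

lemma B_eq: "B = generated_subalgebra univ_ring R (P 1 ` {a \<in> carrier A. \<theta> a = a} \<union>
    P (Poly_Mapping.single (-1) 1) ` {a \<in> carrier A. \<theta> a = \<ominus>\<^bsub>A\<^esub> a})"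
  unfolding contraction_carrier_def L_eq laurent_monom_eq single_one ..

lemma B_sub: "is_subalgebra univ_ring R B"
  unfolding B_eq by (rule generated_subalgebra[OF algebra_R]) (auto simp: P_closed)

lemmas B_props = is_subalgebraD[OF B_sub, simplified]

lemma B_closed: "x \<in> B \<Longrightarrow> x \<in> carrier L"
  using B_props(1) by auto

lemma B_even: "a \<in> carrier A \<Longrightarrow> \<theta> a = a \<Longrightarrow> P 1 a \<in> B"
  and B_odd: "a \<in> carrier A \<Longrightarrow> \<theta> a = \<ominus>\<^bsub>A\<^esub> a \<Longrightarrow> P (Poly_Mapping.single (-1) 1) a \<in> B"
  unfolding B_eq by (rule subsetD[OF generated_subalgebra_incl], blast)+

text \<open>The induction principle for the contraction algebra, through which its stability under
  the structure maps is reduced to the two kinds of generators.\<close>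

lemma B_least:
  assumes "\<And>x. x \<in> C \<Longrightarrow> x \<in> carrier L" "\<one>\<^bsub>L\<^esub> \<in> C" "\<And>x y. x \<in> C \<Longrightarrow> y \<in> C \<Longrightarrow> x \<oplus>\<^bsub>L\<^esub> y \<in> C"
    "\<And>x y. x \<in> C \<Longrightarrow> y \<in> C \<Longrightarrow> x \<otimes>\<^bsub>L\<^esub> y \<in> C" "\<And>r x. x \<in> C \<Longrightarrow> poly_t_to_u r \<odot>\<^bsub>L\<^esub> x \<in> C"
    "\<And>a. a \<in> carrier A \<Longrightarrow> \<theta> a = a \<Longrightarrow> P 1 a \<in> C"
    "\<And>a. a \<in> carrier A \<Longrightarrow> \<theta> a = \<ominus>\<^bsub>A\<^esub> a \<Longrightarrow> P (Poly_Mapping.single (-1) 1) a \<in> C"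
  shows "B \<subseteq> C"
  unfolding B_eq
proof (rule generated_subalgebra_mono)
  show "is_subalgebra univ_ring R C" by (rule is_subalgebraI[OF algebra_R]) (use assms in auto)
qed (use assms in auto)

text \<open>\<sigma> combines u -> -u with \<theta>. It fixes a if \<theta> a = a and u^-1 a if
  \<theta> a = -a, hence the whole contraction algebra.\<close>

lemma \<sigma>_morphism: "base_change_morphism (Poly_Mapping.single 0 :: 'f \<Rightarrow> 'f laurent) A (Poly_Mapping.single 0) A id laurent_sign \<theta>"
  by (intro base_change_morphism.intro base_changed_axioms base_change_morphism_axioms.intro laurent_sign_hom \<theta>_hopf)
     (simp add: laurent_sign_single)

abbreviation \<sigma> where "\<sigma> \<equiv> base_change_morphism.F (Poly_Mapping.single 0 :: 'f \<Rightarrow> 'f laurent) A laurent_sign \<theta>"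

lemmas \<sigma>_semilinear = base_change_morphism.F_semilinear[OF \<sigma>_morphism]
lemmas \<sigma>_ring_hom = base_change_morphism.F_ring_hom[OF \<sigma>_morphism]
lemmas \<sigma>_pure = base_change_morphism.F_pure[OF \<sigma>_morphism]

lemma P_uminus: "a \<in> carrier A \<Longrightarrow> P s (\<ominus>\<^bsub>A\<^esub> a) = P (- s) a"
  using P_smult[of a s "-1"] algebra_univD(3)[OF A.algebra_axioms, of a] algebra_univD(5)[OF A.algebra_axioms, of a 1] by (simp add: single_uminus)

lemma \<sigma>_fixes_B: "x \<in> B \<Longrightarrow> \<sigma> x = x"
proof -
  have "B \<subseteq> {x \<in> carrier L. \<sigma> x = x}"
    by (rule B_least)
       (auto simp: P_closed semilinearD[OF \<sigma>_semilinear] ring_hom_mult[OF \<sigma>_ring_hom] ring_hom_one[OF \<sigma>_ring_hom]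
         \<sigma>_pure univ_homD(3)[OF laurent_sign_hom] laurent_sign_t_to_u laurent_sign_single P_uminus single_uminus)
  then show "x \<in> B \<Longrightarrow> \<sigma> x = x" by blast
qed

section \<open>Structure maps of the contraction algebra\<close>

lemma algebra_BB: "algebra univ_ring BB"
  by (rule algebra_restrict[OF algebra_L poly_t_to_u_hom B_sub])

lemma incl: "id \<in> semilinear poly_t_to_u BB L" "id \<in> ring_hom BB L"
  by (auto intro!: semilinearI ring_hom_memI simp: B_closed)

lemma u_smult: "a \<in> carrier A \<Longrightarrow> Poly_Mapping.single 1 1 \<odot>\<^bsub>L\<^esub> P (Poly_Mapping.single (-1) 1) a = P 1 a"
  by (simp add: smult_L_pure mult_single)

text \<open>Each factor of a pure tensor is split into even and odd parts under \<theta>. In the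
  even part of X, a term odd \<otimes> odd becomes t (u^-1 m \<otimes> u^-1 m'), which lies in the
  image of the square of B; in the odd part, u^-1 is absorbed by the odd factor of each
  term.\<close>

lemma comult_decomposition:
  fixes \<Delta> \<Theta> D
  defines "\<Theta> \<equiv> tmap A A \<theta> \<theta>" and "D \<equiv> tmap L L (P 1) (P 1)" and "I \<equiv> tmap L L id id ` carrier (tens BB BB)"
  assumes X: "X \<in> carrier (tens A A)"
  shows "\<exists>Y Z. Y \<in> carrier (tens A A) \<and> Z \<in> carrier (tens A A) \<and> X = Y \<oplus>\<^bsub>tens A A\<^esub> Z \<and> \<Theta> Y = Y \<and>
    \<Theta> Z = \<ominus>\<^bsub>tens A A\<^esub> Z \<and> D Y \<in> I \<and> Poly_Mapping.single (-1) 1 \<odot>\<^bsub>tens L L\<^esub> D Z \<in> I"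
proof -
  note mA = A.module_axioms and mL = L.module_axioms
  interpret BBB: tensor_algebras BB BB by (intro tensor_algebras.intro algebra_BB)
  note mB = BBB.A.module_axioms
  note ii = tensor_map_semilinear[OF mB mB mL mL incl(1) incl(1)]
  note DD = tensor_map_semilinear[OF mA mA mL mL unit_semilinear unit_semilinear, folded D_def]
  note TT = tensor_map_semilinear[OF mA mA mA mA \<theta>(2) \<theta>(2), folded \<Theta>_def]
  note Dp = tensor_map_pure[OF mA mA mL mL unit_semilinear unit_semilinear, folded D_def]
  note Tp = tensor_map_pure[OF mA mA mA mA \<theta>(2) \<theta>(2), folded \<Theta>_def]
  have Ip: "pure L L x y \<in> I" if "x \<in> B" "y \<in> B" for x y
    unfolding I_def
  proof (rule image_eqI)
    show "pure BB BB x y \<in> carrier (tens BB BB)" by (rule BBB.pure_closed) (simp_all only: restrict_alg_simps that)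
    have "tmap L L id id (pure BB BB x y) = pure L L (id x) (id y)"
      by (rule tensor_map_pure[OF mB mB mL mL incl(1) incl(1)]) (simp_all only: restrict_alg_simps that)
    then show "pure L L x y = tmap L L id id (pure BB BB x y)" unfolding id_apply by (rule HOL.sym)
  qed
  have Ia: "x \<oplus>\<^bsub>tens L L\<^esub> y \<in> I" if "x \<in> I" "y \<in> I" for x y
  proof -
    obtain x' y' where x: "x' \<in> carrier (tens BB BB)" "x = tmap L L id id x'" and y: "y' \<in> carrier (tens BB BB)" "y = tmap L L id id y'"
      using \<open>x \<in> I\<close> \<open>y \<in> I\<close> unfolding I_def by blast
    show ?thesis unfolding I_def x(2) y(2) semilinearD(2)[OF ii x(1) y(1), symmetric]
      by (rule imageI[OF BBB.T.a_closed[OF x(1) y(1)]])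
  qed
  have Is: "poly_t_to_u r \<odot>\<^bsub>tens L L\<^esub> x \<in> I" if "x \<in> I" for r x
  proof -
    obtain x' where x: "x' \<in> carrier (tens BB BB)" "x = tmap L L id id x'"
      using \<open>x \<in> I\<close> unfolding I_def by blast
    show ?thesis unfolding I_def x(2) semilinearD(3)[OF ii x(1), symmetric]
      by (rule imageI[OF algebra_univD(6)[OF BBB.algebra_tens x(1)]])
  qed
  have I0: "\<zero>\<^bsub>tens L L\<^esub> \<in> I"
    unfolding I_def additive_maps_zero[symmetric, OF BBB.abelian_group_tens LL.abelian_group_tens semilinearD(4)[OF ii]]
    by (rule imageI[OF BBB.T.zero_closed])
  note D0 = additive_maps_zero[OF A.HH.abelian_group_tens LL.abelian_group_tens semilinearD(4)[OF DD]]
  note T0 = additive_maps_zero[OF A.HH.abelian_group_tens A.HH.abelian_group_tens semilinearD(4)[OF TT]]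
  let ?v = "Poly_Mapping.single (-1) 1 :: 'f laurent"
  show ?thesis using X
  proof (induction rule: A.HH.tensor_induct)
    case zero
    show ?case by (rule exI[of _ "\<zero>\<^bsub>tens A A\<^esub>"], rule exI[of _ "\<zero>\<^bsub>tens A A\<^esub>"]) (simp add: D0 T0 I0)
  next
    case (pure a b)
    obtain p m where a: "p \<in> carrier A" "m \<in> carrier A" "\<theta> p = p" "\<theta> m = \<ominus>\<^bsub>A\<^esub> m" "a = p \<oplus>\<^bsub>A\<^esub> m"
      by (rule involution_decomposition[OF mA \<theta>(2) \<theta>_hopf(2)[OF pure(1)] pure(1)])
    obtain p' m' where b: "p' \<in> carrier A" "m' \<in> carrier A" "\<theta> p' = p'" "\<theta> m' = \<ominus>\<^bsub>A\<^esub> m'" "b = p' \<oplus>\<^bsub>A\<^esub> m'"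
      by (rule involution_decomposition[OF mA \<theta>(2) \<theta>_hopf(2)[OF pure(2)] pure(2)])
    let ?Y = "pure A A p p' \<oplus>\<^bsub>tens A A\<^esub> pure A A m m'" and ?Z = "pure A A p m' \<oplus>\<^bsub>tens A A\<^esub> pure A A m p'"
    have w: "P ?v m \<in> carrier L" "P ?v m' \<in> carrier L" using a b by (simp_all add: P_closed)
    \<comment> \<open>The scalar t collects one factor u from each of the two odd elements.\<close>
    have t: "Poly_Mapping.single 1 1 * Poly_Mapping.single 1 1 = poly_t_to_u [:0, 1 :: 'f:]"
      by (simp add: poly_t_to_u_t mult_single)
    have "pure L L (P 1 m) (P 1 m') = poly_t_to_u [:0, 1:] \<odot>\<^bsub>tens L L\<^esub> pure L L (P ?v m) (P ?v m')"
      unfolding u_smult[OF a(2), symmetric] u_smult[OF b(2), symmetric] t[symmetric] using w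
      by (simp add: LL.smult_pure LL.pure_smult_swap[symmetric] algebra_univD(2)[OF algebra_L])
    then have "D ?Y \<in> I"
      using a b by (simp add: semilinearD(2)[OF DD] Dp Ia Is Ip B_even B_odd)
    moreover have "?v \<odot>\<^bsub>tens L L\<^esub> pure L L (P 1 p) (P 1 m') = pure L L (P 1 p) (P ?v m')"
      "?v \<odot>\<^bsub>tens L L\<^esub> pure L L (P 1 m) (P 1 p') = pure L L (P ?v m) (P 1 p')"
      using a b LL.pure_smult_swap[of "P 1 p" "P 1 m'" ?v] by (simp_all add: LL.smult_pure P_closed smult_L_pure)
    then have "?v \<odot>\<^bsub>tens L L\<^esub> D ?Z \<in> I"
      using a b by (simp add: semilinearD(2)[OF DD] Dp LL.TA.smult_r_distr P_closed Ia Ip B_even B_odd)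
    moreover have "pure A A a b = ?Y \<oplus>\<^bsub>tens A A\<^esub> ?Z"
      unfolding a(5) b(5) using a(1,2) b(1,2) by (simp add: A.HH.pure_add_left A.HH.pure_add_right A.HH.T.a_ac)
    moreover have "\<Theta> ?Y = ?Y" "\<Theta> ?Z = \<ominus>\<^bsub>tens A A\<^esub> ?Z"
      using a b by (simp_all add: semilinearD(2)[OF TT] Tp A.HH.pure_uminus_left A.HH.pure_uminus_right A.HH.T.minus_add)
    moreover have "?Y \<in> carrier (tens A A)" "?Z \<in> carrier (tens A A)" using a b by simp_all
    ultimately show ?case by blast
  next
    case (add X1 X2)
    obtain Y1 Z1 where 1: "Y1 \<in> carrier (tens A A)" "Z1 \<in> carrier (tens A A)" "X1 = Y1 \<oplus>\<^bsub>tens A A\<^esub> Z1" "\<Theta> Y1 = Y1"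
      "\<Theta> Z1 = \<ominus>\<^bsub>tens A A\<^esub> Z1" "D Y1 \<in> I" "?v \<odot>\<^bsub>tens L L\<^esub> D Z1 \<in> I" using add.IH(1) by blast
    obtain Y2 Z2 where 2: "Y2 \<in> carrier (tens A A)" "Z2 \<in> carrier (tens A A)" "X2 = Y2 \<oplus>\<^bsub>tens A A\<^esub> Z2" "\<Theta> Y2 = Y2"
      "\<Theta> Z2 = \<ominus>\<^bsub>tens A A\<^esub> Z2" "D Y2 \<in> I" "?v \<odot>\<^bsub>tens L L\<^esub> D Z2 \<in> I" using add.IH(2) by blast
    show ?case
    proof (rule exI[of _ "Y1 \<oplus>\<^bsub>tens A A\<^esub> Y2"], rule exI[of _ "Z1 \<oplus>\<^bsub>tens A A\<^esub> Z2"], intro conjI)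
      show "D (Y1 \<oplus>\<^bsub>tens A A\<^esub> Y2) \<in> I" using 1(1,6) 2(1,6) by (simp add: semilinearD(2)[OF DD] Ia)
      show "?v \<odot>\<^bsub>tens L L\<^esub> D (Z1 \<oplus>\<^bsub>tens A A\<^esub> Z2) \<in> I" using 1(2,7) 2(2,7)
        by (simp add: semilinearD(1,2)[OF DD] LL.TA.smult_r_distr Ia)
      show "X1 \<oplus>\<^bsub>tens A A\<^esub> X2 = Y1 \<oplus>\<^bsub>tens A A\<^esub> Y2 \<oplus>\<^bsub>tens A A\<^esub> (Z1 \<oplus>\<^bsub>tens A A\<^esub> Z2)"
        unfolding 1(3) 2(3) using 1(1,2) 2(1,2) by (simp add: A.HH.T.a_ac)
      show "\<Theta> (Y1 \<oplus>\<^bsub>tens A A\<^esub> Y2) = Y1 \<oplus>\<^bsub>tens A A\<^esub> Y2" using 1(1,4) 2(1,4) by (simp add: semilinearD(2)[OF TT])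
      show "\<Theta> (Z1 \<oplus>\<^bsub>tens A A\<^esub> Z2) = \<ominus>\<^bsub>tens A A\<^esub> (Z1 \<oplus>\<^bsub>tens A A\<^esub> Z2)"
        using 1(2,5) 2(2,5) by (simp add: semilinearD(2)[OF TT] A.HH.T.minus_add)
    qed (use 1 2 in auto)
  qed
qed

text \<open>Comultiplication commutes with \<theta>, so it maps even elements to even tensors and
  odd ones to odd tensors; only one part of \<open>comult_decomposition\<close> is left for each
  generator. Closure under the operations holds because the image of the square of B is a
  subalgebra.\<close>

lemma comult_B: "x \<in> B \<Longrightarrow> comult L x \<in> tmap L L id id ` carrier (tens BB BB)"
proof -
  let ?I = "tmap L L id id ` carrier (tens BB BB)"
  note mA = A.module_axioms and mL = L.module_axioms
  interpret LH: pre_hopf_algebra L by (rule pre_hopf_algebraI[OF pre_hopf_L])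
  interpret BBB: tensor_algebras BB BB by (intro tensor_algebras.intro algebra_BB)
  note mB = BBB.A.module_axioms
  note ii = tensor_map_semilinear[OF mB mB mL mL incl(1) incl(1)]
  note ih = tensor_map_ring_hom[OF algebra_BB algebra_BB algebra_L algebra_L incl(1) incl(1) incl(2) incl(2)]
  note TT = tensor_map_semilinear[OF mA mA mA mA \<theta>(2) \<theta>(2)]
  note c = LH.comult_hom
  have even: "comult L (P 1 a) \<in> ?I" if a: "a \<in> carrier A" "\<theta> a = a" for a
  proof -
    obtain Y Z where yz: "Y \<in> carrier (tens A A)" "Z \<in> carrier (tens A A)" "comult A a = Y \<oplus>\<^bsub>tens A A\<^esub> Z" "tmap A A \<theta> \<theta> Y = Y"
      "tmap A A \<theta> \<theta> Z = \<ominus>\<^bsub>tens A A\<^esub> Z" "tmap L L (P 1) (P 1) Y \<in> ?I"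
      using comult_decomposition[OF A.comult_simps(1)[OF a(1)]] by blast
    have "Y \<oplus>\<^bsub>tens A A\<^esub> Z = Y"
      by (rule involution_parts(1)[OF A.HH.module_tens semilinearD(4)[OF TT] yz(1,4,2,5)])
         (use \<theta>(3)[OF a(1)] a(2) yz(3) in simp)
    then show ?thesis using yz structure_L(4)[OF a(1)] by simp
  qed
  have odd: "comult L (P (Poly_Mapping.single (-1) 1) a) \<in> ?I" if a: "a \<in> carrier A" "\<theta> a = \<ominus>\<^bsub>A\<^esub> a" for a
  proof -
    obtain Y Z where yz: "Y \<in> carrier (tens A A)" "Z \<in> carrier (tens A A)" "comult A a = Y \<oplus>\<^bsub>tens A A\<^esub> Z" "tmap A A \<theta> \<theta> Y = Y"
      "tmap A A \<theta> \<theta> Z = \<ominus>\<^bsub>tens A A\<^esub> Z" "Poly_Mapping.single (-1) 1 \<odot>\<^bsub>tens L L\<^esub> tmap L L (P 1) (P 1) Z \<in> ?I"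
      using comult_decomposition[OF A.comult_simps(1)[OF a(1)]] by blast
    have "comult A (\<ominus>\<^bsub>A\<^esub> a) = \<ominus>\<^bsub>tens A A\<^esub> comult A a"
      by (rule additive_maps_uminus[OF A.M.abelian_group_axioms A.HH.abelian_group_tens semilinearD(4)[OF A.comult_hom(2)] a(1)])
    then have "Y \<oplus>\<^bsub>tens A A\<^esub> Z = Z"
      by (intro involution_parts(2)[OF A.HH.module_tens semilinearD(4)[OF TT] yz(1,4,2,5)])
         (use \<theta>(3)[OF a(1)] a(2) yz(3) in simp)
    then show ?thesis using yz structure_L(4)[OF a(1)] semilinearD(3)[OF structure_L(1), of "P 1 a"] a(1)
      by (simp add: P_closed P_eq[of a "Poly_Mapping.single (-1) 1"])
  qed
  have "B \<subseteq> {x \<in> carrier L. comult L x \<in> ?I}"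
  proof (rule B_least; (elim CollectE conjE)?; (intro CollectI conjI)?)
    have "comult L \<one>\<^bsub>L\<^esub> = tmap L L id id \<one>\<^bsub>tens BB BB\<^esub>"
      unfolding ring_hom_one[OF c(1)] ring_hom_one[OF ih] ..
    then show "comult L \<one>\<^bsub>L\<^esub> \<in> ?I" by (rule image_eqI) (rule BBB.TA.one_closed)
    fix x assume x: "x \<in> carrier L" "comult L x \<in> ?I"
    then obtain x' where x': "x' \<in> carrier (tens BB BB)" "comult L x = tmap L L id id x'" by blast
    have "comult L (poly_t_to_u r \<odot>\<^bsub>L\<^esub> x) = tmap L L id id (r \<odot>\<^bsub>tens BB BB\<^esub> x')" for r
      unfolding semilinearD(3)[OF ii x'(1)] semilinearD(3)[OF c(2) x(1)] x'(2) id_apply ..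
    then show "comult L (poly_t_to_u r \<odot>\<^bsub>L\<^esub> x) \<in> ?I" for r
      by (rule image_eqI) (rule algebra_univD(6)[OF BBB.algebra_tens x'(1)])
    fix y assume y: "y \<in> carrier L" "comult L y \<in> ?I"
    then obtain y' where y': "y' \<in> carrier (tens BB BB)" "comult L y = tmap L L id id y'" by blast
    have "comult L (x \<oplus>\<^bsub>L\<^esub> y) = tmap L L id id (x' \<oplus>\<^bsub>tens BB BB\<^esub> y')"
      unfolding semilinearD(2)[OF ii x'(1) y'(1)] semilinearD(2)[OF c(2) x(1) y(1)] x'(2) y'(2) ..
    then show "comult L (x \<oplus>\<^bsub>L\<^esub> y) \<in> ?I" by (rule image_eqI) (rule BBB.T.a_closed[OF x'(1) y'(1)])
    have "comult L (x \<otimes>\<^bsub>L\<^esub> y) = tmap L L id id (x' \<otimes>\<^bsub>tens BB BB\<^esub> y')"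
      unfolding ring_hom_mult[OF ih x'(1) y'(1)] ring_hom_mult[OF c(1) x(1) y(1)] x'(2) y'(2) ..
    then show "comult L (x \<otimes>\<^bsub>L\<^esub> y) \<in> ?I" by (rule image_eqI) (rule BBB.TA.m_closed[OF x'(1) y'(1)])
  qed (simp_all only: even odd P_closed L.one_closed L.M.a_closed L.m_closed algebra_univD(6)[OF algebra_L])
  then show "x \<in> B \<Longrightarrow> comult L x \<in> ?I" by blast
qed

text \<open>The counit is invariant under \<theta>, so it vanishes on odd elements and the
  generators u^-1 a cause no pole.\<close>

lemma counit_B: "x \<in> B \<Longrightarrow> counit L x \<in> range poly_t_to_u"
proof -
  interpret LH: pre_hopf_algebra L by (rule pre_hopf_algebraI[OF pre_hopf_L])
  note u = univ_homD[OF poly_t_to_u_hom, symmetric]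
  have odd: "counit A a = 0" if a: "a \<in> carrier A" "\<theta> a = \<ominus>\<^bsub>A\<^esub> a" for a
  proof -
    have "counit A (\<ominus>\<^bsub>A\<^esub> a) = - counit A a"
      using A.counit_add[of "\<ominus>\<^bsub>A\<^esub> a" a] A.counit_hom(2)[of a 0] a(1) algebra_univD(4)[OF A.algebra_axioms a(1)]
      by (simp add: A.M.l_neg eq_neg_iff_add_eq_0)
    then have "counit A a = - counit A a" using \<theta>(4)[OF a(1)] a(2) by simp
    then show ?thesis by (metis eq_neg_iff_add_eq_0 mult_2 mult_eq_0_iff zero_neq_numeral)
  qed
  have "B \<subseteq> {x \<in> carrier L. counit L x \<in> range poly_t_to_u}"
  proof (rule B_least)
    show "\<one>\<^bsub>L\<^esub> \<in> {x \<in> carrier L. counit L x \<in> range poly_t_to_u}"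
      using ring_hom_one[OF LH.counit_hom(1)] univ_homD(3)[OF poly_t_to_u_hom] by (auto intro!: range_eqI[of _ _ 1])
    fix a assume a: "a \<in> carrier A"
    show "P 1 a \<in> {x \<in> carrier L. counit L x \<in> range poly_t_to_u}"
      using a by (auto simp: structure_L P_closed simp flip: poly_t_to_u_const)
    assume "\<theta> a = \<ominus>\<^bsub>A\<^esub> a"
    then have "counit L (P (Poly_Mapping.single (-1) 1) a) = poly_t_to_u 0"
      using a odd[of a] by (simp add: P_eq[of a "Poly_Mapping.single (-1) 1"] LH.counit_hom structure_L P_closed univ_homD[OF poly_t_to_u_hom])
    then show "P (Poly_Mapping.single (-1) 1) a \<in> {x \<in> carrier L. counit L x \<in> range poly_t_to_u}"
      using a by (auto simp: P_closed)
  qed (auto simp: LH.counit_add LH.counit_hom(2) ring_hom_mult[OF LH.counit_hom(1), simplified] ring_hom_one[OF LH.counit_hom(1), simplified]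
u(1,2))
  then show "x \<in> B \<Longrightarrow> counit L x \<in> range poly_t_to_u" by blast
qed

text \<open>The antipode commutes with \<theta> and thus preserves parity.\<close>

lemma antipode_B: "x \<in> B \<Longrightarrow> antipode L x \<in> B"
proof -
  interpret LH: pre_hopf_algebra L by (rule pre_hopf_algebraI[OF pre_hopf_L])
  note s = LH.antipode_hom
  have "B \<subseteq> {x \<in> B. antipode L x \<in> B}"
  proof (rule B_least)
    fix a assume a: "a \<in> carrier A"
    note Sa = A.antipode_simps(1)[OF a]
    show "P 1 a \<in> {x \<in> B. antipode L x \<in> B}" if "\<theta> a = a"
      using a that B_even[OF Sa] \<theta>(5)[OF a] by (simp add: structure_L B_even)
    have "antipode A (\<ominus>\<^bsub>A\<^esub> a) = \<ominus>\<^bsub>A\<^esub> antipode A a"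
      by (rule additive_maps_uminus[OF A.M.abelian_group_axioms A.M.abelian_group_axioms semilinearD(4)[OF A.antipode_hom(2)] a(1)])
    then show "P (Poly_Mapping.single (-1) 1) a \<in> {x \<in> B. antipode L x \<in> B}" if "\<theta> a = \<ominus>\<^bsub>A\<^esub> a"
      using a that B_odd[OF Sa] B_odd[OF a] \<theta>(5)[OF a] Sa semilinearD(3)[OF s(2), of "P 1 a" "Poly_Mapping.single (-1) 1"]
      by (simp add: structure_L P_eq[of _ "Poly_Mapping.single (-1) 1"] P_closed)
  qed (auto simp: B_closed B_props semilinearD(2,3)[OF s(2)] ring_hom_mult[OF s(1)] ring_hom_one[OF s(1)])
  then show "x \<in> B \<Longrightarrow> antipode L x \<in> B" by blast
qed

lemma contraction_eq: "contraction A \<theta> = restrict_hopf univ_ring poly_t_to_u univ_ring L B"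
  unfolding contraction_def L_eq ..

lemmas contraction = restrict_hopf[OF poly_t_to_u_hom pre_hopf_L B_sub comult_B counit_B antipode_B, folded contraction_eq]

lemma carrier_contraction: "carrier (contraction A \<theta>) = B"
  using same_algebraD(1)[OF contraction(1)] by simp

section \<open>Descent from F[u, 1/u] to F[t]\<close>

lemma laurent_unit: "Poly_Mapping.single k 1 * s = 0 \<Longrightarrow> s = (0 :: 'f laurent)"
  by (metis mult_eq_0_iff single_zero lookup_single_eq lookup_zero zero_neq_one)

text \<open>\<open>fixed_relation\<close> with the odd unit u makes the coefficients even, and a
  power of t clears their denominators. The form of the new coefficients is recorded so that, for
  the real family, they can be seen to stay real.\<close>

lemma even_relation:
  assumes I: "finite (I :: nat set)" "y \<in> I \<rightarrow> carrier L" "\<And>i. i \<in> I \<Longrightarrow> \<sigma> (y i) = y i" "i \<in> I" "s i \<noteq> 0"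
    "finsum L (\<lambda>i. s i \<odot>\<^bsub>L\<^esub> y i) I = \<zero>\<^bsub>L\<^esub>"
  obtains r j n w where "j \<in> I" "r j \<noteq> 0" "finsum L (\<lambda>i. poly_t_to_u (r i) \<odot>\<^bsub>L\<^esub> y i) I = \<zero>\<^bsub>L\<^esub>"
    "(\<forall>i\<in>I. poly_t_to_u (r i) = Poly_Mapping.single n 1 * (s i + laurent_sign (s i))) \<or>
     (\<forall>i\<in>I. poly_t_to_u (r i) = Poly_Mapping.single n 1 * s i)"
proof -
  have y: "i \<in> I \<Longrightarrow> y i \<in> carrier L" for i using I(2) by auto
  have w: "laurent_sign (Poly_Mapping.single 1 1) = - Poly_Mapping.single 1 (1 :: 'f)"
    by (simp add: laurent_sign_single single_uminus)
  obtain s' j where s': "j \<in> I" "s' j \<noteq> 0" "\<forall>i\<in>I. laurent_sign (s' i) = s' i" "finsum L (\<lambda>i. s' i \<odot>\<^bsub>L\<^esub> y i) I = \<zero>\<^bsub>L\<^esub>"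
    "s' = (\<lambda>i. s i + laurent_sign (s i)) \<or> s' = (\<lambda>i. Poly_Mapping.single 1 1 * s i)"
    by (rule fixed_relation[OF algebra_L \<sigma>_semilinear laurent_sign_hom laurent_sign_involution w laurent_unit I]) blast
  obtain n r where r: "\<forall>i\<in>I. Poly_Mapping.single (2 * int n) 1 * s' i = poly_t_to_u (r i)"
    using common_denominator[OF I(1), of s'] s'(3) by blast
  have "finsum L (\<lambda>i. poly_t_to_u (r i) \<odot>\<^bsub>L\<^esub> y i) I = finsum L (\<lambda>i. Poly_Mapping.single (2 * int n) 1 \<odot>\<^bsub>L\<^esub> (s' i \<odot>\<^bsub>L\<^esub> y i)) I"
    using y r by (intro L.M.finsum_cong') (auto simp: algebra_univD[OF algebra_L] simp flip: r)
  also have "\<dots> = Poly_Mapping.single (2 * int n) 1 \<odot>\<^bsub>L\<^esub> finsum L (\<lambda>i. s' i \<odot>\<^bsub>L\<^esub> y i) I"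
    by (rule additive_maps_finsum[symmetric, OF L.M.abelian_group_axioms L.M.abelian_group_axioms _ I(1)])
       (use y in \<open>auto intro!: additive_mapsI simp: L.smult_r_distr\<close>)
  also have "\<dots> = \<zero>\<^bsub>L\<^esub>" unfolding s'(4) by simp
  finally have rel: "finsum L (\<lambda>i. poly_t_to_u (r i) \<odot>\<^bsub>L\<^esub> y i) I = \<zero>\<^bsub>L\<^esub>" .
  have "r j \<noteq> 0"
  proof
    assume "r j = 0"
    then have "Poly_Mapping.single (2 * int n) 1 * s' j = 0" using r s'(1) by (simp add: univ_homD[OF poly_t_to_u_hom])
    then show False using laurent_unit s'(2) by blast
  qed
  moreover have u: "Poly_Mapping.single (2 * int n) 1 * (Poly_Mapping.single 1 1 * x) = Poly_Mapping.single (2 * int n + 1) 1 * x" for x :: "'f laurent"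
    unfolding mult.assoc[symmetric] mult_single by simp
  have "(\<forall>i\<in>I. poly_t_to_u (r i) = Poly_Mapping.single (2 * int n) 1 * (s i + laurent_sign (s i))) \<or>
     (\<forall>i\<in>I. poly_t_to_u (r i) = Poly_Mapping.single (2 * int n + 1) 1 * s i)"
    using s'(5)
  proof
    assume "s' = (\<lambda>i. Poly_Mapping.single 1 1 * s i)"
    then show ?thesis using r u by simp
  qed (use r in simp)
  ultimately show ?thesis using that[OF s'(1) _ rel] by blast
qed

text \<open>Descent works because \<sigma> fixes the image B pointwise; this serves the contraction
  and the complex family alike.\<close>

lemma even_embedding:
  assumes H: "algebra univ_ring H" and f: "f \<in> hopf_semilinear poly_t_to_u H L" "inj_on f (carrier H)"
    and closed: "\<And>x. x \<in> carrier H \<Longrightarrow> comult H x \<in> carrier (tens H H)" "\<And>x. x \<in> carrier H \<Longrightarrow> antipode H x \<in> carrier H"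
    and img: "f ` carrier H = B"
  shows "hopf_embedding poly_t_to_u H L f"
proof (rule embedding_into_L[OF _ poly_t_to_u_hom inj_poly_t_to_u H f closed])
  fix I :: "nat set" and y s i
  assume I: "finite I" "y \<in> I \<rightarrow> f ` carrier H" "i \<in> I" "s i \<noteq> 0" "finsum L (\<lambda>i. s i \<odot>\<^bsub>L\<^esub> y i) I = \<zero>\<^bsub>L\<^esub>"
  have y: "y i \<in> B" if "i \<in> I" for i using I(2) that img by auto
  have y': "y \<in> I \<rightarrow> carrier L" using y B_closed by auto
  show "\<exists>r j. j \<in> I \<and> r j \<noteq> 0 \<and> finsum L (\<lambda>i. poly_t_to_u (r i) \<odot>\<^bsub>L\<^esub> y i) I = \<zero>\<^bsub>L\<^esub>"
    by (rule even_relation[OF I(1) y' \<sigma>_fixes_B[OF y] I(3,4,5)]) blast+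
qed auto

lemma contraction_embedding: "hopf_embedding poly_t_to_u (contraction A \<theta>) L id"
  by (rule even_embedding[OF contraction(2,3) inj_on_id contraction(4,5)]) (simp_all add: carrier_contraction)

end

section \<open>Entries of representations\<close>

text \<open>At a matrix of determinant 1 the generator of \<open>SL_ideal\<close> evaluates to 0, so
  the value depends only on the class.\<close>

lemma mat_poly_eval_rep_SL:
  fixes v :: "'m::finite \<Rightarrow> 'm \<Rightarrow> 't" and p :: "('m, 'r::comm_ring_1) mat_poly"
  assumes T: "algebra univ_ring T" and v: "\<And>i j. v i j \<in> carrier T"
    and det: "mat_poly_eval T v (det (\<chi> i j. mat_var i j) :: ('m, 'r) mat_poly) = \<one>\<^bsub>T\<^esub>"
  shows "mat_poly_eval T v (rep (SL_class p)) = mat_poly_eval T v p"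
proof -
  interpret matrix_evaluation T v by (rule matrix_evaluationI[OF T v])
  have "ev (det (\<chi> i j. mat_var i j) - 1) \<oplus>\<^bsub>T\<^esub> \<one>\<^bsub>T\<^esub> = \<one>\<^bsub>T\<^esub>"
    using ev_add[of "det (\<chi> i j. mat_var i j) - 1" 1] det ring_hom_one[OF ev_hom] by simp
  then have "ev (det (\<chi> i j. mat_var i j) - 1) = \<zero>\<^bsub>T\<^esub>"
    using M.add.r_cancel_one[of "\<one>\<^bsub>T\<^esub>" "ev (det (\<chi> i j. mat_var i j) - 1)"] by simp
  then have k: "x \<in> SL_ideal \<Longrightarrow> ev x = \<zero>\<^bsub>T\<^esub>" for x
    by (auto simp: SL_ideal_iff ev_mult)
  have "ev \<in> additive_maps mat_poly_alg T" by (rule additive_mapsI) (simp_all add: ev_add)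
  then show ?thesis
    unfolding SL_class_eq
    by (rule quotient_algebra.hom_rep_proj[OF quotient_algebra_SL _ M.abelian_group_axioms k]) simp_all
qed

text \<open>Both matrices are read off one generic block diagonal matrix, where determinants are multiplicative.\<close>

lemma det_matrix_product:
  fixes v w :: "'m::finite \<Rightarrow> 'm \<Rightarrow> 't" and T :: "('r::comm_ring_1, 't, 'x) module_scheme"
  defines "D \<equiv> det (\<chi> i j. mat_var i j) :: ('m, 'r) mat_poly"
  assumes T: "algebra univ_ring T" and v: "\<And>i j. v i j \<in> carrier T" and w: "\<And>i j. w i j \<in> carrier T"
    and det: "mat_poly_eval T v D = \<one>\<^bsub>T\<^esub>" "mat_poly_eval T w D = \<one>\<^bsub>T\<^esub>"
  shows "mat_poly_eval T (\<lambda>i j. finsum T (\<lambda>k. v i k \<otimes>\<^bsub>T\<^esub> w k j) UNIV) D = \<one>\<^bsub>T\<^esub>"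
proof -
  let ?b = "block v (\<lambda>i j. \<zero>\<^bsub>T\<^esub>) (\<lambda>i j. \<zero>\<^bsub>T\<^esub>) w" and ?vw = "\<lambda>i j. finsum T (\<lambda>k. v i k \<otimes>\<^bsub>T\<^esub> w k j) UNIV"
  interpret T: algebra univ_ring T by (rule T)
  have b: "?b i j \<in> carrier T" for i j by (cases i; cases j) (simp_all add: v w)
  have vw: "?vw i j \<in> carrier T" for i j using v w by (intro T.M.finsum_closed) auto
  interpret b: matrix_evaluation T ?b by (rule matrix_evaluationI[OF T b])
  interpret v: matrix_evaluation T v by (rule matrix_evaluationI[OF T v])
  interpret w: matrix_evaluation T w by (rule matrix_evaluationI[OF T w])
  interpret vw: matrix_evaluation T ?vw by (rule matrix_evaluationI[OF T vw])
  let ?X = "\<chi> i j. (mat_var (Inl i) (Inl j) :: ('m + 'm, 'r) mat_poly)" and ?Y = "\<chi> i j. (mat_var (Inr i) (Inr j) :: ('m + 'm, 'r) mat_poly)"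
  have "vw.ev D = b.ev (det (?X ** ?Y))"
    unfolding D_def
    by (rule det_hom_cong[OF T.is_cring vw.ev_hom b.ev_hom])
       (simp add: vw.ev_var matrix_matrix_mult_def univ_hom_sum(1)[OF T.is_cring b.ev_hom] b.ev_mult b.ev_var)
  also have "\<dots> = b.ev (det ?X) \<otimes>\<^bsub>T\<^esub> b.ev (det ?Y)" by (simp add: det_mul b.ev_mult)
  also have "b.ev (det ?X) = v.ev D"
    unfolding D_def by (rule det_hom_cong[OF T.is_cring b.ev_hom v.ev_hom]) (simp add: b.ev_var v.ev_var)
  also have "b.ev (det ?Y) = w.ev D"
    unfolding D_def by (rule det_hom_cong[OF T.is_cring b.ev_hom w.ev_hom]) (simp add: b.ev_var w.ev_var)
  finally show ?thesis using det by simp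
qed

lemma SL_class_det: "SL_class (det (\<chi> i j. mat_var i j) :: ('m::finite, 'r::comm_ring_1) mat_poly) = \<one>\<^bsub>SL\<^esub>"
  (is "SL_class ?D = _")
proof -
  interpret P: algebra univ_ring "mat_poly_alg :: ('r, ('m, 'r) mat_poly) module" by (rule algebra_mat_poly)
  have "?D - 1 \<in> SL_ideal" unfolding SL_ideal_iff by (rule exI[of _ 1]) simp
  moreover have "(?D \<ominus>\<^bsub>mat_poly_alg\<^esub> 1) \<oplus>\<^bsub>mat_poly_alg\<^esub> 1 = ?D"
    by (simp only: P.M.minus_eq P.M.a_assoc P.M.l_neg P.M.r_zero P.M.a_inv_closed mat_poly_alg_simps(1) UNIV_I)
  then have "?D \<ominus>\<^bsub>mat_poly_alg\<^esub> 1 = ?D - 1" by (simp add: eq_diff_eq)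
  ultimately show ?thesis
    using quotient_algebra.proj_eq_iff[OF quotient_algebra_SL, of ?D 1] SL_ops(3)[where 'm = 'm and 'r = 'r] by (simp add: SL_class_eq)
qed

text \<open>\<open>comult SL\<close> evaluates a chosen representative, so its value at an entry is
  known once the matrix with entries \<Sum> x i k \<otimes> x k j has determinant 1. That matrix is
  the product of x \<otimes> 1 and 1 \<otimes> x, both of determinant 1.\<close>

lemma SL_structure_entries:
  fixes i j :: "'m::finite"
  defines "x \<equiv> \<lambda>i j. SL_class (mat_var i j) :: ('m, 'r::comm_ring_1) mat_poly set"
  shows "comult SL (x i j) = finsum (tens SL SL) (\<lambda>k. pure SL SL (x i k) (x k j)) UNIV"
    "counit SL (x i j) = (if i = j then 1 else 0)"
proof -
  let ?S = "SL :: ('r, ('m, 'r) mat_poly set) hopf" and ?D = "det (\<chi> i j. mat_var i j) :: ('m, 'r) mat_poly"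
  interpret SS: tensor_algebras ?S ?S by (intro tensor_algebras.intro algebra_SL)
  note one = SL_class_det[where 'm = 'm and 'r = 'r]
  note c = ring_hom_closed[OF SL_class_hom(1), simplified] ring_hom_add[OF SL_class_hom(1), simplified]
    ring_hom_mult[OF SL_class_hom(1), simplified] ring_hom_one[OF SL_class_hom(1), simplified]
  let ?v = "\<lambda>i j. pure ?S ?S (x i j) \<one>\<^bsub>?S\<^esub>" and ?w = "\<lambda>i j. pure ?S ?S \<one>\<^bsub>?S\<^esub> (x i j)"
  interpret v: matrix_evaluation "tens ?S ?S" ?v by (rule matrix_evaluationI[OF SS.algebra_tens]) (simp add: x_def)
  interpret w: matrix_evaluation "tens ?S ?S" ?w by (rule matrix_evaluationI[OF SS.algebra_tens]) (simp add: x_def)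
  have hv: "(\<lambda>p. pure ?S ?S (SL_class p) \<one>\<^bsub>?S\<^esub>) \<in> ring_hom univ_ring (tens ?S ?S)"
    by (rule ring_hom_memI) (simp_all add: c SS.mult_pure SS.pure_add_left SS.one_tens)
  have hw: "(\<lambda>p. pure ?S ?S \<one>\<^bsub>?S\<^esub> (SL_class p)) \<in> ring_hom univ_ring (tens ?S ?S)"
    by (rule ring_hom_memI) (simp_all add: c SS.mult_pure SS.pure_add_right SS.one_tens)
  have "v.ev ?D = pure ?S ?S (SL_class ?D) \<one>\<^bsub>?S\<^esub>"
    by (rule det_hom_cong[OF SS.TA.is_cring v.ev_hom hv]) (simp add: v.ev_var, simp add: x_def)
  then have v1: "v.ev ?D = \<one>\<^bsub>tens ?S ?S\<^esub>" by (simp add: one SS.one_tens)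
  have "w.ev ?D = pure ?S ?S \<one>\<^bsub>?S\<^esub> (SL_class ?D)"
    by (rule det_hom_cong[OF SS.TA.is_cring w.ev_hom hw]) (simp add: w.ev_var, simp add: x_def)
  then have w1: "w.ev ?D = \<one>\<^bsub>tens ?S ?S\<^esub>" by (simp add: one SS.one_tens)
  let ?u = "\<lambda>i j. finsum (tens ?S ?S) (\<lambda>k. pure ?S ?S (x i k) (x k j)) UNIV"
  have uc: "?u i j \<in> carrier (tens ?S ?S)" for i j by (intro SS.T.finsum_closed) (auto simp: x_def)
  interpret u: matrix_evaluation "tens ?S ?S" ?u by (rule matrix_evaluationI[OF SS.algebra_tens uc])
  have eq: "?v i k \<otimes>\<^bsub>tens ?S ?S\<^esub> ?w k j = pure ?S ?S (x i k) (x k j)" for i k j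
    by (simp add: SS.mult_pure x_def)
  have u1: "u.ev ?D = \<one>\<^bsub>tens ?S ?S\<^esub>"
    using det_matrix_product[OF SS.algebra_tens v.v_closed w.v_closed v1 w1] unfolding eq .
  have "comult ?S (x i j) = u.ev (rep (x i j))" by (simp add: comult_SL x_def)
  also have "\<dots> = u.ev (mat_var i j)" unfolding x_def by (rule mat_poly_eval_rep_SL[OF SS.algebra_tens uc[unfolded x_def] u1[unfolded x_def]])
  finally show "comult ?S (x i j) = ?u i j" by (simp add: u.ev_var)
  let ?d = "\<lambda>i j :: 'm. if i = j then 1 else 0 :: 'r"
  have idh: "id \<in> ring_hom univ_ring univ_ring" by (auto intro: univ_homI)
  interpret d: matrix_evaluation "univ_alg id :: ('r, 'r) module" ?d
    by (rule matrix_evaluationI[OF algebra_univ_alg[OF idh]]) simp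
  have "d.ev ?D = det (\<chi> i j. ?d i j)"
    by (rule det_hom_cong[OF d.is_cring d.ev_hom, where h = "\<lambda>x. x"]) (auto simp: d.ev_var intro!: ring_hom_memI)
  also have "(\<chi> i j. ?d i j) = mat 1" by (simp add: mat_def)
  finally have d1: "d.ev ?D = \<one>\<^bsub>univ_alg id\<^esub>" by (simp only: det_I univ_alg_simps)
  have "counit ?S (x i j) = d.ev (mat_var i j)"
    unfolding counit_SL x_def by (rule mat_poly_eval_rep_SL[OF d.algebra_axioms _ d1]) simp
  then show "counit ?S (x i j) = ?d i j" by (simp add: d.ev_var)
qed

lemma (in abelian_monoid) finsum_plus_UNIV:
  fixes g :: "'n::finite + 'm::finite \<Rightarrow> 'a"
  assumes "\<And>k. g k \<in> carrier G"
  shows "finsum G g UNIV = finsum G (\<lambda>k. g (Inl k)) UNIV \<oplus> finsum G (\<lambda>k. g (Inr k)) UNIV"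
proof -
  have "finsum G g (range Inl \<union> range Inr) = finsum G g (range Inl) \<oplus> finsum G g (range Inr)"
    using assms by (intro finsum_Un_disjoint) auto
  also have "range Inl \<union> range Inr = (UNIV :: ('n + 'm) set)" by (simp add: UNIV_sum)
  also have "finsum G g (range Inl) = finsum G (\<lambda>k. g (Inl k)) UNIV"
    using assms by (intro finsum_reindex) auto
  also have "finsum G g (range Inr) = finsum G (\<lambda>k. g (Inr k)) UNIV"
    using assms by (intro finsum_reindex) auto
  finally show ?thesis .
qed

text \<open>The difference d = x - x' is even while d + y = y' is odd, so
  \<open>involution_parts\<close> removes d.\<close>

lemma involution_unique:
  fixes M :: "('f::field_char_0, 'm, 'x) module_scheme"
  assumes M: "module univ_ring M" and T: "T \<in> additive_maps M M"
    and x: "x \<in> carrier M" "T x = x" and y: "y \<in> carrier M" "T y = \<ominus>\<^bsub>M\<^esub> y"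
    and x': "x' \<in> carrier M" "T x' = x'" and y': "y' \<in> carrier M" "T y' = \<ominus>\<^bsub>M\<^esub> y'"
    and eq: "x \<oplus>\<^bsub>M\<^esub> y = x' \<oplus>\<^bsub>M\<^esub> y'"
  shows "x = x'" "y = y'"
proof -
  interpret M: module univ_ring M by fact
  define d where "d = x \<oplus>\<^bsub>M\<^esub> \<ominus>\<^bsub>M\<^esub> x'"
  note neg = additive_maps_uminus[OF M.abelian_group_axioms M.abelian_group_axioms T]
  have d: "d \<in> carrier M" "T d = d" using x x' by (simp_all add: d_def additive_mapsD(2)[OF T] neg)
  have "d \<oplus>\<^bsub>M\<^esub> x' = x" using x x' by (simp add: d_def M.M.a_assoc M.M.l_neg)
  moreover have "x' \<oplus>\<^bsub>M\<^esub> (d \<oplus>\<^bsub>M\<^esub> y) = (d \<oplus>\<^bsub>M\<^esub> x') \<oplus>\<^bsub>M\<^esub> y" using d x' y by (simp add: M.M.a_ac)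
  ultimately have "x' \<oplus>\<^bsub>M\<^esub> (d \<oplus>\<^bsub>M\<^esub> y) = x' \<oplus>\<^bsub>M\<^esub> y'" using eq by simp
  then have dy: "d \<oplus>\<^bsub>M\<^esub> y = y'" using d x y x' y' by simp
  have "d \<oplus>\<^bsub>M\<^esub> y = y"
    by (rule involution_parts(2)[OF M T d y]) (simp add: dy y')
  then show "y = y'" using dy by simp
  then show "x = x'" using eq x x' y' by simp
qed

section \<open>The Barbasch--Higson--Subag representation\<close>

locale complex_bhs = involution_laurent A \<theta> for A :: "(complex, 'a) hopf" and \<theta> +
  fixes \<iota> :: "('n::finite, complex) mat_poly set \<Rightarrow> 'a"
  assumes faithful: "faithful_representation A \<iota>"
begin

abbreviation E where "E \<equiv> bhs_entry A \<theta> \<iota>"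

text \<open>q is the map from polynomials in the entries to A induced by \<iota>, a the matrix of
  the representation, and e and f its even and odd parts under \<theta>. The conjugated matrix has
  the blocks e, u f, u^-1 f and e.\<close>

definition q where "q p = \<iota> (SL_class p)"
definition a where "a i j = q (mat_var i j)"
definition e where "e i j = (1/2) \<odot>\<^bsub>A\<^esub> (a i j \<oplus>\<^bsub>A\<^esub> \<theta> (a i j))"
definition f where "f i j = (1/2) \<odot>\<^bsub>A\<^esub> (a i j \<ominus>\<^bsub>A\<^esub> \<theta> (a i j))"

lemma \<iota>: "\<iota> \<in> ring_hom SL A" "\<iota> \<in> semilinear id SL A"
  "X \<in> carrier SL \<Longrightarrow> comult A (\<iota> X) = tmap A A \<iota> \<iota> (comult SL X)" "X \<in> carrier SL \<Longrightarrow> counit A (\<iota> X) = counit SL X"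
  "\<iota> ` carrier SL = carrier A"
  using faithful by (auto simp: faithful_representation_def hopf_hom_def alg_hom_univ)

lemma q_hom: "q \<in> ring_hom univ_ring A"
  unfolding q_def
  by (rule ring_hom_memI)
     (simp_all add: ring_hom_closed[OF \<iota>(1)] ring_hom_one[OF \<iota>(1)] SL_ops(3)[symmetric]
       ring_hom_add[OF \<iota>(1), symmetric] ring_hom_mult[OF \<iota>(1), symmetric] SL_ops(1,2))

lemma q_closed [simp]: "q p \<in> carrier A"
  using ring_hom_closed[OF q_hom] by simp

lemma q_const: "q (Poly_Mapping.single 0 c) = c \<odot>\<^bsub>A\<^esub> \<one>\<^bsub>A\<^esub>"
  using semilinearD(3)[OF \<iota>(2), of "SL_class 1" c] ring_hom_one[OF q_hom] by (simp add: q_def SL_ops(4))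

lemma q_surj: assumes "x \<in> carrier A" obtains p where "x = q p"
proof -
  obtain X where "X \<in> carrier SL" "x = \<iota> X" using assms \<iota>(5) by blast
  then show thesis using that unfolding q_def by (metis SL_cases)
qed

lemma a_closed [simp]: "a i j \<in> carrier A" by (simp add: a_def)

lemma parts: "e i j \<in> carrier A" "f i j \<in> carrier A" "\<theta> (e i j) = e i j" "\<theta> (f i j) = \<ominus>\<^bsub>A\<^esub> f i j" "a i j = e i j \<oplus>\<^bsub>A\<^esub> f i j"
proof -
  obtain x y where xy: "x \<in> carrier A" "y \<in> carrier A" "\<theta> x = x" "\<theta> y = \<ominus>\<^bsub>A\<^esub> y" "a i j = x \<oplus>\<^bsub>A\<^esub> y" "x = e i j" "y = f i j"
    unfolding e_def f_def
    by (rule involution_decomposition[OF A.module_axioms \<theta>(2) \<theta>_hopf(2)[OF a_closed[of i j]] a_closed[of i j]])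
  then show "e i j \<in> carrier A" "f i j \<in> carrier A" "\<theta> (e i j) = e i j" "\<theta> (f i j) = \<ominus>\<^bsub>A\<^esub> f i j" "a i j = e i j \<oplus>\<^bsub>A\<^esub> f i j"
    by simp_all
qed

section \<open>Structure maps on the entries of the representation\<close>

lemma comult_a: "comult A (a i j) = finsum (tens A A) (\<lambda>k. pure A A (a i k) (a k j)) UNIV"
proof -
  interpret SS: tensor_algebras "SL :: (complex, ('n, complex) mat_poly set) hopf" SL by (intro tensor_algebras.intro algebra_SL)
  note m = algebra_module[OF algebra_SL] algebra_module[OF algebra_SL] A.module_axioms A.module_axioms \<iota>(2) \<iota>(2)
  note ii = tensor_map_semilinear[OF m]
  let ?x = "\<lambda>i j. SL_class (mat_var i j) :: ('n, complex) mat_poly set"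
  have "comult A (a i j) = tmap A A \<iota> \<iota> (finsum (tens SL SL) (\<lambda>k. pure SL SL (?x i k) (?x k j)) UNIV)"
    by (simp add: a_def q_def \<iota>(3) SL_structure_entries)
  also have "\<dots> = finsum (tens A A) (\<lambda>k. tmap A A \<iota> \<iota> (pure SL SL (?x i k) (?x k j))) UNIV"
    by (rule additive_maps_finsum[OF SS.abelian_group_tens A.HH.abelian_group_tens semilinearD(4)[OF ii] finite]) auto
  finally show ?thesis by (simp add: tensor_map_pure[OF m] a_def q_def)
qed

text \<open>Insert a = e + f into the comultiplication of a and sort by parity under \<theta>
  \<otimes> \<theta>. As comultiplication commutes with \<theta>, uniqueness of the decomposition
  identifies the two parts.\<close>

lemma comult_parts:
  "comult A (e i j) = finsum (tens A A) (\<lambda>k. pure A A (e i k) (e k j) \<oplus>\<^bsub>tens A A\<^esub> pure A A (f i k) (f k j)) UNIV" (is "_ = ?Y")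
  "comult A (f i j) = finsum (tens A A) (\<lambda>k. pure A A (e i k) (f k j) \<oplus>\<^bsub>tens A A\<^esub> pure A A (f i k) (e k j)) UNIV" (is "_ = ?Z")
proof -
  note mA = A.module_axioms
  note TT = tensor_map_semilinear[OF mA mA mA mA \<theta>(2) \<theta>(2)]
  note Tp = tensor_map_pure[OF mA mA mA mA \<theta>(2) \<theta>(2)]
  note Ts = additive_maps_finsum[OF A.HH.abelian_group_tens A.HH.abelian_group_tens semilinearD(4)[OF TT] finite]
  let ?T = "tens A A"
  have c: "?Y \<in> carrier ?T" "?Z \<in> carrier ?T" by (auto intro!: A.HH.T.finsum_closed simp: parts)
  have "comult A (a i j) = finsum ?T (\<lambda>k. (pure A A (e i k) (e k j) \<oplus>\<^bsub>?T\<^esub> pure A A (f i k) (f k j)) \<oplus>\<^bsub>?T\<^esub>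
      (pure A A (e i k) (f k j) \<oplus>\<^bsub>?T\<^esub> pure A A (f i k) (e k j))) UNIV"
    unfolding comult_a
    by (rule A.HH.T.finsum_cong')
       (auto simp: parts(5) A.HH.pure_add_left A.HH.pure_add_right parts(1,2) A.HH.T.a_ac)
  also have "\<dots> = ?Y \<oplus>\<^bsub>?T\<^esub> ?Z" by (rule A.HH.T.finsum_addf) (auto simp: parts)
  finally have s: "comult A (e i j) \<oplus>\<^bsub>?T\<^esub> comult A (f i j) = ?Y \<oplus>\<^bsub>?T\<^esub> ?Z"
    by (simp add: parts(1,2,5) semilinearD(2)[OF A.comult_hom(2)])
  have neg: "comult A (\<ominus>\<^bsub>A\<^esub> f i j) = \<ominus>\<^bsub>?T\<^esub> comult A (f i j)"
    by (rule additive_maps_uminus[OF A.M.abelian_group_axioms A.HH.abelian_group_tens semilinearD(4)[OF A.comult_hom(2)] parts(2)])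
  have Y: "tmap A A \<theta> \<theta> ?Y = ?Y"
    by (subst Ts) (auto simp: parts semilinearD(2)[OF TT] Tp A.HH.pure_uminus_left A.HH.pure_uminus_right intro!: A.HH.T.finsum_cong')
  have "tmap A A \<theta> \<theta> ?Z = finsum ?T (\<lambda>k. \<ominus>\<^bsub>?T\<^esub> (pure A A (e i k) (f k j) \<oplus>\<^bsub>?T\<^esub> pure A A (f i k) (e k j))) UNIV"
    by (subst Ts) (auto simp: parts semilinearD(2)[OF TT] Tp A.HH.pure_uminus_left A.HH.pure_uminus_right A.HH.T.minus_add intro!: A.HH.T.finsum_cong')
  also have "\<dots> = \<ominus>\<^bsub>?T\<^esub> ?Z"
    by (rule additive_maps_finsum[symmetric, OF A.HH.abelian_group_tens A.HH.abelian_group_tens _ finite])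
       (auto intro!: additive_mapsI simp: parts A.HH.T.minus_add)
  finally have Z: "tmap A A \<theta> \<theta> ?Z = \<ominus>\<^bsub>?T\<^esub> ?Z" .
  note u = involution_unique[OF A.HH.module_tens semilinearD(4)[OF TT] A.comult_simps(1)[OF parts(1)] _
      A.comult_simps(1)[OF parts(2)] _ c(1) Y c(2) Z s]
  show "comult A (e i j) = ?Y" "comult A (f i j) = ?Z"
    by (rule u; use \<theta>(3)[OF parts(1), of i j] \<theta>(3)[OF parts(2), of i j] neg in \<open>simp add: parts(3,4)\<close>)+
qed

lemma counit_parts: "counit A (e i j) = (if i = j then 1 else 0)" "counit A (f i j) = 0"
proof -
  have a: "counit A (a i j) = (if i = j then 1 else 0)"
    by (simp add: a_def q_def \<iota>(4) SL_structure_entries)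
  have neg: "counit A (\<ominus>\<^bsub>A\<^esub> \<theta> (a i j)) = - counit A (a i j)"
    using A.counit_hom(2)[of "\<theta> (a i j)" "-1"] \<theta>(4,6)[OF a_closed, of i j]
      algebra_univD(3)[OF A.algebra_axioms, of "\<theta> (a i j)"] algebra_univD(5)[OF A.algebra_axioms, of "\<theta> (a i j)" 1] by simp
  show "counit A (e i j) = (if i = j then 1 else 0)" "counit A (f i j) = 0"
    using \<theta>(4,6)[OF a_closed, of i j] neg
    by (simp_all add: e_def f_def A.M.minus_eq A.counit_hom(2) A.counit_add a)
qed

lemma entries: "E (Inl i) (Inl j) = P 1 (e i j)" "E (Inl i) (Inr j) = P (Poly_Mapping.single 1 1) (f i j)"
  "E (Inr i) (Inl j) = P (Poly_Mapping.single (-1) 1) (f i j)" "E (Inr i) (Inr j) = P 1 (e i j)"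
  using \<theta>(6)[OF a_closed, of i j]
  by (simp_all add: Let_def laurent_monom_eq e_def f_def P_smult mult_single flip: a_def[unfolded q_def])

lemma E_closed: "E i j \<in> carrier L"
  by (cases i; cases j) (simp_all only: entries P_closed parts)

text \<open>Collects the powers of u of both factors in front, where u and u^-1 can cancel.\<close>

lemma pure_scale:
  assumes "x \<in> carrier A" "y \<in> carrier A"
  shows "pure L L (P s x) (P t y) = (s * t) \<odot>\<^bsub>tens L L\<^esub> pure L L (P 1 x) (P 1 y)"
  using LL.pure_smult_swap[of "P s x" "P 1 y" t] assms
  by (simp add: P_closed LL.smult_pure smult_L_pure mult.commute)

lemmas pure_scale_u =
  pure_scale[of _ _ 1 "Poly_Mapping.single 1 1", simplified] pure_scale[of _ _ 1 "Poly_Mapping.single (-1) 1", simplified]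
  pure_scale[of _ _ "Poly_Mapping.single 1 1" 1, simplified] pure_scale[of _ _ "Poly_Mapping.single (-1) 1" 1, simplified]
  pure_scale[of _ _ "Poly_Mapping.single 1 1" "Poly_Mapping.single (-1) 1", simplified mult_single, simplified]
  pure_scale[of _ _ "Poly_Mapping.single (-1) 1" "Poly_Mapping.single 1 1", simplified mult_single, simplified]

lemma comult_sum:
  assumes b: "b \<in> carrier A" "comult A b = finsum (tens A A) g UNIV" "\<And>k :: 'n. g k \<in> carrier (tens A A)"
  shows "comult L (P s b) = finsum (tens L L) (\<lambda>k. s \<odot>\<^bsub>tens L L\<^esub> tmap L L (P 1) (P 1) (g k)) UNIV"
proof -
  note mA = A.module_axioms and mL = L.module_axioms
  note DD = tensor_map_semilinear[OF mA mA mL mL unit_semilinear unit_semilinear]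
  have "comult L (P s b) = s \<odot>\<^bsub>tens L L\<^esub> tmap L L (P 1) (P 1) (finsum (tens A A) g UNIV)"
    using b(1) by (simp add: P_eq[of b s] semilinearD(3)[OF structure_L(1)] P_closed structure_L b(2))
  also have "\<dots> = finsum (tens L L) (\<lambda>k. s \<odot>\<^bsub>tens L L\<^esub> tmap L L (P 1) (P 1) (g k)) UNIV"
    by (rule additive_maps_finsum[OF A.HH.abelian_group_tens LL.abelian_group_tens _ finite])
       (use b(3) in \<open>auto intro!: additive_mapsI simp: semilinearD[OF DD] LL.TA.smult_r_distr\<close>)
  finally show ?thesis .
qed

text \<open>Block multiplication: the two halves of the index sum give e \<otimes> e and f \<otimes>
  f on the diagonal blocks, where u and u^-1 cancel, and e \<otimes> f and f \<otimes> e off the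
  diagonal, with the factor u or u^-1 of that block.\<close>

lemma E_comult: "comult L (E i j) = finsum (tens L L) (\<lambda>k. pure L L (E i k) (E k j)) UNIV"
proof -
  note mA = A.module_axioms and mL = L.module_axioms
  note DD = tensor_map_semilinear[OF mA mA mL mL unit_semilinear unit_semilinear]
  note Dp = tensor_map_pure[OF mA mA mL mL unit_semilinear unit_semilinear]
  have "finsum (tens L L) (\<lambda>k. pure L L (E i k) (E k j)) UNIV =
     finsum (tens L L) (\<lambda>k. pure L L (E i (Inl k)) (E (Inl k) j) \<oplus>\<^bsub>tens L L\<^esub> pure L L (E i (Inr k)) (E (Inr k) j)) UNIV"
    by (subst LL.T.finsum_plus_UNIV) (auto simp: E_closed LL.T.finsum_addf simp del: bhs_entry.simps)
  also have "\<dots> = comult L (E i j)"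
  proof -
    have ce: "comult L (P s (e i j)) = finsum (tens L L) (\<lambda>k. s \<odot>\<^bsub>tens L L\<^esub> pure L L (P 1 (e i k)) (P 1 (e k j)) \<oplus>\<^bsub>tens L L\<^esub>
        s \<odot>\<^bsub>tens L L\<^esub> pure L L (P 1 (f i k)) (P 1 (f k j))) UNIV" for s i j
      by (subst comult_sum[OF parts(1) comult_parts(1)])
         (auto intro!: LL.T.finsum_cong' simp: parts semilinearD[OF DD] Dp P_closed LL.TA.smult_r_distr)
    have cf: "comult L (P s (f i j)) = finsum (tens L L) (\<lambda>k. s \<odot>\<^bsub>tens L L\<^esub> pure L L (P 1 (e i k)) (P 1 (f k j)) \<oplus>\<^bsub>tens L L\<^esub>
        s \<odot>\<^bsub>tens L L\<^esub> pure L L (P 1 (f i k)) (P 1 (e k j))) UNIV" for s i j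
      by (subst comult_sum[OF parts(2) comult_parts(2)])
         (auto intro!: LL.T.finsum_cong' simp: parts semilinearD[OF DD] Dp P_closed LL.TA.smult_r_distr)
    have one: "1 \<odot>\<^bsub>tens L L\<^esub> pure L L (P 1 x) (P 1 y) = pure L L (P 1 x) (P 1 y)" if "x \<in> carrier A" "y \<in> carrier A" for x y
      by (rule algebra_univD(3)[OF LL.algebra_tens]) (simp add: that P_closed)
    show ?thesis
      by (cases i; cases j)
         (auto intro!: LL.T.finsum_cong' simp: entries ce cf parts P_closed pure_scale_u one LL.T.a_comm simp del: bhs_entry.simps)
  qed
  finally show ?thesis ..
qed

lemma E_counit: "counit L (E i j) = (if i = j then 1 else 0)"
proof -
  interpret LH: pre_hopf_algebra L by (rule pre_hopf_algebraI[OF pre_hopf_L])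
  have "x \<in> carrier A \<Longrightarrow> counit L (P s x) = s * Poly_Mapping.single 0 (counit A x)" for s x
    using LH.counit_hom(2)[of "P 1 x" s] by (simp add: P_eq[of x s] P_closed structure_L)
  then show ?thesis by (cases i; cases j) (simp_all only: entries, simp_all add: parts counit_parts)
qed

text \<open>E is the value of \<open>?N\<close>, a conjugate of a generic block diagonal matrix,
  when the two blocks are sent to a and \<theta>(a). Its determinant is therefore det(a)
  \<theta>(det(a)), and det(a) is the image of the class of the generic determinant, which is
  1.\<close>

lemma E_det:
  fixes \<phi> :: "'r::comm_ring_1 \<Rightarrow> complex laurent"
  assumes \<phi>: "\<phi> \<in> ring_hom univ_ring univ_ring"
  shows "mat_poly_eval (restrict_alg \<phi> L (carrier L)) E (det (\<chi> i j. mat_var i j)) = \<one>\<^bsub>L\<^esub>"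
proof -
  let ?R = "restrict_alg \<phi> L (carrier L)"
  let ?D = "det (\<chi> i j. mat_var i j) :: ('n, complex) mat_poly"
  interpret ev: matrix_evaluation ?R E
    by (rule matrix_evaluationI[OF algebra_restrict_carrier[OF algebra_L \<phi>]]) (simp only: restrict_alg_simps E_closed)
  \<comment> \<open>Only the variables of the two diagonal blocks occur in the generic matrix; the
    others can be sent to 0.\<close>
  let ?b = "block (\<lambda>i j. P 1 (a i j)) (\<lambda>i j. \<zero>\<^bsub>L\<^esub>) (\<lambda>i j. \<zero>\<^bsub>L\<^esub>) (\<lambda>i j. P 1 (\<theta> (a i j)))"
  note \<theta>a = \<theta>(6)[OF a_closed]
  have b: "?b i j \<in> carrier L" for i j by (cases i; cases j) (simp_all add: P_closed \<theta>a)
  interpret b: matrix_evaluation L ?b by (rule matrix_evaluationI[OF algebra_L b])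
  let ?X = "\<lambda>i j. mat_var (Inl i) (Inl j) :: ('n + 'n, complex laurent) mat_poly"
    and ?Y = "\<lambda>i j. mat_var (Inr i) (Inr j) :: ('n + 'n, complex laurent) mat_poly"
  define c :: "complex laurent \<Rightarrow> ('n + 'n, complex laurent) mat_poly" where "c = Poly_Mapping.single 0"
  \<comment> \<open>The numbers 1/2, u and u^-1 of the conjugation, as constants of the polynomial
    ring.\<close>
  define h where "h = c (Poly_Mapping.single 0 (1/2))"
  define u where "u = c (Poly_Mapping.single 1 1)"
  define w where "w = c (Poly_Mapping.single (-1) 1)"
  have cc: "c x * c y = c (x * y)" "c x + c y = c (x + y)" "c 1 = 1" for x y by (simp_all add: c_def mult_single single_add)
  have uw: "u * w = 1" "h + h = 1"
    by (simp_all add: u_def w_def h_def cc mult_single flip: single_add)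
  have c: "b.ev (c s * p) = s \<odot>\<^bsub>L\<^esub> b.ev p" for s p
    unfolding c_def b.ev_mult b.ev_const by (rule smult_eq_mult[OF algebra_L b.ev_closed, symmetric])
  \<comment> \<open>The value on a difference is found from additivity, by adding
    \<open>?Y i j\<close> back.\<close>
  have minus: "b.ev (?X i j - ?Y i j) = P 1 (a i j \<ominus>\<^bsub>A\<^esub> \<theta> (a i j))" for i j
  proof -
    have "b.ev (?X i j - ?Y i j) \<oplus>\<^bsub>L\<^esub> b.ev (?Y i j) = b.ev (?X i j)" by (simp flip: b.ev_add)
    also have "\<dots> = P 1 ((a i j \<ominus>\<^bsub>A\<^esub> \<theta> (a i j)) \<oplus>\<^bsub>A\<^esub> \<theta> (a i j))"
      by (simp add: b.ev_var \<theta>a A.M.minus_eq A.M.a_assoc A.M.l_neg)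
    also have "\<dots> = P 1 (a i j \<ominus>\<^bsub>A\<^esub> \<theta> (a i j)) \<oplus>\<^bsub>L\<^esub> b.ev (?Y i j)"
      by (simp add: b.ev_var \<theta>a P_add A.M.minus_closed)
    finally show ?thesis by (simp add: b.ev_var \<theta>a P_closed L.M.add.r_cancel)
  qed
  have plus: "b.ev (?X i j + ?Y i j) = P 1 (a i j \<oplus>\<^bsub>A\<^esub> \<theta> (a i j))" for i j
    by (simp add: b.ev_add b.ev_var \<theta>a P_add)
  let ?N = "block_matrix (\<lambda>i j. h * (?X i j + ?Y i j)) (\<lambda>i j. h * u * (?X i j - ?Y i j))
      (\<lambda>i j. h * w * (?X i j - ?Y i j)) (\<lambda>i j. h * (?X i j + ?Y i j))"
  have ch: "ev.ev \<in> ring_hom univ_ring L" using ev.ev_hom by (simp add: ring_hom_def)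
  have "ev.ev (det (\<chi> i j. mat_var i j)) = b.ev (det ?N)"
  proof (rule det_hom_cong[OF L.is_cring ch b.ev_hom])
    fix i j :: "'n + 'n"
    have "E i j = b.ev (block (\<lambda>i j. h * (?X i j + ?Y i j)) (\<lambda>i j. h * u * (?X i j - ?Y i j))
      (\<lambda>i j. h * w * (?X i j - ?Y i j)) (\<lambda>i j. h * (?X i j + ?Y i j)) i j)"
      by (cases i; cases j)
         (simp_all add: h_def u_def w_def cc c minus plus smult_L_pure \<theta>a A.M.minus_closed Let_def laurent_monom_eq mult_single flip: a_def[unfolded q_def])
    then show "ev.ev ((\<chi> i j. mat_var i j) $ i $ j) = b.ev (?N $ i $ j)"
      by (simp add: ev.ev_var block_matrix_def)
  qed
  also have "\<dots> = b.ev (det (\<chi> i j. ?X i j)) \<otimes>\<^bsub>L\<^esub> b.ev (det (\<chi> i j. ?Y i j))"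
    by (simp add: det_conjugated[OF uw] b.ev_mult)
  also have "b.ev (det (\<chi> i j. ?X i j)) = P 1 (q ?D)"
    using ring_hom_trans[OF q_hom unit_ring_hom]
    by (intro det_hom_cong[OF L.is_cring b.ev_hom]) (simp add: comp_def, simp add: b.ev_var, simp only: a_def)
  also have "b.ev (det (\<chi> i j. ?Y i j)) = P 1 (\<theta> (q ?D))"
    using ring_hom_trans[OF ring_hom_trans[OF q_hom \<theta>(1)] unit_ring_hom]
    by (intro det_hom_cong[OF L.is_cring b.ev_hom]) (simp add: comp_def, simp add: b.ev_var, simp only: a_def)
  also have "q ?D = \<one>\<^bsub>A\<^esub>"
    unfolding q_def SL_class_det by (rule ring_hom_one[OF \<iota>(1)])
  finally show ?thesis by (simp add: ring_hom_one[OF \<theta>(1)] flip: L_one)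
qed

section \<open>Identification of the complex family inside L\<close>

lemma representation: "\<phi> \<in> ring_hom univ_ring univ_ring \<Longrightarrow> matrix_representation \<phi> L E"
  by (intro matrix_representation.intro hopf_L E_closed E_det E_comult E_counit)

abbreviation \<Phi> :: "('r::comm_ring_1 \<Rightarrow> complex laurent) \<Rightarrow> ('n + 'n, 'r) mat_poly set \<Rightarrow> (complex laurent, 'a) tensor"
  where "\<Phi> \<phi> \<equiv> matrix_representation.\<Phi> \<phi> L E"
abbreviation \<Psi> where "\<Psi> \<equiv> matrix_representation.\<Psi> poly_t_to_u L E"
abbreviation Q where "Q \<equiv> matrix_representation.Q poly_t_to_u L E"

lemmas Rep = representation[OF poly_t_to_u_hom]

text \<open>Mapping the coefficients by \<phi> before evaluating amounts to restricting the scalars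
  of L in two steps instead of one.\<close>

lemma SL_map_\<Phi>:
  assumes \<phi>: "\<phi> \<in> ring_hom univ_ring univ_ring" and \<psi>: "\<psi> \<in> ring_hom univ_ring univ_ring"
  shows "\<Phi> \<psi> (SL_map \<phi> X) = \<Phi> (\<lambda>r. \<psi> (\<phi> r)) X"
proof -
  let ?R = "restrict_alg \<psi> L (carrier L)"
  have c: "(\<lambda>r. \<psi> (\<phi> r)) \<in> ring_hom univ_ring univ_ring" using ring_hom_trans[OF \<phi> \<psi>] by (simp add: comp_def)
  have "\<Phi> \<psi> (SL_map \<phi> X) = mat_poly_eval ?R E (Poly_Mapping.map \<phi> (rep X))"
    unfolding SL_map_def matrix_representation.\<Phi>_class[OF representation[OF \<psi>]] matrix_representation.L\<phi>_def[OF representation[OF \<psi>]] ..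
  also have "\<dots> = mat_poly_eval (restrict_alg \<phi> ?R (carrier ?R)) E (rep X)"
    by (rule mat_poly_eval_map[OF algebra_restrict_carrier[OF algebra_L \<psi>] \<phi>]) (simp only: restrict_alg_simps E_closed)
  also have "restrict_alg \<phi> ?R (carrier ?R) = restrict_alg (\<lambda>r. \<psi> (\<phi> r)) L (carrier L)" by (simp add: restrict_alg_def)
  finally show ?thesis
    unfolding matrix_representation.\<Phi>_def[OF representation[OF c]] matrix_representation.L\<phi>_def[OF representation[OF c]] .
qed

lemma hom_id: "(\<lambda>r. r) \<in> ring_hom univ_ring univ_ring" by (auto intro: univ_homI)

lemma bhs_rep_eq: "bhs_rep A \<theta> \<iota> X = \<Phi> (\<lambda>r. r) X"
proof -
  have "same_algebra L (restrict_alg (\<lambda>r. r) L (carrier L))" by (simp add: same_algebra_def restrict_alg_def)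
  then show ?thesis
    unfolding bhs_rep_def L_eq matrix_representation.\<Phi>_def[OF representation[OF hom_id]]
      matrix_representation.L\<phi>_def[OF representation[OF hom_id]] by (simp only: mat_poly_eval_same)
qed

text \<open>The descended ideal and the closure ideal are successive preimages of the image ideal
  along C[t] -> C[t, 1/t] -> C[u, 1/u], so the last is the kernel of evaluation at E over
  C[t].\<close>

lemma closure_ideal_eq: "bhs_closure_ideal A \<theta> \<iota> = matrix_representation.J poly_t_to_u L E"
proof -
  have m: "\<Phi> (\<lambda>r. r) (SL_map laurent_t_to_u (SL_map poly_to_laurent X)) = \<Phi> poly_t_to_u X" for X
    by (simp add: SL_map_\<Phi>[OF laurent_t_to_u_hom hom_id] SL_map_\<Phi>[OF poly_to_laurent_hom laurent_t_to_u_hom] poly_t_to_u_def[abs_def])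
  have c: "SL_map \<phi> X \<in> carrier SL" for \<phi> and X :: "('n + 'n, 'r::comm_ring_1) mat_poly set" by (simp add: SL_map_def)
  show ?thesis
    unfolding bhs_closure_ideal_def bhs_descended_ideal_def bhs_image_ideal_def a_kernel_def'
    by (auto simp only: c m bhs_rep_eq L_eq matrix_representation.J_iff[OF Rep] mem_Collect_eq)
qed

lemma family_eq: "bhs_family A \<theta> \<iota> = Q"
  unfolding bhs_family_def closure_ideal_eq matrix_representation.Q_def[OF Rep] ..

lemma pullback_eq: "bhs_pullback A \<theta> \<iota> Y = \<Psi> Y"
  unfolding bhs_pullback_def bhs_rep_eq SL_map_\<Phi>[OF poly_t_to_u_hom hom_id] matrix_representation.\<Psi>_def[OF Rep] ..

text \<open>One inclusion holds because the entries lie in B. For the other, every q p has an even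
  part x and an odd part y such that x and u^-1 y are in the range of evaluation. Both are carried
  through the induction together, because the parts of a product mix: its even part contains y y'
  and its odd part is x y' + y x'.\<close>

lemma image_\<Psi>: "\<Psi> ` carrier Q = B"
proof -
  interpret ev: matrix_evaluation R E
    by (rule matrix_evaluationI[OF algebra_R]) (simp only: restrict_alg_simps E_closed)
  note ev = ev.ev_closed[simplified restrict_alg_simps] ev.ev_add[simplified restrict_alg_simps] ev.ev_mult[simplified restrict_alg_simps]
    ev.ev_const[simplified restrict_alg_simps]
  let ?v = "Poly_Mapping.single (-1) 1 :: complex laurent" and ?I = "range ev.ev"
  \<comment> \<open>The upper right block u f is in B because u = t u^-1.\<close>
  have odd: "P (Poly_Mapping.single 1 1) x = poly_t_to_u [:0, 1:] \<odot>\<^bsub>L\<^esub> P ?v x" if "x \<in> carrier A" for x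
    using that by (simp add: smult_L_pure poly_t_to_u_t mult_single)
  have EB: "E i j \<in> B" for i j
    by (cases i; cases j) (simp_all add: entries parts B_even B_odd odd B_props(6) del: bhs_entry.simps)
  have I1: "ev.ev p \<in> ?I" for p by blast
  have Ia: "x \<oplus>\<^bsub>L\<^esub> y \<in> ?I" and Im: "x \<otimes>\<^bsub>L\<^esub> y \<in> ?I" if "x \<in> ?I" "y \<in> ?I" for x y
    using that by (auto simp only: ev(2,3)[symmetric] intro!: rangeI)
  have Is: "poly_t_to_u r \<odot>\<^bsub>L\<^esub> x \<in> ?I" if x: "x \<in> ?I" for r x
  proof -
    have xL: "x \<in> carrier L" using x ev(1) by auto
    have "poly_t_to_u r \<odot>\<^bsub>L\<^esub> x = (poly_t_to_u r \<odot>\<^bsub>L\<^esub> \<one>\<^bsub>L\<^esub>) \<otimes>\<^bsub>L\<^esub> x" by (rule smult_eq_mult[OF algebra_L xL])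
    also have "\<dots> \<in> ?I" by (rule Im[OF _ x]) (simp only: ev(4)[symmetric] I1)
    finally show ?thesis .
  qed
  have "ev.ev 1 = \<one>\<^bsub>L\<^esub>" using ring_hom_one[OF ev.ev_hom] by simp
  then have I_one: "\<one>\<^bsub>L\<^esub> \<in> ?I" by (rule range_eqI[OF HOL.sym])
  have I_zero: "\<zero>\<^bsub>L\<^esub> \<in> ?I" using Is[OF I_one, of 0] algebra_univD(4)[OF algebra_L L.one_closed]
    by (simp add: univ_homD(4)[OF poly_t_to_u_hom])
  have "?I \<subseteq> B"
  proof
    fix y assume "y \<in> ?I"
    then obtain p where y: "y = ev.ev p" by blast
    show "y \<in> B" unfolding y
    proof (induction p rule: mat_poly_induct)
      case (const c) show ?case unfolding ev(4) by (rule B_props(6)[OF B_props(2)])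
    next
      case (var i j) show ?case unfolding ev.ev_var by (rule EB)
    next
      case (add p q) then show ?case unfolding ev(2) by (rule B_props(3))
    next
      case (mult p q) then show ?case unfolding ev(3) by (rule B_props(4))
    qed
  qed
  moreover have split: "\<exists>x y. x \<in> carrier A \<and> y \<in> carrier A \<and> \<theta> x = x \<and> \<theta> y = \<ominus>\<^bsub>A\<^esub> y \<and> q p = x \<oplus>\<^bsub>A\<^esub> y \<and>
      P 1 x \<in> ?I \<and> P ?v y \<in> ?I" (is "\<exists>x y. ?G (q p) x y") for p
  proof (induction p rule: mat_poly_induct)
    case (const c)
    \<comment> \<open>Constants are even, with odd part 0.\<close>
    have "P 1 (c \<odot>\<^bsub>A\<^esub> \<one>\<^bsub>A\<^esub>) = poly_t_to_u [:c:] \<odot>\<^bsub>L\<^esub> \<one>\<^bsub>L\<^esub>"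
      by (simp add: P_smult poly_t_to_u_const L_one smult_L_pure)
    then have "?G (q (Poly_Mapping.single 0 c)) (c \<odot>\<^bsub>A\<^esub> \<one>\<^bsub>A\<^esub>) \<zero>\<^bsub>A\<^esub>"
      using Is[OF I_one, of "[:c:]"] I_zero SA.pure_zero_right[of ?v]
      by (simp add: q_const semilinearD(3)[OF \<theta>(2)] ring_hom_one[OF \<theta>(1)] L_simps(4)
        additive_maps_zero[OF A.M.abelian_group_axioms A.M.abelian_group_axioms semilinearD(4)[OF \<theta>(2)]])
    then show ?case by blast
  next
    case (var i j)
    have "P 1 (e i j) \<in> ?I" "P ?v (f i j) \<in> ?I"
      using I1[of "mat_var (Inl i) (Inl j)"] I1[of "mat_var (Inr i) (Inl j)"] unfolding ev.ev_var entries .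
    then have "?G (q (mat_var i j)) (e i j) (f i j)" by (simp add: parts parts(5)[unfolded a_def])
    then show ?case by blast
  next
    case (add p p')
    then obtain x y x' y' where g: "?G (q p) x y" "?G (q p') x' y'" by blast
    have "?G (q (p + p')) (x \<oplus>\<^bsub>A\<^esub> x') (y \<oplus>\<^bsub>A\<^esub> y')"
      using g ring_hom_add[OF q_hom, of p p'] by (simp add: semilinearD(2)[OF \<theta>(2)] A.M.minus_add P_add Ia A.M.a_ac)
    then show ?case by blast
  next
    case (mult p p')
    then obtain x y x' y' where g: "?G (q p) x y" "?G (q p') x' y'" by blast
    \<comment> \<open>The product of two odd parts costs a factor t: y y' = t (u^-1 y) (u^-1
      y').\<close>
    have "P 1 (y \<otimes>\<^bsub>A\<^esub> y') = poly_t_to_u [:0, 1:] \<odot>\<^bsub>L\<^esub> (P ?v y \<otimes>\<^bsub>L\<^esub> P ?v y')"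
      using g by (simp add: L_mult smult_L_pure poly_t_to_u_t mult_single)
    then have "P 1 (y \<otimes>\<^bsub>A\<^esub> y') \<in> ?I" using g by (simp only: Is Im)
    moreover have "P 1 (x \<otimes>\<^bsub>A\<^esub> x') \<in> ?I" "P ?v (x \<otimes>\<^bsub>A\<^esub> y') \<in> ?I" "P ?v (y \<otimes>\<^bsub>A\<^esub> x') \<in> ?I"
      using g Im[of "P 1 x" "P 1 x'"] Im[of "P 1 x" "P ?v y'"] Im[of "P ?v y" "P 1 x'"] by (simp_all add: L_mult)
    ultimately have "?G (q (p * p')) (x \<otimes>\<^bsub>A\<^esub> x' \<oplus>\<^bsub>A\<^esub> y \<otimes>\<^bsub>A\<^esub> y') (x \<otimes>\<^bsub>A\<^esub> y' \<oplus>\<^bsub>A\<^esub> y \<otimes>\<^bsub>A\<^esub> x')"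
      using g ring_hom_mult[OF q_hom, of p p']
      by (simp add: semilinearD(2)[OF \<theta>(2)] ring_hom_mult[OF \<theta>(1)] A.l_minus A.r_minus A.M.minus_add P_add Ia
        A.l_distr A.r_distr A.M.a_ac)
    then show ?case by blast
  qed
  have "B \<subseteq> ?I"
  proof (rule B_least)
    fix x assume x: "x \<in> carrier A"
    obtain p where p: "x = q p" using x by (rule q_surj)
    obtain x0 x1 where g: "?G (q p) x0 x1" using split[of p] by (elim exE) (rule that)
    then have c: "x0 \<in> carrier A" "x1 \<in> carrier A" "\<theta> x0 = x0" "\<theta> x1 = \<ominus>\<^bsub>A\<^esub> x1" and x01: "x = x0 \<oplus>\<^bsub>A\<^esub> x1"
      and I: "P 1 x0 \<in> ?I" "P ?v x1 \<in> ?I" using p by simp_all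
    \<comment> \<open>For an element of pure parity, one of the two parts is the element
      itself.\<close>
    note ip = involution_parts[OF A.module_axioms semilinearD(4)[OF \<theta>(2)] c(1,3,2,4), folded x01]
    show "P 1 x \<in> ?I" if "\<theta> x = x" unfolding ip(1)[OF that] by (rule I)
    show "P ?v x \<in> ?I" if "\<theta> x = \<ominus>\<^bsub>A\<^esub> x" unfolding ip(2)[OF that] by (rule I)
  next
    fix x assume "x \<in> ?I" then show "x \<in> carrier L" using ev(1) by blast
  qed (fact I_one Ia Im Is)+
  ultimately show ?thesis
    unfolding matrix_representation.image_\<Psi>[OF Rep] matrix_representation.L\<phi>_def[OF Rep] by blast
qed

lemma family_embedding: "hopf_embedding poly_t_to_u Q L \<Psi>"
  by (rule even_embedding[OF matrix_representation.algebra_Q[OF Rep] matrix_representation.\<Psi>_hopf[OF Rep]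
      matrix_representation.inj_\<Psi>[OF Rep] matrix_representation.Q_structure_closed[OF Rep] image_\<Psi>])

theorem contraction_isomorphic_bhs: "group_schemes_isomorphic univ_ring (contraction A \<theta>) (bhs_family A \<theta> \<iota>)"
  unfolding family_eq
  by (rule isomorphic_of_embeddings[OF poly_t_to_u_hom inj_poly_t_to_u hopf_L contraction_embedding family_embedding])
     (simp only: image_\<Psi> carrier_contraction image_id id_apply)

end

section \<open>The real family\<close>

lemma of_real_hom: "(of_real :: real \<Rightarrow> complex) \<in> ring_hom univ_ring univ_ring"
  by (auto intro: univ_homI)

lemma cnj_hom: "cnj \<in> ring_hom univ_ring univ_ring"
  by (auto intro: univ_homI)

lemma hopf_semilinear_id: "pre_hopf H \<Longrightarrow> id \<in> hopf_semilinear id H H"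
proof -
  assume "pre_hopf H"
  then interpret H: pre_hopf_algebra H by (rule pre_hopf_algebraI)
  have "id \<in> ring_hom H H" by (rule ring_hom_memI) simp_all
  moreover have "x \<in> carrier H \<Longrightarrow> tmap H H id id (comult H x) = comult H x" for x
    by (rule tensor_map_id[OF H.module_axioms H.module_axioms]) (simp_all add: H.comult_simps)
  ultimately show ?thesis by (simp add: hopf_semilinear_def semilinear_id)
qed

lemma map_cnj_of_real: "Poly_Mapping.map cnj (Poly_Mapping.map of_real s) = Poly_Mapping.map of_real s"
  by (rule poly_mapping_eqI) (simp add: lookup_map)

section \<open>Real polynomials inside complex Laurent polynomials\<close>

definition real_t_to_u :: "real poly \<Rightarrow> complex laurent" where
  "real_t_to_u r = poly_t_to_u (map_poly of_real r)"

lemma real_t_to_u_eq: "real_t_to_u r = Poly_Mapping.map of_real (poly_t_to_u r)"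
  by (simp add: real_t_to_u_def map_poly_t_to_u)

lemma real_t_to_u_hom: "real_t_to_u \<in> ring_hom univ_ring univ_ring"
  using ring_hom_trans[OF poly_t_to_u_hom map_hom[OF of_real_hom]] by (simp add: comp_def real_t_to_u_eq[abs_def])

lemma inj_real_t_to_u: "inj real_t_to_u"
proof (rule injI)
  fix r s assume "real_t_to_u r = real_t_to_u s"
  then have "map_poly of_real r = (map_poly of_real s :: complex poly)"
    unfolding real_t_to_u_def by (rule injD[OF inj_poly_t_to_u])
  then have "of_real (coeff r n) = (of_real (coeff s n) :: complex)" for n by (metis coeff_map_poly of_real_0)
  then show "r = s" by (simp add: poly_eq_iff)
qed

text \<open>Tested after the injection \<open>poly_t_to_u\<close>, where the composite is the
  homomorphism \<open>real_t_to_u\<close>.\<close>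

lemma map_poly_of_real_hom: "(map_poly of_real :: real poly \<Rightarrow> complex poly) \<in> ring_hom univ_ring univ_ring"
  by (rule univ_homI; rule injD[OF inj_poly_t_to_u])
     (simp_all add: univ_homD[OF poly_t_to_u_hom] univ_homD[OF real_t_to_u_hom] flip: real_t_to_u_def)

lemma complexification_eq: "pre_hopf G \<Longrightarrow> complexification G = base_changed.L of_real G"
  unfolding complexification_def by (rule base_changed.L_def[symmetric, OF base_changed.intro[OF of_real_hom]])

lemma complexified_involution_morphism:
  assumes "pre_hopf G" "\<eta> \<in> hopf_semilinear id G G"
  shows "base_change_morphism (of_real :: real \<Rightarrow> complex) G of_real G id id \<eta>"
  by (intro base_change_morphism.intro base_changed.intro base_change_morphism_axioms.intro of_real_hom assms)
     (auto intro: univ_homI)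

lemma complexified_involution_eq:
  "pre_hopf G \<Longrightarrow> \<eta> \<in> hopf_semilinear id G G \<Longrightarrow> complexified_involution G \<eta> = base_change_morphism.F of_real G id \<eta>"
  unfolding complexified_involution_def
  by (rule base_change_morphism.F_def[symmetric, OF complexified_involution_morphism])

text \<open>The representation \<kappa> belongs to the complexification and may fail to be defined
  over R; the real structure of the family is therefore carried over from the Laurent Hopf algebra
  \<open>X.L\<close>.\<close>

locale real_bhs = G: involution_laurent G \<eta> +
    X: complex_bhs "base_changed.L (of_real :: real \<Rightarrow> complex) G" "base_change_morphism.F (of_real :: real \<Rightarrow> complex) G id \<eta>" \<kappa>
  for G :: "(real, 'b) hopf" and \<eta> and \<kappa> :: "('m::finite, complex) mat_poly set \<Rightarrow> (complex, 'b) tensor"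
begin

sublocale C: base_changed_field "of_real :: real \<Rightarrow> complex" G
  by (intro base_changed_field.intro base_changed.intro of_real_hom G.pre_hopf)

text \<open>In turn: the complexified involution, conjugation on the complexification, its extension
  fixing u, and the inclusion of the real Laurent Hopf algebra in the complex one.\<close>

abbreviation \<Theta> where "\<Theta> \<equiv> base_change_morphism.F (of_real :: real \<Rightarrow> complex) G id \<eta>"
abbreviation c0 where "c0 \<equiv> base_change_morphism.F (of_real :: real \<Rightarrow> complex) G cnj id"
abbreviation cj where "cj \<equiv> base_change_morphism.F (Poly_Mapping.single 0 :: complex \<Rightarrow> complex laurent) C.L (Poly_Mapping.map cnj) c0"
abbreviation j where "j \<equiv> base_change_morphism.F (Poly_Mapping.single 0 :: complex \<Rightarrow> complex laurent) C.L (Poly_Mapping.map of_real) (C.P 1)"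

lemma \<Theta>_morphism: "base_change_morphism (of_real :: real \<Rightarrow> complex) G of_real G id id \<eta>"
  by (rule complexified_involution_morphism[OF G.pre_hopf G.\<theta>_hopf(1)])

lemma c0_morphism: "base_change_morphism (of_real :: real \<Rightarrow> complex) G of_real G id cnj id"
  by (intro base_change_morphism.intro C.base_changed_axioms base_change_morphism_axioms.intro cnj_hom hopf_semilinear_id G.pre_hopf) simp

lemma cj_morphism: "base_change_morphism (Poly_Mapping.single 0 :: complex \<Rightarrow> complex laurent) C.L (Poly_Mapping.single 0) C.L cnj (Poly_Mapping.map cnj) c0"
  by (intro base_change_morphism.intro X.base_changed_axioms base_change_morphism_axioms.intro map_hom cnj_hom
      base_change_morphism.F_hopf[OF c0_morphism]) (simp add: map_single)

lemma j_morphism: "base_change_morphism (Poly_Mapping.single 0 :: real \<Rightarrow> real laurent) G (Poly_Mapping.single 0 :: complex \<Rightarrow> complex laurent) C.L of_real (Poly_Mapping.map of_real) (C.P 1)"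
  by (intro base_change_morphism.intro X.base_changed_axioms G.base_changed_axioms base_change_morphism_axioms.intro map_hom of_real_hom
      C.unit_hopf) (simp add: map_single)

lemmas \<Theta>_pure = base_change_morphism.F_pure[OF \<Theta>_morphism]
lemmas \<Theta>_semilinear = base_change_morphism.F_semilinear[OF \<Theta>_morphism]
lemmas c0_pure = base_change_morphism.F_pure[OF c0_morphism]
lemmas cj_pure = base_change_morphism.F_pure[OF cj_morphism]
lemmas cj_semilinear = base_change_morphism.F_semilinear[OF cj_morphism]
lemmas j_pure = base_change_morphism.F_pure[OF j_morphism]
lemmas j_semilinear = base_change_morphism.F_semilinear[OF j_morphism]
lemmas j_hopf = base_change_morphism.F_hopf[OF j_morphism]
lemmas jD = hopf_semilinearD[OF j_hopf]

lemma \<Theta>_unit: "b \<in> carrier G \<Longrightarrow> \<Theta> (C.P 1 b) = C.P 1 (\<eta> b)"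
  by (rule HOL.trans[OF \<Theta>_pure]) simp_all

lemma c0_unit: "b \<in> carrier G \<Longrightarrow> c0 (C.P 1 b) = C.P 1 b"
  by (rule HOL.trans[OF c0_pure]) simp_all

lemma map_of_real_monom: "Poly_Mapping.map of_real (Poly_Mapping.single k (1::real)) = (Poly_Mapping.single k 1 :: complex laurent)"
  by (simp add: map_single)

text \<open>Conjugation fixes the Laurent polynomials with real coefficients, so both sides are
  semilinear along the same inclusion of scalars and can be compared on 1 \<otimes> b.\<close>

lemma cj_j:
  assumes x: "x \<in> carrier G.L" shows "cj (j x) = j x"
proof (rule G.semilinear_eqI[OF X.L.M.abelian_group_axioms _ j_semilinear _ x])
  show "(\<lambda>x. cj (j x)) \<in> semilinear (Poly_Mapping.map of_real) G.L X.L"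
    using semilinear_comp[OF j_semilinear cj_semilinear] by (simp add: map_cnj_of_real)
  show "cj (j (G.P 1 b)) = j (G.P 1 b)" if "b \<in> carrier G" for b
    using that by (simp add: j_pure cj_pure c0_unit C.P_closed univ_homD[OF map_hom[OF of_real_hom]] univ_homD[OF map_hom[OF cnj_hom]])
qed

text \<open>A functional of G, extended to the complexification and then to Laurent polynomials,
  restricts along j to its real extension. If j d = 0, all extended functionals vanish at d, and
  these separate the points of \<open>G.L\<close>.\<close>

lemma inj_j: "inj_on j (carrier G.L)"
proof (rule inj_onI)
  note j0 = additive_maps_minus[OF G.L.M.abelian_group_axioms X.L.M.abelian_group_axioms jD(2)[THEN semilinearD(4)]]
  fix x y assume xy: "x \<in> carrier G.L" "y \<in> carrier G.L" "j x = j y"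
  let ?d = "x \<ominus>\<^bsub>G.L\<^esub> y"
  have d: "?d \<in> carrier G.L" using xy by simp
  have jd: "j ?d = \<zero>\<^bsub>X.L\<^esub>" using xy jD(6)[of y] by (simp add: j0 X.L.M.r_neg X.L.M.minus_eq)
  have "?d = \<zero>\<^bsub>G.L\<^esub>"
  proof (rule G.extended_functionals_separate[OF d])
    fix l assume l: "l \<in> functionals G"
    note Cl = C.extend_functional[OF l]
    note Xl = X.extend_functional[OF Cl(1)]
    have "X.extend_functional (C.extend_functional l) (j ?d) = Poly_Mapping.map of_real (G.extend_functional l ?d)"
    proof (rule G.semilinear_eqI[OF algebra_abelian_group[OF algebra_univ_alg[OF X.univ_hom_id]] _ _ _ d])
      show "(\<lambda>x. X.extend_functional (C.extend_functional l) (j x)) \<in> semilinear (Poly_Mapping.map of_real) G.L (univ_alg id)"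
        using semilinear_comp[OF j_semilinear Xl(1)] by simp
      show "(\<lambda>x. Poly_Mapping.map of_real (G.extend_functional l x) :: complex laurent) \<in> semilinear (Poly_Mapping.map of_real) G.L (univ_alg id)"
        using G.extend_functional(1)[OF l] by (intro semilinearI) (simp_all add: semilinearD univ_homD[OF map_hom[OF of_real_hom]])
    qed (simp add: j_pure Xl(2) Cl(2) C.P_closed G.extend_functional(2)[OF l] univ_homD[OF map_hom[OF of_real_hom]] map_single)
    then have "Poly_Mapping.map of_real (G.extend_functional l ?d) = (0 :: complex laurent)"
      unfolding jd using additive_maps_zero[OF X.L.M.abelian_group_axioms algebra_abelian_group[OF algebra_univ_alg[OF X.univ_hom_id]] semilinearD(4)[OF Xl(1)]]
      by simp
    then have "of_real (Poly_Mapping.lookup (G.extend_functional l ?d) k) = (0 :: complex)" for k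
      by (metis lookup_map lookup_zero of_real_0)
    then show "G.extend_functional l ?d = 0" by (intro poly_mapping_eqI) simp
  qed
  then show "x = y" using xy by simp
qed

lemma C_uminus: "b \<in> carrier G \<Longrightarrow> C.P 1 (\<ominus>\<^bsub>G\<^esub> b) = \<ominus>\<^bsub>C.L\<^esub> C.P 1 b"
  by (rule additive_maps_uminus[OF G.A.M.abelian_group_axioms X.A.M.abelian_group_axioms semilinearD(4)[OF C.unit_semilinear]])

text \<open>Complexification preserves parity, so generators go to generators.\<close>

lemma j_B: "x \<in> G.B \<Longrightarrow> j x \<in> X.B"
proof -
  have m: "Poly_Mapping.map of_real (poly_t_to_u r) = poly_t_to_u (map_poly of_real r :: complex poly)" for r :: "real poly"
    by (simp add: map_poly_t_to_u)
  have "G.B \<subseteq> {x \<in> carrier G.L. j x \<in> X.B}"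
  proof (rule G.B_least)
    fix b assume b: "b \<in> carrier G"
    show "G.P 1 b \<in> {x \<in> carrier G.L. j x \<in> X.B}" if "\<eta> b = b"
      using b that X.B_even[of "C.P 1 b"] by (simp add: j_pure G.P_closed C.P_closed \<Theta>_unit univ_homD[OF map_hom[OF of_real_hom]])
    show "G.P (Poly_Mapping.single (-1) 1) b \<in> {x \<in> carrier G.L. j x \<in> X.B}" if "\<eta> b = \<ominus>\<^bsub>G\<^esub> b"
      using b that X.B_odd[of "C.P 1 b"] by (simp add: j_pure G.P_closed C.P_closed \<Theta>_unit C_uminus map_of_real_monom)
  qed (auto simp: semilinearD(2,3)[OF jD(2)] ring_hom_mult[OF jD(1)] ring_hom_one[OF jD(1)] X.B_props m)
  then show "x \<in> G.B \<Longrightarrow> j x \<in> X.B" by blast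
qed

section \<open>Real and imaginary parts\<close>

abbreviation iu :: "complex laurent" where "iu \<equiv> Poly_Mapping.single 0 \<i>"

text \<open>For s \<otimes> b, the real and imaginary parts of s are moved to b as real
  scalars.\<close>

lemma C_parts:
  assumes "z \<in> carrier C.L"
  shows "\<exists>b b'. b \<in> carrier G \<and> b' \<in> carrier G \<and> z = C.P 1 b \<oplus>\<^bsub>C.L\<^esub> \<i> \<odot>\<^bsub>C.L\<^esub> C.P 1 b'"
  using assms
proof (induction rule: C.L_induct)
  case zero
  have "C.P 1 \<zero>\<^bsub>G\<^esub> = \<zero>\<^bsub>C.L\<^esub>"
    by (rule additive_maps_zero[OF G.A.M.abelian_group_axioms X.A.M.abelian_group_axioms semilinearD(4)[OF C.unit_semilinear]])
  then show ?case by (intro exI[of _ "\<zero>\<^bsub>G\<^esub>"]) simp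
next
  case (pure s b)
  note u = C.P_closed[OF pure(2), of 1]
  have "C.P s b = (of_real (Re s) + \<i> * of_real (Im s)) \<odot>\<^bsub>C.L\<^esub> C.P 1 b"
    by (simp add: C.P_eq[OF pure(2), of s] flip: complex_eq)
  also have "\<dots> = C.P 1 (Re s \<odot>\<^bsub>G\<^esub> b) \<oplus>\<^bsub>C.L\<^esub> \<i> \<odot>\<^bsub>C.L\<^esub> C.P 1 (Im s \<odot>\<^bsub>G\<^esub> b)"
    using u by (simp only: algebra_univD(1,2)[OF C.algebra_L u] semilinearD(3)[OF C.unit_semilinear pure(2)])
  finally show ?case using algebra_univD(6)[OF G.A.algebra_axioms pure(2)] by blast
next
  case (add x y)
  then obtain b b' d d' where g: "b \<in> carrier G" "b' \<in> carrier G" "d \<in> carrier G" "d' \<in> carrier G"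
    "x = C.P 1 b \<oplus>\<^bsub>C.L\<^esub> \<i> \<odot>\<^bsub>C.L\<^esub> C.P 1 b'" "y = C.P 1 d \<oplus>\<^bsub>C.L\<^esub> \<i> \<odot>\<^bsub>C.L\<^esub> C.P 1 d'" by blast
  show ?case
    by (rule exI[of _ "b \<oplus>\<^bsub>G\<^esub> d"], rule exI[of _ "b' \<oplus>\<^bsub>G\<^esub> d'"])
       (use g in \<open>simp add: C.P_add C.P_closed X.A.smult_r_distr X.A.M.a_ac\<close>)
qed

text \<open>The involution is defined over R, so real and imaginary parts can be split by parity
  separately; the sum of the wrong parity drops out by \<open>involution_parts\<close>.\<close>

lemma C_involution_parts:
  assumes z: "z \<in> carrier C.L"
  shows "\<Theta> z = z \<Longrightarrow> \<exists>p p'. p \<in> carrier G \<and> p' \<in> carrier G \<and> \<eta> p = p \<and> \<eta> p' = p' \<and>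
      z = C.P 1 p \<oplus>\<^bsub>C.L\<^esub> \<i> \<odot>\<^bsub>C.L\<^esub> C.P 1 p'"
    "\<Theta> z = \<ominus>\<^bsub>C.L\<^esub> z \<Longrightarrow> \<exists>p p'. p \<in> carrier G \<and> p' \<in> carrier G \<and> \<eta> p = \<ominus>\<^bsub>G\<^esub> p \<and> \<eta> p' = \<ominus>\<^bsub>G\<^esub> p' \<and>
      z = C.P 1 p \<oplus>\<^bsub>C.L\<^esub> \<i> \<odot>\<^bsub>C.L\<^esub> C.P 1 p'"
proof -
  obtain b b' where b: "b \<in> carrier G" "b' \<in> carrier G" "z = C.P 1 b \<oplus>\<^bsub>C.L\<^esub> \<i> \<odot>\<^bsub>C.L\<^esub> C.P 1 b'" using C_parts[OF z] by blast
  obtain p m where 1: "p \<in> carrier G" "m \<in> carrier G" "\<eta> p = p" "\<eta> m = \<ominus>\<^bsub>G\<^esub> m" "b = p \<oplus>\<^bsub>G\<^esub> m"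
    by (rule involution_decomposition[OF G.A.module_axioms G.\<theta>(2) G.\<theta>_hopf(2)[OF b(1)] b(1)])
  obtain p' m' where 2: "p' \<in> carrier G" "m' \<in> carrier G" "\<eta> p' = p'" "\<eta> m' = \<ominus>\<^bsub>G\<^esub> m'" "b' = p' \<oplus>\<^bsub>G\<^esub> m'"
    by (rule involution_decomposition[OF G.A.module_axioms G.\<theta>(2) G.\<theta>_hopf(2)[OF b(2)] b(2)])
  let ?p = "C.P 1 p \<oplus>\<^bsub>C.L\<^esub> \<i> \<odot>\<^bsub>C.L\<^esub> C.P 1 p'" and ?m = "C.P 1 m \<oplus>\<^bsub>C.L\<^esub> \<i> \<odot>\<^bsub>C.L\<^esub> C.P 1 m'"
  have s: "z = ?p \<oplus>\<^bsub>C.L\<^esub> ?m"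
    unfolding b(3) 1(5) 2(5) using 1(1,2) 2(1,2) by (simp add: C.P_add C.P_closed X.A.smult_r_distr X.A.M.a_ac)
  have c: "?p \<in> carrier C.L" "?m \<in> carrier C.L" using 1 2 by (simp_all add: C.P_closed)
  have t: "\<Theta> ?p = ?p" "\<Theta> ?m = \<ominus>\<^bsub>C.L\<^esub> ?m"
    using 1 2 by (simp_all add: semilinearD(2,3)[OF \<Theta>_semilinear] C.P_closed \<Theta>_unit C_uminus X.A.M.minus_add X.A.smult_r_minus)
  note ip = involution_parts[OF X.A.module_axioms semilinearD(4)[OF \<Theta>_semilinear] c(1) t(1) c(2) t(2), folded s]
  show "\<Theta> z = z \<Longrightarrow> \<exists>p p'. p \<in> carrier G \<and> p' \<in> carrier G \<and> \<eta> p = p \<and> \<eta> p' = p' \<and>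
      z = C.P 1 p \<oplus>\<^bsub>C.L\<^esub> \<i> \<odot>\<^bsub>C.L\<^esub> C.P 1 p'" using ip(1) 1(1,3) 2(1,3) by blast
  show "\<Theta> z = \<ominus>\<^bsub>C.L\<^esub> z \<Longrightarrow> \<exists>p p'. p \<in> carrier G \<and> p' \<in> carrier G \<and> \<eta> p = \<ominus>\<^bsub>G\<^esub> p \<and> \<eta> p' = \<ominus>\<^bsub>G\<^esub> p' \<and>
      z = C.P 1 p \<oplus>\<^bsub>C.L\<^esub> \<i> \<odot>\<^bsub>C.L\<^esub> C.P 1 p'" using ip(2) 1(2,4) 2(2,4) by blast
qed

lemma X_P_parts:
  assumes "p \<in> carrier G" "p' \<in> carrier G"
  shows "X.P (Poly_Mapping.map of_real s) (C.P 1 p \<oplus>\<^bsub>C.L\<^esub> \<i> \<odot>\<^bsub>C.L\<^esub> C.P 1 p') = j (G.P s p) \<oplus>\<^bsub>X.L\<^esub> iu \<odot>\<^bsub>X.L\<^esub> j (G.P s p')"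
  using assms by (simp add: j_pure X.P_add X.P_smult X.smult_L_pure C.P_closed)

lemma G_B_uminus: "x \<in> G.B \<Longrightarrow> \<ominus>\<^bsub>G.L\<^esub> x \<in> G.B"
  using G.B_props(6)[of x "-1"] algebra_univD(3)[OF G.algebra_L G.B_closed, of x] algebra_univD(5)[OF G.algebra_L G.B_closed, of x 1]
  by (simp add: univ_homD[OF poly_t_to_u_hom])

lemma iu_iu: "x \<in> carrier X.L \<Longrightarrow> iu \<odot>\<^bsub>X.L\<^esub> (iu \<odot>\<^bsub>X.L\<^esub> x) = \<ominus>\<^bsub>X.L\<^esub> x"
  using algebra_univD(2)[OF X.algebra_L, of x iu iu] algebra_univD(3)[OF X.algebra_L, of x] algebra_univD(5)[OF X.algebra_L, of x 1]
  by (simp add: mult_single single_uminus)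

text \<open>The elements j x + i j y, with x and y in the real contraction algebra, form a
  C[t]-subalgebra containing the generators of the complex one. Products stay of this form because
  i^2 = -1.\<close>

lemma X_B_parts:
  assumes "z \<in> X.B" obtains x y where "x \<in> G.B" "y \<in> G.B" "z = j x \<oplus>\<^bsub>X.L\<^esub> iu \<odot>\<^bsub>X.L\<^esub> j y"
proof -
  let ?D = "{z. \<exists>x y. x \<in> G.B \<and> y \<in> G.B \<and> z = j x \<oplus>\<^bsub>X.L\<^esub> iu \<odot>\<^bsub>X.L\<^esub> j y}"
  have jc: "x \<in> G.B \<Longrightarrow> j x \<in> carrier X.L" for x by (rule jD(6)[OF G.B_closed])
  have D: "j x \<oplus>\<^bsub>X.L\<^esub> iu \<odot>\<^bsub>X.L\<^esub> j y \<in> ?D" if "x \<in> G.B" "y \<in> G.B" for x y using that by blast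
  note jn = additive_maps_uminus[OF G.L.M.abelian_group_axioms X.L.M.abelian_group_axioms jD(2)[THEN semilinearD(4)]]
  note j0 = additive_maps_zero[OF G.L.M.abelian_group_axioms X.L.M.abelian_group_axioms jD(2)[THEN semilinearD(4)]]
  have z: "\<zero>\<^bsub>G.L\<^esub> \<in> G.B" using G.B_props(6)[OF G.B_props(2), of 0] algebra_univD(4)[OF G.algebra_L G.L.one_closed]
    by (simp add: univ_homD(4)[OF poly_t_to_u_hom])
  have Dm: "z \<otimes>\<^bsub>X.L\<^esub> z' \<in> ?D" if "z \<in> ?D" "z' \<in> ?D" for z z'
  proof -
    obtain x y x' y' where g: "x \<in> G.B" "y \<in> G.B" "x' \<in> G.B" "y' \<in> G.B"
      "z = j x \<oplus>\<^bsub>X.L\<^esub> iu \<odot>\<^bsub>X.L\<^esub> j y" "z' = j x' \<oplus>\<^bsub>X.L\<^esub> iu \<odot>\<^bsub>X.L\<^esub> j y'" using \<open>z \<in> ?D\<close> \<open>z' \<in> ?D\<close> by blast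
    note c = g(1-4)[THEN jc] g(1-4)[THEN G.B_closed]
    have "z \<otimes>\<^bsub>X.L\<^esub> z' = j (x \<otimes>\<^bsub>G.L\<^esub> x' \<oplus>\<^bsub>G.L\<^esub> \<ominus>\<^bsub>G.L\<^esub> (y \<otimes>\<^bsub>G.L\<^esub> y')) \<oplus>\<^bsub>X.L\<^esub> iu \<odot>\<^bsub>X.L\<^esub> j (x \<otimes>\<^bsub>G.L\<^esub> y' \<oplus>\<^bsub>G.L\<^esub> y \<otimes>\<^bsub>G.L\<^esub> x')"
      unfolding g(5,6) using c
      by (simp add: semilinearD(2)[OF jD(2)] ring_hom_mult[OF jD(1)] jn X.L.l_distr X.L.r_distr X.L.smult_assoc2
        algebra_univD(7)[OF X.algebra_L] iu_iu X.L.smult_r_distr X.L.M.a_ac)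
    also have "\<dots> \<in> ?D" using g by (intro D G.B_props G_B_uminus)
    finally show ?thesis .
  qed
  have sc: "poly_t_to_u r \<odot>\<^bsub>X.L\<^esub> \<one>\<^bsub>X.L\<^esub> \<in> ?D" for r :: "complex poly"
  proof -
    \<comment> \<open>A complex polynomial in t is split coefficientwise into real and imaginary
      parts.\<close>
    have "poly_t_to_u r = Poly_Mapping.map of_real (poly_t_to_u (map_poly Re r)) + iu * Poly_Mapping.map of_real (poly_t_to_u (map_poly Im r))"
      by (rule poly_mapping_eqI) (simp add: lookup_add lookup_map lookup_monom_mult lookup_poly_t_to_u coeff_map_poly complex_eq)
    then have "poly_t_to_u r \<odot>\<^bsub>X.L\<^esub> \<one>\<^bsub>X.L\<^esub> = j (poly_t_to_u (map_poly Re r) \<odot>\<^bsub>G.L\<^esub> \<one>\<^bsub>G.L\<^esub>) \<oplus>\<^bsub>X.L\<^esub>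
        iu \<odot>\<^bsub>X.L\<^esub> j (poly_t_to_u (map_poly Im r) \<odot>\<^bsub>G.L\<^esub> \<one>\<^bsub>G.L\<^esub>)"
      by (simp only: algebra_univD(1,2)[OF X.algebra_L X.L.one_closed] semilinearD(3)[OF jD(2) G.L.one_closed] ring_hom_one[OF jD(1)])
    also have "\<dots> \<in> ?D" by (intro D G.B_props(6)[OF G.B_props(2)])
    finally show ?thesis .
  qed
  have "X.B \<subseteq> ?D"
  proof (rule X.B_least)
    show "x \<in> carrier X.L" if "x \<in> ?D" for x using that jc by auto
    \<comment> \<open>Scaling by r is multiplication by r times the unit element, which reduces it
      to \<open>Dm\<close> and \<open>sc\<close>.\<close>
    then show "poly_t_to_u r \<odot>\<^bsub>X.L\<^esub> x \<in> ?D" if "x \<in> ?D" for r x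
      using Dm[OF sc[of r] that] smult_eq_mult[OF X.algebra_L, of x "poly_t_to_u r"] that by simp
    have "\<one>\<^bsub>X.L\<^esub> = j \<one>\<^bsub>G.L\<^esub> \<oplus>\<^bsub>X.L\<^esub> iu \<odot>\<^bsub>X.L\<^esub> j \<zero>\<^bsub>G.L\<^esub>" by (simp add: ring_hom_one[OF jD(1)] j0)
    also have "\<dots> \<in> ?D" by (intro D z G.B_props)
    finally show "\<one>\<^bsub>X.L\<^esub> \<in> ?D" .
    show "x \<oplus>\<^bsub>X.L\<^esub> y \<in> ?D" if "x \<in> ?D" "y \<in> ?D" for x y
    proof -
      obtain x1 x2 y1 y2 where g: "x1 \<in> G.B" "x2 \<in> G.B" "y1 \<in> G.B" "y2 \<in> G.B"
        "x = j x1 \<oplus>\<^bsub>X.L\<^esub> iu \<odot>\<^bsub>X.L\<^esub> j x2" "y = j y1 \<oplus>\<^bsub>X.L\<^esub> iu \<odot>\<^bsub>X.L\<^esub> j y2" using \<open>x \<in> ?D\<close> \<open>y \<in> ?D\<close> by blast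
      note c = g(1-4)[THEN jc] g(1-4)[THEN G.B_closed]
      have "x \<oplus>\<^bsub>X.L\<^esub> y = j (x1 \<oplus>\<^bsub>G.L\<^esub> y1) \<oplus>\<^bsub>X.L\<^esub> iu \<odot>\<^bsub>X.L\<^esub> j (x2 \<oplus>\<^bsub>G.L\<^esub> y2)"
        unfolding g(5,6) using c by (simp add: semilinearD(2)[OF jD(2)] X.L.smult_r_distr X.L.M.a_ac)
      also have "\<dots> \<in> ?D" using g by (intro D G.B_props)
      finally show ?thesis .
    qed
    fix z assume z: "z \<in> carrier C.L"
    show "X.P 1 z \<in> ?D" if "\<Theta> z = z"
    proof -
      obtain p p' where p: "p \<in> carrier G" "p' \<in> carrier G" "\<eta> p = p" "\<eta> p' = p'" "z = C.P 1 p \<oplus>\<^bsub>C.L\<^esub> \<i> \<odot>\<^bsub>C.L\<^esub> C.P 1 p'"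
        using C_involution_parts(1)[OF z \<open>\<Theta> z = z\<close>] by blast
      have "X.P 1 z = j (G.P 1 p) \<oplus>\<^bsub>X.L\<^esub> iu \<odot>\<^bsub>X.L\<^esub> j (G.P 1 p')"
        unfolding p(5) using X_P_parts[OF p(1,2), of 1] by (simp add: univ_homD[OF map_hom[OF of_real_hom]])
      also have "\<dots> \<in> ?D" using p by (intro D G.B_even)
      finally show ?thesis .
    qed
    show "X.P (Poly_Mapping.single (-1) 1) z \<in> ?D" if "\<Theta> z = \<ominus>\<^bsub>C.L\<^esub> z"
    proof -
      obtain p p' where p: "p \<in> carrier G" "p' \<in> carrier G" "\<eta> p = \<ominus>\<^bsub>G\<^esub> p" "\<eta> p' = \<ominus>\<^bsub>G\<^esub> p'" "z = C.P 1 p \<oplus>\<^bsub>C.L\<^esub> \<i> \<odot>\<^bsub>C.L\<^esub> C.P 1 p'"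
        using C_involution_parts(2)[OF z \<open>\<Theta> z = \<ominus>\<^bsub>C.L\<^esub> z\<close>] by blast
      have "X.P (Poly_Mapping.single (-1) 1) z = j (G.P (Poly_Mapping.single (-1) 1) p) \<oplus>\<^bsub>X.L\<^esub> iu \<odot>\<^bsub>X.L\<^esub> j (G.P (Poly_Mapping.single (-1) 1) p')"
        unfolding p(5) using X_P_parts[OF p(1,2), of "Poly_Mapping.single (-1) 1"] by (simp add: map_of_real_monom)
      also have "\<dots> \<in> ?D" using p by (intro D G.B_odd)
      finally show ?thesis .
    qed
  qed (rule Dm)
  then show thesis using assms that by blast
qed

lemma cj_parts:
  assumes "x \<in> G.B" "y \<in> G.B"
  shows "cj (j x \<oplus>\<^bsub>X.L\<^esub> iu \<odot>\<^bsub>X.L\<^esub> j y) = j x \<oplus>\<^bsub>X.L\<^esub> (- iu) \<odot>\<^bsub>X.L\<^esub> j y"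
  using assms[THEN G.B_closed] jD(6)[of x] jD(6)[of y]
  by (simp add: semilinearD(2,3)[OF cj_semilinear] cj_j map_single single_uminus)

text \<open>Guarantees that the conjugate of an element of the family has a preimage under \<Psi>,
  as \<open>inv_into\<close> in \<open>bhs_conj\<close> requires.\<close>

lemma cj_stable: "z \<in> X.B \<Longrightarrow> cj z \<in> X.B"
proof -
  assume "z \<in> X.B"
  then obtain x y where g: "x \<in> G.B" "y \<in> G.B" "z = j x \<oplus>\<^bsub>X.L\<^esub> iu \<odot>\<^bsub>X.L\<^esub> j y" by (rule X_B_parts)
  have "- iu = poly_t_to_u [:- \<i>:]" by (simp add: poly_t_to_u_const single_uminus)
  then show ?thesis unfolding g(3) cj_parts[OF g(1,2)] using g by (simp only: X.B_props(3,6) j_B)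
qed

text \<open>Conjugation changes the sign of the imaginary part, so 2 i j y = 0, and
  \<open>X.L\<close> has no torsion.\<close>

lemma conj_fixed:
  assumes z: "z \<in> X.B" "cj z = z" shows "z \<in> j ` G.B"
proof -
  obtain x y where g: "x \<in> G.B" "y \<in> G.B" "z = j x \<oplus>\<^bsub>X.L\<^esub> iu \<odot>\<^bsub>X.L\<^esub> j y" using z(1) by (rule X_B_parts)
  note c = g(1,2)[THEN G.B_closed, THEN jD(6)]
  have "(- iu) \<odot>\<^bsub>X.L\<^esub> j y = iu \<odot>\<^bsub>X.L\<^esub> j y"
    using z(2) c unfolding g(3) cj_parts[OF g(1,2)] by simp
  then have "(iu + iu) \<odot>\<^bsub>X.L\<^esub> j y = \<zero>\<^bsub>X.L\<^esub>"
    using algebra_univD(1)[OF X.algebra_L c(2), of iu "- iu"] algebra_univD(1)[OF X.algebra_L c(2), of iu iu]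
      algebra_univD(4)[OF X.algebra_L c(2)] by simp
  moreover have "iu + iu \<noteq> 0"
  proof
    assume z: "iu + iu = 0"
    have "Poly_Mapping.lookup (iu + iu) 0 = 2 * \<i>" unfolding lookup_add lookup_single_eq by simp
    then show False unfolding z by simp
  qed
  ultimately have "j y = \<zero>\<^bsub>X.L\<^esub>" using X.L_torsion_free[OF c(2), of "iu + iu"] by auto
  then have "z = j x" using c by (simp add: g(3))
  then show ?thesis using g(1) by blast
qed

text \<open>Two rounds of descent. The first, along conjugation with the odd unit i, makes the
  coefficients real; the second is \<open>even_relation\<close>. The trace under u -> -u and
  multiplication by powers of u commute with conjugation, so the second round keeps the coefficients
  real.\<close>

lemma real_embedding:
  assumes H: "algebra univ_ring H" and f: "f \<in> hopf_semilinear real_t_to_u H X.L" "inj_on f (carrier H)"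
    and closed: "\<And>x. x \<in> carrier H \<Longrightarrow> comult H x \<in> carrier (tens H H)" "\<And>x. x \<in> carrier H \<Longrightarrow> antipode H x \<in> carrier H"
    and img: "f ` carrier H = j ` G.B"
  shows "hopf_embedding real_t_to_u H X.L f"
proof (rule X.embedding_into_L[OF _ real_t_to_u_hom inj_real_t_to_u H f closed])
  fix I :: "nat set" and y s i
  assume I: "finite I" "y \<in> I \<rightarrow> f ` carrier H" "i \<in> I" "s i \<noteq> 0" "finsum X.L (\<lambda>i. s i \<odot>\<^bsub>X.L\<^esub> y i) I = \<zero>\<^bsub>X.L\<^esub>"
  have y: "y i \<in> j ` G.B" if "i \<in> I" for i using I(2) that img by auto
  have yB: "y i \<in> X.B" "cj (y i) = y i" if "i \<in> I" for i using y[OF that] j_B cj_j G.B_closed by auto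
  have yL: "y \<in> I \<rightarrow> carrier X.L" using yB(1) X.B_closed by auto
  have w: "Poly_Mapping.map cnj iu = - iu" by (simp add: map_single single_uminus)
  have invol: "Poly_Mapping.map cnj (Poly_Mapping.map cnj t) = t" for t :: "complex laurent"
    by (rule poly_mapping_eqI) (simp add: lookup_map)
  have unit: "t = 0" if "iu * t = 0" for t :: "complex laurent"
  proof -
    have "iu \<noteq> 0"
    proof
      assume z: "iu = 0"
      have "Poly_Mapping.lookup iu 0 = \<i>" by (rule lookup_single_eq)
      then show False unfolding z by simp
    qed
    then show ?thesis using that by simp
  qed
  obtain s' k where s': "k \<in> I" "s' k \<noteq> 0" "\<forall>i\<in>I. Poly_Mapping.map cnj (s' i) = s' i" "finsum X.L (\<lambda>i. s' i \<odot>\<^bsub>X.L\<^esub> y i) I = \<zero>\<^bsub>X.L\<^esub>"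
    by (rule fixed_relation[OF X.algebra_L cj_semilinear map_hom[OF cnj_hom] invol w unit I(1) yL yB(2) I(3,4,5)]) blast
  obtain r l n where r: "l \<in> I" "r l \<noteq> 0" "finsum X.L (\<lambda>i. poly_t_to_u (r i) \<odot>\<^bsub>X.L\<^esub> y i) I = \<zero>\<^bsub>X.L\<^esub>"
    "(\<forall>i\<in>I. poly_t_to_u (r i) = Poly_Mapping.single n 1 * (s' i + laurent_sign (s' i))) \<or>
     (\<forall>i\<in>I. poly_t_to_u (r i) = Poly_Mapping.single n 1 * s' i)"
    by (rule X.even_relation[OF I(1) yL X.\<sigma>_fixes_B[OF yB(1)] s'(1,2,4)]) blast+
  have sign: "Poly_Mapping.map cnj (laurent_sign t) = laurent_sign (Poly_Mapping.map cnj t)" for t :: "complex laurent"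
    by (rule poly_mapping_eqI) (simp add: lookup_map lookup_laurent_sign)
  \<comment> \<open>The last clause of \<open>even_relation\<close> expresses these coefficients
    through s', which conjugation fixes.\<close>
  have conj_r: "Poly_Mapping.map cnj (poly_t_to_u (r i)) = poly_t_to_u (r i)" if "i \<in> I" for i
    using r(4) s'(3) that by (auto simp: univ_homD[OF map_hom[OF cnj_hom]] sign map_single)
  \<comment> \<open>The r i are fixed by conjugation, so nothing is lost on passing to real
    parts.\<close>
  define r' where "r' i = map_poly Re (r i)" for i
  have r': "map_poly of_real (r' i) = r i" if "i \<in> I" for i
  proof -
    have "map_poly cnj (r i) = r i"
      using conj_r[OF that] by (intro injD[OF inj_poly_t_to_u]) (simp add: map_poly_t_to_u)
    then have "cnj (coeff (r i) n) = coeff (r i) n" for n by (metis coeff_map_poly complex_cnj_zero)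
    then have "of_real (Re (coeff (r i) n)) = coeff (r i) n" for n by (metis Reals_cnj_iff of_real_Re)
    then show ?thesis by (intro poly_eqI) (simp add: r'_def coeff_map_poly)
  qed
  have "r' l \<noteq> 0" using r'[OF r(1)] r(2) by auto
  moreover have "finsum X.L (\<lambda>i. real_t_to_u (r' i) \<odot>\<^bsub>X.L\<^esub> y i) I = finsum X.L (\<lambda>i. poly_t_to_u (r i) \<odot>\<^bsub>X.L\<^esub> y i) I"
    using yL by (intro X.L.M.finsum_cong') (auto simp: real_t_to_u_def r' Pi_iff)
  ultimately show "\<exists>r l. l \<in> I \<and> r l \<noteq> 0 \<and> finsum X.L (\<lambda>i. real_t_to_u (r i) \<odot>\<^bsub>X.L\<^esub> y i) I = \<zero>\<^bsub>X.L\<^esub>"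
    using r(1,3) by (intro exI[of _ r'] exI[of _ l]) simp
qed auto

text \<open>The embedding is the inclusion into \<open>G.L\<close> followed by j, along R[t] ->
  R[u, 1/u] -> C[u, 1/u].\<close>

lemma real_contraction_embedding: "hopf_embedding real_t_to_u (contraction G \<eta>) X.L j"
proof (rule real_embedding[OF G.contraction(2) _ _ G.contraction(4,5)])
  have "(\<lambda>x. j (id x)) \<in> hopf_semilinear (\<lambda>r. Poly_Mapping.map of_real (poly_t_to_u r)) (contraction G \<eta>) X.L"
    by (rule hopf_semilinear_comp[OF G.contraction(2) G.algebra_L X.algebra_L G.contraction(3) j_hopf G.contraction(4,5)])
  moreover have "(\<lambda>x. j (id x)) = j" by (rule ext) (rule arg_cong[OF id_apply])
  ultimately show "j \<in> hopf_semilinear real_t_to_u (contraction G \<eta>) X.L" unfolding real_t_to_u_eq[abs_def] by (simp only:)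
  show "inj_on j (carrier (contraction G \<eta>))"
    unfolding G.carrier_contraction using inj_on_subset[OF inj_j] G.B_closed by blast
  show "j ` carrier (contraction G \<eta>) = j ` G.B" unfolding G.carrier_contraction ..
qed

section \<open>The invariants of conjugation in the complex family\<close>

definition K where "K = {Y \<in> carrier X.Q. X.\<Psi> Y \<in> j ` G.B}"

lemma bhs_conj_eq: "bhs_conj G \<eta> \<kappa> Y = inv_into (carrier X.Q) X.\<Psi> (cj (X.\<Psi> Y))"
proof -
  have c: "complexification_conj G = c0"
    unfolding complexification_conj_def by (rule base_change_morphism.F_def[symmetric, OF c0_morphism])
  have "laurent_conj G = cj"
    unfolding laurent_conj_def c complexification_eq[OF G.pre_hopf] laurent_alg_def
    by (rule base_change_morphism.F_def[symmetric, OF cj_morphism])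
  then show ?thesis
    unfolding bhs_conj_def Let_def complexification_eq[OF G.pre_hopf] complexified_involution_eq[OF G.pre_hopf G.\<theta>_hopf(1)]
      X.family_eq X.pullback_eq[abs_def] by simp
qed

text \<open>Under \<Psi> the conjugation of the family becomes \<open>cj\<close>, and by
  \<open>conj_fixed\<close> the elements of the complex contraction algebra fixed by
  \<open>cj\<close> are those of the real one.\<close>

lemma K_eq: "{Y \<in> carrier X.Q. bhs_conj G \<eta> \<kappa> Y = Y} = K"
proof -
  note inj = matrix_representation.inj_\<Psi>[OF X.Rep]
  have "bhs_conj G \<eta> \<kappa> Y = Y \<longleftrightarrow> X.\<Psi> Y \<in> j ` G.B" if Y: "Y \<in> carrier X.Q" for Y
  proof
    have B: "X.\<Psi> Y \<in> X.B" using Y X.image_\<Psi> by blast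
    have m: "cj (X.\<Psi> Y) \<in> X.\<Psi> ` carrier X.Q" unfolding X.image_\<Psi> by (rule cj_stable[OF B])
    assume "bhs_conj G \<eta> \<kappa> Y = Y"
    then have "cj (X.\<Psi> Y) = X.\<Psi> Y" using f_inv_into_f[OF m] unfolding bhs_conj_eq by simp
    then show "X.\<Psi> Y \<in> j ` G.B" using conj_fixed[OF B] by blast
  next
    assume "X.\<Psi> Y \<in> j ` G.B"
    then have "cj (X.\<Psi> Y) = X.\<Psi> Y" using cj_j G.B_closed by auto
    then show "bhs_conj G \<eta> \<kappa> Y = Y" unfolding bhs_conj_eq using inv_into_f_f[OF inj Y] by simp
  qed
  then show ?thesis unfolding K_def by blast
qed

lemma family_eq: "real_bhs_family G \<eta> \<kappa> = restrict_hopf univ_ring (map_poly of_real) univ_ring X.Q K"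
  unfolding real_bhs_family_def Let_def complexification_eq[OF G.pre_hopf] complexified_involution_eq[OF G.pre_hopf G.\<theta>_hopf(1)]
    X.family_eq K_eq ..

lemma image_K: "X.\<Psi> ` K = j ` G.B"
proof
  show "X.\<Psi> ` K \<subseteq> j ` G.B" unfolding K_def by blast
  show "j ` G.B \<subseteq> X.\<Psi> ` K"
  proof
    fix z assume z: "z \<in> j ` G.B"
    then have "z \<in> X.B" using j_B by blast
    then obtain Y where "Y \<in> carrier X.Q" "z = X.\<Psi> Y" using X.image_\<Psi> by blast
    then show "z \<in> X.\<Psi> ` K" using z unfolding K_def by blast
  qed
qed

lemma K_closed: "Y \<in> K \<Longrightarrow> Y \<in> carrier X.Q" and K_image: "Y \<in> K \<Longrightarrow> X.\<Psi> Y \<in> j ` G.B"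
  and K_I: "Y \<in> carrier X.Q \<Longrightarrow> X.\<Psi> Y \<in> j ` G.B \<Longrightarrow> Y \<in> K"
  unfolding K_def by blast+

lemmas embD = hopf_embeddingD[OF X.family_embedding]
lemmas \<Psi>D = hopf_semilinearD[OF embD(2)]

lemma algebra_K: "is_subalgebra univ_ring (restrict_alg (map_poly of_real) X.Q (carrier X.Q)) K"
proof -
  interpret Q: algebra univ_ring X.Q by (rule embD(1))
  have one: "\<one>\<^bsub>X.Q\<^esub> \<in> K"
    by (rule K_I[OF Q.one_closed]) (unfold ring_hom_one[OF \<Psi>D(1)] ring_hom_one[OF jD(1), symmetric], rule imageI, rule G.B_props(2))
  have smult: "map_poly of_real r \<odot>\<^bsub>X.Q\<^esub> x \<in> K" if x: "x \<in> K" for r x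
  proof (rule K_I)
    note xQ = K_closed[OF x]
    show "map_poly of_real r \<odot>\<^bsub>X.Q\<^esub> x \<in> carrier X.Q" by (rule algebra_univD(6)[OF embD(1) xQ])
    obtain b where b: "b \<in> G.B" "X.\<Psi> x = j b" using K_image[OF x] by blast
    have "X.\<Psi> (map_poly of_real r \<odot>\<^bsub>X.Q\<^esub> x) = j (poly_t_to_u r \<odot>\<^bsub>G.L\<^esub> b)"
      unfolding semilinearD(3)[OF \<Psi>D(2) xQ] semilinearD(3)[OF jD(2) G.B_closed[OF b(1)]] b(2) real_t_to_u_def[symmetric] real_t_to_u_eq ..
    then show "X.\<Psi> (map_poly of_real r \<odot>\<^bsub>X.Q\<^esub> x) \<in> j ` G.B" using G.B_props(6)[OF b(1)] by blast
  qed
  have ops: "x \<oplus>\<^bsub>X.Q\<^esub> y \<in> K \<and> x \<otimes>\<^bsub>X.Q\<^esub> y \<in> K" if x: "x \<in> K" and y: "y \<in> K" for x y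
  proof -
    note xQ = K_closed[OF x] and yQ = K_closed[OF y]
    obtain b d where b: "b \<in> G.B" "X.\<Psi> x = j b" and d: "d \<in> G.B" "X.\<Psi> y = j d" using K_image[OF x] K_image[OF y] by blast
    note bL = G.B_closed[OF b(1)] and dL = G.B_closed[OF d(1)]
    have "X.\<Psi> (x \<oplus>\<^bsub>X.Q\<^esub> y) = j (b \<oplus>\<^bsub>G.L\<^esub> d)" "X.\<Psi> (x \<otimes>\<^bsub>X.Q\<^esub> y) = j (b \<otimes>\<^bsub>G.L\<^esub> d)"
      unfolding semilinearD(2)[OF \<Psi>D(2) xQ yQ] semilinearD(2)[OF jD(2) bL dL] ring_hom_mult[OF \<Psi>D(1) xQ yQ] ring_hom_mult[OF jD(1) bL dL] b(2) d(2)
      by (rule HOL.refl)+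
    then show ?thesis
      using K_I[OF Q.M.a_closed[OF xQ yQ]] K_I[OF Q.m_closed[OF xQ yQ]] G.B_props(3)[OF b(1) d(1)] G.B_props(4)[OF b(1) d(1)] by blast
  qed
  show ?thesis
    by (rule is_subalgebraI[OF algebra_restrict_carrier[OF embD(1) map_poly_of_real_hom]]; unfold restrict_alg_simps;
        (rule one smult subsetI K_closed conjunct1[OF ops] conjunct2[OF ops]; assumption?)+)
qed

text \<open>Let x correspond to the real element b. The comultiplication of b comes from a tensor Y
  over the real contraction algebra. Transported to K, it has the same image in
  \<open>tens X.L X.L\<close> as \<open>comult X.Q x\<close>, and \<Psi> \<otimes> \<Psi> is
  injective on the square of \<open>X.Q\<close>.\<close>

lemma comult_K:
  assumes x: "x \<in> K"
  shows "comult X.Q x \<in> tmap X.Q X.Q id id ` carrier (tens (restrict_alg (map_poly of_real) X.Q K) (restrict_alg (map_poly of_real) X.Q K))"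
proof -
  let ?K = "restrict_alg (map_poly of_real) X.Q K"
  \<comment> \<open>k is \<Psi>^-1 j, from the real contraction algebra to K.\<close>
  define k where "k b = inv_into (carrier X.Q) X.\<Psi> (j b)" for b
  have k: "k b \<in> K" "X.\<Psi> (k b) = j b" if "b \<in> G.B" for b
  proof -
    have m: "j b \<in> X.\<Psi> ` carrier X.Q" unfolding X.image_\<Psi> by (rule j_B[OF that])
    show e: "X.\<Psi> (k b) = j b" unfolding k_def by (rule f_inv_into_f[OF m])
    show "k b \<in> K" by (rule K_I) (use inv_into_into[OF m] e that in \<open>simp_all add: k_def\<close>)
  qed
  have aK: "algebra univ_ring ?K" by (rule algebra_restrict[OF embD(1) map_poly_of_real_hom algebra_K])
  note sK = is_subalgebraD[OF algebra_K, simplified restrict_alg_simps]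
  note mB = algebra_module[OF G.algebra_BB] and mG = G.L.module_axioms and mX = X.L.module_axioms
    and mK = algebra_module[OF aK] and mQ = algebra_module[OF embD(1)]
  \<comment> \<open>Verified after the injective map \<Psi>, under which k becomes j.\<close>
  have ks: "k \<in> semilinear id G.BB ?K"
  proof (rule semilinearI; unfold restrict_alg_simps)
    fix a b assume a: "a \<in> G.B"
    note aL = G.B_closed[OF a] and ka = k[OF a] and kaQ = K_closed[OF k(1)[OF a]]
    show "k a \<in> K" by (rule ka)
    have sm: "k (poly_t_to_u r \<odot>\<^bsub>G.L\<^esub> a) = map_poly of_real r \<odot>\<^bsub>X.Q\<^esub> k a" for r
    proof (rule inj_onD[OF embD(5)])
      show "X.\<Psi> (k (poly_t_to_u r \<odot>\<^bsub>G.L\<^esub> a)) = X.\<Psi> (map_poly of_real r \<odot>\<^bsub>X.Q\<^esub> k a)"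
        unfolding k(2)[OF G.B_props(6)[OF a]] semilinearD(3)[OF \<Psi>D(2) kaQ] semilinearD(3)[OF jD(2) aL] ka(2) real_t_to_u_def[symmetric] real_t_to_u_eq ..
    qed (rule K_closed[OF k(1)[OF G.B_props(6)[OF a]]], rule algebra_univD(6)[OF embD(1) kaQ])
    show "k (poly_t_to_u r \<odot>\<^bsub>G.L\<^esub> a) = map_poly of_real (id r) \<odot>\<^bsub>X.Q\<^esub> k a" for r
      by (rule HOL.trans[OF sm arg_cong[of r "id r" "\<lambda>r. map_poly of_real r \<odot>\<^bsub>X.Q\<^esub> k a", OF id_apply[symmetric]]])
    assume b: "b \<in> G.B"
    note bL = G.B_closed[OF b] and kb = k[OF b] and kbQ = K_closed[OF k(1)[OF b]]
    show "k (a \<oplus>\<^bsub>G.L\<^esub> b) = k a \<oplus>\<^bsub>X.Q\<^esub> k b"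
    proof (rule inj_onD[OF embD(5)])
      show "X.\<Psi> (k (a \<oplus>\<^bsub>G.L\<^esub> b)) = X.\<Psi> (k a \<oplus>\<^bsub>X.Q\<^esub> k b)"
        unfolding k(2)[OF G.B_props(3)[OF a b]] semilinearD(2)[OF \<Psi>D(2) kaQ kbQ] semilinearD(2)[OF jD(2) aL bL] ka(2) kb(2) ..
    qed (rule K_closed[OF k(1)[OF G.B_props(3)[OF a b]]], rule K_closed[OF sK(3)[OF ka(1) kb(1)]])
  qed
  have iK: "id \<in> semilinear (map_poly of_real) ?K X.Q"
    by (rule semilinearI) (simp_all add: K_closed)
  obtain b where b: "b \<in> G.B" "X.\<Psi> x = j b" using K_image[OF x] by blast
  note xQ = K_closed[OF x]
  obtain Y where Y: "Y \<in> carrier (tens G.BB G.BB)" "comult G.L b = tmap G.L G.L id id Y" using G.comult_B[OF b(1)] by blast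
  note kY = semilinearD(1)[OF tensor_map_semilinear[OF mB mB mK mK ks ks] Y(1)]
  note ik = semilinear_comp[OF ks iK]
  have "tmap X.L X.L X.\<Psi> X.\<Psi> (tmap X.Q X.Q id id (tmap ?K ?K k k Y)) = tmap X.L X.L X.\<Psi> X.\<Psi> (tmap X.Q X.Q (\<lambda>a. id (k a)) (\<lambda>a. id (k a)) Y)"
    by (simp only: tensor_map_comp[OF mB mB mK mK mQ mQ ks ks iK iK Y(1)])
  also have "\<dots> = tmap X.L X.L (\<lambda>a. X.\<Psi> (id (k a))) (\<lambda>a. X.\<Psi> (id (k a))) Y"
    by (rule tensor_map_comp[OF mB mB mQ mQ mX mX ik ik \<Psi>D(2) \<Psi>D(2) Y(1)])
  also have "\<dots> = tmap X.L X.L (\<lambda>a. j (id a)) (\<lambda>a. j (id a)) Y"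
    by (rule tensor_map_cong[OF mB mB _ _ Y(1)]; unfold restrict_alg_simps;
        rule HOL.trans[OF arg_cong[of _ _ X.\<Psi>, OF id_apply] HOL.trans[OF k(2) arg_cong[of _ _ j, OF id_apply[symmetric]]]])
  also have "\<dots> = tmap X.L X.L j j (comult G.L b)"
    unfolding Y(2) by (rule tensor_map_comp[symmetric, OF mB mB mG mG mX mX G.incl(1) G.incl(1) jD(2) jD(2) Y(1)])
  also have "\<dots> = comult X.L (X.\<Psi> x)" unfolding b(2) by (rule jD(3)[symmetric, OF G.B_closed[OF b(1)]])
  also have "\<dots> = tmap X.L X.L X.\<Psi> X.\<Psi> (comult X.Q x)" by (rule \<Psi>D(3)[OF xQ])
  finally have "tmap X.Q X.Q id id (tmap ?K ?K k k Y) = comult X.Q x"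
    by (rule inj_onD[OF embD(6)]) (rule semilinearD(1)[OF tensor_map_semilinear[OF mK mK mQ mQ iK iK] kY], rule embD(3)[OF xQ])
  then show ?thesis using imageI[OF kY, of "tmap X.Q X.Q id id"] by (simp only:)
qed

lemma counit_K:
  assumes x: "x \<in> K" shows "counit X.Q x \<in> range (map_poly of_real)"
proof -
  obtain b where b: "b \<in> G.B" "X.\<Psi> x = j b" using K_image[OF x] by blast
  obtain r where r: "counit G.L b = poly_t_to_u r" using G.counit_B[OF b(1)] by blast
  have "poly_t_to_u (counit X.Q x) = poly_t_to_u (map_poly of_real r)"
    using \<Psi>D(4)[OF K_closed[OF x]] jD(4)[OF G.B_closed[OF b(1)]] by (simp add: b(2) r map_poly_t_to_u)
  then show ?thesis using injD[OF inj_poly_t_to_u] by blast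
qed

lemma antipode_K:
  assumes x: "x \<in> K" shows "antipode X.Q x \<in> K"
proof (rule K_I[OF embD(4)[OF K_closed[OF x]]])
  obtain b where b: "b \<in> G.B" "X.\<Psi> x = j b" using K_image[OF x] by blast
  have "X.\<Psi> (antipode X.Q x) = j (antipode G.L b)"
    using \<Psi>D(5)[OF K_closed[OF x]] jD(5)[OF G.B_closed[OF b(1)]] by (simp add: b(2))
  then show "X.\<Psi> (antipode X.Q x) \<in> j ` G.B" using G.antipode_B[OF b(1)] by blast
qed

lemma pre_hopf_Q: "pre_hopf X.Q"
  using hopf_algebra_embedded[OF poly_t_to_u_hom inj_poly_t_to_u X.hopf_L X.family_embedding] by (simp add: hopf_algebra_iff)

lemmas real_family = restrict_hopf[OF map_poly_of_real_hom pre_hopf_Q algebra_K comult_K counit_K antipode_K, folded family_eq]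

lemma carrier_real_family: "carrier (real_bhs_family G \<eta> \<kappa>) = K"
  using same_algebraD(1)[OF real_family(1)] by simp

text \<open>The embedding is the inclusion of K in \<open>X.Q\<close> followed by \<Psi>, along R[t]
  -> C[t] -> C[u, 1/u].\<close>

lemma real_family_embedding: "hopf_embedding real_t_to_u (real_bhs_family G \<eta> \<kappa>) X.L X.\<Psi>"
proof (rule real_embedding[OF real_family(2) _ _ real_family(4,5)])
  have "(\<lambda>x. X.\<Psi> (id x)) \<in> hopf_semilinear (\<lambda>r. poly_t_to_u (map_poly of_real r)) (real_bhs_family G \<eta> \<kappa>) X.L"
    by (rule hopf_semilinear_comp[OF real_family(2) embD(1) X.algebra_L real_family(3) embD(2) real_family(4,5)])
  moreover have "(\<lambda>x. X.\<Psi> (id x)) = X.\<Psi>" by (rule ext) (rule arg_cong[OF id_apply])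
  ultimately show "X.\<Psi> \<in> hopf_semilinear real_t_to_u (real_bhs_family G \<eta> \<kappa>) X.L" unfolding real_t_to_u_def[abs_def] by (simp only:)
  show "inj_on X.\<Psi> (carrier (real_bhs_family G \<eta> \<kappa>))"
    unfolding carrier_real_family using inj_on_subset[OF embD(5)] K_closed by blast
  show "X.\<Psi> ` carrier (real_bhs_family G \<eta> \<kappa>) = j ` G.B"
    unfolding carrier_real_family by (rule image_K)
qed

theorem contraction_isomorphic_real_bhs: "group_schemes_isomorphic univ_ring (contraction G \<eta>) (real_bhs_family G \<eta> \<kappa>)"
proof (rule isomorphic_of_embeddings[OF real_t_to_u_hom inj_real_t_to_u X.hopf_L real_contraction_embedding real_family_embedding])
  show "j ` carrier (contraction G \<eta>) = X.\<Psi> ` carrier (real_bhs_family G \<eta> \<kappa>)"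
    unfolding carrier_real_family G.carrier_contraction by (rule image_K[symmetric])
qed

end

theorem proposition1p3:
  fixes A :: "(complex, 'a) hopf" and \<theta> :: "'a \<Rightarrow> 'a"
    and \<iota> :: "('n::finite, complex) mat_poly set \<Rightarrow> 'a"
    and B :: "(real, 'b) hopf" and \<eta> :: "'b \<Rightarrow> 'b"
    and \<kappa> :: "('m::finite, complex) mat_poly set \<Rightarrow> (complex, 'b) tensor"
  shows
    "(affine_algebraic_group univ_ring A \<and> hopf_involution univ_ring A \<theta> \<and>
      faithful_representation A \<iota> \<longrightarrow>
        group_schemes_isomorphic univ_ring (contraction A \<theta>) (bhs_family A \<theta> \<iota>)) \<and>
     (affine_algebraic_group univ_ring B \<and> hopf_involution univ_ring B \<eta> \<and>
      faithful_representation (complexification B) \<kappa> \<longrightarrow>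
        group_schemes_isomorphic univ_ring (contraction B \<eta>) (real_bhs_family B \<eta> \<kappa>))"
proof (intro conjI impI; elim conjE)
  assume "affine_algebraic_group univ_ring A" "hopf_involution univ_ring A \<theta>" "faithful_representation A \<iota>"
  then show "group_schemes_isomorphic univ_ring (contraction A \<theta>) (bhs_family A \<theta> \<iota>)"
    by (intro complex_bhs.contraction_isomorphic_bhs complex_bhs.intro involution_laurent.intro complex_bhs_axioms.intro)
       (simp_all add: affine_algebraic_group_def)
next
  assume B: "affine_algebraic_group univ_ring B" "hopf_involution univ_ring B \<eta>" "faithful_representation (complexification B) \<kappa>"
  then have h: "hopf_algebra univ_ring B" by (simp add: affine_algebraic_group_def)
  then have p: "pre_hopf B" by (simp add: hopf_algebra_iff)
  have inv: "involution_laurent B \<eta>" by (rule involution_laurent.intro[OF h B(2)])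
  have \<eta>: "\<eta> \<in> hopf_semilinear id B B" "\<And>b. b \<in> carrier B \<Longrightarrow> \<eta> (\<eta> b) = b"
    using B(2) by (auto simp: hopf_involution_def hopf_hom_def hopf_semilinear_def alg_hom_univ)
  note m = complexified_involution_morphism[OF p \<eta>(1)]
  interpret C: base_changed "of_real :: real \<Rightarrow> complex" B by (rule base_changed.intro[OF of_real_hom p])
  let ?\<Theta> = "base_change_morphism.F (of_real :: real \<Rightarrow> complex) B id \<eta>"
  have s: "?\<Theta> \<in> semilinear id C.L C.L" by (rule base_change_morphism.F_semilinear[OF m])
  \<comment> \<open>Both sides are complex linear in x, hence compared on 1 \<otimes> b, where the
    claim is \<eta> (\<eta> b) = b.\<close>
  have "?\<Theta> (?\<Theta> x) = x" if x: "x \<in> carrier C.L" for x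
  proof (rule C.semilinear_eqI[OF C.L.M.abelian_group_axioms _ _ _ x])
    show "(\<lambda>x. ?\<Theta> (?\<Theta> x)) \<in> semilinear id C.L C.L" using semilinear_comp[OF s s] by (simp add: id_def)
    show "(\<lambda>x. x) \<in> semilinear id C.L C.L" using semilinear_id[of C.L] by (simp add: id_def)
    show "?\<Theta> (?\<Theta> (C.P 1 b)) = C.P 1 b" if b: "b \<in> carrier B" for b
      using b hopf_semilinearD(6)[OF \<eta>(1) b] \<eta>(2)[OF b] by (simp add: base_change_morphism.F_pure[OF m])
  qed
  then have i: "hopf_involution univ_ring C.L ?\<Theta>"
    using base_change_morphism.F_hopf[OF m] by (auto simp: hopf_involution_def hopf_hom_def hopf_semilinear_def alg_hom_univ)
  have "complex_bhs C.L ?\<Theta> \<kappa>"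
    using B(3) unfolding complexification_eq[OF p]
    by (intro complex_bhs.intro involution_laurent.intro complex_bhs_axioms.intro C.hopf_algebra_L[OF h] i)
  then show "group_schemes_isomorphic univ_ring (contraction B \<eta>) (real_bhs_family B \<eta> \<kappa>)"
    by (intro real_bhs.contraction_isomorphic_real_bhs real_bhs.intro inv)
qed

end
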